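(* The ideal of relations $\widetilde K_n\vartriangleleft\sigma\langle\widetilde X\rangle$ for $R^{GL(n)}\simeq\sigma\langle\widetilde X\rangle/\widetilde K_n$ is generated (as an ideal) by - $\sigma_t(a)=0$, where $n<t\le 2n$ and $a\in\mathbb{F}\langle X\rangle$; - $\sigma_t(b)=0$, where $t>2n$ and $b\in\langle\widetilde X\rangle$.
   Context: Let $\mathbb{F}$ be an infinite field of arbitrary characteristic $p\ge 0$ and $n>1$ an integer. Ideals are two-sided, $\mathbb{N}=\{1,2,\ldots\}$, $\mathbb{N}_0=\mathbb{N}\sqcup\{0\}$, $|\underline{t}|=t_1+\cdots+t_u$. A relation $f=h$ is identified with the element $f-h$. Matrices. $R=\mathbb{F}[x_{ij}(k)\mid 1\le i,j\le n,\ k\ge 1]$ and $X_k=(x_{ij}(k))_{1\le i,j\le n}$ are the generic matrices. For an $n\times n$ matrix $A$ define $\sigma_t(A)$ by $\det(\lambda E-A)=\sum_{t=0}^n(-1)^t\lambda^{n-t}\sigma_t(A)$. $R^{GL(n)}\subset R$ is the algebra of matrix $GL(n)$-invariants, i.e. the subalgebra generated by all $\sigma_t(A)$, $1\le t\le n$, $A$ a monomial in generic matrices. Words. $\langle X\rangle$ is the free semigroup (without unity) on letters $x_1,x_2,\ldots$; $\langle X\rangle^{\#}=\langle X\rangle\sqcup\{1\}$; $\mathbb{F}\langle X\rangle$ is the vector space with basis $\langle X\rangle$. $\phi_n$ is the multiplicative linear map on $\mathbb{F}\langle X\rangle$ with $x_k\mapsto X_k$. $\langle X\rangle$ carries the lexicographical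 linear order with $x_1>x_2>\cdots$ and $ab>a$. Words $a,b$ are cyclic equivalent if $a=a_1a_2$, $b=a_2a_1$ for some $a_1,a_2\in\langle X\rangle^{\#}$. A word $a$ is primitive if $a\ne b^l$ for all $b\in\langle X\rangle$, $l>1$. $\langle\widetilde X\rangle$ is the set of maximal representatives of the cyclic equivalence classes of primitive words. $\mathrm{mdeg}(a)=(\deg_{x_1}(a),\deg_{x_2}(a),\ldots)$. Free algebras. $\sigma\langle X\rangle$ is the commutative polynomial ring over $\mathbb{F}$ freely generated by symbols $\sigma_t(a)$, where $t\ge1$ and $a\in\mathbb{F}\langle X\rangle$ has coefficient $1$ in its highest term; put $\sigma_t(\alpha a)=\alpha^t\sigma_t(a)$ for $\alpha\in\mathbb{F}$ and $\sigma_0(a)=1$. The large free algebra $\sigma\langle\widetilde X\rangle$ is the commutative polynomial ring over $\mathbb{F}$ freely generated by symbols $\sigma_t(e)$, $t>0$, $e\in\langle\widetilde X\rangle$. Special elements. For $\underline t\in\mathbb{N}_0^u$ let $\Omega(\underline t)$ be the set of multisets $\omega$ consisting of pairwise different $e_1,\ldots,e_q\in\langle\widetilde X\rangle$ ($q>0$) with multiplicities $k_1,\ldots,k_q\in\mathbb{N}$ such that $\sum_i k_i\,\mathrm{mdeg}(e_i)=\underline t$; put $\sigma(\omega)=(-1)^{k_1+\cdots+k_q}\sigma_{k_1}(e_1)\cdots\sigma_{k_q}(e_q)$ and $\sigma_{\underline t}(x_1,\ldots,x_u)=(-1)^{|\underline t|}\sum_{\omega\in\Omega(\underline t)}\sigma(\omega)\in\sigma\langle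 X\rangle$ (equal to $1$ if $\Omega(\underline t)$ is empty). For $t>0$, $F_t(x_1,\ldots,x_u)=\sum\sigma_{\underline t}(x_1,\ldots,x_u)$ over $\underline t\in\mathbb{N}_0^u$ with $|\underline t|=t$. For $a_i\in\mathbb{F}\langle X\rangle$, $\sigma_{\underline t}(a_1,\ldots,a_u)$ and $F_t(a_1,\ldots,a_u)$ are the results of the substitutions $x_i\to a_i$. For $t\ge1$, $l\ge2$ there is a unique polynomial $P_{t,l}$ in $tl$ variables with coefficients in the image of $\mathbb{Z}$ in $\mathbb{F}$ such that $\sigma_t(A^l)=P_{t,l}(\sigma_1(A),\ldots,\sigma_{tl}(A))$ for all $m\times m$ matrices $A$ over commutative $\mathbb{F}$-algebras with $m\ge tl$; $P_{t,l}(a)=P_{t,l}(\sigma_1(a),\ldots,\sigma_{tl}(a))\in\sigma\langle X\rangle$. The map $\widetilde\pi$. By a theorem of Donkin there is a surjective homomorphism $\widetilde\pi:\sigma\langle X\rangle\to\sigma\langle\widetilde X\rangle$ with $\widetilde\pi(\sigma_t(e))=\sigma_t(e)$ for $e\in\langle\widetilde X\rangle$, whose kernel is the ideal generated by $\sigma_t(a_1+\cdots+a_u)-F_t(a_1,\ldots,a_u)$, $\sigma_t(a^l)-P_{t,l}(a)$, $\sigma_t(ab)-\sigma_t(ba)$, where $t>0$, $l,u>1$, $a_i\in\mathbb{F}\langle X\rangle$, $a,b\in\langle X\rangle$. Elements of $\sigma\langle X\rangle$ (such as $\sigma_t(a)$, $a\in\mathbb{F}\langle X\rangle$) are regarded as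 elements of $\sigma\langle\widetilde X\rangle$ via $\widetilde\pi$. $\widetilde K_n$ is the kernel of the surjective homomorphism $\widetilde\Phi_n:\sigma\langle\widetilde X\rangle\to R^{GL(n)}$ with $\sigma_t(e)\mapsto\sigma_t(\phi_n(e))$ for $1\le t\le n$ and $\sigma_t(e)\mapsto0$ for $t>n$. *)

theory Defs
  imports
    "HOL-Library.Poly_Mapping"
    "HOL-Library.Multiset"
    "Jordan_Normal_Form.Char_Poly"
begin

section \<open>Multivariate polynomials\<close>

text \<open>The polynomial ring over \<open>'a\<close> in commuting variables indexed by the type \<open>'v\<close>:
  finitely supported maps from monomials (exponent functions) to coefficients.\<close>

type_synonym ('v, 'a) pol = "('v \<Rightarrow>\<^sub>0 nat) \<Rightarrow>\<^sub>0 'a"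

definition const_pol :: "'a::comm_ring_1 \<Rightarrow> ('v, 'a) pol" where
  "const_pol c = Poly_Mapping.single 0 c"

definition var_pol :: "'v \<Rightarrow> ('v, 'a::comm_ring_1) pol" where
  "var_pol v = Poly_Mapping.single (Poly_Mapping.single v 1) 1"

text \<open>The algebra homomorphism sending each variable \<open>v\<close> to \<open>f v\<close>.\<close>

definition subst_pol ::
  "('v \<Rightarrow> ('w, 'a::comm_ring_1) pol) \<Rightarrow> ('v, 'a) pol \<Rightarrow> ('w, 'a) pol" where
  "subst_pol f p =
     (\<Sum>m\<in>Poly_Mapping.keys p. const_pol (Poly_Mapping.lookup p m) *
        (\<Prod>v\<in>Poly_Mapping.keys m. f v ^ Poly_Mapping.lookup m v))"

definition alg_hom :: "(('v, 'a::comm_ring_1) pol \<Rightarrow> ('w, 'a) pol) \<Rightarrow> bool" where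
  "alg_hom h \<longleftrightarrow>
     (\<forall>p q. h (p + q) = h p + h q) \<and>
     (\<forall>p q. h (p * q) = h p * h q) \<and>
     (\<forall>c. h (const_pol c) = const_pol c)"

text \<open>The ideal generated by \<open>S\<close>: the submodule spanned by \<open>S\<close> of the ring viewed as a module
  over itself.\<close>

definition ideal_gen :: "'r::comm_ring_1 set \<Rightarrow> 'r set" where
  "ideal_gen S = module.span (*) S"


section \<open>Words and the free algebra\<close>

text \<open>Words in the letters \<open>x\<^sub>1, x\<^sub>2, \<dots>\<close>, the empty word included; the number \<open>i\<close> stands for the
  letter \<open>x\<^bsub>i+1\<^esub>\<close>. Concatenation is written additively and the empty word is \<open>0\<close>, because
  the convolution product on \<open>word \<Rightarrow>\<^sub>0 'a\<close> takes the monoid of exponents additively. With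
  this product \<open>word \<Rightarrow>\<^sub>0 'a\<close> is the free associative algebra with unit.\<close>

datatype word = Word (letters: "nat list")

instantiation word :: monoid_add
begin

definition zero_word :: word where
  "0 = Word []"

definition plus_word :: "word \<Rightarrow> word \<Rightarrow> word" where
  "u + v = Word (letters u @ letters v)"

instance
  by standard (simp_all add: zero_word_def plus_word_def)

end

text \<open>The lexicographical order with \<open>x\<^sub>1 > x\<^sub>2 > \<dots>\<close> (hence the reversed order on letter
  numbers) and \<open>ab > a\<close>.\<close>

instantiation word :: linorder
begin

definition less_word :: "word \<Rightarrow> word \<Rightarrow> bool" where
  "u < v \<longleftrightarrow> (letters u, letters v) \<in> lexord {(i, j). j < i}"

definition less_eq_word :: "word \<Rightarrow> word \<Rightarrow> bool" where
  "u \<le> v \<longleftrightarrow> u = v \<or> u < (v :: word)"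

instance
proof
  let ?r = "{(i, j). j < (i :: nat)}"
  have tr: "trans ?r" by (auto simp: trans_def)
  have irr: "\<not> u < u" for u :: word
    unfolding less_word_def by (rule lexord_irreflexive) auto
  have trn: "u < w" if "u < v" "v < w" for u v w :: word
    using that lexord_trans[OF _ _ tr] unfolding less_word_def by blast
  fix u v w :: word
  show "(u < v) = (u \<le> v \<and> \<not> v \<le> u)"
    using irr[of u] trn[of u v u] unfolding less_eq_word_def by auto
  show "u \<le> u" by (simp add: less_eq_word_def)
  show "u \<le> v \<Longrightarrow> v \<le> w \<Longrightarrow> u \<le> w"
    using trn[of u v w] unfolding less_eq_word_def by auto
  show "u \<le> v \<Longrightarrow> v \<le> u \<Longrightarrow> u = v"
    using irr[of u] trn[of u v u] unfolding less_eq_word_def by auto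
  show "u \<le> v \<or> v \<le> u"
  proof -
    have "\<forall>i j. (i, j) \<in> ?r \<or> i = j \<or> (j, i) \<in> ?r" by auto
    from lexord_linear[OF this, of "letters u" "letters v"] word.expand[of u v]
    show ?thesis unfolding less_eq_word_def less_word_def by auto
  qed
qed

end

definition primitive_word :: "word \<Rightarrow> bool" where
  "primitive_word a \<longleftrightarrow> a \<noteq> 0 \<and> (\<forall>b l. l > 1 \<longrightarrow> a \<noteq> sum_list (replicate l b))"

definition cyclic_equiv :: "word \<Rightarrow> word \<Rightarrow> bool" where
  "cyclic_equiv a b \<longleftrightarrow> (\<exists>a1 a2. a = a1 + a2 \<and> b = a2 + a1)"

definition X_tilde :: "word set" where
  "X_tilde = {e. primitive_word e \<and> (\<forall>b. cyclic_equiv e b \<longrightarrow> b \<le> e)}"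

text \<open>\<open>F\<langle>X\<rangle>\<close>, spanned by the nonempty words only.\<close>

definition free_alg :: "(word \<Rightarrow>\<^sub>0 'a::field) set" where
  "free_alg = {a. Poly_Mapping.lookup a 0 = 0}"

definition of_word :: "word \<Rightarrow> (word \<Rightarrow>\<^sub>0 'a::field)" where
  "of_word w = Poly_Mapping.single w 1"

text \<open>The coefficient of the highest term; it is only used for nonzero arguments.\<close>

definition highest_coeff :: "(word \<Rightarrow>\<^sub>0 'a::field) \<Rightarrow> 'a" where
  "highest_coeff a = Poly_Mapping.lookup a (Max (Poly_Mapping.keys a))"

definition subst_word :: "(word \<Rightarrow>\<^sub>0 'a::field) list \<Rightarrow> word \<Rightarrow> (word \<Rightarrow>\<^sub>0 'a)" where
  "subst_word as e = prod_list (map (\<lambda>i. as ! i) (letters e))"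


section \<open>The algebras \<open>\<sigma>\<langle>X\<rangle>\<close> and \<open>\<sigma>\<langle>X_tilde\<rangle>\<close>\<close>

text \<open>The free generators \<open>\<sigma>\<^sub>t(a)\<close> and \<open>\<sigma>\<^sub>t(e)\<close> of the two polynomial rings.\<close>

typedef (overloaded) 'a sigma_sym =
  "{(t :: nat, a :: word \<Rightarrow>\<^sub>0 'a::field). t \<ge> 1 \<and> a \<in> free_alg \<and> a \<noteq> 0 \<and> highest_coeff a = 1}"
proof -
  let ?a = "of_word (Word [0]) :: word \<Rightarrow>\<^sub>0 'a"
  have "Poly_Mapping.keys ?a = {Word [0]}" by (simp add: of_word_def)
  then have "?a \<in> free_alg \<and> ?a \<noteq> 0 \<and> highest_coeff ?a = 1"
    by (auto simp: free_alg_def highest_coeff_def of_word_def zero_word_def lookup_single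
        simp flip: keys_eq_empty)
  then show ?thesis by (intro exI[of _ "(1, ?a)"]) simp
qed

lemma X_tilde_letter: "Word [i] \<in> X_tilde"
proof -
  have len: "length (letters (sum_list (replicate l b))) = l * length (letters b)" for l b
    by (induction l) (simp_all add: zero_word_def plus_word_def)
  have "primitive_word (Word [i])"
    unfolding primitive_word_def
  proof (intro conjI allI impI notI)
    fix b l assume "l > (1 :: nat)" "Word [i] = sum_list (replicate l b)"
    then have "1 = l * length (letters b)" 
      using len[of l b] by (metis length_Cons list.size(3) One_nat_def word.sel)
    with \<open>l > 1\<close> show False by simp
  qed (simp add: zero_word_def)
  moreover have "b \<le> Word [i]" if "cyclic_equiv (Word [i]) b" for b
    using that unfolding cyclic_equiv_def less_eq_word_def
    by (auto simp: plus_word_def Cons_eq_append_conv)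
  ultimately show ?thesis by (simp add: X_tilde_def)
qed

typedef tilde_sym = "{(t :: nat, e :: word). t \<ge> 1 \<and> e \<in> X_tilde}"
  using X_tilde_letter by (intro exI[of _ "(1, Word [0])"]) simp

type_synonym 'a sigma_alg = "('a sigma_sym, 'a) pol"
type_synonym 'a sigma_tilde_alg = "(tilde_sym, 'a) pol"

text \<open>\<open>\<sigma>\<^sub>t(a)\<close> in \<open>\<sigma>\<langle>X\<rangle>\<close> for arbitrary \<open>t\<close> and \<open>a\<close> in \<open>F\<langle>X\<rangle>\<close>, by the conventions
  \<open>\<sigma>\<^sub>0(a) = 1\<close> and \<open>\<sigma>\<^sub>t(\<alpha>a) = \<alpha>\<^sup>t \<sigma>\<^sub>t(a)\<close>; the latter with \<open>\<alpha> = 0\<close> gives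
  \<open>\<sigma>\<^sub>t(0) = 0\<close> for \<open>t > 0\<close>. The element \<open>a\<close> is divided by its highest coefficient by
  multiplying with a scalar multiple of the empty word.\<close>

definition sigma :: "nat \<Rightarrow> (word \<Rightarrow>\<^sub>0 'a::field) \<Rightarrow> 'a sigma_alg" where
  "sigma t a =
     (if t = 0 then 1
      else if a = 0 then 0
      else const_pol (highest_coeff a ^ t) *
        var_pol (Abs_sigma_sym
          (t, Poly_Mapping.single 0 (inverse (highest_coeff a)) * a)))"

text \<open>The free generator \<open>\<sigma>\<^sub>t(e)\<close> of \<open>\<sigma>\<langle>X_tilde\<rangle>\<close>, meaningful for \<open>t \<ge> 1\<close> and \<open>e \<in> X_tilde\<close>.\<close>

definition sigma_tilde :: "nat \<Rightarrow> word \<Rightarrow> 'a::field sigma_tilde_alg" where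
  "sigma_tilde t e = var_pol (Abs_tilde_sym (t, e))"


section \<open>The elements \<open>\<sigma>\<^sub>t(a\<^sub>1, \<dots>, a\<^sub>u)\<close> and \<open>F\<^sub>t\<close>\<close>

text \<open>A multidegree in \<open>\<nat>\<^sub>0\<^sup>u\<close> is a list of length \<open>u\<close>, padded by zeros.\<close>

definition Omega :: "nat list \<Rightarrow> word multiset set" where
  "Omega ts = {\<omega>. \<omega> \<noteq> {#} \<and> set_mset \<omega> \<subseteq> X_tilde \<and>
     (\<forall>i. (\<Sum>e\<in>#\<omega>. count_list (letters e) i) = (if i < length ts then ts ! i else 0))}"

text \<open>The result of substituting the \<open>a\<^sub>i\<close> for the letters \<open>x\<^sub>i\<close> in
  \<open>\<sigma>\<^sub>t(x\<^sub>1, \<dots>, x\<^sub>u)\<close>; here \<open>as = [a\<^sub>1, \<dots>, a\<^sub>u]\<close> and \<open>length ts = u\<close>.\<close>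

definition sigma_multi :: "nat list \<Rightarrow> (word \<Rightarrow>\<^sub>0 'a::field) list \<Rightarrow> 'a sigma_alg" where
  "sigma_multi ts as =
     (if Omega ts = {} then 1
      else (- 1) ^ sum_list ts *
        (\<Sum>\<omega>\<in>Omega ts. (- 1) ^ size \<omega> *
           (\<Prod>e\<in>set_mset \<omega>. sigma (count \<omega> e) (subst_word as e))))"

definition F_rel :: "nat \<Rightarrow> (word \<Rightarrow>\<^sub>0 'a::field) list \<Rightarrow> 'a sigma_alg" where
  "F_rel t as = (\<Sum>ts | length ts = length as \<and> sum_list ts = t. sigma_multi ts as)"


section \<open>Generic matrices and the polynomials \<open>P\<^sub>t\<^sub>,\<^sub>l\<close>\<close>

text \<open>\<open>\<sigma>\<^sub>t(A)\<close> is read off from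
  \<open>det(\<lambda>E - A) = \<Sum>\<^sub>t (-1)\<^sup>t \<lambda>\<^bsup>m-t\<^esup> \<sigma>\<^sub>t(A)\<close> with \<open>m\<close> the size of \<open>A\<close>.\<close>

definition sigma_mat :: "nat \<Rightarrow> 'r::comm_ring_1 mat \<Rightarrow> 'r" where
  "sigma_mat t A =
     (if t \<le> dim_row A then (- 1) ^ t * poly.coeff (char_poly A) (dim_row A - t) else 0)"

text \<open>The variable \<open>(i, j, k)\<close> is the entry \<open>x\<^sub>i\<^sub>j(k)\<close>, with rows, columns and matrices
  numbered from \<open>0\<close>. The ring does not depend on the matrix size: for \<open>n \<times> n\<close> matrices
  only the variables with \<open>i, j < n\<close> occur.\<close>

type_synonym 'a gen_ring = "(nat \<times> nat \<times> nat, 'a) pol"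

definition generic_mat :: "nat \<Rightarrow> nat \<Rightarrow> 'a::field gen_ring mat" where
  "generic_mat n k = mat n n (\<lambda>(i, j). var_pol (i, j, k))"

definition phi_word :: "nat \<Rightarrow> word \<Rightarrow> 'a::field gen_ring mat" where
  "phi_word n w = foldr (\<lambda>k A. generic_mat n k * A) (letters w) (1\<^sub>m n)"

text \<open>\<open>P\<^sub>t\<^sub>,\<^sub>l\<close> is a polynomial in the variables with numbers \<open>1, \<dots>, tl\<close> and with coefficients
  in the image of the integers. Its defining identity is required for matrices over
  \<open>'a gen_ring\<close>. As that ring contains the generic matrices of all sizes, and every matrix over a
  commutative algebra is a specialization of a generic one, the identity then holds over all
  commutative algebras.\<close>

definition is_power_pol :: "nat \<Rightarrow> nat \<Rightarrow> (nat, 'a::field) pol \<Rightarrow> bool" where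
  "is_power_pol t l P \<longleftrightarrow>
     (\<forall>m\<in>Poly_Mapping.keys P. Poly_Mapping.keys m \<subseteq> {1..t * l} \<and> Poly_Mapping.lookup P m \<in> \<int>) \<and>
     (\<forall>m \<ge> t * l. \<forall>A \<in> carrier_mat m m.
        sigma_mat t (A ^\<^sub>m l) = subst_pol (\<lambda>i. sigma_mat i (A :: 'a gen_ring mat)) P)"

definition power_pol :: "nat \<Rightarrow> nat \<Rightarrow> (nat, 'a::field) pol" where
  "power_pol t l = (THE P. is_power_pol t l P)"

definition P_rel :: "nat \<Rightarrow> nat \<Rightarrow> (word \<Rightarrow>\<^sub>0 'a::field) \<Rightarrow> 'a sigma_alg" where
  "P_rel t l a = subst_pol (\<lambda>i. sigma i a) (power_pol t l)"


section \<open>The map from \<open>\<sigma>\<langle>X\<rangle>\<close> to \<open>\<sigma>\<langle>X_tilde\<rangle>\<close> and the relations of matrix invariants\<close>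

definition donkin_relations :: "'a::field sigma_alg set" where
  "donkin_relations =
     {sigma t (sum_list as) - F_rel t as | t as.
        t > 0 \<and> length as > 1 \<and> set as \<subseteq> free_alg} \<union>
     {sigma t (of_word a ^ l) - P_rel t l (of_word a) | t l a. t > 0 \<and> l > 1 \<and> a \<noteq> 0} \<union>
     {sigma t (of_word (a + b)) - sigma t (of_word (b + a)) | t a b.
        t > 0 \<and> a \<noteq> 0 \<and> b \<noteq> 0}"

definition is_donkin_map :: "('a::field sigma_alg \<Rightarrow> 'a sigma_tilde_alg) \<Rightarrow> bool" where
  "is_donkin_map h \<longleftrightarrow>
     alg_hom h \<and> surj h \<and>
     (\<forall>t \<ge> 1. \<forall>e \<in> X_tilde. h (sigma t (of_word e)) = sigma_tilde t e) \<and>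
     {f. h f = 0} = ideal_gen donkin_relations"

text \<open>Existence is Donkin's theorem. Uniqueness: for \<open>p = h f\<close>, the element of \<open>\<sigma>\<langle>X\<rangle>\<close>
  given by the same polynomial expression as \<open>p\<close> differs from \<open>f\<close> by an element of the prescribed
  kernel, so every other such map also sends \<open>f\<close> to \<open>p\<close>.\<close>

definition pi_tilde :: "'a::field sigma_alg \<Rightarrow> 'a sigma_tilde_alg" where
  "pi_tilde = (THE h. is_donkin_map h)"

text \<open>The map is taken into the whole polynomial ring; its image is the algebra of
  matrix invariants generated by the \<open>\<sigma>\<^sub>t\<close> of monomials in generic matrices, and the kernel does
  not depend on the choice of the codomain.\<close>

definition Phi_tilde :: "nat \<Rightarrow> 'a::field sigma_tilde_alg \<Rightarrow> 'a gen_ring" where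
  "Phi_tilde n = subst_pol (\<lambda>s. case Rep_tilde_sym s of (t, e) \<Rightarrow>
     if t \<le> n then sigma_mat t (phi_word n e) else 0)"

definition K_tilde :: "nat \<Rightarrow> 'a::field sigma_tilde_alg set" where
  "K_tilde n = {f. Phi_tilde n f = 0}"

end

theory Submission
 imports Defs "HOL-Algebra.Algebraic_Closure_Type" "HOL-Library.Product_Lexorder"
begin

text \<open>Donkin's map exists because every \<open>\<sigma>\<^sub>t(a)\<close> is, uniformly in \<open>N\<close>, a polynomial in the \<open>\<sigma>\<^sub>s(e)\<close> when
  evaluated at generic \<open>N \<times> N\<close> matrices, and these evaluations are jointly injective: direct sums of
  cyclic matrices realise any finite system of values of the \<open>\<sigma>\<^sub>s(e)\<close>.

  The relations hold for all \<open>a\<close> and all \<open>t > n\<close>, as the determinant of \<open>(1 + \<tau>a)(1 + \<tau>b)\<close> shows for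
  \<open>t > 2n\<close>. Given a homogeneous element of the kernel, consider its value \<open>P\<close> at generic \<open>N \<times> N\<close> matrices,
  \<open>N\<close> large. Invariance under row and column operations makes the leading exponents of \<open>P\<close> lattice words,
  which are the exponents of a picture in the sense of Zelevinsky, and this picture is the leading
  term of a multihomogeneous component of \<open>det (1 + b)\<close> for a block matrix \<open>b\<close> of linear combinations of
  generic matrices. As \<open>P\<close> vanishes on \<open>n \<times> n\<close> matrices, the picture has more than \<open>n\<close> rows; then, by a Schur
  complement, the component lies in the ideal up to higher degree, and subtracting it lowers the
  leading monomial.\<close>

text \<open>As the characteristic is arbitrary, the relations cannot be linearized and restored by
  dividing by factorials. Homogeneous components are extracted by interpolation over the infinite
  field instead, and the leading coefficient of the subtracted component is 1 or -1, so the division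
  succeeds in every characteristic. The bound 2n comes from the coefficient of degree t in det (1 +
  xa) det (1 + xb): each product \<sigma>_i(a) \<sigma>_{t-i}(b) has an index above n as soon as t >
  2n, and the terms \<sigma>_s(a + b + \<tau>ab) occur only with t <= 2s. The blocks of b correspond
  to the columns of the picture. Multiplying block row 0 by z and eliminating the other blocks
  leaves, up to a factor free of z, det (1 + za), whose coefficient of z^\<rho> is
  \<sigma>_\<rho>(a); for the picture \<rho> is the length of its first column, that is, its number
  of rows. The elimination inverts elements 1 + c, which the free algebra does not allow, so
  geometric series are truncated; the error has higher degree and disappears on passing to the
  homogeneous part.\<close>

hide_const (open) up_ring.coeff up_ring.monom Polynomials.degree Polynomials.lead_coeff module.smult

abbreviation lookup :: "('b \<Rightarrow>\<^sub>0 'c::zero) => 'b => 'c" where "lookup \<equiv> Poly_Mapping.lookup"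
abbreviation keys :: "('b \<Rightarrow>\<^sub>0 'c::zero) => 'b set" where "keys \<equiv> Poly_Mapping.keys"
abbreviation single :: "'b => 'c => ('b \<Rightarrow>\<^sub>0 'c::zero)" where "single \<equiv> Poly_Mapping.single"

section \<open>Number expansions, interpolation, and extraction of multihomogeneous
  components\<close>

lemma sum_base_less:
 fixes x y :: "nat => nat"
 assumes "!!i. i < r ==> x i < B" and "i < r" and "x i < y i"
  and "!!j. [|i < j; j < r|] ==> x j = y j"
 shows "(\<Sum>i<r. x i * B ^ i) < (\<Sum>i<r. y i * B ^ i)"
proof -
 have low: "(\<Sum>j<s. x j * B ^ j) < B ^ s" if "s <= r" for s
  using that
 proof (induction s)
  case 0
  thus ?case by simp
 next
  case (Suc s)
  hence "(\<Sum>j<Suc s. x j * B ^ j) < B ^ s + x s * B ^ s" by simp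
  also have "... = (x s + 1) * B ^ s" by simp
  also have "... <= B * B ^ s" using assms(1)[of s] Suc.prems by (intro mult_right_mono) auto
  finally show ?case by simp
 qed
 have split: "{..<r} = {..<i} \<union> {i} \<union> {Suc i..<r}" using assms(2) by auto
 have dec: "(\<Sum>j<r. z j * B ^ j) = (\<Sum>j<i. z j * B ^ j) + z i * B ^ i + (\<Sum>j=Suc i..<r. z j * B ^ j)"
  for z :: "nat => nat"
  unfolding split by (subst sum.union_disjoint; (simp add: disjoint_iff)?)+
 have "(\<Sum>j=Suc i..<r. x j * B ^ j) = (\<Sum>j=Suc i..<r. y j * B ^ j)"
  using assms(4) by (intro sum.cong) auto
 moreover have "(\<Sum>j<i. x j * B ^ j) + x i * B ^ i < (x i + 1) * B ^ i"
  using low[of i] assms(2) by simp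
 moreover have "(x i + 1) * B ^ i <= y i * B ^ i"
  using assms(3) by (intro mult_right_mono) auto
 ultimately show ?thesis unfolding dec by linarith
qed

lemma sum_base_inj:
 fixes x y :: "nat => nat"
 assumes "!!i. i < r ==> x i < B" "!!i. i < r ==> y i < B"
  and "(\<Sum>i<r. x i * B ^ i) = (\<Sum>i<r. y i * B ^ i)" and "i < r"
 shows "x i = y i"
proof (rule ccontr)
 assume "x i ~= y i"
 define I where "I = {i. i < r & x i ~= y i}"
 have fin: "finite I" "I ~= {}" using \<open>x i ~= y i\<close> assms(4) by (auto simp: I_def)
 define m where "m = Max I"
 have "m \<in> I" using Max_in[OF fin] by (simp add: m_def)
 hence m: "m < r" "x m ~= y m" by (auto simp: I_def)
 have top: "x j = y j" if "m < j" "j < r" for j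
  using Max_ge[OF fin(1), of j] that by (fastforce simp: I_def m_def)
 show False
  using sum_base_less[of r x B m y] sum_base_less[of r y B m x] assms(1-3) m top
  by (metis linorder_neqE_nat less_irrefl)
qed

text \<open>The weight \<open>l j\<close> is the coefficient of degree \<open>m\<close> in the j-th
  Lagrange basis polynomial, so the weights recover that coefficient of any polynomial of degree at
  most \<open>n\<close> from its values at the \<open>ts j\<close>. Nodes and weights are scalars
  and therefore serve for polynomials over every algebra over the field.\<close>

lemma lagrange_functional:
 assumes "infinite (UNIV :: 'a::field set)"
 obtains ts l :: "nat => 'a::field"
 where "!!i. i <= n ==> (\<Sum>j\<le>n. l j * ts j ^ i) = (if i = m then 1 else 0)"
proof -
 obtain A :: "'a set" where A: "finite A" "card A = Suc n"
  using infinite_arbitrarily_large[OF assms] by blast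
 obtain ts :: "nat => 'a" where ts: "bij_betw ts {..n} A"
  using ex_bij_betw_nat_finite[OF A(1)] A(2) by (auto simp: atLeast0LessThan lessThan_Suc_atMost)
 have inj: "ts j = ts k \<longleftrightarrow> j = k" if "j <= n" "k <= n" for j k
  using ts that by (auto simp: bij_betw_def inj_on_def)
 define L where "L j = (\<Prod>k\<in>{..n} - {j}. smult (inverse (ts j - ts k)) [:- ts k, 1:])" for j
 have evL: "poly (L j) (ts k) = (if j = k then 1 else 0)" if "j <= n" "k <= n" for j k
 proof (cases "j = k")
  case True
  have "poly (smult (inverse (ts j - ts k)) [:- ts k, 1:]) (ts j) = 1" if "k \<in> {..n} - {j}" for k
  proof -
   have "poly (smult (inverse (ts j - ts k)) [:- ts k, 1:]) (ts j) = inverse (ts j - ts k) * (ts j - ts k)"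
    by (simp add: left_diff_distrib mult.commute)
   thus ?thesis using inj[of j k] that \<open>j <= n\<close> by simp
  qed
  hence "poly (L j) (ts j) = (\<Prod>k\<in>{..n} - {j}. 1)"
   unfolding L_def poly_prod by (intro prod.cong refl)
  thus ?thesis using True by simp
 next
  case False
  thus ?thesis unfolding L_def poly_prod using that
   by (simp, intro bexI[of _ k]) auto
 qed
 have degL: "degree (L j) <= n" if "j <= n" for j
 proof -
  have "degree (L j) <= (\<Sum>k\<in>{..n} - {j}. 1)"
   unfolding L_def
   by (rule order_trans[OF degree_prod_sum_le], simp, unfold o_def, rule sum_mono,
     rule order_trans[OF degree_smult_le], simp)
  thus ?thesis using that by simp
 qed
 have "(\<Sum>j\<le>n. coeff (L j) m * ts j ^ i) = (if i = m then 1 else 0)" if i: "i <= n" for i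
 proof -
  define p where "p = monom 1 i - (\<Sum>j\<le>n. smult (ts j ^ i) (L j))"
  have "p = 0"
  proof (rule ccontr)
   assume "p ~= 0"
   have deg: "degree p <= n" unfolding p_def using i degL
    by (intro degree_diff_le degree_sum_le) (auto simp: degree_monom_eq intro: order_trans[OF degree_smult_le])
   have "poly p (ts k) = 0" if "k <= n" for k
   proof -
    have "(\<Sum>j\<le>n. ts j ^ i * poly (L j) (ts k)) = (\<Sum>j\<le>n. if j = k then ts k ^ i else 0)"
     using that by (intro sum.cong) (auto simp: evL)
    thus ?thesis using that by (simp add: p_def poly_sum poly_monom)
   qed
   hence "A \<subseteq> {x. poly p x = 0}" using ts by (auto simp: bij_betw_def)
   hence "card A <= degree p"
    using card_poly_roots_bound[OF \<open>p ~= 0\<close>] poly_roots_finite[OF \<open>p ~= 0\<close>]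
    by (meson card_mono order_trans)
   thus False using A deg by simp
  qed
  hence "coeff (monom 1 i) m = (\<Sum>j\<le>n. ts j ^ i * coeff (L j) m)"
   unfolding p_def by (simp add: coeff_sum flip: coeff_smult)
  thus ?thesis by (simp add: mult.commute split: if_splits)
 qed
 thus ?thesis by (rule that)
qed

lemma poly_coeff_functional:
 fixes c :: "'a::field => 'r::comm_ring_1"
 assumes "comm_ring_hom c" and "!!i. i <= n ==> (\<Sum>j\<le>n. l j * ts j ^ i) = (if i = m then 1 else 0)"
  and "degree q <= n" and "m <= n"
 shows "coeff q m = (\<Sum>j\<le>n. c (l j) * poly q (c (ts j)))"
proof -
 interpret comm_ring_hom c by fact
 have alt: "poly q x = (\<Sum>i\<le>n. coeff q i * x ^ i)" for x
  unfolding poly_altdef using assms(3) by (intro sum.mono_neutral_left) (auto simp: coeff_eq_0)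
 have "(\<Sum>j\<le>n. c (l j) * poly q (c (ts j))) = (\<Sum>j\<le>n. \<Sum>i\<le>n. coeff q i * c (l j * ts j ^ i))"
  unfolding alt by (simp add: sum_distrib_left hom_distribs mult.left_commute mult.assoc)
 also have "... = (\<Sum>i\<le>n. coeff q i * c (\<Sum>j\<le>n. l j * ts j ^ i))"
  by (subst sum.swap) (simp add: sum_distrib_left hom_distribs)
 also have "... = (\<Sum>i\<le>n. if i = m then coeff q i else 0)"
  by (intro sum.cong) (auto simp: assms(2))
 also have "... = coeff q m" using assms(4) by simp
 finally show ?thesis by simp
qed

text \<open>Each coefficient is a fixed scalar combination of values at scalars, hence stays in any
  linear subspace \<open>W\<close> that contains these values.\<close>

lemma poly_coeff_mem:
 fixes c :: "'a::field => 'r::comm_ring_1"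
 assumes "comm_ring_hom c" and "infinite (UNIV :: 'a set)"
  and "0 \<in> W" and "!!x y. [|x \<in> W; y \<in> W|] ==> x + y \<in> W" and "!!a x. x \<in> W ==> c a * x \<in> W"
  and "!!t. poly q (c t) \<in> W"
 shows "coeff q m \<in> W"
proof -
 define n where "n = max m (degree q)"
 obtain ts l :: "nat => 'a"
  where l: "!!i. i <= n ==> (\<Sum>j\<le>n. l j * ts j ^ i) = (if i = m then 1 else 0)"
  using lagrange_functional[OF assms(2)] by metis
 have sumW: "sum g A \<in> W" if "!!x. x \<in> A ==> g x \<in> W" for g and A :: "nat set"
  using that by (induction A rule: infinite_finite_induct) (auto intro: assms(3,4))
 have "coeff q m = (\<Sum>j\<le>n. c (l j) * poly q (c (ts j)))"
  by (rule poly_coeff_functional[OF assms(1) l]) (auto simp: n_def)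
 also have "... \<in> W" by (intro sumW assms(5,6))
 finally show ?thesis .
qed

lemma comm_ring_hom_id: "comm_ring_hom (%a. a)"
 by standard auto

text \<open>The characteristic-free way to pass to components, used throughout. The substitution
  \<open>t i = t ^ (B ^ h i)\<close> packs a multidegree into one exponent; as \<open>B\<close>
  exceeds every degree, different multidegrees keep different exponents.\<close>

lemma multigrade_mem:
 fixes c :: "'a::field => 'r::comm_ring_1" and f :: "'k => 'r" and g :: "'k => 'i => nat"
 assumes c: "comm_ring_hom c" and inf: "infinite (UNIV :: 'a set)" and K: "finite K" and A: "finite A"
  and W: "0 \<in> W" "!!x y. [|x \<in> W; y \<in> W|] ==> x + y \<in> W" "!!a x. x \<in> W ==> c a * x \<in> W"
  and mem: "!!t. (\<Sum>m\<in>K. c (\<Prod>i\<in>A. t i ^ g m i) * f m) \<in> W"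
 shows "(\<Sum>m | m \<in> K & (\<forall>i\<in>A. g m i = gs i). f m) \<in> W"
proof (cases "\<exists>m\<in>K. \<forall>i\<in>A. g m i = gs i")
 case False
 hence "{m \<in> K. \<forall>i\<in>A. g m i = gs i} = {}" by blast
 thus ?thesis by (simp only: sum.empty W(1))
next
 case True
 then obtain m0 where m0: "m0 \<in> K" "!!i. i \<in> A ==> g m0 i = gs i" by blast
 interpret c: comm_ring_hom c by fact
 define B where "B = Suc (\<Sum>m\<in>K. \<Sum>i\<in>A. g m i)"
 have B: "g m i < B" if "m \<in> K" "i \<in> A" for m i
 proof -
  have "g m i <= (\<Sum>i\<in>A. g m i)" using that A by (intro member_le_sum) auto
  also have "... <= (\<Sum>m\<in>K. \<Sum>i\<in>A. g m i)" using that K by (intro member_le_sum) auto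
  finally show ?thesis by (simp add: B_def)
 qed
 obtain h where h: "bij_betw h A {..<card A}"
  using ex_bij_betw_finite_nat[OF A] by (auto simp: atLeast0LessThan)
 define h' where "h' = inv_into A h"
 have h': "h' (h i) = i" "h i < card A" if "i \<in> A" for i using h that by (auto simp: h'_def bij_betw_def)
 have h'A: "h' j \<in> A" if "j < card A" for j
  using h that unfolding h'_def bij_betw_def by (metis inv_into_into lessThan_iff)
 define E where "E m = (\<Sum>i\<in>A. g m i * B ^ h i)" for m
 have Eh: "E m = (\<Sum>j<card A. g m (h' j) * B ^ j)" for m
  unfolding E_def sum.reindex_bij_betw[OF h, symmetric] by (intro sum.cong) (simp_all add: h')
 have E: "E m = E m0 \<longleftrightarrow> (\<forall>i\<in>A. g m i = gs i)" if "m \<in> K" for m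
 proof
  assume eq: "E m = E m0"
  have "g m i = g m0 i" if "i \<in> A" for i
   using sum_base_inj[OF B[OF \<open>m \<in> K\<close> h'A] B[OF m0(1) h'A] eq[unfolded Eh], of "h i"] h'[OF that] by simp
  thus "\<forall>i\<in>A. g m i = gs i" using m0 by simp
 next
  assume "\<forall>i\<in>A. g m i = gs i"
  thus "E m = E m0" using m0 by (simp add: E_def)
 qed
 define q where "q = (\<Sum>m\<in>K. monom (f m) (E m))"
 have "poly q (c t) \<in> W" for t
 proof -
  have "(\<Prod>i\<in>A. (t ^ B ^ h i) ^ g m i) = t ^ E m" for m
   by (simp add: E_def power_sum mult.commute flip: power_mult)
  hence "poly q (c t) = (\<Sum>m\<in>K. c (\<Prod>i\<in>A. (t ^ B ^ h i) ^ g m i) * f m)"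
   by (simp add: q_def poly_sum poly_monom c.hom_power mult.commute)
  thus ?thesis using mem[of "%i. t ^ B ^ h i"] by simp
 qed
 from poly_coeff_mem[OF c inf W this, of "E m0"] have "coeff q (E m0) \<in> W" .
 also have "coeff q (E m0) = (\<Sum>m\<in>K. if \<forall>i\<in>A. g m i = gs i then f m else 0)"
  unfolding q_def coeff_sum using E by (intro sum.cong) auto
 also have "... = (\<Sum>m | m \<in> K & (\<forall>i\<in>A. g m i = gs i). f m)"
  using K by (simp add: sum.inter_filter)
 finally show ?thesis .
qed

lemma multigrade_eq:
 fixes c :: "'a::field => 'r::comm_ring_1" and f :: "'k => 'r" and f' :: "'l => 'r"
 assumes c: "comm_ring_hom c" and inf: "infinite (UNIV :: 'a set)" and K: "finite K" "finite K'" and A: "finite A"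
  and eq: "!!t. (\<Sum>m\<in>K. c (\<Prod>i\<in>A. t i ^ g m i) * f m) = (\<Sum>m\<in>K'. c (\<Prod>i\<in>A. t i ^ g' m i) * f' m)"
 shows "(\<Sum>m | m \<in> K & (\<forall>i\<in>A. g m i = gs i). f m) = (\<Sum>m | m \<in> K' & (\<forall>i\<in>A. g' m i = gs i). f' m)"
proof -
 let ?g = "case_sum g g'" and ?f = "case_sum f (%m. - f' m)"
 have "(\<Sum>m | m \<in> K <+> K' & (\<forall>i\<in>A. ?g m i = gs i). ?f m) \<in> {0}"
  by (rule multigrade_mem[OF c inf _ A, where K = "K <+> K'" and g = ?g and f = ?f and W = "{0}"]) (use K eq in "auto simp: sum.Plus sum_negf")
 moreover have "{m \<in> K <+> K'. \<forall>i\<in>A. ?g m i = gs i} = {m \<in> K. \<forall>i\<in>A. g m i = gs i} <+> {m \<in> K'. \<forall>i\<in>A. g' m i = gs i}"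
  by auto
 ultimately have "sum ?f ({m \<in> K. \<forall>i\<in>A. g m i = gs i} <+> {m \<in> K'. \<forall>i\<in>A. g' m i = gs i}) \<in> {0}"
  by (simp only:)
 thus ?thesis using K by (simp add: sum.Plus sum_negf)
qed

subsection \<open>Evaluation of polynomials\<close>

definition mon_ev :: "('v => 'r::comm_ring_1) => ('v \<Rightarrow>\<^sub>0 nat) => 'r" where
 "mon_ev f m = (\<Prod>v\<in>keys m. f v ^ lookup m v)"

text \<open>The evaluation homomorphism into a ring that is an algebra by way of \<open>c\<close>.
  The generality in \<open>c\<close> allows specialization to scalars and to the algebraic closure;
  \<open>subst_pol\<close> is the case \<open>c = const_pol\<close>.\<close>

definition ev :: "('a::comm_ring_1 => 'r::comm_ring_1) => ('v => 'r) => ('v, 'a) pol => 'r" where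
 "ev c f p = (\<Sum>m\<in>keys p. c (lookup p m) * mon_ev f m)"

lemma mon_ev_superset:
 assumes "finite V" "keys m \<subseteq> V"
 shows "mon_ev f m = (\<Prod>v\<in>V. f v ^ lookup m v)"
 unfolding mon_ev_def using assms by (intro prod.mono_neutral_left) (auto simp: in_keys_iff)

lemma mon_ev_0 [simp]: "mon_ev f 0 = 1"
 by (simp add: mon_ev_def)

lemma mon_ev_add: "mon_ev f (m + m') = mon_ev f m * mon_ev f m'"
proof -
 let ?V = "keys m \<union> keys m'"
 have "keys (m + m') \<subseteq> ?V" by (rule Poly_Mapping.keys_add)
 thus ?thesis
  by (simp add: mon_ev_superset[of ?V] lookup_add power_add prod.distrib)
qed

lemma mon_ev_single: "mon_ev f (single v k) = f v ^ k"
 by (cases "k = 0") (auto simp: mon_ev_def)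

lemma ev_superset:
 assumes "c 0 = 0" "finite M" "keys p \<subseteq> M"
 shows "ev c f p = (\<Sum>m\<in>M. c (lookup p m) * mon_ev f m)"
 unfolding ev_def using assms by (intro sum.mono_neutral_left) (auto simp: in_keys_iff)

lemma subst_pol_ev: "subst_pol f = ev const_pol f"
 by (rule ext) (simp add: subst_pol_def ev_def mon_ev_def)

lemma pol_add_induct [case_names zero single add]:
 fixes p :: "'m \<Rightarrow>\<^sub>0 'a::comm_monoid_add"
 assumes "P 0" and "!!m a. P (single m a)" and "!!p q. [|P p; P q|] ==> P (p + q)"
 shows "P p"
proof -
 have "p = (\<Sum>m\<in>keys p. single m (lookup p m))"
  by (rule poly_mapping_eqI)
   (auto simp: lookup_sum lookup_single when_def in_keys_iff)
 moreover have "P (\<Sum>m\<in>A. single m (lookup p m))" for A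
  by (induction A rule: infinite_finite_induct) (auto intro: assms)
 ultimately show ?thesis by metis
qed

context comm_ring_hom
begin


lemma ev_add: "ev hom f (p + q) = ev hom f p + ev hom f q"
proof -
 let ?M = "keys p \<union> keys q"
 have "keys (p + q) \<subseteq> ?M" by (rule Poly_Mapping.keys_add)
 thus ?thesis
  by (simp add: ev_superset[of hom ?M] lookup_add hom_distribs algebra_simps sum.distrib)
qed

lemma ev_0 [simp]: "ev hom f 0 = 0"
 by (simp add: ev_def)

lemma ev_single: "ev hom f (single m a) = hom a * mon_ev f m"
 by (cases "a = 0") (auto simp: ev_def)

lemma ev_mult: "ev hom f (p * q) = ev hom f p * ev hom f q"
proof (induction p rule: pol_add_induct)
 case (single m a)
 show ?case
  by (induction q rule: pol_add_induct)
   (simp_all add: ev_single ev_add mult_single mon_ev_add hom_distribs algebra_simps)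
qed (simp_all add: ev_add algebra_simps)

lemma ev_hom: "comm_ring_hom (ev hom f)"
proof
 show "ev hom f 1 = 1"
  by (simp add: ev_single flip: single_one)
qed (simp_all add: ev_add ev_mult)

lemma ev_const: "ev hom f (const_pol a) = hom a"
 by (simp add: const_pol_def ev_single)

lemma ev_var: "ev hom f (var_pol v) = f v"
 by (simp add: var_pol_def ev_single mon_ev_single)

end

lemma const_pol_hom: "comm_ring_hom (const_pol :: 'a::comm_ring_1 => ('v, 'a) pol)"
 by standard (simp_all add: const_pol_def single_add mult_single)

interpretation const_pol: comm_ring_hom "const_pol :: 'a::comm_ring_1 => ('v, 'a) pol"
 by (rule const_pol_hom)

lemma const_pol_mult_lookup: "lookup (const_pol a * p) m = a * lookup p m"
 by (induction p rule: pol_add_induct)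
  (simp_all add: const_pol_def mult_single lookup_single when_def lookup_add algebra_simps)

lemma mon_ev_var: "mon_ev var_pol m = (single m 1 :: ('v, 'a::comm_ring_1) pol)"
proof (induction m rule: pol_add_induct)
 case (single v k)
 show ?case
 proof (induction k)
  case (Suc k)
  have "single v (Suc k) = single v 1 + single v k"
   by (simp flip: single_add)
  with Suc show ?case by (simp add: mon_ev_add mon_ev_single var_pol_def mult_single)
 qed simp
qed (simp_all add: mon_ev_add mult_single)

lemma single_eq_const_mult_mon: "single m a = const_pol a * mon_ev var_pol m"
 by (simp add: mon_ev_var const_pol_def mult_single)

lemma pol_induct [case_names const var add mult]:
 fixes p :: "('v, 'a::comm_ring_1) pol"
 assumes "!!a. P (const_pol a)" "!!v. P (var_pol v)" "!!p q. [|P p; P q|] ==> P (p + q)"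
  "!!p q. [|P p; P q|] ==> P (p * q)"
 shows "P p"
proof (induction p rule: pol_add_induct)
 case zero
 show ?case using assms(1)[of 0] by simp
next
 case (single m a)
 have one: "P 1" using assms(1)[of 1] by simp
 have pow: "P (var_pol v ^ k)" for v k
  by (induction k) (auto intro: assms one)
 have "P (\<Prod>v\<in>A. var_pol v ^ lookup m v)" for A
  by (induction A rule: infinite_finite_induct) (auto intro: assms one pow)
 thus ?case unfolding single_eq_const_mult_mon mon_ev_def by (intro assms)
qed (rule assms)

lemma comm_ring_hom_pol_eqI:
 fixes h g :: "('v, 'a::comm_ring_1) pol => 'r::comm_ring_1"
 assumes "comm_ring_hom h" "comm_ring_hom g"
  and "!!a. h (const_pol a) = g (const_pol a)" "!!v. h (var_pol v) = g (var_pol v)"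
 shows "h p = g p"
proof -
 interpret h: comm_ring_hom h by fact
 interpret g: comm_ring_hom g by fact
 show ?thesis
  by (induction p rule: pol_induct) (simp_all add: assms(3,4) hom_distribs hom_distribs)
qed

lemma comm_ring_hom_compose:
 assumes "comm_ring_hom h" "comm_ring_hom g"
 shows "comm_ring_hom (%x. h (g x))"
proof -
 interpret h: comm_ring_hom h by fact
 interpret g: comm_ring_hom g by fact
 show ?thesis by standard (simp_all add: hom_distribs hom_distribs)
qed

lemma ev_ev:
 assumes "comm_ring_hom h" "comm_ring_hom c"
 shows "h (ev c f p) = ev (%a. h (c a)) (%v. h (f v)) p"
proof (rule comm_ring_hom_pol_eqI)
 interpret h: comm_ring_hom h by fact
 interpret c: comm_ring_hom c by fact
 interpret hc: comm_ring_hom "%a. h (c a)" by (rule comm_ring_hom_compose) fact+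
 show "comm_ring_hom (%p. h (ev c f p))"
  by (rule comm_ring_hom_compose) (fact, rule c.ev_hom)
 show "comm_ring_hom (ev (%a. h (c a)) (%v. h (f v)))" by (rule hc.ev_hom)
qed (simp_all add: comm_ring_hom.ev_const comm_ring_hom.ev_var assms comm_ring_hom_compose)

lemma ev_cong:
 assumes "!!m v. [|m \<in> keys p; v \<in> keys m|] ==> f v = g v"
 shows "ev c f p = ev c g p"
 unfolding ev_def mon_ev_def using assms by (intro sum.cong refl arg_cong2[of _ _ _ _ "(*)"] prod.cong) auto

lemma ev_var_pol: "ev const_pol var_pol (p :: ('v, 'a::comm_ring_1) pol) = p"
proof -
 interpret e: comm_ring_hom "ev const_pol var_pol :: ('v, 'a) pol => _"
  by (rule const_pol.ev_hom)
 show ?thesis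
  by (induction p rule: pol_induct) (simp_all add: const_pol.ev_const const_pol.ev_var hom_distribs)
qed

lemma alg_homD:
 assumes "alg_hom h"
 shows "comm_ring_hom h" "h (const_pol a) = const_pol a"
proof -
 have c: "!!a. h (const_pol a) = const_pol a" using assms by (auto simp: alg_hom_def)
 show "comm_ring_hom h"
 proof
  show "h 0 = 0" using c[of 0] by simp
  show "h 1 = 1" using c[of 1] by simp
 qed (use assms in "auto simp: alg_hom_def")
 show "h (const_pol a) = const_pol a" by (rule c)
qed

lemma alg_hom_subst_pol: "alg_hom (subst_pol f)"
 by (simp add: alg_hom_def subst_pol_ev const_pol.ev_add const_pol.ev_mult const_pol.ev_const)

text \<open>If all values were zero, rescaling the variables would isolate any single monomial of
  \<open>p\<close> and force its coefficient to vanish.\<close>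

lemma ex_ev_nonzero:
 fixes c :: "'a::comm_ring_1 => 'k::field" and p :: "('v, 'a) pol"
 assumes "comm_ring_hom c" "!!a. c a = 0 ==> a = 0" "infinite (UNIV :: 'k set)" "p ~= 0"
 shows "\<exists>f. ev c f p ~= 0"
proof (rule ccontr)
 assume "\<not> ?thesis"
 hence zero: "ev c t p = 0" for t by blast
 define V where "V = (\<Union>m\<in>keys p. keys m)"
 have V: "finite V" "keys m \<subseteq> V" if "m \<in> keys p" for m using that by (auto simp: V_def)
 obtain M where M: "M \<in> keys p" using assms(4) by fastforce
 have "(\<Sum>m | m \<in> keys p & (\<forall>v\<in>V. lookup m v = lookup M v). c (lookup p m)) \<in> {0}"
 proof (rule multigrade_mem[OF comm_ring_hom_id assms(3)])
  fix t
  have "(\<Sum>m\<in>keys p. (\<Prod>v\<in>V. t v ^ lookup m v) * c (lookup p m)) = ev c t p"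
   unfolding ev_def by (intro sum.cong) (simp_all add: mon_ev_superset[OF V] mult.commute)
  thus "(\<Sum>m\<in>keys p. (\<Prod>v\<in>V. t v ^ lookup m v) * c (lookup p m)) \<in> {0}"
   by (simp add: zero)
 qed (simp_all add: V_def)
 also have "{m \<in> keys p. \<forall>v\<in>V. lookup m v = lookup M v} = {M}"
 proof -
  have "m = M" if "m \<in> keys p" "\<forall>v\<in>V. lookup m v = lookup M v" for m
  proof (rule poly_mapping_eqI)
   fix v
   show "lookup m v = lookup M v"
    using that(2) V(2)[OF that(1)] V(2)[OF M] by (metis in_keys_iff subsetD)
  qed
  thus ?thesis using M by blast
 qed
 finally have "lookup p M = 0" using assms(2) by simp
 thus False using M by (simp add: in_keys_iff)
qed

subsection \<open>The coefficients of \<open>det (1 + xA)\<close>\<close>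

text \<open>The reversed characteristic polynomial det (1 + xA). Its coefficients are the
  \<sigma>_t(A) without signs, and over a domain it does not change when A is enlarged by a zero
  block, so matrices of different sizes can be compared.\<close>

definition gdet :: "'r::comm_ring_1 mat => 'r poly" where
 "gdet A = det (mat (dim_row A) (dim_row A) (%(i, j). [:if i = j then 1 else 0, A $$ (i, j):]))"

lemma degree_linear_le: "degree [:a, b:] <= 1"
 by (rule order_trans[OF degree_pCons_le]) simp

lemma coeff_prod_linear_reverse:
 fixes b d :: "'i => 'r::comm_ring_1"
 assumes "finite I" "t <= card I"
 shows "coeff (\<Prod>i\<in>I. [:b i, d i:]) (card I - t) = coeff (\<Prod>i\<in>I. [:d i, b i:]) t"
 using assms
proof (induction I arbitrary: t rule: finite_induct)
 case (insert i I)
 have high: "coeff (\<Prod>i\<in>I. [:f i, g i:]) k = 0" if "k > card I" for k and f g :: "'i => 'r"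
 proof (rule coeff_eq_0)
  have "degree (\<Prod>i\<in>I. [:f i, g i:]) <= (\<Sum>i\<in>I. 1)"
   by (rule order_trans[OF degree_prod_sum_le[OF insert.hyps(1)]]) (rule sum_mono, simp only: o_apply degree_linear_le)
  thus "degree (\<Prod>i\<in>I. [:f i, g i:]) < k" using that by simp
 qed
 have step: "coeff ([:x, y:] * p) k = x * coeff p k + (case k of 0 => 0 | Suc j => y * coeff p j)"
  for x y :: 'r and p k
  by (cases k) simp_all
 show ?case
 proof (cases t)
  case 0
  thus ?thesis using insert high[of "Suc (card I)"] insert.IH[of 0] by (simp add: step)
 next
  case (Suc s)
  show ?thesis
  proof (cases "s = card I")
   case True
   thus ?thesis using Suc insert high[of "Suc s"] insert.IH[of s] by (simp add: step)
  next
   case False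
   hence s: "Suc s <= card I" using insert.prems insert.hyps Suc by simp
   have "card I - s = Suc (card I - Suc s)" using s by simp
   thus ?thesis using Suc insert.hyps insert.IH[of s] insert.IH[of "Suc s"] s
    by (simp add: step algebra_simps)
  qed
 qed
qed simp

lemma coeff_prod_linear_uminus:
 fixes b d :: "'i => 'r::comm_ring_1"
 shows "coeff (\<Prod>i\<in>I. [:d i, - b i:]) t = (-1) ^ t * coeff (\<Prod>i\<in>I. [:d i, b i:]) t"
proof (induction I arbitrary: t rule: infinite_finite_induct)
 case (insert i I)
 thus ?case by (cases t) (simp_all add: algebra_simps)
qed (cases t; simp)+

lemma degree_gdet_le: "degree (gdet A) <= dim_row A"
proof -
 let ?n = "dim_row A"
 have "degree (\<Prod>i = 0..<?n. [:f i, g i:]) <= ?n" for f g :: "nat => 'a"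
 proof -
  have "degree (\<Prod>i = 0..<?n. [:f i, g i:]) <= (\<Sum>i=0..<?n. 1)"
   by (rule order_trans[OF degree_prod_sum_le], simp) (rule sum_mono, simp only: o_apply degree_linear_le)
  thus ?thesis by simp
 qed
 from this[of "%i. if i = p i then 1 else 0" "%i. A $$ (i, p i)" for p]
 have "degree (\<Prod>i = 0..<?n. [:if i = p i then 1 else 0, A $$ (i, p i):]) <= ?n" for p
  by blast
 moreover have "(\<Prod>i = 0..<?n. mat ?n ?n (%(i, j). [:if i = j then 1 else 0, A $$ (i, j):]) $$ (i, p i))
   = (\<Prod>i = 0..<?n. [:if i = p i then 1 else 0, A $$ (i, p i):])" if "p permutes {0..<?n}" for p
  using that by (intro prod.cong) (auto simp: permutes_in_image)
 ultimately show ?thesis unfolding gdet_def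
  by (subst det_def'[where n = "?n"])
   (auto intro!: degree_sum_le order_trans[OF degree_mult_le] simp: finite_permutations sign_def)
qed

lemma coeff_gdet:
 assumes A: "A \<in> carrier_mat n n"
 shows "coeff (gdet A) t = sigma_mat t A"
proof (cases "t <= n")
 case False
 thus ?thesis using A degree_gdet_le[of A] by (auto simp: sigma_mat_def intro!: coeff_eq_0)
next
 case True
 have dim: "dim_row A = n" using A by auto
 let ?P = "%p. (\<Prod>i = 0..<n. [:if i = p i then 1 else 0, A $$ (i, p i):])"
 have g: "gdet A = (\<Sum>p | p permutes {0..<n}. signof p * ?P p)"
  unfolding gdet_def dim by (subst det_def'[where n = n])
   (auto intro!: sum.cong prod.cong simp: permutes_in_image)
 have "char_poly A = (\<Sum>p | p permutes {0..<n}. signof p * (\<Prod>i = 0..<n. [:- A $$ (i, p i), if i = p i then 1 else 0:]))"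
 proof -
  have "char_poly_matrix A $$ (i, p i) = [:- A $$ (i, p i), if i = p i then 1 else 0:]"
   if "p permutes {0..<n}" "i < n" for p i
  proof -
   have "p i < n" using that permutes_in_image by fastforce
   thus ?thesis using A that by (simp add: char_poly_matrix_def)
  qed
  thus ?thesis using A unfolding char_poly_def
   by (subst det_def'[where n = n]) (auto intro!: sum.cong arg_cong2[of _ _ _ _ "(*)"] prod.cong)
 qed
 moreover have "coeff (signof p * q) k = signof p * coeff q k" for p k and q :: "'a poly"
  by (simp add: sign_def)
 ultimately have "sigma_mat t A = (\<Sum>p | p permutes {0..<n}. signof p * ((- 1) ^ t *
   coeff (\<Prod>i = 0..<n. [:- A $$ (i, p i), if i = p i then 1 else 0:]) (n - t)))"
  using True by (simp add: sigma_mat_def dim coeff_sum sum_distrib_left mult.left_commute)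
 also have "... = (\<Sum>p | p permutes {0..<n}. signof p * coeff (?P p) t)"
 proof (intro sum.cong refl arg_cong2[of _ _ _ _ "(*)"])
  fix p
  have "coeff (\<Prod>i = 0..<n. [:- A $$ (i, p i), if i = p i then 1 else 0:]) (n - t)
    = (- 1) ^ t * coeff (?P p) t"
   using coeff_prod_linear_reverse[of "{0..<n}" t "%i. - A $$ (i, p i)" "%i. if i = p i then 1 else 0"] True
   by (simp add: coeff_prod_linear_uminus)
  thus "(- 1) ^ t * coeff (\<Prod>i = 0..<n. [:- A $$ (i, p i), if i = p i then 1 else 0:]) (n - t)
    = coeff (?P p) t"
   by (simp flip: mult.assoc power_add power_mult_distrib)
 qed
 finally show ?thesis
  by (simp add: g coeff_sum sign_def flip: sum_distrib_left)
    (auto intro!: sum.cong)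
qed

lemma gdet_eqI:
 assumes "A \<in> carrier_mat n n" "B \<in> carrier_mat m m" "gdet A = gdet B"
 shows "sigma_mat t A = sigma_mat t B"
 using assms coeff_gdet by metis

lemma poly_gdet:
 assumes "A \<in> carrier_mat n n"
 shows "poly (gdet A) x = det (1\<^sub>m n + x \<cdot>\<^sub>m A)"
proof -
 have "comm_ring_hom (%p :: 'a poly. poly p x)" by standard auto
 from comm_ring_hom.hom_det[OF this, symmetric] show ?thesis using assms
  unfolding gdet_def by (auto intro!: arg_cong[of _ _ det])
qed

lemma det_one_plus:
 assumes "A \<in> carrier_mat n n"
 shows "det (1\<^sub>m n + A) = (\<Sum>t\<le>n. sigma_mat t A)"
proof -
 have "det (1\<^sub>m n + A) = poly (gdet A) 1" using poly_gdet[OF assms, of 1] assms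
  by (auto intro!: arg_cong[of _ _ det])
 also have "... = (\<Sum>t\<le>n. coeff (gdet A) t)"
  unfolding poly_altdef using degree_gdet_le[of A] assms
  by (simp, intro sum.mono_neutral_left) (auto simp: coeff_eq_0)
 finally show ?thesis using assms by (simp add: coeff_gdet)
qed

lemma gdet_eq_det:
 assumes "A \<in> carrier_mat n n"
 shows "gdet A = det (1\<^sub>m n + [:0, 1:] \<cdot>\<^sub>m map_mat (%a. [:a:]) A)"
 unfolding gdet_def using assms by (intro arg_cong[of _ _ det] eq_matI) (auto simp: one_pCons)

lemma sigma_mat_0 [simp]:
 assumes "A \<in> carrier_mat n n"
 shows "sigma_mat 0 A = 1"
proof -
 have "sigma_mat 0 A = poly (gdet A) 0" using coeff_gdet[OF assms] by (simp add: poly_0_coeff_0)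
 also have "... = 1" 
 proof -
  have "1\<^sub>m n + 0 \<cdot>\<^sub>m A = 1\<^sub>m n" using assms by (intro eq_matI) auto
  thus ?thesis by (simp add: poly_gdet[OF assms])
 qed
 finally show ?thesis .
qed

lemma (in comm_ring_hom) sigma_mat_hom:
 assumes "A \<in> carrier_mat n n"
 shows "sigma_mat t (map_mat hom A) = hom (sigma_mat t A)"
 using assms by (simp add: sigma_mat_def char_poly_hom hom_distribs)

lemma sigma_mat_smult:
 assumes A: "A \<in> carrier_mat n n"
 shows "sigma_mat t (c \<cdot>\<^sub>m A) = c ^ t * sigma_mat t A"
proof -
 have "gdet (c \<cdot>\<^sub>m A) = gdet A \<circ>\<^sub>p [:0, c:]"
 proof -
  have "comm_ring_hom (%p :: 'a poly. p \<circ>\<^sub>p [:0, c:])"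
   by standard (auto simp: pcompose_add pcompose_mult)
  from comm_ring_hom.hom_det[OF this, symmetric] show ?thesis
   unfolding gdet_def using A by (auto intro!: arg_cong[of _ _ det] simp: pcompose_pCons mult.commute)
 qed
 thus ?thesis using A coeff_pcompose_linear[of "gdet A" c t] by (simp flip: coeff_gdet[of _ n])
qed

lemma gdet_block:
 fixes A :: "'r::idom mat"
 assumes A: "A \<in> carrier_mat n n" "B \<in> carrier_mat m n" "D \<in> carrier_mat m m"
 shows "gdet (four_block_mat A (0\<^sub>m n m) B D) = gdet A * gdet D"
proof -
 let ?e = "%M. mat (dim_row M) (dim_row M) (%(i, j). [:if i = j then 1 else 0, M $$ (i, j):])"
 have e: "?e (four_block_mat A (0\<^sub>m n m) B D)
   = four_block_mat (?e A) (0\<^sub>m n m) ([:0, 1:] \<cdot>\<^sub>m map_mat (%a. [:a:]) B) (?e D)"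
  using A by (intro eq_matI) auto
 thus ?thesis using A unfolding gdet_def
  by (subst e, subst det_four_block_mat_upper_right_zero[where n = n and m = m]) auto
qed

lemma gdet_zero: "gdet (0\<^sub>m n n) = 1"
proof -
 have "mat n n (%(i, j). [:if i = j then 1 else 0, 0\<^sub>m n n $$ (i, j) :: 'a:]) = 1\<^sub>m n"
  by (intro eq_matI) auto
 thus ?thesis by (simp add: gdet_def)
qed

lemma sigma_mat_zero: "t > 0 ==> sigma_mat t (0\<^sub>m n n) = 0"
 by (simp flip: coeff_gdet[of _ n] add: gdet_zero)

text \<open>Similarity without inverses: over a domain the nonzero factor det P cancels from det (1
  + xA) det P = det P det (1 + xB).\<close>

lemma gdet_intertwine:
 fixes P :: "'r::idom mat"
 assumes "P \<in> carrier_mat n n" "A \<in> carrier_mat n n" "B \<in> carrier_mat n n"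
  and "A * P = P * B" "det P ~= 0"
 shows "gdet A = gdet B"
proof -
 let ?c = "%a :: 'r. [:a:]"
 interpret c: comm_ring_hom ?c by standard (auto simp: one_pCons)
 let ?A = "map_mat ?c A" and ?B = "map_mat ?c B" and ?P = "map_mat ?c P" and ?x = "[:0, 1:] :: 'r poly"
 have car: "?A \<in> carrier_mat n n" "?B \<in> carrier_mat n n" "?P \<in> carrier_mat n n" using assms by auto
 have AP: "?A * ?P = ?P * ?B"
  using assms by (simp flip: c.mat_hom_mult[where n = n and nc = n and nr = n])
 have "(1\<^sub>m n + ?x \<cdot>\<^sub>m ?A) * ?P = ?P + ?x \<cdot>\<^sub>m (?A * ?P)"
  using car by (subst add_mult_distrib_mat[of _ n n]) auto
 also have "... = ?P * (1\<^sub>m n + ?x \<cdot>\<^sub>m ?B)"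
  using car by (subst mult_add_distrib_mat[of _ n n _ n]) (auto simp: AP mult_smult_distrib[where nr=n and n=n and nc=n])
 finally have "det ((1\<^sub>m n + ?x \<cdot>\<^sub>m ?A) * ?P) = det (?P * (1\<^sub>m n + ?x \<cdot>\<^sub>m ?B))" by simp
 hence "gdet A * det ?P = det ?P * gdet B"
  using car assms by (simp add: det_mult[where n = n] gdet_eq_det[where n = n])
 moreover have "det ?P ~= 0" using assms by simp
 ultimately show ?thesis by (metis mult.commute mult_left_cancel)
qed

text \<open>The block matrices with diagonal blocks AB, 0 and 0, BA and with lower left block B are
  intertwined by the unipotent matrix with upper right block A, whether or not A and B are
  invertible.\<close>

lemma gdet_mult_comm:
 fixes A :: "'r::idom mat"
 assumes A: "A \<in> carrier_mat n n" "B \<in> carrier_mat n n"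
 shows "gdet (A * B) = gdet (B * A)"
proof -
 let ?Z = "0\<^sub>m n n :: 'r mat" and ?I = "1\<^sub>m n :: 'r mat"
 let ?M = "four_block_mat (A * B) ?Z B ?Z" and ?N = "four_block_mat ?Z ?Z B (B * A)"
 let ?P = "four_block_mat ?I A ?Z ?I"
 have car: "A * B \<in> carrier_mat n n" "B * A \<in> carrier_mat n n" using A by auto
 have "gdet ?M = gdet ?N"
 proof (rule gdet_intertwine)
  show "?M * ?P = ?P * ?N"
   using A car by (simp add: mult_four_block_mat[where ?nr1.0=n and ?nr2.0=n and ?n1.0=n and ?n2.0=n and ?nc1.0=n and ?nc2.0=n]
     assoc_mult_mat[of A n n B n A n])
  show "det ?P ~= 0"
   using A by (subst det_four_block_mat_lower_left_zero[where n = n and m = n]) auto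
 qed (use A in auto)
 thus ?thesis
  using A car by (simp add: gdet_block[where n = n and m = n] gdet_zero)
qed

lemma sigma_mat_mult_comm:
 fixes A :: "'r::idom mat"
 assumes "A \<in> carrier_mat n n" "B \<in> carrier_mat n n"
 shows "sigma_mat t (A * B) = sigma_mat t (B * A)"
 using assms gdet_mult_comm[OF assms] by (intro gdet_eqI[where n = n and m = n]) auto

text \<open>In (1 + xA)(1 + xB) = 1 + x(A + B + xAB) the inner x is first replaced by an independent
  variable y: \<open>C\<close> is A + B + yAB over the polynomials in y. After setting y = x, the
  term with s = t contributes \<sigma>_t(A + B), and all others have s < t.\<close>

lemma sigma_mat_add:
 fixes A B :: "'r::comm_ring_1 mat"
 assumes A: "A \<in> carrier_mat n n" "B \<in> carrier_mat n n"
 defines "C \<equiv> mat n n (%(i, j). [:(A + B) $$ (i, j), (A * B) $$ (i, j):])"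
 shows "(\<Sum>i\<le>t. sigma_mat i A * sigma_mat (t - i) B) = (\<Sum>s\<le>t. coeff (sigma_mat s C) (t - s))"
  "!!c. poly (sigma_mat s C) c = sigma_mat s (A + B + c \<cdot>\<^sub>m (A * B))"
  "coeff (sigma_mat s C) 0 = sigma_mat s (A + B)"
  "k > s ==> coeff (sigma_mat s C) k = 0"
proof -
 let ?c = "%a :: 'r. [:a:]" and ?x = "[:0, 1:] :: 'r poly"
 have C: "C \<in> carrier_mat n n" by (simp add: C_def)
 interpret cc: comm_ring_hom ?c by standard (auto simp: one_pCons)
 show ev: "poly (sigma_mat s C) c = sigma_mat s (A + B + c \<cdot>\<^sub>m (A * B))" for c s
 proof -
  have "comm_ring_hom (%p :: 'r poly. poly p c)" by standard auto
  from comm_ring_hom.sigma_mat_hom[OF this C, symmetric] show ?thesis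
   using A by (auto intro!: arg_cong[of _ _ "sigma_mat s"] simp: C_def)
 qed
 show "coeff (sigma_mat s C) 0 = sigma_mat s (A + B)"
 proof -
  have "A + B + 0 \<cdot>\<^sub>m (A * B) = A + B" using A by (intro eq_matI) auto
  thus ?thesis using ev[of s 0] by (simp flip: poly_0_coeff_0)
 qed
 show high: "coeff (sigma_mat s C) k = 0" if "k > s" for s k
 proof -
  \<comment> \<open>Each entry is constant in y at x^0 and at most linear in y at x^1; so in every
    product of the Leibniz formula the coefficient of x^s has degree at most s in y.\<close>
  have deg: "degree (coeff (det M) s) <= s" if M: "M \<in> carrier_mat n n" "!!i j. [|i < n; j < n|] ==> degree (coeff (M $$ (i, j)) 0) <= 0 & degree (coeff (M $$ (i, j)) 1) <= 1 & degree (M $$ (i, j)) <= 1"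
   for M :: "'r poly poly mat" and s
  proof -
   have pr: "\<forall>s. degree (coeff (\<Prod>i\<in>I. M $$ (i, p i)) s) <= s" if "p permutes {0..<n}" "I \<subseteq> {0..<n}" "finite I" for p I
    using that(3,2)
   proof (induction I rule: finite_induct)
    case empty
    thus ?case by (simp add: coeff_1)
   next
    case (insert i I)
    let ?m = "M $$ (i, p i)"
    have i: "i < n" "p i < n" using insert.prems that(1) by (auto simp: permutes_in_image)
    note Mi = M(2)[OF i]
    obtain a b where m: "?m = [:a, b:]"
     using Mi by (metis degree_eq_zeroE less_Suc0 le_Suc_eq One_nat_def degree1_coeffs le_zero_eq pCons_0_0)
    have ab: "degree a = 0" "degree b <= 1" using Mi by (auto simp: m)
    show ?case
    proof
     fix s
     have "degree (a * coeff (\<Prod>i\<in>I. M $$ (i, p i)) s) <= s"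
      using insert ab by (intro order_trans[OF degree_mult_le]) simp
     moreover have "degree (b * coeff (\<Prod>i\<in>I. M $$ (i, p i)) u) <= Suc u" for u
      using insert ab by (intro order_trans[OF degree_mult_le]) (simp add: add_mono_thms_linordered_semiring(1)[of _ 1 _ u, simplified])
     ultimately show "degree (coeff (\<Prod>i\<in>insert i I. M $$ (i, p i)) s) <= s"
      using insert.hyps by (cases s) (auto simp: m intro!: degree_add_le)
    qed
   qed
   show ?thesis
    unfolding det_def'[OF M(1)] coeff_sum
    by (intro degree_sum_le) (auto simp: finite_permutations sign_def pr)
  qed
  have "degree (coeff (gdet C) s) <= s"
   unfolding gdet_def by (rule deg) (auto simp: C_def degree_pCons_eq_if)
  thus ?thesis using that by (simp add: coeff_gdet[OF C] coeff_eq_0)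
 qed
 have "gdet A * gdet B = det ((1\<^sub>m n + ?x \<cdot>\<^sub>m map_mat ?c A) * (1\<^sub>m n + ?x \<cdot>\<^sub>m map_mat ?c B))"
  using A by (simp add: gdet_eq_det[where n = n] det_mult[where n = n])
 also have "(1\<^sub>m n + ?x \<cdot>\<^sub>m map_mat ?c A) * (1\<^sub>m n + ?x \<cdot>\<^sub>m map_mat ?c B) = 1\<^sub>m n + ?x \<cdot>\<^sub>m C"
 proof -
  let ?A = "map_mat ?c A" and ?B = "map_mat ?c B"
  have car: "?A \<in> carrier_mat n n" "?B \<in> carrier_mat n n" using A by auto
  have AB: "?A * ?B = map_mat ?c (A * B)"
   using A by (simp add: cc.mat_hom_mult[where n = n and nc = n and nr = n])
  have "(1\<^sub>m n + ?x \<cdot>\<^sub>m ?A) * (1\<^sub>m n + ?x \<cdot>\<^sub>m ?B) = (1\<^sub>m n + ?x \<cdot>\<^sub>m ?B) + (?x \<cdot>\<^sub>m ?A) * (1\<^sub>m n + ?x \<cdot>\<^sub>m ?B)"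
   using car by (subst add_mult_distrib_mat[of _ n n]) auto
  also have "(?x \<cdot>\<^sub>m ?A) * (1\<^sub>m n + ?x \<cdot>\<^sub>m ?B) = ?x \<cdot>\<^sub>m ?A + ?x \<cdot>\<^sub>m (?x \<cdot>\<^sub>m (?A * ?B))"
   using car by (subst mult_add_distrib_mat[of _ n n _ n]) (auto simp: mult_smult_distrib[where nr=n and n=n and nc=n])
  finally show ?thesis unfolding AB using A by (auto intro!: eq_matI simp: C_def)
 qed
 also have "det (1\<^sub>m n + ?x \<cdot>\<^sub>m C) = (\<Sum>s\<le>n. ?x ^ s * sigma_mat s C)"
  using C by (simp add: det_one_plus[where n = n] sigma_mat_smult[OF C])
 finally have "coeff (gdet A * gdet B) t = (\<Sum>s\<le>n. coeff (?x ^ s * sigma_mat s C) t)"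
  by (simp add: coeff_sum)
 also have "... = (\<Sum>s\<le>n. if s <= t then coeff (sigma_mat s C) (t - s) else 0)"
 proof (intro sum.cong refl)
  fix s
  have "?x ^ s = monom 1 s" by (simp add: monom_altdef)
  thus "coeff (?x ^ s * sigma_mat s C) t = (if s <= t then coeff (sigma_mat s C) (t - s) else 0)"
   by (simp only: coeff_monom_mult) auto
 qed
 also have "... = (\<Sum>s\<in>{..n} \<inter> {..t}. coeff (sigma_mat s C) (t - s))"
  by (subst sum.inter_restrict) (auto intro!: sum.cong)
 also have "... = (\<Sum>s\<le>t. coeff (sigma_mat s C) (t - s))"
  using C by (intro sum.mono_neutral_left) (auto simp: sigma_mat_def)
 finally show "(\<Sum>i\<le>t. sigma_mat i A * sigma_mat (t - i) B) = (\<Sum>s\<le>t. coeff (sigma_mat s C) (t - s))"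
  using A by (simp add: coeff_mult coeff_gdet[where n = n])
qed

lemma smult_pow_mat:
 fixes A :: "'r::comm_ring_1 mat"
 assumes A: "A \<in> carrier_mat n n"
 shows "(c \<cdot>\<^sub>m A) ^\<^sub>m k = c ^ k \<cdot>\<^sub>m (A ^\<^sub>m k)"
proof (induction k)
 case 0
 thus ?case using A by (intro eq_matI) auto
next
 case (Suc k)
 have car: "A ^\<^sub>m k \<in> carrier_mat n n" using A by (rule pow_carrier_mat)
 have "(c ^ k \<cdot>\<^sub>m (A ^\<^sub>m k)) * (c \<cdot>\<^sub>m A) = c \<cdot>\<^sub>m (c ^ k \<cdot>\<^sub>m (A ^\<^sub>m k * A))"
  using A car by (simp add: mult_smult_distrib[where nr=n and n=n and nc=n] mult_smult_assoc_mat[where nr=n and n=n and nc=n])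
 also have "... = c ^ Suc k \<cdot>\<^sub>m (A ^\<^sub>m k * A)" by (intro eq_matI) auto
 finally show ?case using Suc by simp
qed

lemma pow_mat_commute:
 fixes A :: "'r::comm_ring_1 mat"
 assumes A: "A \<in> carrier_mat n n"
 shows "A * A ^\<^sub>m k = A ^\<^sub>m k * A"
proof (induction k)
 case (Suc k)
 have "A ^\<^sub>m k \<in> carrier_mat n n" using A by (rule pow_carrier_mat)
 hence "A * (A ^\<^sub>m k * A) = (A * A ^\<^sub>m k) * A" using A by (simp add: assoc_mult_mat[of _ n n _ n _ n])
 thus ?case using Suc by simp
qed (use A in simp)

lemma ex_geometric_mat:
 fixes B :: "'r::comm_ring_1 mat"
 assumes B: "B \<in> carrier_mat n n"
 shows "\<exists>Q\<in>carrier_mat n n. (1\<^sub>m n + B) * Q = 1\<^sub>m n - (- 1) ^ k \<cdot>\<^sub>m (B ^\<^sub>m k)"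
proof (induction k)
 case 0
 show ?case using B by (intro bexI[of _ "0\<^sub>m n n"]) auto
next
 case (Suc k)
 then obtain Q where Q: "Q \<in> carrier_mat n n" "(1\<^sub>m n + B) * Q = 1\<^sub>m n - (- 1) ^ k \<cdot>\<^sub>m (B ^\<^sub>m k)" by blast
 have car: "B ^\<^sub>m k \<in> carrier_mat n n" using B by (rule pow_carrier_mat)
 let ?R = "(- 1) ^ k \<cdot>\<^sub>m (B ^\<^sub>m k)"
 have comm: "B * B ^\<^sub>m k = B ^\<^sub>m k * B"
  using B by (rule pow_mat_commute)
 have "(1\<^sub>m n + B) * (Q + ?R) = (1\<^sub>m n + B) * Q + (1\<^sub>m n + B) * ?R"
  using B Q car by (subst mult_add_distrib_mat[of _ n n _ n]) auto
 also have "(1\<^sub>m n + B) * ?R = ?R + (- 1) ^ k \<cdot>\<^sub>m (B * B ^\<^sub>m k)"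
  using B car by (subst add_mult_distrib_mat[of _ n n]) (auto simp: mult_smult_distrib[where nr=n and n=n and nc=n])
 also have "(1\<^sub>m n + B) * Q + ... = 1\<^sub>m n - (- 1) ^ Suc k \<cdot>\<^sub>m (B ^\<^sub>m Suc k)"
  unfolding Q(2) comm using B car by (intro eq_matI) auto
 finally show ?case using B Q car by (intro bexI[of _ "Q + ?R"]) auto
qed

text \<open>The geometric series inverts 1 + xA over the polynomials, so its determinant is a unit
  there. Over a domain such units are constant, and the value at x = 0 is 1.\<close>

lemma gdet_nilpotent:
 fixes A :: "'r::idom mat"
 assumes A: "A \<in> carrier_mat n n" and "A ^\<^sub>m k = 0\<^sub>m n n"
 shows "gdet A = 1"
proof -
 interpret c: comm_ring_hom "%a :: 'r. [:a:]" by standard (auto simp: one_pCons)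
 let ?A = "map_mat (%a. [:a:]) A"
 let ?B = "[:0, 1:] \<cdot>\<^sub>m ?A"
 have car: "?A \<in> carrier_mat n n" "?B \<in> carrier_mat n n" using A by auto
 have "?A ^\<^sub>m k = map_mat (%a. [:a:]) (A ^\<^sub>m k)" using c.mat_hom_pow[OF A] by simp
 hence "?B ^\<^sub>m k = 0\<^sub>m n n"
  unfolding smult_pow_mat[OF car(1)] assms(2) by (auto intro!: eq_matI)
 moreover obtain Q where Q: "Q \<in> carrier_mat n n" "(1\<^sub>m n + ?B) * Q = 1\<^sub>m n - (- 1) ^ k \<cdot>\<^sub>m (?B ^\<^sub>m k)"
  using ex_geometric_mat[OF car(2)] by blast
 ultimately have "(1\<^sub>m n + ?B) * Q = 1\<^sub>m n" by (auto intro!: eq_matI)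
 hence "det ((1\<^sub>m n + ?B) * Q) = 1" by simp
 hence "gdet A * det Q = 1"
  using Q car A by (simp add: det_mult[where n = n] gdet_eq_det[where n = n])
 hence "gdet A dvd 1" by (metis dvdI)
 then obtain c where "gdet A = [:c:]" using is_unit_poly_iff by blast
 moreover have "coeff (gdet A) 0 = 1" using A by (simp add: coeff_gdet[where n = n])
 ultimately show ?thesis by (metis coeff_pCons_0 one_pCons)
qed

lemma gdet_transpose:
 assumes "A \<in> carrier_mat n n"
 shows "gdet (transpose_mat A) = gdet A"
proof (rule poly_eqI)
 fix t
 have "transpose_mat A \<in> carrier_mat n n" using assms by auto
 from coeff_gdet[OF this] coeff_gdet[OF assms] show "coeff (gdet (transpose_mat A)) t = coeff (gdet A) t"
  using assms char_poly_transpose_mat[OF assms] by (simp add: sigma_mat_def)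
qed

definition companion :: "nat => (nat => 'r) => 'r::comm_ring_1 mat" where
 "companion q r = mat q q (%(i, j). if i = 0 then r j else if i = Suc j then 1 else 0)"

lemma companion_carrier [simp]: "companion q r \<in> carrier_mat q q"
 by (simp add: companion_def)

lemma gdet_companion:
 "gdet (companion q r) = 1 + (\<Sum>j<q. monom ((- 1) ^ j * r j) (Suc j))"
proof (cases "q = 0")
 case True
 thus ?thesis by (simp add: gdet_def companion_def)
next
 case False
 let ?x = "[:0, - 1:] :: 'a poly"
 define M where "M = mat q q (%(i, j). [:if i = j then 1 else 0, companion q r $$ (i, j):])"
 \<comment> \<open>\<open>L\<close> is the inverse of the lower bidiagonal matrix with 1 on the
   diagonal and x below it. The product with it is upper triangular, and only its first diagonal
   entry differs from 1.\<close>
 define L where "L = mat q q (%(i, j). if j <= i then ?x ^ (i - j) else 0)"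
 have car: "M \<in> carrier_mat q q" "L \<in> carrier_mat q q" by (auto simp: M_def L_def)
 have LT: "det L = 1"
  by (subst det_lower_triangular[OF _ car(2)])
   (auto simp: L_def diag_mat_def intro!: prod_list_neutral)
 have entry: "(M * L) $$ (i, j) = (\<Sum>k<q. M $$ (i, k) * L $$ (k, j))" if "i < q" "j < q" for i j
  using that car by (simp add: times_mat_def scalar_prod_def atLeast0LessThan)
 have low: "(M * L) $$ (i, j) = (if i = j then 1 else 0)" if ij: "0 < i" "i < q" "j < q" for i j
 proof -
  have "(\<Sum>k<q. M $$ (i, k) * L $$ (k, j)) = (\<Sum>k\<in>{i - 1, i}. M $$ (i, k) * L $$ (k, j))"
   using ij by (intro sum.mono_neutral_right) (auto simp: M_def companion_def)
  also have "... = [:0, 1:] * L $$ (i - 1, j) + L $$ (i, j)"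
   using ij by (auto simp: M_def companion_def one_pCons)
  also have "... = (if i = j then 1 else 0)"
  proof (cases "j < i")
   case True
   hence "i - j = Suc (i - 1 - j)" by simp
   with True ij show ?thesis by (auto simp: L_def)
  qed (use ij in "auto simp: L_def")
  finally show ?thesis using entry ij by simp
 qed
 have x: "[:0, 1:] * ?x ^ k = monom ((- 1) ^ k) (Suc k)" for k
 proof -
  have "?x = smult (- 1) [:0, 1:]" by simp
  hence "?x ^ k = smult ((- 1) ^ k) ([:0, 1:] ^ k)" by (simp only: smult_power)
  thus ?thesis by (simp add: monom_altdef)
 qed
 have "(M * L) $$ (0, 0) = (\<Sum>k<q. M $$ (0, k) * ?x ^ k)"
  using False by (subst entry) (auto simp: L_def)
 also have "... = (\<Sum>k<q. (if k = 0 then 1 else 0) + monom ((- 1) ^ k * r k) (Suc k))"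
 proof (intro sum.cong refl)
  fix k assume k: "k \<in> {..<q}"
  have "M $$ (0, k) = (if k = 0 then 1 else 0) + smult (r k) [:0, 1:]"
   using k False by (auto simp: M_def companion_def one_pCons)
  hence "M $$ (0, k) * ?x ^ k = (if k = 0 then 1 else 0) * ?x ^ k + smult (r k) ([:0, 1:] * ?x ^ k)"
   by (simp only: distrib_right mult_smult_left)
  also have "... = (if k = 0 then 1 else 0) + monom ((- 1) ^ k * r k) (Suc k)"
   unfolding x by (simp add: smult_monom mult.commute)
  finally show "M $$ (0, k) * ?x ^ k = (if k = 0 then 1 else 0) + monom ((- 1) ^ k * r k) (Suc k)" .
 qed
 also have "... = 1 + (\<Sum>j<q. monom ((- 1) ^ j * r j) (Suc j))"
  using False by (simp add: sum.distrib)
 finally have c0: "(M * L) $$ (0, 0) = ..." .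
 have "upper_triangular (M * L)" using low car by (auto simp: upper_triangular_def)
 hence "det (M * L) = prod_list (diag_mat (M * L))"
  using car by (intro det_upper_triangular[where n = q]) auto
 also have "... = (\<Prod>i<q. (M * L) $$ (i, i))"
  using car by (simp add: prod_list_diag_prod atLeast0LessThan)
 also have "... = (\<Prod>i<q. if i = 0 then (M * L) $$ (0, 0) else 1)"
  using low by (intro prod.cong) auto
 also have "... = (M * L) $$ (0, 0)" using False by simp
 finally have "det M * det L = (M * L) $$ (0, 0)" using car by (simp add: det_mult[where n = q])
 thus ?thesis using c0 LT by (simp add: gdet_def M_def companion_def)
qed

subsection \<open>Evaluation of words and of elements of the free algebra at matrices\<close>

definition word_mat :: "nat => (nat => 'r::comm_ring_1 mat) => word => 'r mat" where
 "word_mat n Xs w = foldr (%k A. Xs k * A) (letters w) (1\<^sub>m n)"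

definition alg_mat :: "nat => ('a::comm_ring_1 => 'r) => (nat => 'r mat) => (word \<Rightarrow>\<^sub>0 'a) => 'r::comm_ring_1 mat" where
 "alg_mat n c Xs a = mat n n (%(i, j). \<Sum>w\<in>keys a. c (lookup a w) * word_mat n Xs w $$ (i, j))"

abbreviation gen_alg :: "nat => (word \<Rightarrow>\<^sub>0 'a::field) => 'a gen_ring mat" where
 "gen_alg N \<equiv> alg_mat N const_pol (generic_mat N)"
abbreviation gen_word :: "nat => word => 'a::field gen_ring mat" where
 "gen_word N \<equiv> word_mat N (generic_mat N)"

lemma phi_word_eq: "phi_word n = word_mat n (generic_mat n)"
 by (rule ext) (simp add: phi_word_def word_mat_def)

lemma alg_mat_carrier [simp]: "alg_mat n c Xs a \<in> carrier_mat n n"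
 by (simp add: alg_mat_def)

lemma alg_mat_dim [simp]: "dim_row (alg_mat n c Xs a) = n" "dim_col (alg_mat n c Xs a) = n"
 by (simp_all add: alg_mat_def)

lemma word_mat_0 [simp]: "word_mat n Xs 0 = 1\<^sub>m n"
 by (simp add: word_mat_def zero_word_def)

lemma word_mat_Nil [simp]: "word_mat n Xs (Word []) = 1\<^sub>m n"
 by (simp add: word_mat_def)

lemma word_mat_Cons: "word_mat n Xs (Word (k # ks)) = Xs k * word_mat n Xs (Word ks)"
 by (simp add: word_mat_def)

context
 fixes n :: nat and Xs :: "nat => 'r::comm_ring_1 mat"
 assumes X: "!!k. Xs k \<in> carrier_mat n n"
begin

lemma word_mat_carrier [simp]: "word_mat n Xs w \<in> carrier_mat n n"
proof -
 have "foldr (%k A. Xs k * A) ks (1\<^sub>m n) \<in> carrier_mat n n" for ks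
  by (induction ks) (auto intro: mult_carrier_mat X)
 thus ?thesis by (simp add: word_mat_def)
qed

lemma word_mat_letter [simp]: "word_mat n Xs (Word [k]) = Xs k"
 using X[of k] by (simp add: word_mat_def)

lemma word_mat_append: "word_mat n Xs (Word (ks @ ls)) = word_mat n Xs (Word ks) * word_mat n Xs (Word ls)"
proof (induction ks)
 case Nil
 show ?case using left_mult_one_mat[OF word_mat_carrier] by simp
next
 case (Cons k ks)
 have "Xs k * (word_mat n Xs (Word ks) * word_mat n Xs (Word ls))
   = (Xs k * word_mat n Xs (Word ks)) * word_mat n Xs (Word ls)"
  by (rule assoc_mult_mat[symmetric, OF X word_mat_carrier word_mat_carrier])
 thus ?case by (simp add: word_mat_Cons Cons)
qed

lemma word_mat_add: "word_mat n Xs (v + w) = word_mat n Xs v * word_mat n Xs w"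
 using word_mat_append[of "letters v" "letters w"] by (simp add: plus_word_def)

lemma word_mat_power: "word_mat n Xs (sum_list (replicate l w)) = word_mat n Xs w ^\<^sub>m l"
proof (induction l)
 case 0
 show ?case using carrier_matD[OF word_mat_carrier[of w]] by simp
next
 case (Suc l)
 have "word_mat n Xs w * word_mat n Xs w ^\<^sub>m l = word_mat n Xs w ^\<^sub>m l * word_mat n Xs w"
  by (rule pow_mat_commute[OF word_mat_carrier])
 thus ?case using Suc by (simp add: word_mat_add)
qed

end

lemma (in comm_ring_hom) word_mat_hom:
 assumes X: "!!k. Xs k \<in> carrier_mat n n"
 shows "map_mat hom (word_mat n Xs w) = word_mat n (%k. map_mat hom (Xs k)) w"
proof -
 have "map_mat hom (foldr (%k A. Xs k * A) ks (1\<^sub>m n)) = foldr (%k A. map_mat hom (Xs k) * A) ks (1\<^sub>m n)" for ks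
 proof (induction ks)
  case Nil
  show ?case by (simp add: mat_hom_one)
 next
  case (Cons k ks)
  have "foldr (%k A. Xs k * A) ks (1\<^sub>m n) \<in> carrier_mat n n"
   by (induction ks) (auto intro: mult_carrier_mat X)
  thus ?case using Cons X[of k] by (simp add: mat_hom_mult[of _ n n _ n])
 qed
 thus ?thesis by (simp add: word_mat_def)
qed

context comm_ring_hom
begin

context
 fixes n :: nat and Xs :: "nat => 'b mat"
 assumes X: "!!k. Xs k \<in> carrier_mat n n"
begin

lemma alg_mat_superset:
 assumes "finite M" "keys a \<subseteq> M" "i < n" "j < n"
 shows "alg_mat n hom Xs a $$ (i, j) = (\<Sum>w\<in>M. hom (lookup a w) * word_mat n Xs w $$ (i, j))"
 unfolding alg_mat_def using assms by (simp, intro sum.mono_neutral_left) (auto simp: in_keys_iff)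

lemma alg_mat_add: "alg_mat n hom Xs (a + b) = alg_mat n hom Xs a + alg_mat n hom Xs b"
proof -
 let ?M = "keys a \<union> keys b"
 have "keys (a + b) \<subseteq> ?M" by (rule Poly_Mapping.keys_add)
 hence "alg_mat n hom Xs (a + b) $$ (i, j) = alg_mat n hom Xs a $$ (i, j) + alg_mat n hom Xs b $$ (i, j)"
  if "i < n" "j < n" for i j
  using that by (subst (1 2 3) alg_mat_superset[of ?M])
   (simp_all add: lookup_add hom_distribs distrib_right sum.distrib)
 thus ?thesis
  by (intro eq_matI) auto
qed

lemma alg_mat_0 [simp]: "alg_mat n hom Xs 0 = 0\<^sub>m n n"
 by (auto simp: alg_mat_def)

lemma alg_mat_single: "alg_mat n hom Xs (single w a) = hom a \<cdot>\<^sub>m word_mat n Xs w"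
proof -
 have "word_mat n Xs w \<in> carrier_mat n n" by (rule word_mat_carrier) (rule X)
 thus ?thesis by (cases "a = 0") (auto simp: alg_mat_def intro!: eq_matI)
qed


lemma alg_mat_single_mult:
 "alg_mat n hom Xs (single v c * b) = alg_mat n hom Xs (single v c) * alg_mat n hom Xs b"
proof (induction b rule: pol_add_induct)
 case zero
 show ?case by (simp add: right_mult_zero_mat[OF alg_mat_carrier])
next
 case (single w d)
 show ?case using word_mat_carrier[OF X]
  by (simp add: alg_mat_single mult_single word_mat_add[OF X] hom_distribs
    mult_smult_distrib[where nr=n and n=n and nc=n] mult_smult_assoc_mat[where nr=n and n=n and nc=n])
   (auto intro!: eq_matI)
next
 case (add p q)
 have "alg_mat n hom Xs (single v c * (p + q))
   = alg_mat n hom Xs (single v c) * alg_mat n hom Xs p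
    + alg_mat n hom Xs (single v c) * alg_mat n hom Xs q"
  by (simp add: distrib_left alg_mat_add add)
 also have "... = alg_mat n hom Xs (single v c) * alg_mat n hom Xs (p + q)"
  by (simp add: alg_mat_add mult_add_distrib_mat[of _ n n _ n])
 finally show ?case .
qed

lemma alg_mat_mult: "alg_mat n hom Xs (a * b) = alg_mat n hom Xs a * alg_mat n hom Xs b"
proof (induction a rule: pol_add_induct)
 case zero
 show ?case by (simp add: left_mult_zero_mat[OF alg_mat_carrier])
next
 case (single v c)
 show ?case by (rule alg_mat_single_mult)
next
 case (add p q)
 thus ?case by (simp add: distrib_right alg_mat_add add_mult_distrib_mat[of _ n n _ _ n])
qed

lemma alg_mat_const_mult: "alg_mat n hom Xs (single 0 c * a) = hom c \<cdot>\<^sub>m alg_mat n hom Xs a"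
 by (simp add: alg_mat_mult alg_mat_single mult_smult_assoc_mat[OF one_carrier_mat alg_mat_carrier]
   left_mult_one_mat[OF alg_mat_carrier])

lemma alg_mat_1: "alg_mat n hom Xs 1 = 1\<^sub>m n"
 using alg_mat_single[of 0 1] by (auto simp flip: single_one)

lemma alg_mat_uminus: "alg_mat n hom Xs (- a) = - alg_mat n hom Xs a"
proof -
 have "alg_mat n hom Xs (- a) = mat n n (%(i, j). \<Sum>w\<in>keys a. hom (- lookup a w) * word_mat n Xs w $$ (i, j))"
  unfolding alg_mat_def by (intro cong_mat refl) (simp_all add: keys_minus hom_distribs)
 thus ?thesis by (auto simp: alg_mat_def hom_distribs sum_negf)
qed

end

end

lemma alg_mat_hom:
 assumes "comm_ring_hom h" and X: "!!k. Xs k \<in> carrier_mat n n"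
 shows "map_mat h (alg_mat n c Xs a) = alg_mat n (%x. h (c x)) (%k. map_mat h (Xs k)) a"
proof -
 interpret h: comm_ring_hom h by fact
 have "h (word_mat n Xs w $$ (i, j)) = word_mat n (%k. map_mat h (Xs k)) w $$ (i, j)" if "i < n" "j < n" for w i j
 proof -
  have "word_mat n Xs w \<in> carrier_mat n n" by (rule word_mat_carrier) (rule X)
  moreover have "map_mat h (word_mat n Xs w) = word_mat n (%k. map_mat h (Xs k)) w"
   by (rule h.word_mat_hom) (rule X)
  ultimately show ?thesis using that by (metis carrier_matD index_map_mat(1))
 qed
 thus ?thesis by (intro eq_matI) (auto simp: alg_mat_def hom_distribs)
qed

subsection \<open>Words\<close>

definition primitive_list :: "'b list => bool" where
 "primitive_list xs \<longleftrightarrow> xs ~= [] & (\<forall>zs l. xs = concat (replicate l zs) --> l = 1)"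

lemma length_concat_replicate: "length (concat (replicate l zs)) = l * length zs"
 by (induction l) auto

lemma concat_replicate_add: "concat (replicate (k + l) zs) = concat (replicate k zs) @ concat (replicate l zs)"
 by (induction k) auto

lemma concat_replicate_mult: "concat (replicate (k * l) zs) = concat (replicate k (concat (replicate l zs)))"
 by (induction k) (auto simp: concat_replicate_add)

lemma concat_replicate_nth:
 assumes "i < l * length zs"
 shows "concat (replicate l zs) ! i = zs ! (i mod length zs)"
 using assms
proof (induction l arbitrary: i)
 case (Suc l)
 show ?case
 proof (cases "i < length zs")
  case False
  hence "(i - length zs) mod length zs = i mod length zs"
   by (simp add: le_mod_geq)
  with False Suc.IH[of "i - length zs"] Suc.prems show ?thesis by (simp add: nth_append)
 qed (simp add: nth_append)
qed simp

lemma primitive_commute: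
 assumes "primitive_list xs" "xs = a @ b" "a @ b = b @ a"
 shows "a = [] \<or> b = []"
proof (rule ccontr)
 assume ne: "\<not> ?thesis"
 obtain m n zs where "concat (replicate m zs) = a" "concat (replicate n zs) = b"
  using comm_append_are_replicate[OF assms(3)] by blast
 moreover from this have "m > 0" "n > 0" using ne by (auto intro!: Nat.gr0I)
 ultimately have "xs = concat (replicate (m + n) zs)" "m + n > 1"
  using assms(2) by (auto simp: concat_replicate_add)
 thus False using assms(1) unfolding primitive_list_def by fastforce
qed

text \<open>Let g be the shorter word and f = g f'. Moving g around in (g f')^m = g^n gives (f' g)^m
  = (g f')^m, so f' and g commute, and commuting words are powers of a common word.\<close>

lemma power_eq_common_root:
 assumes "concat (replicate m f) = concat (replicate n g)" "m > 0" "n > 0"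
 shows "\<exists>zs i j. f = concat (replicate i zs) & g = concat (replicate j zs)"
proof -
 have main: "\<exists>zs i j. f = concat (replicate i zs) & g = concat (replicate j zs)"
  if eq: "concat (replicate m f) = concat (replicate n g)" and pos: "m > 0" "n > 0"
   and len: "length g <= length f" for m n and f g :: "'a list"
 proof -
  obtain m' n' where mn: "m = Suc m'" "n = Suc n'" using pos by (metis gr0_conv_Suc)
  have "f @ concat (replicate m' f) = g @ concat (replicate n' g)" using eq mn by simp
  hence "take (length g) (f @ concat (replicate m' f)) = g" by simp
  hence "take (length g) f = g" using len by simp
  then obtain f' where f: "f = g @ f'" by (metis append_take_drop_id)
  have shift: "concat (replicate k (g @ f')) @ g = g @ concat (replicate k (f' @ g))" for k
   by (induction k) auto
  have snoc: "concat (replicate k g) @ g = g @ concat (replicate k g)" for k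
   by (induction k) auto
  have "g @ concat (replicate m (f' @ g)) = concat (replicate n g) @ g"
   using eq f shift[of m] by simp
  hence "concat (replicate m (f' @ g)) = concat (replicate m (g @ f'))"
   using eq f snoc[of n] by simp
  hence "take (length f) ((f' @ g) @ concat (replicate m' (f' @ g)))
    = take (length f) ((g @ f') @ concat (replicate m' (g @ f')))" by (simp add: mn)
  hence "f' @ g = g @ f'" using f by simp
  then obtain i j zs where "concat (replicate i zs) = f'" "concat (replicate j zs) = g"
   using comm_append_are_replicate by blast
  thus ?thesis using f by (metis concat_replicate_add)
 qed
 show ?thesis
 proof (cases "length g <= length f")
  case True
  thus ?thesis using main assms by blast
 next
  case False
  thus ?thesis using main[OF assms(1)[symmetric] assms(3,2)] by auto
 qed
qed

lemma primitive_power_inj: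
 assumes "primitive_list f" "primitive_list g"
  and "concat (replicate m f) = concat (replicate n g)" "m > 0" "n > 0"
 shows "f = g"
proof -
 obtain zs i j where "f = concat (replicate i zs)" "g = concat (replicate j zs)"
  using power_eq_common_root[OF assms(3-5)] by blast
 moreover from this have "i = 1" "j = 1" using assms(1,2) by (auto simp: primitive_list_def)
 ultimately show ?thesis by simp
qed

lemma ex_primitive_root:
 assumes "xs ~= []"
 shows "\<exists>f l. primitive_list f & l > 0 & xs = concat (replicate l f)"
 using assms
proof (induction "length xs" arbitrary: xs rule: less_induct)
 case less
 show ?case
 proof (cases "primitive_list xs")
  case True
  thus ?thesis by (intro exI[of _ xs] exI[of _ 1]) simp
 next
  case False
  then obtain zs l where zs: "xs = concat (replicate l zs)" "l ~= 1"
   using less.prems by (auto simp: primitive_list_def)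
  hence "l > 1" "zs ~= []" using less.prems by (cases l; auto)+
  hence "length zs < length xs" using zs(1) by (simp add: length_concat_replicate)
  from less.hyps[OF this \<open>zs ~= []\<close>] obtain f k where
   "primitive_list f" "k > 0" "zs = concat (replicate k f)" by blast
  thus ?thesis using zs \<open>l > 1\<close>
   by (intro exI[of _ f] exI[of _ "l * k"]) (simp add: concat_replicate_mult)
 qed
qed

lemma rotate1_power: "rotate1 (concat (replicate l zs)) = concat (replicate l (rotate1 zs))"
proof (cases zs)
 case Nil
 thus ?thesis by simp
next
 case (Cons z ys)
 have "concat (replicate l (z # ys)) @ [z] = z # concat (replicate l (ys @ [z]))" for l
  by (induction l) auto
 thus ?thesis unfolding Cons
  by (cases l) auto
qed

lemma rotate_power: "rotate k (concat (replicate l zs)) = concat (replicate l (rotate k zs))"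
 by (induction k) (simp_all add: rotate1_power)

lemma rotate_inverse: "\<exists>j. rotate j (rotate k xs) = xs"
proof -
 have "rotate (length xs * k) xs = xs" by (metis mod_mult_self1_is_0 rotate_id)
 thus ?thesis
 proof (cases "xs = []")
  case False
  have "k <= length xs * k" using False by (cases "length xs") auto
  hence "rotate (length xs * k - k) (rotate k xs) = rotate (length xs * k) xs"
   by (simp only: rotate_rotate le_add_diff_inverse2)
  thus ?thesis using \<open>rotate (length xs * k) xs = xs\<close> by metis
 qed simp
qed

lemma primitive_rotate:
 assumes "primitive_list xs"
 shows "primitive_list (rotate k xs)"
 unfolding primitive_list_def
proof (intro conjI allI impI)
 show "rotate k xs ~= []" using assms by (simp add: primitive_list_def)
 fix zs l assume eq: "rotate k xs = concat (replicate l zs)"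
 obtain j where "rotate j (rotate k xs) = xs" using rotate_inverse by blast
 hence "xs = concat (replicate l (rotate j zs))" using eq by (simp add: rotate_power)
 thus "l = 1" using assms by (auto simp: primitive_list_def)
qed

lemma letters_sum_list_replicate: "letters (sum_list (replicate l b)) = concat (replicate l (letters b))"
 by (induction l) (simp_all add: zero_word_def plus_word_def)

lemma primitive_word_iff: "primitive_word a \<longleftrightarrow> primitive_list (letters a)"
proof
 assume a: "primitive_word a"
 hence ne: "letters a ~= []" by (metis primitive_word_def word.collapse zero_word_def)
 show "primitive_list (letters a)"
  unfolding primitive_list_def
 proof (intro conjI allI impI)
  fix zs l assume eq: "letters a = concat (replicate l zs)"
  hence "a = sum_list (replicate l (Word zs))"
   by (intro word.expand) (simp add: letters_sum_list_replicate)
  hence "\<not> l > 1" using a by (auto simp: primitive_word_def)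
  moreover have "l ~= 0" using eq ne by (intro notI) simp
  ultimately show "l = 1" by linarith
 qed (rule ne)
next
 assume a: "primitive_list (letters a)"
 show "primitive_word a"
  unfolding primitive_word_def
 proof (intro conjI allI impI notI)
  show "a = 0 ==> False" using a by (simp add: primitive_list_def zero_word_def)
  fix b l assume "l > (1 :: nat)" "a = sum_list (replicate l b)"
  thus False using a letters_sum_list_replicate[of l b] by (auto simp: primitive_list_def)
 qed
qed

lemma cyclic_equiv_iff: "cyclic_equiv a b \<longleftrightarrow> (\<exists>k. letters b = rotate k (letters a))"
proof
 assume "cyclic_equiv a b"
 then obtain a1 a2 where "a = a1 + a2" "b = a2 + a1" by (auto simp: cyclic_equiv_def)
 hence "letters b = rotate (length (letters a1)) (letters a)"
  by (simp add: plus_word_def rotate_append)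
 thus "\<exists>k. letters b = rotate k (letters a)" ..
next
 assume "\<exists>k. letters b = rotate k (letters a)"
 then obtain k where k: "letters b = rotate k (letters a)" ..
 let ?m = "k mod length (letters a)"
 show "cyclic_equiv a b" unfolding cyclic_equiv_def
  by (intro exI[of _ "Word (take ?m (letters a))"] exI[of _ "Word (drop ?m (letters a))"] conjI word.expand)
    (simp_all add: plus_word_def k rotate_drop_take)
qed

lemma X_tilde_nonempty: "e \<in> X_tilde ==> letters e ~= []"
 by (auto simp: X_tilde_def primitive_word_iff primitive_list_def)

lemma X_tilde_rotate_eq:
 assumes "e \<in> X_tilde" "f \<in> X_tilde" "letters f = rotate k (letters e)"
 shows "e = f"
proof -
 obtain j where "letters e = rotate j (letters f)" using rotate_inverse assms(3) by metis
 hence "cyclic_equiv e f" "cyclic_equiv f e" using assms(3) by (auto simp: cyclic_equiv_iff)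
 thus ?thesis using assms by (auto simp: X_tilde_def intro!: antisym)
qed

lemma X_tilde_rotate_self:
 assumes "e \<in> X_tilde" "rotate k (letters e) = letters e"
 shows "k mod length (letters e) = 0"
proof (rule ccontr)
 let ?m = "k mod length (letters e)"
 assume m: "?m ~= 0"
 have ne: "letters e ~= []" by (rule X_tilde_nonempty) fact
 hence lt: "?m < length (letters e)" by simp
 moreover have "take ?m (letters e) @ drop ?m (letters e) = drop ?m (letters e) @ take ?m (letters e)"
  using assms(2) by (simp add: rotate_drop_take)
 ultimately show False
  using primitive_commute[of "letters e" "take ?m (letters e)" "drop ?m (letters e)"] assms(1) m ne lt
  by (auto simp: X_tilde_def primitive_word_iff)
qed

lemma X_tilde_power_rotate_eq:
 assumes "e \<in> X_tilde" "f \<in> X_tilde" "m > 0" "n > 0"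
  and "concat (replicate m (letters f)) = concat (replicate n (rotate k (letters e)))"
 shows "e = f"
 using assms primitive_power_inj[of "letters f" "rotate k (letters e)" m n] primitive_rotate X_tilde_rotate_eq[of e f k]
 by (auto simp: X_tilde_def primitive_word_iff)

text \<open>Take the primitive root of \<open>a\<close> and then the maximum of its finitely many
  rotations; rotating commutes with taking powers.\<close>

lemma ex_X_tilde_root:
 assumes "a ~= 0"
 shows "\<exists>e\<in>X_tilde. \<exists>l>0. cyclic_equiv a (sum_list (replicate l e)) & set (letters e) \<subseteq> set (letters a)
  & length (letters a) = l * length (letters e)"
proof -
 have "letters a ~= []" using assms by (metis word.collapse zero_word_def)
 then obtain f l where f: "primitive_list f" "l > 0" "letters a = concat (replicate l f)"
  using ex_primitive_root by blast
 let ?R = "(%k. Word (rotate k f)) ` {..<length f}"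
 have R: "Word (rotate k f) \<in> ?R" for k
 proof -
  have "f ~= []" using f(1) by (simp add: primitive_list_def)
  thus ?thesis by (intro image_eqI[of _ _ "k mod length f"]) (simp_all add: rotate_conv_mod[symmetric])
 qed
 have "Max ?R \<in> ?R" using R[of 0] by (intro Max_in) auto
 then obtain k where k: "Max ?R = Word (rotate k f)" by auto
 let ?e = "Word (rotate k f)"
 have "b <= ?e" if cyc: "cyclic_equiv ?e b" for b
 proof -
  obtain j where "letters b = rotate j (rotate k f)" using cyc by (auto simp: cyclic_equiv_iff)
  hence "b = Word (rotate (j + k) f)" by (intro word.expand) (simp add: rotate_rotate)
  hence "b \<in> ?R" using R by simp
  thus ?thesis using k by (metis Max_ge finite_imageI finite_lessThan)
 qed
 hence "?e \<in> X_tilde" using primitive_rotate[OF f(1)] by (simp add: X_tilde_def primitive_word_iff)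
 moreover have "cyclic_equiv a (sum_list (replicate l ?e))"
  unfolding cyclic_equiv_iff letters_sum_list_replicate using f(3)
  by (intro exI[of _ k]) (simp add: rotate_power)
 moreover have "set (letters ?e) \<subseteq> set (letters a)" using f by auto
 ultimately show ?thesis using f(2,3) by (intro bexI[of _ ?e] exI[of _ l]) (auto simp: length_concat_replicate)
qed

subsection \<open>Cyclic matrices\<close>

text \<open>The letters act on a cycle whose edge from p to p + 1 is labelled by the letter
  \<open>es ! p\<close>; the closing edge has weight z, the others weight 1. A word has a nonzero
  entry only where it can be read along the cycle.\<close>

definition cyc_mat :: "nat list => 'r::comm_ring_1 => nat => 'r mat" where
 "cyc_mat es z k = mat (length es) (length es)
   (%(p, q). if q = Suc p mod length es & es ! p = k then (if Suc p = length es then z else 1) else 0)"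

lemma cyc_mat_carrier [simp]: "cyc_mat es z k \<in> carrier_mat (length es) (length es)"
 by (simp add: cyc_mat_def)

lemma cyc_mat_dim [simp]: "dim_row (cyc_mat es z k) = length es" "dim_col (cyc_mat es z k) = length es"
 by (simp_all add: cyc_mat_def)

lemma cyc_mat_mult:
 assumes "A \<in> carrier_mat (length es) (length es)" "p < length es" "q < length es"
 shows "(cyc_mat es z k * A) $$ (p, q)
  = (if es ! p = k then (if Suc p = length es then z else 1) else 0) * A $$ (Suc p mod length es, q)"
proof -
 let ?l = "length es"
 have "?l > 0" using assms(2) by linarith
 hence l: "Suc p mod ?l < ?l" by simp
 have "(cyc_mat es z k * A) $$ (p, q) = (\<Sum>r<?l. cyc_mat es z k $$ (p, r) * A $$ (r, q))"
  using assms by (simp add: times_mat_def scalar_prod_def atLeast0LessThan)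
 also have "... = (\<Sum>r<?l. if r = Suc p mod ?l then
   (if es ! p = k then (if Suc p = ?l then z else 1) else 0) * A $$ (Suc p mod ?l, q) else 0)"
  using assms by (intro sum.cong) (auto simp: cyc_mat_def)
 also have "... = (if es ! p = k then (if Suc p = ?l then z else 1) else 0) * A $$ (Suc p mod ?l, q)"
  using l by simp
 finally show ?thesis .
qed

lemma cyc_word_nonzero:
 assumes "word_mat (length es) (cyc_mat es z) (Word w) $$ (p, q) ~= 0" "p < length es" "q < length es"
 shows "q = (p + length w) mod length es & (\<forall>i<length w. w ! i = es ! ((p + i) mod length es))"
 using assms
proof (induction w arbitrary: p)
 case Nil
 thus ?case by (auto split: if_splits)
next
 case (Cons k w)
 let ?p = "Suc p mod length es"
 have car: "word_mat (length es) (cyc_mat es z) (Word w) \<in> carrier_mat (length es) (length es)"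
  by (rule word_mat_carrier) simp
 have "(if es ! p = k then (if Suc p = length es then z else 1) else 0)
   * word_mat (length es) (cyc_mat es z) (Word w) $$ (?p, q) ~= 0"
  using Cons.prems by (simp only: word_mat_Cons cyc_mat_mult[OF car] not_False_eq_True)
 hence nz: "es ! p = k" "word_mat (length es) (cyc_mat es z) (Word w) $$ (?p, q) ~= 0"
  by (auto split: if_splits)
 moreover have "length es > 0" using Cons.prems by linarith
 hence "?p < length es" by simp
 ultimately have IH: "q = (?p + length w) mod length es" "\<forall>i<length w. w ! i = es ! ((?p + i) mod length es)"
  using Cons.IH[of ?p] Cons.prems(3) by auto
 have "(k # w) ! i = es ! ((p + i) mod length es)" if "i < length (k # w)" for i
  using that IH(2) nz(1) Cons.prems(2) by (cases i) (auto simp: mod_add_left_eq)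
 thus ?case using IH(1) by (auto simp: mod_add_left_eq)
qed

lemma cyc_word_value:
 assumes "p < length es"
 shows "word_mat (length es) (cyc_mat es z) (Word (drop p es)) $$ (p, 0) = z"
 using assms
proof (induction "length es - p" arbitrary: p)
 case (Suc d)
 let ?l = "length es"
 have car: "word_mat ?l (cyc_mat es z) (Word (drop (Suc p) es)) \<in> carrier_mat ?l ?l"
  by (rule word_mat_carrier) simp
 have l: "0 < ?l" using Suc.prems by auto
 have "drop p es = es ! p # drop (Suc p) es" using Suc.prems by (rule Cons_nth_drop_Suc[symmetric])
 hence eq: "word_mat ?l (cyc_mat es z) (Word (drop p es)) $$ (p, 0)
   = (if Suc p = ?l then z else 1) * word_mat ?l (cyc_mat es z) (Word (drop (Suc p) es)) $$ (Suc p mod ?l, 0)"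
  using Suc.prems l by (simp add: word_mat_Cons cyc_mat_mult[OF car])
 show ?case
 proof (cases "Suc p = ?l")
  case True
  thus ?thesis using eq l by simp
 next
  case False
  hence "Suc p < ?l" "d = ?l - Suc p" using Suc by auto
  thus ?thesis using eq Suc.hyps(1)[of "Suc p"] False by simp
 qed
qed simp

lemma gdet_corner:
 assumes "A \<in> carrier_mat n n" "n > 0" "!!i j. [|i < n; j < n; \<not> (i = 0 & j = 0)|] ==> A $$ (i, j) = 0"
 shows "gdet A = [:1, A $$ (0, 0):]"
proof -
 let ?M = "mat n n (%(i, j). [:if i = j then 1 else 0, A $$ (i, j):])"
 have "det ?M = prod_list (diag_mat ?M)"
  by (rule det_upper_triangular[where n = n]) (auto simp: upper_triangular_def assms(3))
 also have "... = (\<Prod>i<n. ?M $$ (i, i))" by (simp add: prod_list_diag_prod atLeast0LessThan)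
 also have "... = (\<Prod>i<n. if i = 0 then [:1, A $$ (0, 0):] else 1)"
  using assms(3) by (intro prod.cong) (auto simp: one_pCons)
 finally show ?thesis using assms(1,2) by (simp add: gdet_def)
qed

text \<open>With l the length of \<open>es\<close>, a nonzero entry at the word f^l means that f^l
  is a power of a rotation of \<open>es\<close>. For two elements of \<open>X_tilde\<close> this
  forces equality; otherwise the matrix is nilpotent. If the words are equal, primitivity leaves
  only the entry (0, 0).\<close>

lemma gdet_cyc_word:
 fixes z :: "'r::idom"
 assumes e: "Word es \<in> X_tilde" and f: "f \<in> X_tilde"
 shows "gdet (word_mat (length es) (cyc_mat es z) f) = (if Word es = f then [:1, z:] else 1)"
proof -
 let ?l = "length es" and ?A = "word_mat (length es) (cyc_mat es z) f"
 have car: "?A \<in> carrier_mat ?l ?l" by (rule word_mat_carrier) simp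
 have l: "?l > 0" using X_tilde_nonempty[OF e] by simp
 show ?thesis
 proof (cases "Word es = f")
  case True
  have z: "?A $$ (0, 0) = z" using cyc_word_value[of 0 es z] l True by auto
  have "?A $$ (i, j) = 0" if ij: "i < ?l" "j < ?l" "\<not> (i = 0 & j = 0)" for i j
  proof (rule ccontr)
   assume "?A $$ (i, j) ~= 0"
   hence nz: "word_mat ?l (cyc_mat es z) (Word es) $$ (i, j) ~= 0" using True by simp
   note * = cyc_word_nonzero[OF nz ij(1,2)]
   have "rotate i es = es"
    by (rule nth_equalityI) (use * in "auto simp: nth_rotate add.commute")
   hence "i mod ?l = 0" using X_tilde_rotate_self[OF e, of i] by simp
   hence "i = 0" using ij by simp
   moreover have "j = 0" using * \<open>i = 0\<close> by simp
   ultimately show False using ij by simp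
  qed
  thus ?thesis using gdet_corner[OF car l] z True by simp
 next
  case False
  have "?A ^\<^sub>m ?l = 0\<^sub>m ?l ?l"
  proof (rule eq_matI)
   fix i j assume "i < dim_row (0\<^sub>m ?l ?l :: 'r mat)" "j < dim_col (0\<^sub>m ?l ?l :: 'r mat)"
   hence ij: "i < ?l" "j < ?l" by auto
   let ?w = "concat (replicate ?l (letters f))"
   have pw: "?A ^\<^sub>m ?l = word_mat ?l (cyc_mat es z) (Word ?w)"
    using word_mat_power[of "cyc_mat es z" ?l ?l f] letters_sum_list_replicate[of ?l f]
    by simp (metis word.collapse)
   show "(?A ^\<^sub>m ?l) $$ (i, j) = 0\<^sub>m ?l ?l $$ (i, j)"
   proof (rule ccontr)
    assume "\<not> ?thesis"
    hence "word_mat ?l (cyc_mat es z) (Word ?w) $$ (i, j) ~= 0" using pw ij by simp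
    note * = cyc_word_nonzero[OF this ij]
    let ?g = "concat (replicate (length (letters f)) (rotate i es))"
    have "?w = ?g"
    proof (rule nth_equalityI)
     show "length ?w = length ?g" by (simp add: length_concat_replicate mult.commute)
     fix m assume m: "m < length ?w"
     have "?g ! m = rotate i es ! (m mod ?l)"
      using m by (subst concat_replicate_nth) (simp_all add: length_concat_replicate mult.commute)
     also have "... = es ! ((i + m) mod ?l)"
      using l by (subst nth_rotate) (auto simp: mod_simps)
     finally show "?w ! m = ?g ! m" using * m by simp
    qed
    hence "Word es = f"
     using X_tilde_power_rotate_eq[OF e f, of ?l "length (letters f)" i] l X_tilde_nonempty[OF f] by simp
    thus False using False by simp
   qed
  qed (use carrier_matD[OF car] l in simp_all)
  thus ?thesis using gdet_nilpotent[OF car] False by simp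
 qed
qed

definition letter_sum :: "nat => (nat => 'r::comm_ring_1 mat) => nat => 'r mat" where
 "letter_sum N Xs u = mat N N (%(i, j). \<Sum>k<u. Xs k $$ (i, j))"

text \<open>Summing over the letters forgets the labels of the cycle: what remains is a weighted
  cyclic permutation matrix, the transpose of a companion matrix with the single coefficient
  z.\<close>

lemma gdet_letter_sum_cyc:
 assumes "set es \<subseteq> {..<u}" "es ~= []"
 shows "gdet (letter_sum (length es) (cyc_mat es z) u)
  = 1 + monom ((- 1) ^ (length es - Suc 0) * z) (length es)"
proof -
 let ?l = "length es" and ?r = "%j. if Suc j = length es then z else 0"
 have "letter_sum ?l (cyc_mat es z) u = transpose_mat (companion ?l ?r)"
 proof (rule eq_matI)
  fix p q assume "p < dim_row (transpose_mat (companion ?l ?r))" "q < dim_col (transpose_mat (companion ?l ?r))"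
  hence pq: "p < ?l" "q < ?l" by (auto simp: companion_def)
  have "es ! p \<in> set es" using pq by simp
  hence "es ! p < u" using assms(1) by blast
  hence "(\<Sum>k<u. cyc_mat es z k $$ (p, q)) = (if q = Suc p mod ?l then (if Suc p = ?l then z else 1) else 0)"
   using pq by (simp add: cyc_mat_def sum.delta if_distrib conj_commute cong: if_cong)
  thus "letter_sum ?l (cyc_mat es z) u $$ (p, q) = transpose_mat (companion ?l ?r) $$ (p, q)"
   using pq by (auto simp: letter_sum_def companion_def mod_Suc)
 qed (auto simp: letter_sum_def companion_def)
 hence "gdet (letter_sum ?l (cyc_mat es z) u) = gdet (companion ?l ?r)"
  by (simp add: gdet_transpose[OF companion_carrier])
 also have "... = 1 + (\<Sum>j<?l. if j = ?l - Suc 0 then monom ((- 1) ^ (?l - Suc 0) * z) ?l else 0)"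
  unfolding gdet_companion using assms(2) by (intro arg_cong2[of _ _ _ _ "(+)"] sum.cong) auto
 also have "... = 1 + monom ((- 1) ^ (?l - Suc 0) * z) ?l" using assms(2) by simp
 finally show ?thesis .
qed

subsection \<open>Direct sums of tuples of matrices\<close>

lemma word_mat_block:
 assumes A: "!!k. A k \<in> carrier_mat n n" and B: "!!k. B k \<in> carrier_mat m m"
 shows "word_mat (n + m) (%k. four_block_mat (A k) (0\<^sub>m n m) (0\<^sub>m m n) (B k)) w
  = four_block_mat (word_mat n A w) (0\<^sub>m n m) (0\<^sub>m m n) (word_mat m B w)"
proof -
 have "word_mat (n + m) (%k. four_block_mat (A k) (0\<^sub>m n m) (0\<^sub>m m n) (B k)) (Word ks)
  = four_block_mat (word_mat n A (Word ks)) (0\<^sub>m n m) (0\<^sub>m m n) (word_mat m B (Word ks))" for ks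
 proof (induction ks)
  case Nil
  show ?case by (auto intro!: eq_matI)
 next
  case (Cons k ks)
  have "word_mat n A (Word ks) \<in> carrier_mat n n" "word_mat m B (Word ks) \<in> carrier_mat m m"
   by (rule word_mat_carrier, fact)+
  thus ?case unfolding word_mat_Cons Cons using A[of k] B[of k]
   by (subst mult_four_block_mat[of _ n n _ m _ m _ _ n _ m]) auto
 qed
 thus ?thesis by (metis word.collapse)
qed

fun cyc_dim :: "(nat list \<times> 'r) list => nat" where
 "cyc_dim [] = 0"
| "cyc_dim ((es, z) # ps) = length es + cyc_dim ps"

fun cyc_sum :: "(nat list \<times> 'r) list => nat => 'r::comm_ring_1 mat" where
 "cyc_sum [] k = 0\<^sub>m 0 0"
| "cyc_sum ((es, z) # ps) k = four_block_mat (cyc_mat es z k) (0\<^sub>m (length es) (cyc_dim ps))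
   (0\<^sub>m (cyc_dim ps) (length es)) (cyc_sum ps k)"

lemma cyc_sum_carrier [simp]: "cyc_sum ps k \<in> carrier_mat (cyc_dim ps) (cyc_dim ps)"
 by (induction ps k rule: cyc_sum.induct) auto

lemma gdet_dim_0: "A \<in> carrier_mat 0 0 ==> gdet A = 1"
 by (auto simp: gdet_def)

lemma gdet_cyc_sum_word:
 fixes ps :: "(nat list \<times> 'r::idom) list"
 assumes "!!es z. (es, z) \<in> set ps ==> Word es \<in> X_tilde" "f \<in> X_tilde"
 shows "gdet (word_mat (cyc_dim ps) (cyc_sum ps) f) = (\<Prod>(es, z)\<leftarrow>ps. if Word es = f then [:1, z:] else 1)"
 using assms(1)
proof (induction ps)
 case Nil
 show ?case using word_mat_carrier[of "cyc_sum []" 0 f] by (simp add: gdet_dim_0)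
next
 case (Cons p ps)
 obtain es z where p: "p = (es, z)" by fastforce
 have eq: "cyc_dim (p # ps) = length es + cyc_dim ps" "cyc_sum (p # ps) =
   (%k. four_block_mat (cyc_mat es z k) (0\<^sub>m (length es) (cyc_dim ps)) (0\<^sub>m (cyc_dim ps) (length es)) (cyc_sum ps k))"
  by (auto simp: p)
 have "word_mat (length es) (cyc_mat es z) f \<in> carrier_mat (length es) (length es)"
  "word_mat (cyc_dim ps) (cyc_sum ps) f \<in> carrier_mat (cyc_dim ps) (cyc_dim ps)"
  by (rule word_mat_carrier, simp)+
 hence "gdet (word_mat (cyc_dim (p # ps)) (cyc_sum (p # ps)) f)
   = gdet (word_mat (length es) (cyc_mat es z) f) * gdet (word_mat (cyc_dim ps) (cyc_sum ps) f)"
  using word_mat_block[of "cyc_mat es z" "length es" "cyc_sum ps" "cyc_dim ps" f]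
  by (simp add: eq gdet_block)
 moreover have "Word es \<in> X_tilde" using Cons.prems[of es z] by (simp add: p)
 moreover have "gdet (word_mat (cyc_dim ps) (cyc_sum ps) f) = (\<Prod>(es, z)\<leftarrow>ps. if Word es = f then [:1, z:] else 1)"
  by (rule Cons.IH) (use Cons.prems in auto)
 ultimately show ?case using gdet_cyc_word[of es f z] assms(2)
  by (simp only: p list.map prod_list.Cons prod.case)
qed

lemma gdet_cyc_sum_letters:
 fixes ps :: "(nat list \<times> 'r::idom) list"
 assumes "!!es z. (es, z) \<in> set ps ==> set es \<subseteq> {..<u} & es ~= []"
 shows "gdet (letter_sum (cyc_dim ps) (cyc_sum ps) u)
  = (\<Prod>(es, z)\<leftarrow>ps. 1 + monom ((- 1) ^ (length es - Suc 0) * z) (length es))"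
 using assms
proof (induction ps)
 case Nil
 show ?case by (simp add: gdet_dim_0 letter_sum_def)
next
 case (Cons p ps)
 obtain es z where p: "p = (es, z)" by fastforce
 have "letter_sum (cyc_dim (p # ps)) (cyc_sum (p # ps)) u
   = four_block_mat (letter_sum (length es) (cyc_mat es z) u) (0\<^sub>m (length es) (cyc_dim ps))
     (0\<^sub>m (cyc_dim ps) (length es)) (letter_sum (cyc_dim ps) (cyc_sum ps) u)"
  using carrier_matD[OF cyc_sum_carrier[of ps]] carrier_matD[OF cyc_mat_carrier[of es z]]
  by (intro eq_matI) (auto simp: letter_sum_def p)
 moreover have "letter_sum (length es) (cyc_mat es z) u \<in> carrier_mat (length es) (length es)"
  "letter_sum (cyc_dim ps) (cyc_sum ps) u \<in> carrier_mat (cyc_dim ps) (cyc_dim ps)"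
  by (simp_all add: letter_sum_def)
 ultimately have "gdet (letter_sum (cyc_dim (p # ps)) (cyc_sum (p # ps)) u)
   = gdet (letter_sum (length es) (cyc_mat es z) u) * gdet (letter_sum (cyc_dim ps) (cyc_sum ps) u)"
  by (simp only: gdet_block zero_carrier_mat)
 moreover have "set es \<subseteq> {..<u}" "es ~= []" using Cons.prems[of es z] by (auto simp: p)
 moreover have "gdet (letter_sum (cyc_dim ps) (cyc_sum ps) u)
   = (\<Prod>(es, z)\<leftarrow>ps. 1 + monom ((- 1) ^ (length es - Suc 0) * z) (length es))"
  by (rule Cons.IH) (use Cons.prems in auto)
 moreover from calculation(2,3) have "gdet (letter_sum (length es) (cyc_mat es z) u)
   = 1 + monom ((- 1) ^ (length es - Suc 0) * z) (length es)"
  using gdet_letter_sum_cyc[of es u z] by simp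
 ultimately show ?case by (simp only: p list.map prod_list.Cons prod.case)
qed

text \<open>Factors with z = 0 pad the list to length exactly \<open>q\<close>, which keeps the size
  of the matrices in \<open>ex_specialization\<close> independent of the polynomials.\<close>

lemma split_poly_const_1:
 fixes p :: "'k::alg_closed_field poly"
 assumes "coeff p 0 = 1" "degree p <= q"
 shows "\<exists>zs. length zs = q & p = (\<Prod>z\<leftarrow>zs. [:1, z:])"
 using assms
proof (induction q arbitrary: p)
 case 0
 hence "p = 1" by (metis degree_0_id le_zero_eq one_pCons)
 thus ?case by simp
next
 case (Suc q)
 show ?case
 proof (cases "degree p = 0")
  case True
  from Suc.IH[of p] True Suc.prems obtain zs where "length zs = q" "p = (\<Prod>z\<leftarrow>zs. [:1, z:])" by auto
  thus ?thesis by (intro exI[of _ "0 # zs"]) (simp add: one_pCons)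
 next
  case False
  then obtain r where r: "poly p r = 0" using alg_closed_imp_poly_has_root by blast
  hence r0: "r ~= 0" using Suc.prems by (metis poly_0_coeff_0 zero_neq_one)
  obtain p' where p': "p = [:- r, 1:] * p'" using r poly_eq_0_iff_dvd by blast
  define p2 where "p2 = smult (- r) p'"
  have lin: "[:- r, 1:] = smult (- r) [:1, - inverse r:]" using r0 by simp
  have p: "p = [:1, - inverse r:] * p2"
   unfolding p2_def p' lin by (simp only: mult_smult_left mult_smult_right)
  have c: "coeff p2 0 = 1" using Suc.prems(1) unfolding p by simp
  hence "p2 ~= 0" by auto
  have "degree p = degree [:1, - inverse r:] + degree p2"
   unfolding p by (rule degree_mult_eq) (use \<open>p2 ~= 0\<close> in auto)
  hence "degree p2 <= q" using Suc.prems(2) r0 by simp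
  from Suc.IH[OF c this] obtain zs where "length zs = q" "p2 = (\<Prod>z\<leftarrow>zs. [:1, z:])" by blast
  thus ?thesis using p by (intro exI[of _ "- inverse r # zs"]) simp
 qed
qed

text \<open>For every linear factor 1 + zx of \<open>P e\<close> the direct sum gets one cyclic
  matrix of \<open>e\<close> with weight z, which by \<open>gdet_cyc_word\<close> affects no other
  word of \<open>X_tilde\<close>. The size depends on \<open>E\<close> and \<open>q\<close> alone.
  The value at the sum of the letters is recorded because the formula for \<sigma>_t(x_1 + ... +
  x_u) is read off from it.\<close>

lemma ex_specialization:
 fixes P :: "word => 'k::alg_closed_field poly"
 assumes "finite E" "E \<subseteq> X_tilde" "!!e. e \<in> E ==> coeff (P e) 0 = 1 & degree (P e) <= q"
 shows "\<exists>Xs. (\<forall>k. Xs k \<in> carrier_mat (q * (\<Sum>e\<in>E. length (letters e))) (q * (\<Sum>e\<in>E. length (letters e)))) &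
  (\<forall>f\<in>X_tilde. gdet (word_mat (q * (\<Sum>e\<in>E. length (letters e))) Xs f) = (if f \<in> E then P f else 1)) &
  (\<forall>u. (\<forall>e\<in>E. set (letters e) \<subseteq> {..<u}) -->
   gdet (letter_sum (q * (\<Sum>e\<in>E. length (letters e))) Xs u)
    = (\<Prod>e\<in>E. P e \<circ>\<^sub>p monom ((- 1) ^ (length (letters e) - Suc 0)) (length (letters e))))"
proof -
 have "\<exists>ps. cyc_dim ps = q * (\<Sum>e\<in>E. length (letters e)) & (\<forall>(es, z)\<in>set ps. Word es \<in> E) &
   (\<forall>f. (\<Prod>(es, z)\<leftarrow>ps. if Word es = f then [:1, z:] else 1) = (if f \<in> E then P f else 1)) &
   (\<Prod>(es, z)\<leftarrow>ps. 1 + monom ((- 1) ^ (length es - Suc 0) * z) (length es))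
    = (\<Prod>e\<in>E. P e \<circ>\<^sub>p monom ((- 1) ^ (length (letters e) - Suc 0)) (length (letters e)))"
  using assms(1,3)
 proof (induction E rule: finite_induct)
  case empty
  show ?case by (intro exI[of _ "[]"]) simp
 next
  case (insert e E)
  then obtain ps where ps: "cyc_dim ps = q * (\<Sum>e\<in>E. length (letters e))" "\<forall>(es, z)\<in>set ps. Word es \<in> E"
   "!!f. (\<Prod>(es, z)\<leftarrow>ps. if Word es = f then [:1, z:] else 1) = (if f \<in> E then P f else 1)"
   "(\<Prod>(es, z)\<leftarrow>ps. 1 + monom ((- 1) ^ (length es - Suc 0) * z) (length es))
    = (\<Prod>e\<in>E. P e \<circ>\<^sub>p monom ((- 1) ^ (length (letters e) - Suc 0)) (length (letters e)))"
   by fastforce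
  obtain zs where zs: "length zs = q" "P e = (\<Prod>z\<leftarrow>zs. [:1, z:])"
   using split_poly_const_1[of "P e" q] insert.prems by auto
  let ?l = "length (letters e)"
  let ?qs = "map (%z. (letters e, z)) zs @ ps"
  have 1: "cyc_dim (map (%z. (letters e, z)) ys @ ps) = length ys * ?l + cyc_dim ps" for ys
   by (induction ys) auto
  have 2: "(\<Prod>(es, z)\<leftarrow>map (%z. (letters e, z)) ys. if Word es = f then [:1, z:] else 1)
    = (if f = e then (\<Prod>z\<leftarrow>ys. [:1, z:]) else 1)" for ys and f
   by (induction ys) auto
  have 3: "(\<Prod>(es, z)\<leftarrow>map (%z. (letters e, z)) ys. 1 + monom ((- 1) ^ (length es - Suc 0) * z) (length es))
    = (\<Prod>z\<leftarrow>ys. [:1, z:]) \<circ>\<^sub>p monom ((- 1) ^ (?l - Suc 0)) ?l" for ys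
  proof (induction ys)
   case (Cons y ys)
   have "[:1, y:] \<circ>\<^sub>p monom ((- 1) ^ (?l - Suc 0)) ?l = 1 + monom ((- 1) ^ (?l - Suc 0) * y) ?l"
    by (simp add: pcompose_pCons smult_monom mult.commute one_pCons)
   with Cons show ?case by (simp only: list.map prod_list.Cons pcompose_mult prod.case o_apply)
  qed simp
  show ?case
  proof (intro exI[of _ ?qs] conjI allI)
   show "cyc_dim ?qs = q * (\<Sum>e\<in>insert e E. length (letters e))"
    using insert.hyps by (simp add: 1 ps(1) zs(1) distrib_left)
   show "\<forall>(es, z)\<in>set ?qs. Word es \<in> insert e E" using ps(2) by auto
   show "(\<Prod>(es, z)\<leftarrow>?qs. if Word es = f then [:1, z:] else 1) = (if f \<in> insert e E then P f else 1)" for f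
    unfolding map_append prod_list.append 2 ps(3) using insert.hyps zs(2) by auto
   show "(\<Prod>(es, z)\<leftarrow>?qs. 1 + monom ((- 1) ^ (length es - Suc 0) * z) (length es))
     = (\<Prod>e\<in>insert e E. P e \<circ>\<^sub>p monom ((- 1) ^ (length (letters e) - Suc 0)) (length (letters e)))"
    unfolding map_append prod_list.append 3 ps(4) using insert.hyps zs(2) by simp
  qed
 qed
 then obtain ps where ps: "cyc_dim ps = q * (\<Sum>e\<in>E. length (letters e))" "\<forall>(es, z)\<in>set ps. Word es \<in> E"
   "!!f. (\<Prod>(es, z)\<leftarrow>ps. if Word es = f then [:1, z:] else 1) = (if f \<in> E then P f else 1)"
   "(\<Prod>(es, z)\<leftarrow>ps. 1 + monom ((- 1) ^ (length es - Suc 0) * z) (length es))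
    = (\<Prod>e\<in>E. P e \<circ>\<^sub>p monom ((- 1) ^ (length (letters e) - Suc 0)) (length (letters e)))"
  by fastforce
 have E: "Word es \<in> X_tilde" if "(es, z) \<in> set ps" for es z using that ps(2) assms(2) by auto
 show ?thesis
  unfolding ps(1)[symmetric]
 proof (intro exI[of _ "cyc_sum ps"] conjI allI ballI impI)
  show "gdet (word_mat (cyc_dim ps) (cyc_sum ps) f) = (if f \<in> E then P f else 1)" if "f \<in> X_tilde" for f
   by (subst gdet_cyc_sum_word) (use E that ps(3) in auto)
  show "gdet (letter_sum (cyc_dim ps) (cyc_sum ps) u)
    = (\<Prod>e\<in>E. P e \<circ>\<^sub>p monom ((- 1) ^ (length (letters e) - Suc 0)) (length (letters e)))"
   if "\<forall>e\<in>E. set (letters e) \<subseteq> {..<u}" for u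
   unfolding ps(4)[symmetric] using that ps(2) E X_tilde_nonempty
   by (intro gdet_cyc_sum_letters) fastforce
 qed simp
qed

subsection \<open>Joint injectivity of the maps to matrix invariants\<close>

definition sym_mat :: "nat => (nat => 'r::comm_ring_1 mat) => tilde_sym => 'r" where
 "sym_mat N Xs s = (case Rep_tilde_sym s of (t, e) => sigma_mat t (word_mat N Xs e))"

lemma generic_mat_carrier [simp]: "generic_mat n k \<in> carrier_mat n n"
 by (simp add: generic_mat_def)

text \<open>The case distinction t <= n is absorbed by \<open>sigma_mat\<close>, which vanishes
  beyond the size of the matrix.\<close>

lemma Phi_tilde_ev: "Phi_tilde n = ev const_pol (sym_mat n (generic_mat n))"
proof -
 have "dim_row (word_mat n (generic_mat n) e :: 'a gen_ring mat) = n" for e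
  using carrier_matD[OF word_mat_carrier[of "generic_mat n" n e]] by simp
 hence "(case Rep_tilde_sym s of (t, e) => if t <= n then sigma_mat t (phi_word n e) else 0)
   = (sym_mat n (generic_mat n) s :: 'a gen_ring)" for s
  by (auto simp: sym_mat_def phi_word_eq sigma_mat_def split: prod.splits)
 thus ?thesis by (simp add: Phi_tilde_def subst_pol_ev)
qed

lemma comm_ring_hom_Phi_tilde: "comm_ring_hom (Phi_tilde n)"
 unfolding Phi_tilde_ev by (rule const_pol.ev_hom)

interpretation Phi: comm_ring_hom "Phi_tilde N :: 'a::field sigma_tilde_alg => _" for N
 by (rule comm_ring_hom_Phi_tilde)

lemma Phi_tilde_const: "Phi_tilde n (const_pol c) = const_pol c"
 unfolding Phi_tilde_ev by (rule const_pol.ev_const)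

definition mat_ev :: "('a::comm_ring_1 => 'r::comm_ring_1) => (nat => 'r mat) => 'a gen_ring => 'r" where
 "mat_ev c Xs = ev c (%(i, j, k). Xs k $$ (i, j))"

context
 fixes c :: "'a::field => 'r::comm_ring_1" and N :: nat and Xs :: "nat => 'r mat"
 assumes c: "comm_ring_hom c" and Xs: "!!k. Xs k \<in> carrier_mat N N"
begin

interpretation c: comm_ring_hom c by (rule c)

interpretation mev: comm_ring_hom "mat_ev c Xs"
 unfolding mat_ev_def by (rule c.ev_hom)

lemma comm_ring_hom_mat_ev: "comm_ring_hom (mat_ev c Xs)"
 by (rule mev.comm_ring_hom_axioms)

lemma mat_ev_const: "mat_ev c Xs (const_pol a) = c a"
 by (simp add: mat_ev_def c.ev_const)

lemma mat_ev_generic: "map_mat (mat_ev c Xs) (generic_mat N k) = Xs k"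
 using Xs[of k] by (intro eq_matI) (auto simp: generic_mat_def mat_ev_def c.ev_var)

lemma mat_ev_word: "map_mat (mat_ev c Xs) (gen_word N w) = word_mat N Xs w"
 by (subst mev.word_mat_hom) (simp_all add: mat_ev_generic)

lemma mat_ev_alg_mat: "map_mat (mat_ev c Xs) (gen_alg N a) = alg_mat N c Xs a"
 by (subst alg_mat_hom[OF comm_ring_hom_mat_ev]) (simp_all add: mat_ev_generic mat_ev_const)

lemma mat_ev_sigma: "mat_ev c Xs (sigma_mat t (gen_word N w)) = sigma_mat t (word_mat N Xs w)"
proof -
 have "gen_word N w \<in> carrier_mat N N" by (rule word_mat_carrier) simp
 from mev.sigma_mat_hom[OF this] show ?thesis by (simp add: mat_ev_word)
qed

lemma mat_ev_Phi: "mat_ev c Xs (Phi_tilde N s) = ev c (sym_mat N Xs) s"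
proof -
 have "mat_ev c Xs (Phi_tilde N s) = ev (%a. mat_ev c Xs (const_pol a)) (%v. mat_ev c Xs (sym_mat N (generic_mat N) v)) s"
  unfolding Phi_tilde_ev by (rule ev_ev) (rule comm_ring_hom_mat_ev, rule const_pol_hom)
 also have "(%v. mat_ev c Xs (sym_mat N (generic_mat N) v)) = sym_mat N Xs"
  by (rule ext) (auto simp: sym_mat_def mat_ev_sigma split: prod.splits)
 finally show ?thesis by (simp add: mat_ev_const)
qed

end

lemma Rep_tilde_symD: "Rep_tilde_sym s = (t, e) ==> t \<ge> 1 & e \<in> X_tilde"
 using Rep_tilde_sym[of s] by auto

lemma word_mat_zero:
 assumes "w ~= 0"
 shows "word_mat n (%k. 0\<^sub>m n n) w = (0\<^sub>m n n :: 'r::comm_ring_1 mat)"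
proof -
 obtain k ks where "w = Word (k # ks)" using assms by (metis neq_Nil_conv word.collapse zero_word_def)
 moreover have "word_mat n (%k. 0\<^sub>m n n) (Word ks) \<in> carrier_mat n n" for ks :: "nat list"
  by (rule word_mat_carrier) simp
 ultimately show ?thesis by (simp add: word_mat_Cons left_mult_zero_mat[of _ n n])
qed

lemma X_tilde_nonzero: "e \<in> X_tilde ==> e ~= 0"
 using X_tilde_nonempty[of e] by (auto simp: zero_word_def)

lemma to_ac_hom: "comm_ring_hom (to_ac :: 'a::field => 'a alg_closure)"
 by standard auto

lemma infinite_alg_closure: "infinite (UNIV :: 'a::field set) ==> infinite (UNIV :: 'a alg_closure set)"
 using inj_to_ac by (metis finite_imageD finite_subset subset_UNIV)

text \<open>Values of the symbols in \<open>V\<close> at which s does not vanish are realized by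
  matrices over the algebraic closure. The size N depends on \<open>V\<close> only, so it can be
  fixed before the element is known.\<close>

lemma Phi_tilde_inj_on_finite:
 assumes inf: "infinite (UNIV :: 'a::field set)" and V: "finite V"
 obtains N where "!!s :: 'a sigma_tilde_alg. [|(\<Union>m\<in>keys s. keys m) \<subseteq> V; Phi_tilde N s = 0|] ==> s = 0"
proof -
 define E where "E = (%v. snd (Rep_tilde_sym v)) ` V"
 define q where "q = Max (insert 0 ((%v. fst (Rep_tilde_sym v)) ` V))"
 define N where "N = q * (\<Sum>e\<in>E. length (letters e))"
 have E: "finite E" "E \<subseteq> X_tilde"
  using V Rep_tilde_symD by (auto simp: E_def intro: Rep_tilde_symD[THEN conjunct2, OF prod.collapse[symmetric]])
 have q: "fst (Rep_tilde_sym v) <= q" if "v \<in> V" for v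
  unfolding q_def using that V by (intro Max_ge) auto
 have "s = 0" if s: "(\<Union>m\<in>keys s. keys m) \<subseteq> V" "Phi_tilde N s = 0" for s :: "'a sigma_tilde_alg"
 proof (rule ccontr)
  assume "s ~= 0"
  then obtain c where c: "ev to_ac c s ~= 0"
   using ex_ev_nonzero[OF to_ac_hom _ infinite_alg_closure[OF inf]] by auto
  define P where "P e = 1 + (\<Sum>t=1..q. monom (c (Abs_tilde_sym (t, e))) t)" for e
  have coeffP: "coeff (P e) t = c (Abs_tilde_sym (t, e))" if "1 <= t" "t <= q" for e t
  proof -
   have "coeff (P e) t = (\<Sum>i=1..q. if i = t then c (Abs_tilde_sym (i, e)) else 0)"
    using that by (auto simp: P_def coeff_sum intro!: sum.cong)
   thus ?thesis using that by simp
  qed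
  have P: "coeff (P e) 0 = 1" "degree (P e) <= q" for e
   by (auto simp: P_def coeff_sum intro!: degree_add_le degree_sum_le order_trans[OF degree_monom_le])
  have "!!e. e \<in> E ==> coeff (P e) 0 = 1 & degree (P e) <= q" using P by blast
  from ex_specialization[of E P q, folded N_def, OF E this]
  obtain Xs where Xs0: "\<forall>k. Xs k \<in> carrier_mat N N"
   "\<forall>f\<in>X_tilde. gdet (word_mat N Xs f) = (if f \<in> E then P f else 1)" by blast
  hence Xs: "!!k. Xs k \<in> carrier_mat N N"
   "!!f. f \<in> X_tilde ==> gdet (word_mat N Xs f) = (if f \<in> E then P f else 1)" by blast+
  have "sym_mat N Xs v = c v" if "v \<in> V" for v
  proof -
   obtain t e where te: "Rep_tilde_sym v = (t, e)" by fastforce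
   have "t \<ge> 1" "e \<in> X_tilde" using Rep_tilde_symD[OF te] by auto
   moreover have "e \<in> E" "t <= q" using that te q[of v] by (auto simp: E_def image_iff intro!: bexI[of _ v])
   moreover have "word_mat N Xs e \<in> carrier_mat N N" by (rule word_mat_carrier) (rule Xs(1))
   moreover have "Abs_tilde_sym (t, e) = v" using te by (metis Rep_tilde_sym_inverse)
   ultimately show ?thesis
    using Xs(2)[of e] coeffP[of t e] by (simp add: sym_mat_def te flip: coeff_gdet[where n = N])
  qed
  hence "ev to_ac (sym_mat N Xs) s = ev to_ac c s"
   using s(1) by (intro ev_cong) auto
  hence "mat_ev to_ac Xs (Phi_tilde N s) ~= 0"
   using c by (simp add: mat_ev_Phi[OF to_ac_hom Xs(1)])
  thus False using s(2) by (simp add: mat_ev_def comm_ring_hom.ev_0 to_ac_hom)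
 qed
 thus ?thesis by (rule that)
qed

lemma Phi_tilde_joint_inj:
 fixes s :: "'a::field sigma_tilde_alg"
 assumes "infinite (UNIV :: 'a set)" "!!N. Phi_tilde N s = 0"
 shows "s = 0"
proof -
 have "finite (\<Union>m\<in>keys s. keys m)" by simp
 thus ?thesis using Phi_tilde_inj_on_finite[OF assms(1)] assms(2) by (metis order_refl)
qed

subsection \<open>Polynomial expressions of a matrix\<close>

definition poly_mat :: "nat => 'r::comm_ring_1 mat => 'r poly => 'r mat" where
 "poly_mat n B p = fold_coeffs (%a M. a \<cdot>\<^sub>m 1\<^sub>m n + B * M) p (0\<^sub>m n n)"

context
 fixes n :: nat and B :: "'r::comm_ring_1 mat"
 assumes B: "B \<in> carrier_mat n n"
begin

lemma poly_mat_0 [simp]: "poly_mat n B 0 = 0\<^sub>m n n"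
 by (simp add: poly_mat_def)

lemma poly_mat_pCons: "poly_mat n B (pCons a p) = a \<cdot>\<^sub>m 1\<^sub>m n + B * poly_mat n B p"
proof (cases "a = 0 & p = 0")
 case True
 thus ?thesis using B by (auto simp: right_mult_zero_mat[OF B])
next
 case False
 thus ?thesis by (auto simp: poly_mat_def)
qed

lemma poly_mat_carrier [simp]: "poly_mat n B p \<in> carrier_mat n n"
 using B by (induction p) (auto simp: poly_mat_pCons)

lemma poly_mat_dim: "dim_row (poly_mat n B p) = n" "dim_col (poly_mat n B p) = n" "dim_row B = n" "dim_col B = n"
 using carrier_matD[OF poly_mat_carrier[of p]] carrier_matD[OF B] by auto

lemma poly_mat_add: "poly_mat n B (p + q) = poly_mat n B p + poly_mat n B q"
proof (induction p q rule: poly_induct2)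
 case (pCons a p b q)
 have car: "B * poly_mat n B p \<in> carrier_mat n n" "B * poly_mat n B q \<in> carrier_mat n n" using B by auto
 have "B * (poly_mat n B p + poly_mat n B q) = B * poly_mat n B p + B * poly_mat n B q"
  by (rule mult_add_distrib_mat[OF B poly_mat_carrier poly_mat_carrier])
 thus ?case using car by (auto simp: poly_mat_pCons pCons algebra_simps poly_mat_dim intro!: eq_matI)
qed simp

lemma poly_mat_smult: "poly_mat n B (smult c p) = c \<cdot>\<^sub>m poly_mat n B p"
proof (induction p)
 case (pCons a p)
 have "B * (c \<cdot>\<^sub>m poly_mat n B p) = c \<cdot>\<^sub>m (B * poly_mat n B p)"
  by (rule mult_smult_distrib[OF B poly_mat_carrier])
 moreover have "B * poly_mat n B p \<in> carrier_mat n n" using B by auto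
 ultimately show ?case by (auto simp: poly_mat_pCons pCons algebra_simps poly_mat_dim intro!: eq_matI)
qed auto

lemma poly_mat_linear_mult: "poly_mat n B ([:1, z:] * p) = (1\<^sub>m n + z \<cdot>\<^sub>m B) * poly_mat n B p"
proof -
 have car: "B * poly_mat n B p \<in> carrier_mat n n" using B by auto
 have "(1\<^sub>m n + z \<cdot>\<^sub>m B) * poly_mat n B p = poly_mat n B p + (z \<cdot>\<^sub>m B) * poly_mat n B p"
  using B by (subst add_mult_distrib_mat[of _ n n _ _ n]) (auto simp: left_mult_one_mat[OF poly_mat_carrier])
 also have "(z \<cdot>\<^sub>m B) * poly_mat n B p = z \<cdot>\<^sub>m (B * poly_mat n B p)"
  by (rule mult_smult_assoc_mat[OF B poly_mat_carrier])
 moreover have "B * (z \<cdot>\<^sub>m poly_mat n B p) = z \<cdot>\<^sub>m (B * poly_mat n B p)"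
  by (rule mult_smult_distrib[OF B poly_mat_carrier])
 ultimately show ?thesis using car
  by (auto simp: mult_pCons_left poly_mat_add poly_mat_pCons poly_mat_smult poly_mat_dim intro!: eq_matI)
qed

lemma poly_mat_monom: "poly_mat n B (monom c k) = c \<cdot>\<^sub>m (B ^\<^sub>m k)"
proof (induction k)
 case 0
 thus ?case using B by (auto simp: monom_0 poly_mat_pCons right_mult_zero_mat[OF B] poly_mat_dim intro!: eq_matI)
next
 case (Suc k)
 have "B ^\<^sub>m k \<in> carrier_mat n n" using B by (rule pow_carrier_mat)
 hence "B * (c \<cdot>\<^sub>m (B ^\<^sub>m k)) = c \<cdot>\<^sub>m (B ^\<^sub>m Suc k)"
  by (simp add: mult_smult_distrib[OF B] pow_mat_commute[OF B])
 moreover have "B * B ^\<^sub>m k \<in> carrier_mat n n" using B \<open>B ^\<^sub>m k \<in> _\<close> by auto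
 ultimately show ?case using Suc B by (auto simp: monom_Suc poly_mat_pCons poly_mat_dim intro!: eq_matI)
qed

lemma det_poly_mat_prod:
 "det (poly_mat n B (\<Prod>z\<leftarrow>zs. [:1, z:])) = (\<Prod>z\<leftarrow>zs. det (1\<^sub>m n + z \<cdot>\<^sub>m B))"
proof (induction zs)
 case Nil
 have "poly_mat n B 1 = 1\<^sub>m n" using poly_mat_monom[of 1 0] B by (auto simp: monom_0 one_pCons[symmetric] intro!: eq_matI)
 thus ?case by simp
next
 case (Cons z zs)
 have "det (poly_mat n B ([:1, z:] * (\<Prod>z\<leftarrow>zs. [:1, z:])))
   = det (1\<^sub>m n + z \<cdot>\<^sub>m B) * det (poly_mat n B (\<Prod>z\<leftarrow>zs. [:1, z:]))"
  unfolding poly_mat_linear_mult using B by (intro det_mult[of _ n]) auto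
 thus ?case using Cons by (simp only: list.map prod_list.Cons)
qed

end

lemma gdet_pcompose:
 assumes A: "A \<in> carrier_mat n n"
 shows "gdet A \<circ>\<^sub>p q = det (1\<^sub>m n + q \<cdot>\<^sub>m map_mat (%a. [:a:]) A)"
proof -
 have "comm_ring_hom (%p :: 'a poly. p \<circ>\<^sub>p q)" by standard (auto simp: pcompose_add pcompose_mult)
 from comm_ring_hom.hom_det[OF this, symmetric] show ?thesis
  unfolding gdet_def using A by (auto intro!: arg_cong[of _ _ det] simp: pcompose_pCons mult.commute one_pCons)
qed

lemma (in comm_ring_hom) map_poly_one_minus_monom:
 "map_poly hom (1 - monom 1 l) = 1 - monom 1 l"
 by (rule poly_eqI) (simp add: coeff_map_poly coeff_1 hom_distribs)

text \<open>If 1 - x^l is the product of the 1 + zx, then substituting the matrix yA for x and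
  taking determinants writes det (1 - (yA)^l) as the product of the det (1 + zyA). No eigenvalues of
  A are involved.\<close>

lemma gdet_power:
 fixes A :: "'r::comm_ring_1 mat"
 assumes A: "A \<in> carrier_mat n n" and zs: "(\<Prod>z\<leftarrow>zs. [:1, z:]) = 1 - monom 1 l" and "l > 0"
 shows "gdet (A ^\<^sub>m l) \<circ>\<^sub>p monom (- 1) l = (\<Prod>z\<leftarrow>zs. gdet A \<circ>\<^sub>p [:0, z:])"
proof -
 interpret c: comm_ring_hom "%a :: 'r. [:a:]" by standard (auto simp: one_pCons)
 let ?A = "map_mat (%a. [:a:]) A" and ?x = "[:0, 1:] :: 'r poly"
 let ?B = "?x \<cdot>\<^sub>m ?A"
 have car: "?A \<in> carrier_mat n n" "?B \<in> carrier_mat n n" "A ^\<^sub>m l \<in> carrier_mat n n"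
  using A by (auto intro: pow_carrier_mat)
 have "(\<Prod>z\<leftarrow>map (%z. [:z:]) zs. [:1, z:]) = map_poly (%a. [:a:]) (\<Prod>z\<leftarrow>zs. [:1, z:])"
  by (induction zs) (simp_all add: hom_distribs)
 also have "... = 1 + monom (- 1) l"
 proof -
  have "map_poly (%a. [:a:]) (1 - monom (1 :: 'r) l) = 1 - monom 1 l"
   by (rule c.map_poly_one_minus_monom)
  also have "... = 1 + monom (- 1) l" by (rule poly_eqI) simp
  finally show ?thesis unfolding zs .
 qed
 finally have zs': "(\<Prod>z\<leftarrow>map (%z. [:z:]) zs. [:1, z:]) = 1 + monom (- 1) l" .
 have one: "poly_mat n ?B 1 = 1\<^sub>m n"
  using poly_mat_monom[OF car(2), of 1 0] car by (auto simp: monom_0 one_pCons[symmetric] intro!: eq_matI)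
 have "?B ^\<^sub>m l = ?x ^ l \<cdot>\<^sub>m (map_mat (%a. [:a:]) (A ^\<^sub>m l))"
  using smult_pow_mat[OF car(1)] c.mat_hom_pow[OF A] by simp
 hence "poly_mat n ?B (1 + monom (- 1) l)
   = 1\<^sub>m n + (- 1) \<cdot>\<^sub>m (?x ^ l \<cdot>\<^sub>m (map_mat (%a. [:a:]) (A ^\<^sub>m l)))"
  by (simp only: poly_mat_add[OF car(2)] poly_mat_monom[OF car(2)] one)
 also have "... = 1\<^sub>m n + monom (- 1) l \<cdot>\<^sub>m map_mat (%a. [:a:]) (A ^\<^sub>m l)"
  using car(3) by (auto simp: monom_altdef intro!: eq_matI)
 finally have "det (poly_mat n ?B (1 + monom (- 1) l)) = gdet (A ^\<^sub>m l) \<circ>\<^sub>p monom (- 1) l"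
  by (simp add: gdet_pcompose[OF car(3)])
 moreover have "det (1\<^sub>m n + [:z:] \<cdot>\<^sub>m ?B) = gdet A \<circ>\<^sub>p [:0, z:]" for z
  unfolding gdet_pcompose[OF A] using A by (auto intro!: arg_cong[of _ _ det] eq_matI)
 ultimately show ?thesis
  using det_poly_mat_prod[OF car(2), of "map (%z. [:z:]) zs"] unfolding zs' by (simp add: o_def)
qed

lemma coeff_mult_cong:
 assumes "!!i. i <= k ==> coeff p i = coeff p' i" "!!i. i <= k ==> coeff q i = coeff q' i" "m <= k"
 shows "coeff (p * q) m = coeff (p' * q') m"
 unfolding coeff_mult using assms by (intro sum.cong) auto

text \<open>By \<open>gdet_power\<close>, \<sigma>_t(A^l) is up to sign the coefficient of degree tl
  of a product built from det (1 + xA), so it sees only the \<sigma>_i(A) with i <= tl. The two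
  matrices may have different sizes.\<close>

lemma sigma_mat_power_cong_aux:
 fixes A C :: "'r::comm_ring_1 mat" and zs :: "'r list"
 assumes A: "A \<in> carrier_mat n n" and C: "C \<in> carrier_mat m m"
  and zs: "(\<Prod>z\<leftarrow>zs. [:1, z:]) = 1 - monom 1 l" and l: "l > 0"
  and eq: "!!i. i <= t * l ==> sigma_mat i A = sigma_mat i C"
 shows "sigma_mat t (A ^\<^sub>m l) = sigma_mat t (C ^\<^sub>m l)"
proof -
 have "\<forall>k\<le>t * l. coeff (\<Prod>z\<leftarrow>ys. gdet A \<circ>\<^sub>p [:0, z:]) k = coeff (\<Prod>z\<leftarrow>ys. gdet C \<circ>\<^sub>p [:0, z:]) k" for ys
 proof (induction ys)
  case (Cons y ys)
  have "coeff (gdet A \<circ>\<^sub>p [:0, y:]) i = coeff (gdet C \<circ>\<^sub>p [:0, y:]) i" if "i <= t * l" for i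
   using eq[OF that] by (simp add: coeff_pcompose_linear coeff_gdet[OF A] coeff_gdet[OF C])
  with Cons show ?case by (auto intro!: coeff_mult_cong[of "t * l"])
 qed simp
 hence c: "coeff (gdet (A ^\<^sub>m l) \<circ>\<^sub>p monom (- 1) l) (t * l)
   = coeff (gdet (C ^\<^sub>m l) \<circ>\<^sub>p monom (- 1) l) (t * l)"
  by (simp add: gdet_power[OF A zs l] gdet_power[OF C zs l])
 have co: "coeff (p \<circ>\<^sub>p monom (- 1) l) (t * l) = (- 1) ^ t * coeff p t" for p :: "'r poly"
 proof -
  have "p \<circ>\<^sub>p monom (- 1) l = (\<Sum>i\<le>degree p. smult (coeff p i) (monom (- 1) l ^ i))"
   by (simp add: pcompose_altdef poly_altdef coeff_map_poly degree_map_poly)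
  hence "coeff (p \<circ>\<^sub>p monom (- 1) l) (t * l)
    = (\<Sum>i\<le>degree p. if i = t then coeff p t * (- 1) ^ t else 0)"
   by (simp only: coeff_sum, intro sum.cong refl) (use l in "auto simp: monom_power")
  thus ?thesis by (simp add: coeff_eq_0 mult.commute)
 qed
 have inv: "(- 1) ^ t * x = (- 1) ^ t * y \<longleftrightarrow> x = y" for x y :: 'r
 proof
  assume "(- 1) ^ t * x = (- 1) ^ t * y"
  hence "(- 1) ^ t * ((- 1) ^ t * x) = (- 1) ^ t * ((- 1) ^ t * y)" by simp
  thus "x = y" by (simp flip: mult.assoc power_mult_distrib)
 qed simp
 from c show ?thesis
  using A C by (simp add: co inv coeff_gdet[where n = n] coeff_gdet[where n = m] pow_carrier_mat)
qed

definition pol_to_ac :: "('v, 'a::field) pol => ('v, 'a alg_closure) pol" where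
 "pol_to_ac = ev (%a. const_pol (to_ac a)) var_pol"

lemma comm_ring_hom_const_to_ac: "comm_ring_hom (%a. const_pol (to_ac a) :: ('v, 'a::field alg_closure) pol)"
 by (rule comm_ring_hom_compose[OF const_pol_hom to_ac_hom])

lemma comm_ring_hom_pol_to_ac: "comm_ring_hom pol_to_ac"
 unfolding pol_to_ac_def by (rule comm_ring_hom.ev_hom[OF comm_ring_hom_const_to_ac])

lemma pol_to_ac_lookup:
 fixes p :: "('v, 'a::field) pol"
 shows "lookup (pol_to_ac p) m = to_ac (lookup p m)"
proof -
 interpret h: comm_ring_hom "%a. const_pol (to_ac a) :: ('v, 'a alg_closure) pol"
  by (rule comm_ring_hom_const_to_ac)
 show ?thesis unfolding pol_to_ac_def
  by (induction p rule: pol_add_induct)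
    (simp_all add: h.ev_single h.ev_add lookup_add mon_ev_var const_pol_mult_lookup lookup_single when_def)
qed

lemma inj_pol_to_ac: "pol_to_ac p = pol_to_ac q \<longleftrightarrow> p = q"
 by (auto simp: poly_mapping_eq_iff fun_eq_iff pol_to_ac_lookup)

text \<open>Extending scalars to the algebraic closure is injective on polynomials and provides the
  linear factors of 1 - x^l.\<close>

lemma sigma_mat_power_cong:
 fixes A C :: "('v, 'a::field) pol mat"
 assumes A: "A \<in> carrier_mat n n" and C: "C \<in> carrier_mat m m" and l: "l > 0"
  and eq: "!!i. i <= t * l ==> sigma_mat i A = sigma_mat i C"
 shows "sigma_mat t (A ^\<^sub>m l) = sigma_mat t (C ^\<^sub>m l)"
proof -
 interpret h: comm_ring_hom "pol_to_ac :: ('v, 'a) pol => _" by (rule comm_ring_hom_pol_to_ac)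
 let ?p = "1 - monom 1 l :: 'a alg_closure poly"
 have "coeff ?p 0 = 1" using l by simp
 then obtain zs where zs: "?p = (\<Prod>z\<leftarrow>zs. [:1, z:])" using split_poly_const_1 by blast
 have "(\<Prod>z\<leftarrow>map const_pol zs. [:1, z:]) = map_poly const_pol (\<Prod>z\<leftarrow>zs. [:1, z:] :: 'a alg_closure poly)"
  by (induction zs) (simp_all add: hom_distribs)
 also have "... = 1 - monom 1 l"
  unfolding zs[symmetric] by (rule const_pol.map_poly_one_minus_monom)
 finally have zs': "(\<Prod>z\<leftarrow>map const_pol zs. [:1, z:]) = (1 - monom 1 l :: ('v, 'a alg_closure) pol poly)" .
 have "sigma_mat t (map_mat pol_to_ac A ^\<^sub>m l) = sigma_mat t (map_mat pol_to_ac C ^\<^sub>m l)"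
  by (rule sigma_mat_power_cong_aux[OF _ _ zs' l, of _ n _ m])
    (use A C eq in "auto simp: h.sigma_mat_hom[where n = n] h.sigma_mat_hom[where n = m]")
 hence "pol_to_ac (sigma_mat t (A ^\<^sub>m l)) = pol_to_ac (sigma_mat t (C ^\<^sub>m l))"
  using A C by (simp add: pow_carrier_mat flip: h.sigma_mat_hom[where n = n] h.sigma_mat_hom[where n = m] h.mat_hom_pow)
 thus ?thesis by (simp add: inj_pol_to_ac)
qed

subsection \<open>The polynomials \<open>P\<^sub>t\<^sub>,\<^sub>l\<close>\<close>

text \<open>With the set of polynomials with integral coefficients in the variables 1, ..., tl as
  \<open>S\<close>, this yields the integrality of \<open>power_pol'\<close>.\<close>

lemma sigma_mat_closed:
 fixes A :: "'r::comm_ring_1 mat"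
 assumes A: "A \<in> carrier_mat n n" and S: "0 \<in> S" "1 \<in> S" "!!x y. [|x \<in> S; y \<in> S|] ==> x + y \<in> S"
  "!!x y. [|x \<in> S; y \<in> S|] ==> x * y \<in> S" "!!x. x \<in> S ==> - x \<in> S"
  and ent: "!!i j. [|i < n; j < n|] ==> A $$ (i, j) \<in> S"
 shows "sigma_mat t A \<in> S"
proof -
 have sum: "sum f I \<in> S" if "!!i. i \<in> I ==> f i \<in> S" for f :: "'b => 'r" and I
  using that by (induction I rule: infinite_finite_induct) (auto intro: S)
 have prod: "\<forall>t. coeff (\<Prod>i\<in>I. f i) t \<in> S" if "!!i t. i \<in> I ==> coeff (f i) t \<in> S" for f :: "nat => 'r poly" and I
  using that by (induction I rule: infinite_finite_induct) (auto simp: coeff_mult coeff_1 intro!: S sum)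
 let ?M = "mat n n (%(i, j). [:if i = j then 1 else 0, A $$ (i, j):])"
 have "coeff (det ?M) t \<in> S"
 proof -
  have M: "?M \<in> carrier_mat n n" by simp
  have "coeff (\<Prod>i = 0..<n. ?M $$ (i, p i)) t \<in> S" if "p permutes {0..<n}" for p
  proof (rule spec[OF prod])
   fix i t assume i: "i \<in> {0..<n}"
   hence "i < n" "p i < n" using permutes_in_image[OF that, of i] by auto
   thus "coeff (?M $$ (i, p i)) t \<in> S"
    using S ent by (auto simp: coeff_pCons split: nat.splits)
  qed
  thus ?thesis unfolding det_def'[OF M] coeff_sum
   by (intro sum) (auto simp: sign_def intro: S(5))
 qed
 thus ?thesis using A by (simp add: gdet_def flip: coeff_gdet[OF A])
qed

text \<open>The signs are chosen so that \<sigma>_i is exactly \<open>c i\<close> for 1 <= i <= q: a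
  matrix with prescribed characteristic coefficients over any commutative ring.\<close>

definition pow_companion :: "nat => (nat => 'r) => 'r::comm_ring_1 mat" where
 "pow_companion q c = companion q (%j. (- 1) ^ j * c (Suc j))"

lemma pow_companion_carrier [simp]: "pow_companion q c \<in> carrier_mat q q"
 by (simp add: pow_companion_def)

lemma sigma_pow_companion:
 assumes "i \<ge> 1"
 shows "sigma_mat i (pow_companion q c) = (if i <= q then c i else 0)"
proof -
 have "(- 1) ^ j * ((- 1) ^ j * x) = x" for j and x :: 'a
  by (simp flip: mult.assoc power_mult_distrib)
 hence "gdet (pow_companion q c) = 1 + (\<Sum>j<q. monom (c (Suc j)) (Suc j))"
  by (simp add: pow_companion_def gdet_companion)
 hence "coeff (gdet (pow_companion q c)) i = (\<Sum>j<q. coeff (monom (c (Suc j)) (Suc j)) i)"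
  using assms by (simp only: coeff_add coeff_sum) (simp add: coeff_1)
 also have "... = (\<Sum>j<q. if j = i - Suc 0 then c i else 0)"
  by (intro sum.cong refl) (use assms in auto)
 finally have "coeff (gdet (pow_companion q c)) i = (\<Sum>j<q. if j = i - Suc 0 then c i else 0)" .
 hence "sigma_mat i (pow_companion q c) = (\<Sum>j<q. if j = i - Suc 0 then c i else 0)"
  by (simp only: coeff_gdet[OF pow_companion_carrier])
 also have "... = (if i <= q then c i else 0)"
  using assms by (subst sum.delta) auto
 finally show ?thesis .
qed

lemma (in comm_ring_hom) pow_companion_hom:
 "map_mat hom (pow_companion q c) = pow_companion q (%i. hom (c i))"
 by (auto simp: pow_companion_def companion_def hom_distribs)

lemma sigma_mat_pow_companion:
 fixes A :: "('v, 'a::field) pol mat"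
 assumes A: "A \<in> carrier_mat n n" and l: "l > 0"
 shows "sigma_mat t (A ^\<^sub>m l) = sigma_mat t (pow_companion (t * l) (%i. sigma_mat i A) ^\<^sub>m l)"
proof (rule sigma_mat_power_cong[OF A pow_companion_carrier l])
 fix i assume "i <= t * l"
 thus "sigma_mat i A = sigma_mat i (pow_companion (t * l) (%i. sigma_mat i A))"
  by (cases i) (simp_all add: sigma_pow_companion sigma_mat_0[OF A] sigma_mat_0[OF pow_companion_carrier])
qed

text \<open>A closed form of P_{t,l}. Size tl is enough because \<sigma>_t(A^l) depends on the first
  tl characteristic coefficients only, and those of the generic companion matrix are independent
  variables.\<close>

definition power_pol' :: "nat => nat => (nat, 'a::field) pol" where
 "power_pol' t l = sigma_mat t (pow_companion (t * l) var_pol ^\<^sub>m l)"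

lemma subst_power_pol':
 fixes A :: "('v, 'a::field) pol mat"
 assumes A: "A \<in> carrier_mat n n" and l: "l > 0"
 shows "subst_pol (%i. sigma_mat i A) (power_pol' t l) = sigma_mat t (A ^\<^sub>m l)"
proof -
 interpret h: comm_ring_hom "subst_pol (%i. sigma_mat i A)"
  by (rule alg_homD[OF alg_hom_subst_pol])
 have v: "subst_pol (%i. sigma_mat i A) (var_pol i) = sigma_mat i A" for i
  by (simp add: subst_pol_ev const_pol.ev_var)
 have "subst_pol (%i. sigma_mat i A) (power_pol' t l)
   = sigma_mat t (map_mat (subst_pol (%i. sigma_mat i A)) (pow_companion (t * l) var_pol ^\<^sub>m l))"
  unfolding power_pol'_def by (rule h.sigma_mat_hom[symmetric, OF pow_carrier_mat[OF pow_companion_carrier]])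
 also have "... = sigma_mat t (pow_companion (t * l) (%i. sigma_mat i A) ^\<^sub>m l)"
  by (simp add: h.mat_hom_pow[OF pow_companion_carrier] h.pow_companion_hom v)
 finally show ?thesis using sigma_mat_pow_companion[OF A l] by simp
qed

lemma power_pol'_vars:
 "m \<in> keys (power_pol' t l :: (nat, 'a::field) pol) ==>
  keys m \<subseteq> {1..t * l} & lookup (power_pol' t l) m \<in> (\<int> :: 'a set)"
proof -
 let ?S = "{p :: (nat, 'a) pol. (\<forall>m. lookup p m \<in> \<int>) & (\<forall>m\<in>keys p. keys m \<subseteq> {1..t * l})}"
 have S0: "0 \<in> ?S" and S1: "1 \<in> ?S" by (simp_all add: lookup_one when_def)
 have Sadd: "p + q \<in> ?S" if "p \<in> ?S" "q \<in> ?S" for p q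
 proof -
  have "\<forall>m. lookup (p + q) m \<in> \<int>" using that by (simp add: lookup_add)
  moreover have "keys (p + q) \<subseteq> keys p \<union> keys q"
   by (rule Poly_Mapping.keys_add)
  ultimately show ?thesis using that by blast
 qed
 have Sneg: "- p \<in> ?S" if "p \<in> ?S" for p using that by (simp add: keys_minus)
 have Smult: "p * q \<in> ?S" if pq: "p \<in> ?S" "q \<in> ?S" for p q
 proof -
  have "lookup (p * q) m \<in> \<int>" for m
  proof -
   have "p = (\<Sum>m\<in>keys p. single m (lookup p m))"
    by (rule poly_mapping_eqI) (auto simp: lookup_sum lookup_single when_def in_keys_iff)
   hence "p * q = (\<Sum>m\<in>keys p. \<Sum>m'\<in>keys q. single (m + m') (lookup p m * lookup q m'))"
   proof -
    have "q = (\<Sum>m\<in>keys q. single m (lookup q m))"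
     by (rule poly_mapping_eqI) (auto simp: lookup_sum lookup_single when_def in_keys_iff)
    with \<open>p = _\<close> have "p * q = (\<Sum>m\<in>keys p. single m (lookup p m)) * (\<Sum>m\<in>keys q. single m (lookup q m))"
     by metis
    thus ?thesis by (simp add: sum_product mult_single)
   qed
   thus ?thesis using pq
    by (simp add: lookup_sum lookup_single when_def Ints_sum)
  qed
  moreover have "keys m \<subseteq> {1..t * l}" if m: "m \<in> keys (p * q)" for m
  proof -
   obtain a b where "m = a + b" "a \<in> keys p" "b \<in> keys q"
    using m Poly_Mapping.keys_mult[of p q] by blast
   thus ?thesis using pq Poly_Mapping.keys_add[of a b] by blast
  qed
  ultimately show ?thesis by blast
 qed
 have Svar: "var_pol i \<in> ?S" if "1 <= i" "i <= t * l" for i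
  using that by (simp add: var_pol_def lookup_single when_def)
 have Spow: "(- 1) ^ j * p \<in> ?S" if "p \<in> ?S" for j p
  using that by (cases "even j") (auto simp: Sneg)
 have C: "pow_companion (t * l) var_pol $$ (i, j) \<in> ?S" if "i < t * l" "j < t * l" for i j
  using that S0 S1 Svar[of "Suc j"] Spow by (auto simp: pow_companion_def companion_def)
 have pw: "\<forall>i<t * l. \<forall>j<t * l. (pow_companion (t * l) var_pol ^\<^sub>m k) $$ (i, j) \<in> ?S" for k
 proof (induction k)
  case 0
  show ?case using S0 S1 by (auto simp: pow_companion_def companion_def)
 next
  case (Suc k)
  let ?C = "pow_companion (t * l) var_pol :: (nat, 'a) pol mat"
  have car: "?C ^\<^sub>m k \<in> carrier_mat (t * l) (t * l)" by (rule pow_carrier_mat) simp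
  have sum: "sum f I \<in> ?S" if "!!i. i \<in> I ==> f i \<in> ?S" for f :: "nat => (nat, 'a) pol" and I
   using that
  proof (induction I rule: infinite_finite_induct)
   case (insert x F)
   have "f x + sum f F \<in> ?S" by (rule Sadd) (use insert in blast)+
   thus ?case using insert by simp
  qed (use S0 in simp_all)
  have "(?C ^\<^sub>m k * ?C) $$ (i, j) = (\<Sum>r<t * l. (?C ^\<^sub>m k) $$ (i, r) * ?C $$ (r, j))" if "i < t * l" "j < t * l" for i j
   using that car carrier_matD[OF pow_companion_carrier[of "t * l" "var_pol :: nat => (nat, 'a) pol"]]
   by (simp add: times_mat_def scalar_prod_def atLeast0LessThan)
  moreover have "(\<Sum>r<t * l. (?C ^\<^sub>m k) $$ (i, r) * ?C $$ (r, j)) \<in> ?S" if "i < t * l" "j < t * l" for i j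
   by (rule sum, rule Smult) (use Suc C that in blast)+
  ultimately show ?case by (auto simp del: mem_Collect_eq)
 qed
 have "power_pol' t l \<in> ?S"
  unfolding power_pol'_def
  by (rule sigma_mat_closed[of _ "t * l"], rule pow_carrier_mat, simp, rule S0, rule S1, rule Sadd, assumption+,
    rule Smult, assumption+, rule Sneg, assumption) (use pw in blast)
 thus "m \<in> keys (power_pol' t l :: (nat, 'a::field) pol) ==> ?thesis"
  by (auto simp: in_keys_iff)
qed

text \<open>At a companion matrix whose coefficients are independent variables of
  \<open>gen_ring\<close>, the value determines the polynomial; the variables (0, 0, i) only serve
  as such a supply.\<close>

lemma is_power_pol_unique:
 assumes "is_power_pol t l P" "is_power_pol t l Q"
 shows "P = (Q :: (nat, 'a::field) pol)"
proof -
 define c where "c i = (var_pol (0, 0, i) :: 'a gen_ring)" for i :: nat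
 let ?C = "pow_companion (t * l) c"
 define g where "g = (ev const_pol (%(a, b, i). var_pol i) :: 'a gen_ring => (nat, 'a) pol)"
 have "g (subst_pol (%i. sigma_mat i ?C) P) = P" if P: "is_power_pol t l P" for P
 proof -
  have "subst_pol (%i. sigma_mat i ?C) P = ev const_pol c P"
   unfolding subst_pol_ev
  proof (rule ev_cong)
   fix m v assume "m \<in> keys P" "v \<in> keys m"
   hence "v \<in> {1..t * l}" using P unfolding is_power_pol_def by blast
   thus "sigma_mat v ?C = c v" by (simp add: sigma_pow_companion)
  qed
  moreover have "g (ev const_pol c P) = ev const_pol var_pol P"
  proof -
   have "g (ev const_pol c P) = ev (%a. g (const_pol a)) (%i. g (c i)) P"
    unfolding g_def by (rule ev_ev[OF const_pol.ev_hom const_pol_hom])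
   thus ?thesis by (simp add: g_def const_pol.ev_const c_def const_pol.ev_var)
  qed
  ultimately show ?thesis by (simp add: ev_var_pol)
 qed
 moreover have "subst_pol (%i. sigma_mat i ?C) P = subst_pol (%i. sigma_mat i ?C) Q"
 proof -
  have "subst_pol (%i. sigma_mat i ?C) P = sigma_mat t (?C ^\<^sub>m l)" if "is_power_pol t l P" for P
   using that pow_companion_carrier[of "t * l" c] unfolding is_power_pol_def by auto
  from this[OF assms(1)] this[OF assms(2)] show ?thesis by (rule trans[OF _ sym])
 qed
 ultimately show ?thesis using assms by metis
qed

lemma power_pol_eq:
 assumes "l > 0"
 shows "power_pol t l = power_pol' t l"
proof -
 have "is_power_pol t l (power_pol' t l :: (nat, 'a) pol)"
  unfolding is_power_pol_def
  by (intro conjI ballI allI impI) (use power_pol'_vars[of _ t l] subst_power_pol'[OF _ assms, symmetric] in blast)+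
 thus ?thesis unfolding power_pol_def using is_power_pol_unique by blast
qed

lemma subst_power_pol:
 fixes A :: "('v, 'a::field) pol mat"
 assumes "A \<in> carrier_mat n n" "l > 0"
 shows "subst_pol (%i. sigma_mat i A) (power_pol t l) = sigma_mat t (A ^\<^sub>m l)"
 using subst_power_pol'[OF assms] by (simp add: power_pol_eq assms(2))

text \<open>Setting the variables with numbers at least \<open>t\<close> to \<open>0\<close> turns the companion matrix into one
 whose characteristic coefficients agree with those of a matrix of size \<open>t - 1\<close>, and
 \<open>\<sigma>\<^sub>t\<close> vanishes on matrices of that size.\<close>

lemma power_pol_high_vars:
 assumes "l > 0" "t > 0" "m \<in> keys (power_pol t l :: (nat, 'a::field) pol)"
 shows "\<exists>s\<ge>t. s \<in> keys m"
proof (rule ccontr)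
 assume low: "\<not> ?thesis"
 define c where "c i = (if i < t then var_pol i else 0 :: (nat, 'a) pol)" for i
 interpret h: comm_ring_hom "ev const_pol c :: (nat, 'a) pol => _" by (rule const_pol.ev_hom)
 have "ev const_pol c (power_pol t l) = sigma_mat t (pow_companion (t * l) c ^\<^sub>m l)"
 proof -
  have "ev const_pol c (power_pol' t l) = sigma_mat t (map_mat (ev const_pol c) (pow_companion (t * l) var_pol ^\<^sub>m l))"
   unfolding power_pol'_def by (rule h.sigma_mat_hom[symmetric, OF pow_carrier_mat[OF pow_companion_carrier]])
  thus ?thesis
   by (simp add: h.mat_hom_pow[OF pow_companion_carrier] h.pow_companion_hom const_pol.ev_var power_pol_eq assms(1))
 qed
 also have "... = sigma_mat t (pow_companion (t - 1) c ^\<^sub>m l)"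
 proof (rule sigma_mat_power_cong[OF pow_companion_carrier pow_companion_carrier assms(1)])
  fix i assume "i <= t * l"
  thus "sigma_mat i (pow_companion (t * l) c) = sigma_mat i (pow_companion (t - 1) c)"
   by (cases "i = 0") (auto simp: sigma_pow_companion sigma_mat_0[OF pow_companion_carrier] c_def)
 qed
 also have "... = 0"
  using assms(2) carrier_matD[OF pow_carrier_mat[OF pow_companion_carrier[of "t - 1" c]], of l]
  by (simp add: sigma_mat_def)
 finally have "ev const_pol c (power_pol t l) = 0" .
 moreover have "lookup (ev const_pol c p) m = lookup p m" for p :: "(nat, 'a) pol"
 proof (induction p rule: pol_add_induct)
  case (single m' a)
  show ?case
  proof (cases "\<exists>s\<in>keys m'. t <= s")
   case True
   then obtain s where s: "s \<in> keys m'" "t <= s" by blast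
   hence "mon_ev c m' = 0" unfolding mon_ev_def
    by (intro prod_zero bexI[of _ s]) (auto simp: c_def in_keys_iff zero_power)
   moreover have "m' ~= m" using s low by auto
   ultimately show ?thesis by (simp add: const_pol.ev_single lookup_single)
  next
   case False
   hence "mon_ev c m' = mon_ev var_pol m'"
    unfolding mon_ev_def by (intro prod.cong) (auto simp: c_def)
   thus ?thesis by (simp add: const_pol.ev_single const_pol_mult_lookup mon_ev_var lookup_single when_def)
  qed
 qed (simp_all add: const_pol.ev_add lookup_add)
 ultimately show False using assms(3) by (metis in_keys_iff lookup_zero)
qed

section \<open>Elements of the free algebra and their values at generic matrices\<close>

abbreviation sigma_gen :: "nat => nat => (word \<Rightarrow>\<^sub>0 'a::field) => 'a gen_ring" where
 "sigma_gen N t a \<equiv> sigma_mat t (gen_alg N a)"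

lemma lookup_scale: "lookup (single 0 c * a) w = c * lookup a w"
 for a :: "'m::monoid_add \<Rightarrow>\<^sub>0 'a::semiring_0"
 by (induction a rule: pol_add_induct)
  (simp_all add: mult_single lookup_single when_def lookup_add distrib_left)

lemma keys_scale: "c ~= 0 ==> keys (single 0 c * a) = keys a"
 for a :: "'m::monoid_add \<Rightarrow>\<^sub>0 'a::field"
 by (auto simp: in_keys_iff lookup_scale)

lemma word_add_eq_0_iff: "v + w = 0 \<longleftrightarrow> v = 0 & w = (0 :: word)"
 by (cases v; cases w) (auto simp: zero_word_def plus_word_def)

lemma free_alg_add: "a \<in> free_alg ==> b \<in> free_alg ==> a + b \<in> free_alg"
 by (simp add: free_alg_def lookup_add)

lemma free_alg_0: "0 \<in> free_alg"
 by (simp add: free_alg_def)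

lemma free_alg_scale: "a \<in> free_alg ==> single 0 c * a \<in> free_alg"
 by (simp add: free_alg_def lookup_scale)

lemma free_alg_single: "single w c \<in> free_alg \<longleftrightarrow> w ~= 0 \<or> c = 0"
 by (auto simp: free_alg_def lookup_single when_def)

lemma free_alg_of_word: "of_word w \<in> free_alg \<longleftrightarrow> w ~= 0"
 by (simp add: of_word_def free_alg_single)

lemma free_alg_mult: 
 assumes "a \<in> free_alg"
 shows "a * b \<in> free_alg"
proof -
 have "0 \<notin> keys a" using assms by (simp add: free_alg_def in_keys_iff)
 hence "0 \<notin> {v + w | v w. v \<in> keys a & w \<in> keys b}"
  by (auto simp: word_add_eq_0_iff eq_commute[of 0])
 hence "0 \<notin> keys (a * b)"
  using Poly_Mapping.keys_mult[of a b] by blast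
 thus ?thesis by (simp add: free_alg_def in_keys_iff)
qed

lemma free_alg_induct [consumes 1, case_names zero single add]:
 assumes "a \<in> free_alg" "P 0" "!!w c. w ~= 0 ==> P (single w c)"
  "!!a b. [|a \<in> free_alg; b \<in> free_alg; P a; P b|] ==> P (a + b)"
 shows "P a"
proof -
 have a: "a = (\<Sum>w\<in>keys a. single w (lookup a w))"
  by (rule poly_mapping_eqI) (auto simp: lookup_sum lookup_single when_def in_keys_iff)
 have nz: "0 \<notin> keys a" using assms(1) by (simp add: free_alg_def in_keys_iff)
 have "(\<Sum>w\<in>K. single w (lookup a w)) \<in> free_alg &
   P (\<Sum>w\<in>K. single w (lookup a w))" if "K \<subseteq> keys a" for K
  using finite_subset[OF that finite_keys] that
 proof (induction K rule: finite_induct)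
  case (insert w K)
  let ?f = "%w. single w (lookup a w)"
  have w: "w ~= 0" using nz insert.prems by auto
  have K: "sum ?f K \<in> free_alg" "P (sum ?f K)" using insert by auto
  have "P (?f w + sum ?f K)" by (rule assms(4)[OF _ K(1) assms(3)[OF w] K(2)]) (simp add: free_alg_single w)
  moreover have "?f w + sum ?f K \<in> free_alg" by (intro free_alg_add K) (simp add: free_alg_single w)
  ultimately show ?case using insert.hyps by simp
 qed (auto simp: assms(2) free_alg_0)
 from this[OF order_refl] show ?thesis using a by simp
qed

lemma sigma_0 [simp]: "sigma 0 a = 1"
 by (simp add: sigma_def)

lemma sigma_single:
 assumes "w ~= 0"
 shows "sigma t (single w c) = const_pol (c ^ t) * sigma t (of_word w)"
proof (cases "c = 0 \<or> t = 0")
 case True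
 thus ?thesis by (cases "t = 0") (auto simp: sigma_def zero_power)
next
 case False
 have k: "keys (single w (1 :: 'a)) = {w}" "keys (single w c) = {w}"
  using False by simp_all
 have "single w c ~= 0" "single w (1 :: 'a) ~= 0" using k keys_eq_empty[symmetric] by force+
 thus ?thesis using False by (simp add: sigma_def of_word_def highest_coeff_def k mult_single)
qed

lemma sigma_gen_scale: "sigma_gen N t (single 0 c * a) = const_pol (c ^ t) * sigma_gen N t a"
 by (simp add: const_pol.alg_mat_const_mult[of "generic_mat N" N] sigma_mat_smult[OF alg_mat_carrier] const_pol.hom_power)

lemma sigma_gen_0: "sigma_gen N 0 a = 1"
 by (rule sigma_mat_0[OF alg_mat_carrier])

lemma sigma_gen_of_word: "sigma_gen N t (of_word w) = sigma_mat t (gen_word N w)"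
 using carrier_matD[OF word_mat_carrier[of "generic_mat N" N w]] unfolding of_word_def
 by (subst const_pol.alg_mat_single) (auto intro!: arg_cong[of _ _ "sigma_mat t"] eq_matI)

lemma word_mat_gen_carrier [simp]: "gen_word N w \<in> carrier_mat N N"
 by (rule word_mat_carrier) simp

lemma sigma_word_add_comm:
 "sigma_mat t (gen_word N (v + w)) = (sigma_mat t (gen_word N (w + v)) :: 'a::field gen_ring)"
 by (simp add: word_mat_add[of "generic_mat N"] sigma_mat_mult_comm[of _ N])

lemma Phi_tilde_sigma_tilde:
 assumes "t \<ge> 1" "e \<in> X_tilde"
 shows "Phi_tilde N (sigma_tilde t e) = sigma_mat t (gen_word N e)"
 using assms by (simp add: Phi_tilde_ev sigma_tilde_def const_pol.ev_var sym_mat_def Abs_tilde_sym_inverse)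

text \<open>\<open>\<sigma>\<^sub>s\<close> of \<open>A + B + \<tau>AB\<close> is a polynomial of degree at most \<open>s\<close> in \<open>\<tau>\<close>, so its coefficients are
 linear combinations of values over the infinite field, with weights that do not depend on the
 size of the matrices.\<close>

lemma sigma_mat_add_functional:
 assumes "infinite (UNIV :: 'a::field set)"
 obtains l ts :: "nat => nat => 'a::field"
 where "!!N (A :: ('v, 'a::field) pol mat) B. [|A \<in> carrier_mat N N; B \<in> carrier_mat N N|] ==>
  sigma_mat t (A + B) = (\<Sum>i\<le>t. sigma_mat i A * sigma_mat (t - i) B)
   - (\<Sum>s | s < t & t <= 2 * s. \<Sum>j\<le>s. const_pol (l s j) * sigma_mat s (A + B + const_pol (ts s j) \<cdot>\<^sub>m (A * B)))"
proof -
 have "\<forall>s. \<exists>l ts :: nat => 'a. \<forall>i\<le>s. (\<Sum>j\<le>s. l j * ts j ^ i) = (if i = t - s then 1 else 0)"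
 proof
  fix s
  obtain ts l :: "nat => 'a" where "!!i. i <= s ==> (\<Sum>j\<le>s. l j * ts j ^ i) = (if i = t - s then 1 else 0)"
   using lagrange_functional[OF assms, of s "t - s"] by blast
  thus "\<exists>l ts :: nat => 'a. \<forall>i\<le>s. (\<Sum>j\<le>s. l j * ts j ^ i) = (if i = t - s then 1 else 0)" by blast
 qed
 then obtain l ts :: "nat => nat => 'a"
  where lag: "!!s i. i <= s ==> (\<Sum>j\<le>s. l s j * ts s j ^ i) = (if i = t - s then 1 else 0)"
  unfolding choice_iff by blast
 show thesis
 proof
  fix N and A B :: "('v, 'a) pol mat"
  assume A: "A \<in> carrier_mat N N" "B \<in> carrier_mat N N"
  define C where "C = mat N N (%(i, j). [:(A + B) $$ (i, j), (A * B) $$ (i, j):])"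
  note C = sigma_mat_add[OF A, folded C_def]
  have "coeff (sigma_mat s C) (t - s) = (\<Sum>j\<le>s. const_pol (l s j) * sigma_mat s (A + B + const_pol (ts s j) \<cdot>\<^sub>m (A * B)))"
   if "t <= 2 * s" for s
  proof -
   have deg: "degree (sigma_mat s C) <= s" by (rule degree_le) (use C(4) in blast)
   have "coeff (sigma_mat s C) (t - s) = (\<Sum>j\<le>s. const_pol (l s j) * poly (sigma_mat s C) (const_pol (ts s j)))"
    by (rule poly_coeff_functional[OF const_pol_hom lag deg]) (use that in auto)
   thus ?thesis by (simp add: C(2))
  qed
  moreover have "coeff (sigma_mat s C) (t - s) = 0" if "\<not> t <= 2 * s" for s
   by (rule C(4)) (use that in simp)
  ultimately have "(\<Sum>s<t. coeff (sigma_mat s C) (t - s))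
   = (\<Sum>s\<in>{..<t}. if t <= 2 * s then \<Sum>j\<le>s. const_pol (l s j) * sigma_mat s (A + B + const_pol (ts s j) \<cdot>\<^sub>m (A * B)) else 0)"
   by (intro sum.cong) auto
  also have "... = (\<Sum>s | s < t & t <= 2 * s. \<Sum>j\<le>s. const_pol (l s j) * sigma_mat s (A + B + const_pol (ts s j) \<cdot>\<^sub>m (A * B)))"
   by (subst sum.inter_filter[symmetric]) simp_all
  finally show "sigma_mat t (A + B) = (\<Sum>i\<le>t. sigma_mat i A * sigma_mat (t - i) B)
   - (\<Sum>s | s < t & t <= 2 * s. \<Sum>j\<le>s. const_pol (l s j) * sigma_mat s (A + B + const_pol (ts s j) \<cdot>\<^sub>m (A * B)))"
   using C(1)[of t] C(3)[of t] by (simp add: lessThan_Suc_atMost[symmetric])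
 qed
qed

lemma sigma_gen_add_functional:
 assumes "infinite (UNIV :: 'a::field set)"
 shows "\<exists>l ts :: nat => nat => 'a. \<forall>N a b. sigma_gen N t (a + b) = (\<Sum>i\<le>t. sigma_gen N i a * sigma_gen N (t - i) b)
   - (\<Sum>s | s < t & t <= 2 * s. \<Sum>j\<le>s. const_pol (l s j) * sigma_gen N s (a + b + single 0 (ts s j) * (a * b)))"
proof -
 obtain l ts :: "nat => nat => 'a" where
  l: "!!N (A :: 'a gen_ring mat) B. [|A \<in> carrier_mat N N; B \<in> carrier_mat N N|] ==>
  sigma_mat t (A + B) = (\<Sum>i\<le>t. sigma_mat i A * sigma_mat (t - i) B)
   - (\<Sum>s | s < t & t <= 2 * s. \<Sum>j\<le>s. const_pol (l s j) * sigma_mat s (A + B + const_pol (ts s j) \<cdot>\<^sub>m (A * B)))"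
  using sigma_mat_add_functional[OF assms, of t] by blast
 show ?thesis
  by (rule exI[of _ l], rule exI[of _ ts], intro allI,
    unfold const_pol.alg_mat_const_mult[OF generic_mat_carrier] const_pol.alg_mat_add[OF generic_mat_carrier])
   (simp add: const_pol.alg_mat_mult l[OF alg_mat_carrier alg_mat_carrier])
qed

subsection \<open>Traces of free algebra elements are polynomials in the \<open>\<sigma>\<^sub>t(e)\<close>\<close>

text \<open>The working form of the equation \<sigma>_t(a) = p in the large free algebra: equality
  at generic matrices of every size. Joint injectivity makes \<open>p\<close> unique over an
  infinite field, so relations between the \<sigma>_t(a) reduce to matrix identities.\<close>

definition represents :: "'a::field sigma_tilde_alg => nat => (word \<Rightarrow>\<^sub>0 'a) => bool" where
 "represents p t a \<longleftrightarrow> (\<forall>N. Phi_tilde N p = sigma_gen N t a)"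

lemma represents_unique:
 fixes p q :: "'a::field sigma_tilde_alg"
 assumes "infinite (UNIV :: 'a set)" "represents p t a" "represents q t a"
 shows "p = q"
proof -
 have "Phi_tilde N (p - q) = 0" for N
 proof -
  interpret comm_ring_hom "Phi_tilde N :: 'a sigma_tilde_alg => _" by (rule comm_ring_hom_Phi_tilde)
  show ?thesis using assms(2,3) by (simp add: represents_def hom_distribs)
 qed
 hence "p - q = 0" by (rule Phi_tilde_joint_inj[OF assms(1)])
 thus ?thesis by simp
qed

definition sigma_tilde' :: "word => nat => 'a::field sigma_tilde_alg" where
 "sigma_tilde' e t = (if t = 0 then 1 else sigma_tilde t e)"

lemma Phi_tilde_sigma_tilde':
 assumes "e \<in> X_tilde"
 shows "Phi_tilde N (sigma_tilde' e t) = sigma_mat t (gen_word N e)"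
proof -
 interpret comm_ring_hom "Phi_tilde N" by (rule comm_ring_hom_Phi_tilde)
 show ?thesis using assms by (simp add: sigma_tilde'_def Phi_tilde_sigma_tilde sigma_mat_0[of _ N])
qed

lemma sigma_word_cyclic:
 assumes "cyclic_equiv v w"
 shows "sigma_mat t (gen_word N v) = (sigma_mat t (gen_word N w) :: 'a::field gen_ring)"
 using assms sigma_word_add_comm unfolding cyclic_equiv_def by blast

lemma represents_word:
 assumes "w ~= 0" "e \<in> X_tilde" "l > 0" "cyclic_equiv w (sum_list (replicate l e))"
 shows "represents (ev const_pol (sigma_tilde' e) (power_pol t l)) t (of_word w)"
 unfolding represents_def
proof
 fix N
 have "Phi_tilde N (ev const_pol (sigma_tilde' e) (power_pol t l))
   = ev const_pol (%i. sigma_mat i (gen_word N e)) (power_pol t l)"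
  using assms(2) by (simp add: ev_ev[OF comm_ring_hom_Phi_tilde const_pol_hom] Phi_tilde_const Phi_tilde_sigma_tilde')
 also have "... = sigma_mat t (gen_word N e ^\<^sub>m l)"
  using subst_power_pol[of "gen_word N e" N l t] assms(3) by (simp add: subst_pol_ev)
 also have "... = sigma_mat t (gen_word N w)"
  unfolding sigma_word_cyclic[OF assms(4)] by (simp add: word_mat_power[of "generic_mat N"])
 finally show "Phi_tilde N (ev const_pol (sigma_tilde' e) (power_pol t l)) = sigma_gen N t (of_word w)"
  by (simp add: sigma_gen_of_word)
qed

text \<open>Induction on t and, inside it, on the construction of \<open>a\<close> by sums. The
  addition formula involves longer elements a + b + \<tau>ab, but only with indices s < t, so the
  outer induction covers them.\<close>

lemma ex_represents:
 fixes a :: "word \<Rightarrow>\<^sub>0 'a::field"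
 assumes inf: "infinite (UNIV :: 'a set)" and a: "a \<in> free_alg"
 shows "\<exists>p. represents p t a"
 using a
proof (induction t arbitrary: a rule: less_induct)
 case (less t)
 show ?case
 proof (cases "t = 0")
  case True
  hence "represents 1 t a" by (simp add: represents_def sigma_gen_0)
  thus ?thesis ..
 next
  case False
  from less.prems show ?thesis
  proof (induction a rule: free_alg_induct)
   case zero
   have "represents 0 t (0 :: word \<Rightarrow>\<^sub>0 'a)" using False by (simp add: represents_def const_pol.alg_mat_0 sigma_mat_zero)
   thus ?case by (rule exI)
  next
   case (single w c)
   obtain p :: "'a sigma_tilde_alg" where p: "represents p t (of_word w)"
    using represents_word[OF single] ex_X_tilde_root[OF single] by blast
   have eq: "single w c = single 0 c * of_word w" by (simp add: of_word_def mult_single)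
   have "represents (const_pol (c ^ t) * p) t (single w c)"
    using p unfolding represents_def eq sigma_gen_scale by (simp add: Phi.hom_mult Phi_tilde_const)
   thus ?case by (rule exI)
  next
   case (add a b)
   obtain l ts :: "nat => nat => 'a" where
    l: "\<forall>N a b. sigma_gen N t (a + b) = (\<Sum>i\<le>t. sigma_gen N i a * sigma_gen N (t - i) b)
     - (\<Sum>s | s < t & t <= 2 * s. \<Sum>j\<le>s. const_pol (l s j) * sigma_gen N s (a + b + single 0 (ts s j) * (a * b)))"
    using sigma_gen_add_functional[OF inf, of t] by (elim exE) (rule that)
   have "\<exists>p. represents p i a" if "i <= t" for i
    using less.IH[of i a] add.hyps add.IH that by (cases "i = t") auto
   moreover have "\<exists>p. represents p i b" if "i <= t" for i
    using less.IH[of i b] add.hyps add.IH that by (cases "i = t") auto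
   ultimately have "\<forall>i. \<exists>p q. i <= t --> represents p i a & represents q i b" by blast
   then obtain p q where pq: "!!i. i <= t ==> represents (p i) i a" "!!i. i <= t ==> represents (q i) i b"
    unfolding choice_iff by blast
   have "a + b + single 0 (ts s j) * (a * b) \<in> free_alg" for s j
    using add by (intro free_alg_add free_alg_scale free_alg_mult)
   hence "\<forall>s j. \<exists>p. s < t --> represents p s (a + b + single 0 (ts s j) * (a * b))"
    using less.IH by blast
   then obtain r where r: "!!s j. s < t ==> represents (r s j) s (a + b + single 0 (ts s j) * (a * b))"
    unfolding choice_iff by blast
   have "represents ((\<Sum>i\<le>t. p i * q (t - i)) - (\<Sum>s | s < t & t <= 2 * s. \<Sum>j\<le>s. const_pol (l s j) * r s j)) t (a + b)"
    unfolding represents_def l[rule_format] using pq r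
    by (auto simp: Phi.hom_minus Phi.hom_sum Phi.hom_mult Phi_tilde_const represents_def intro!: arg_cong2[of _ _ _ _ "(-)"] sum.cong)
   thus ?case by (rule exI)
  qed
 qed
qed

subsection \<open>Rescaling the letters\<close>

text \<open>The endomorphism induced by x_k -> c_k x_k. With constant \<open>c\<close> it detects
  the degree; with values 0 and 1 it removes letters.\<close>

definition theta :: "(nat => 'a) => 'a::field sigma_tilde_alg => 'a sigma_tilde_alg" where
 "theta c = ev const_pol (%s. case Rep_tilde_sym s of (t, e) =>
   const_pol (prod_list (map c (letters e)) ^ t) * var_pol s)"

lemma comm_ring_hom_theta: "comm_ring_hom (theta c)"
 unfolding theta_def by (rule const_pol.ev_hom)


lemma theta_var:
 "theta c (var_pol s) = (case Rep_tilde_sym s of (t, e) => const_pol (prod_list (map c (letters e)) ^ t) * var_pol s)"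
 unfolding theta_def by (rule const_pol.ev_var)

lemma word_mat_smult:
 assumes Xs: "!!k. Xs k \<in> carrier_mat n n"
 shows "word_mat n (%k. c k \<cdot>\<^sub>m Xs k) w = prod_list (map c (letters w)) \<cdot>\<^sub>m word_mat n Xs w"
proof -
 have "word_mat n (%k. c k \<cdot>\<^sub>m Xs k) (Word ks) = prod_list (map c ks) \<cdot>\<^sub>m word_mat n Xs (Word ks)" for ks
 proof (induction ks)
  case (Cons k ks)
  have W: "word_mat n Xs (Word ks) \<in> carrier_mat n n" by (rule word_mat_carrier[OF Xs])
  have "c k \<cdot>\<^sub>m Xs k * (prod_list (map c ks) \<cdot>\<^sub>m word_mat n Xs (Word ks))
   = c k \<cdot>\<^sub>m (prod_list (map c ks) \<cdot>\<^sub>m (Xs k * word_mat n Xs (Word ks)))"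
   using mult_smult_assoc_mat[OF Xs[of k] smult_carrier_mat[OF W]] mult_smult_distrib[OF Xs[of k] W] by simp
  moreover have "a \<cdot>\<^sub>m (b \<cdot>\<^sub>m A) = (a * b) \<cdot>\<^sub>m A" for a b and A :: "'a mat" by (auto simp: mult.assoc)
  ultimately show ?case by (simp add: word_mat_Cons Cons)
 qed (auto intro!: eq_matI)
 from this[of "letters w"] show ?thesis by simp
qed

lemma Phi_tilde_theta:
 "Phi_tilde N (theta c s) = mat_ev const_pol (%k. const_pol (c k) \<cdot>\<^sub>m generic_mat N k) (Phi_tilde N s)"
proof -
 have "Phi_tilde N (theta c s) = ev const_pol (%v. Phi_tilde N (theta c (var_pol v))) s"
  unfolding theta_def
  by (subst ev_ev[OF comm_ring_hom_Phi_tilde const_pol_hom]) (simp add: Phi_tilde_const const_pol.ev_var)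
 also have "(%v. Phi_tilde N (theta c (var_pol v))) = sym_mat N (%k. const_pol (c k) \<cdot>\<^sub>m generic_mat N k)"
 proof
  fix v
  obtain t e where v: "Rep_tilde_sym v = (t, e)" by fastforce
  have pl: "prod_list (map (%k. const_pol (c k)) ks) = const_pol (prod_list (map c ks))" for ks
   by (induction ks) (simp_all add: const_pol.hom_mult)
  have "Phi_tilde N (theta c (var_pol v)) = const_pol (prod_list (map c (letters e)) ^ t) * sigma_mat t (gen_word N e)"
   by (simp add: theta_var v Phi.hom_mult Phi_tilde_const) (simp add: Phi_tilde_ev const_pol.ev_var sym_mat_def v)
  thus "Phi_tilde N (theta c (var_pol v)) = sym_mat N (%k. const_pol (c k) \<cdot>\<^sub>m generic_mat N k) v"
   by (simp add: sym_mat_def v word_mat_smult[OF generic_mat_carrier] sigma_mat_smult[OF word_mat_gen_carrier] pl const_pol.hom_power)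
 qed
 also have "ev const_pol (sym_mat N (%k. const_pol (c k) \<cdot>\<^sub>m generic_mat N k)) s
  = mat_ev const_pol (%k. const_pol (c k) \<cdot>\<^sub>m generic_mat N k) (Phi_tilde N s)"
  by (rule mat_ev_Phi[symmetric]) (auto intro: const_pol_hom)
 finally show ?thesis .
qed

subsection \<open>The formula for \<open>\<sigma>\<^sub>t\<close> of a sum\<close>

definition F_tilde :: "nat => nat => 'a::field sigma_tilde_alg" where
 "F_tilde t u = (\<Sum>ts | length ts = u & sum_list ts = t.
   if Omega ts = {} then 1
   else (- 1) ^ sum_list ts *
    (\<Sum>om\<in>Omega ts. (- 1) ^ size om * (\<Prod>e\<in>set_mset om. sigma_tilde' e (count om e))))"

definition letter_words :: "nat => nat => word multiset set" where
 "letter_words t u = {om. set_mset om \<subseteq> X_tilde & (\<forall>e\<in>#om. set (letters e) \<subseteq> {..<u}) & (\<Sum>e\<in>#om. length (letters e)) = t}"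

lemma sum_count_list_lessThan: "set xs \<subseteq> {..<u :: nat} ==> (\<Sum>i<u. count_list xs i) = length xs"
 using sum_count_set[of xs "{..<u}"] by simp

lemma Omega_letters:
 assumes "om \<in> Omega ts" "e \<in># om"
 shows "set (letters e) \<subseteq> {..<length ts}"
proof (rule ccontr)
 assume "\<not> ?thesis"
 then obtain i where i: "i \<in> set (letters e)" "\<not> i < length ts" by auto
 hence "(\<Sum>e\<in>#om. count_list (letters e) i) = 0" using assms(1) by (simp add: Omega_def)
 hence "count_list (letters e) i = 0" using assms(2) by simp
 thus False using i by (simp add: count_list_0_iff)
qed

lemma letter_words_eq:
 assumes "t > 0"
 shows "letter_words t u = (\<Union>ts\<in>{ts. length ts = u & sum_list ts = t}. Omega ts)"
proof (intro equalityI subsetI)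
 fix om assume w: "om \<in> letter_words t u"
 define ts where "ts = map (%i. \<Sum>e\<in>#om. count_list (letters e) i) [0..<u]"
 have "sum_list ts = (\<Sum>i<u. \<Sum>e\<in>#om. count_list (letters e) i)"
  by (simp add: ts_def interv_sum_list_conv_sum_set_nat atLeast0LessThan)
 also have "... = (\<Sum>e\<in>#om. \<Sum>i<u. count_list (letters e) i)"
  by (induction om) (simp_all add: sum.distrib)
 also have "... = (\<Sum>e\<in>#om. length (letters e))"
  using w by (intro arg_cong[of _ _ sum_mset] image_mset_cong sum_count_list_lessThan) (auto simp: letter_words_def)
 also have "... = t" using w by (simp add: letter_words_def)
 finally have "sum_list ts = t" .
 moreover have "(\<Sum>e\<in>#om. count_list (letters e) i) = (if i < u then ts ! i else 0)" for i
 proof (cases "i < u")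
  case False
  hence "count_list (letters e) i = 0" if "e \<in># om" for e
   using w that by (auto simp: letter_words_def count_list_0_iff)
  thus ?thesis using False by simp
 qed (simp add: ts_def)
 moreover have "om ~= {#}" using w assms by (auto simp: letter_words_def)
 moreover have "length ts = u" by (simp add: ts_def)
 moreover have "set_mset om \<subseteq> X_tilde" using w by (simp add: letter_words_def)
 ultimately have "om \<in> Omega ts & length ts = u & sum_list ts = t"
  by (simp add: Omega_def)
 thus "om \<in> (\<Union>ts\<in>{ts. length ts = u & sum_list ts = t}. Omega ts)" by blast
next
 fix om assume "om \<in> (\<Union>ts\<in>{ts. length ts = u & sum_list ts = t}. Omega ts)"
 then obtain ts where ts: "length ts = u" "sum_list ts = t" "om \<in> Omega ts" by blast
 have l: "set (letters e) \<subseteq> {..<u}" if "e \<in># om" for e using Omega_letters[OF ts(3) that] ts(1) by simp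
 have "(\<Sum>e\<in>#om. length (letters e)) = (\<Sum>e\<in>#om. \<Sum>i<u. count_list (letters e) i)"
  using l by (intro arg_cong[of _ _ sum_mset] image_mset_cong sum_count_list_lessThan[symmetric]) auto
 also have "... = (\<Sum>i<u. \<Sum>e\<in>#om. count_list (letters e) i)"
  by (induction om) (simp_all add: sum.distrib)
 also have "... = (\<Sum>i<u. ts ! i)" using ts by (intro sum.cong) (auto simp: Omega_def)
 also have "... = t" using ts by (simp add: sum_list_sum_nth atLeast0LessThan)
 finally show "om \<in> letter_words t u" using l ts by (auto simp: letter_words_def Omega_def)
qed

lemma sum_mset_count:
 fixes f :: "'b => nat"
 assumes "finite E" "set_mset om \<subseteq> E"
 shows "(\<Sum>e\<in>#om. f e) = (\<Sum>e\<in>E. count om e * f e)"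
 using assms(2)
proof (induction om)
 case (add x om)
 have "(\<Sum>e\<in>E. count (add_mset x om) e * f e) = (\<Sum>e\<in>E. count om e * f e + (if e = x then f e else 0))"
  by (intro sum.cong) auto
 also have "... = (\<Sum>e\<in>E. count om e * f e) + f x"
  using add.prems assms(1) by (simp add: sum.distrib)
 finally show ?case using add by simp
qed simp

lemma finite_words: "finite {e. set (letters e) \<subseteq> {..<u} & length (letters e) <= (t :: nat)}"
proof -
 have "{e. set (letters e) \<subseteq> {..<u} & length (letters e) <= t} = Word ` {xs. set xs \<subseteq> {..<u} & length xs <= t}"
  by (auto simp: image_iff intro: word.collapse[symmetric])
 thus ?thesis by (simp add: finite_lists_length_le)
qed

lemma letter_words_count:
 assumes "om \<in> letter_words t u"
 shows "e \<in># om ==> length (letters e) <= t" "count om e <= t"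
proof -
 have "count om e * length (letters e) <= (\<Sum>e\<in>#om. length (letters e))" for e
 proof (cases "e \<in># om")
  case True
  thus ?thesis unfolding sum_mset_count[OF finite_set_mset order_refl]
   by (intro member_le_sum[of e "set_mset om" "%e. count om e * length (letters e)"]) auto
 qed (simp add: not_in_iff)
 hence le: "count om e * length (letters e) <= t" for e using assms by (simp add: letter_words_def)
 show "length (letters e) <= t" if "e \<in># om"
  using le[of e] that by (metis count_greater_zero_iff dual_order.trans le_simps(3) mult_le_mono1 nat_mult_1 One_nat_def)
 show "count om e <= t"
 proof (cases "e \<in># om")
  case True
  hence "length (letters e) \<ge> 1" using assms X_tilde_nonempty[of e] by (cases "letters e") (auto simp: letter_words_def)
  thus ?thesis using le[of e] by (metis dual_order.trans mult.right_neutral mult_le_mono2)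
 qed (simp add: not_in_iff)
qed

lemma finite_letter_words: "finite (letter_words t u)"
proof -
 let ?E = "{e. set (letters e) \<subseteq> {..<u} & length (letters e) <= t}"
 have "letter_words t u \<subseteq> (%f. Abs_multiset f) ` {f. \<forall>e. (e \<in> ?E --> f e \<in> {..t}) & (e \<notin> ?E --> f e = 0)}"
 proof
  fix om assume w: "om \<in> letter_words t u"
  have "count om e = 0" if "e \<notin> ?E" for e
   using letter_words_count(1)[OF w, of e] w that by (auto simp: letter_words_def not_in_iff[symmetric])
  hence "count om \<in> {f. \<forall>e. (e \<in> ?E --> f e \<in> {..t}) & (e \<notin> ?E --> f e = 0)}"
   using letter_words_count(2)[OF w] by auto
  thus "om \<in> (%f. Abs_multiset f) ` {f. \<forall>e. (e \<in> ?E --> f e \<in> {..t}) & (e \<notin> ?E --> f e = 0)}"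
   by (rule image_eqI[rotated]) (simp add: count_inverse)
 qed
 thus ?thesis by (rule finite_subset) (intro finite_imageI finite_set_of_finite_funs finite_words finite_atMost)
qed

lemma F_tilde_eq:
 assumes "t > 0" "u > 0"
 shows "F_tilde t u = (\<Sum>om\<in>letter_words t u. (- 1) ^ (t + size om) * (\<Prod>e\<in>set_mset om. sigma_tilde' e (count om e)))"
proof -
 let ?T = "{ts. length ts = u & sum_list ts = t}"
 have fT: "finite ?T"
 proof (rule finite_subset)
  show "?T \<subseteq> {xs. set xs \<subseteq> {..t} & length xs = u}" using member_le_sum_list by auto
 qed (simp add: finite_lists_length_eq)
 \<comment> \<open>For t > 0 the letters themselves, x_i with multiplicity t_i, form an element of
   \<open>Omega ts\<close>, so the convention for empty \<open>Omega ts\<close> does not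
   interfere.\<close>
 have ne: "Omega ts ~= {}" if "ts \<in> ?T" for ts
 proof -
  have ts: "length ts = u" "sum_list ts = t" using that by auto
  define M where "M = (\<Sum>i<u. replicate_mset (ts ! i) i)"
  have M: "count M i = (if i < u then ts ! i else 0)" for i
  proof -
   have "count M i = (\<Sum>j<u. if j = i then ts ! j else 0)"
    unfolding M_def count_sum by (intro sum.cong) auto
   thus ?thesis by simp
  qed
  define om where "om = image_mset (%i. Word [i]) M"
  have "(\<Sum>e\<in>#om. count_list (letters e) i) = count M i" for i
  proof -
   have "count_list (letters (Word [j])) i = (if j = i then 1 else 0)" for j by simp
   thus ?thesis by (simp only: om_def multiset.map_comp o_def sum_mset_delta) simp
  qed
  moreover have "om ~= {#}"
  proof
   assume "om = {#}"
   hence "M = {#}" by (simp add: om_def)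
   hence "ts ! i = 0" if "i < u" for i using M[of i] that by simp
   hence "sum_list ts = 0" using ts(1) by (auto simp: sum_list_sum_nth)
   thus False using ts(2) assms(1) by simp
  qed
  ultimately have "om \<in> Omega ts" using M ts(1) X_tilde_letter by (auto simp: Omega_def om_def)
  thus ?thesis by blast
 qed
 have sub: "Omega ts \<subseteq> letter_words t u" if "ts \<in> ?T" for ts
  using that letter_words_eq[OF assms(1)] by blast
 have "F_tilde t u = (\<Sum>ts\<in>?T. \<Sum>om\<in>Omega ts. (- 1) ^ (t + size om) * (\<Prod>e\<in>set_mset om. sigma_tilde' e (count om e)))"
  unfolding F_tilde_def
 proof (intro sum.cong refl)
  fix ts assume T: "ts \<in> ?T"
  hence "sum_list ts = t" by simp
  thus "(if Omega ts = {} then 1 else (- 1) ^ sum_list ts * (\<Sum>om\<in>Omega ts. (- 1) ^ size om * (\<Prod>e\<in>set_mset om. sigma_tilde' e (count om e))))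
   = (\<Sum>om\<in>Omega ts. (- 1) ^ (t + size om) * (\<Prod>e\<in>set_mset om. sigma_tilde' e (count om e)))"
   using ne[OF T] by (simp only: if_False sum_distrib_left power_add mult.assoc)
 qed
 also have "... = (\<Sum>om\<in>letter_words t u. (- 1) ^ (t + size om) * (\<Prod>e\<in>set_mset om. sigma_tilde' e (count om e)))"
  unfolding letter_words_eq[OF assms(1)]
 proof (rule sum.UNION_disjoint[symmetric, OF fT])
  show "\<forall>ts\<in>?T. finite (Omega ts)" using sub finite_letter_words finite_subset by blast
  show "\<forall>ts\<in>?T. \<forall>ts'\<in>?T. ts ~= ts' --> Omega ts \<inter> Omega ts' = {}"
  proof (intro ballI impI, rule ccontr)
   fix ts ts' assume T: "ts \<in> ?T" "ts' \<in> ?T" "ts ~= ts'" and "Omega ts \<inter> Omega ts' ~= {}"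
   then obtain om where "om \<in> Omega ts" "om \<in> Omega ts'" by blast
   hence "(if i < length ts then ts ! i else 0) = (if i < length ts' then ts' ! i else 0)" for i
    by (auto simp: Omega_def)
   hence "ts ! i = ts' ! i" if "i < u" for i using T that by (metis (mono_tags, lifting) mem_Collect_eq)
   hence "ts = ts'" using T by (auto intro: nth_equalityI)
   thus False using T by simp
  qed
 qed
 finally show ?thesis .
qed

lemma coeff_prod_sum_monom:
 fixes g :: "'e => nat => 'r::comm_ring_1"
 assumes "finite E"
 shows "coeff (\<Prod>e\<in>E. \<Sum>k\<le>q. monom (g e k) (k * l e)) t
  = (\<Sum>h | h \<in> PiE E (%_. {..q}) & (\<Sum>e\<in>E. h e * l e) = t. \<Prod>e\<in>E. g e (h e))"
proof -
 have m: "(\<Prod>e\<in>E'. monom (g e (h e)) (h e * l e)) = monom (\<Prod>e\<in>E'. g e (h e)) (\<Sum>e\<in>E'. h e * l e)" for E' h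
  by (induction E' rule: infinite_finite_induct) (simp_all add: mult_monom)
 have "(\<Prod>e\<in>E. \<Sum>k\<le>q. monom (g e k) (k * l e))
  = (\<Sum>h\<in>PiE E (%_. {..q}). \<Prod>e\<in>E. monom (g e (h e)) (h e * l e))"
  by (rule prod_sum_PiE) (use assms in auto)
 hence "coeff (\<Prod>e\<in>E. \<Sum>k\<le>q. monom (g e k) (k * l e)) t
  = (\<Sum>h\<in>PiE E (%_. {..q}). if (\<Sum>e\<in>E. h e * l e) = t then \<Prod>e\<in>E. g e (h e) else 0)"
  by (simp add: m coeff_sum)
 also have "... = (\<Sum>h | h \<in> PiE E (%_. {..q}) & (\<Sum>e\<in>E. h e * l e) = t. \<Prod>e\<in>E. g e (h e))"
  using assms by (subst sum.inter_filter[symmetric]) (auto intro!: finite_PiE)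
 finally show ?thesis .
qed

text \<open>A multiset corresponds to its function \<open>h\<close> of multiplicities. The signs
  agree because t + size om is the sum of the k(|e| + 1) over the words e with multiplicity k, which
  has the parity of the sum of the k(|e| - 1).\<close>

lemma letter_words_sum:
 fixes g :: "word => nat => 'r::comm_ring_1"
 assumes E: "finite E" "E \<subseteq> X_tilde" "!!e. e \<in> E ==> set (letters e) \<subseteq> {..<u}"
  "!!e. [|e \<in> X_tilde; set (letters e) \<subseteq> {..<u}; length (letters e) <= t|] ==> e \<in> E" and g: "!!e. g e 0 = 1" and "t <= q"
 shows "(\<Sum>om\<in>letter_words t u. (- 1) ^ (t + size om) * (\<Prod>e\<in>set_mset om. g e (count om e)))
  = (\<Sum>h | h \<in> PiE E (%_. {..q}) & (\<Sum>e\<in>E. h e * length (letters e)) = t.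
    \<Prod>e\<in>E. (- 1) ^ ((length (letters e) - Suc 0) * h e) * g e (h e))" (is "?L = sum ?G ?H")
proof -
 define M where "M h = Abs_multiset (%e. if e \<in> E then h e else 0)" for h :: "word => nat"
 have cM: "count (M h) e = (if e \<in> E then h e else 0)" for h e
  unfolding M_def by (subst count_Abs_multiset) (use E(1) in "auto intro: finite_subset[rotated]")
 have sM: "set_mset (M h) \<subseteq> E" for h using cM[of h] by (auto simp flip: count_greater_zero_iff split: if_splits)
 have sub: "set_mset om \<subseteq> E" if "om \<in> letter_words t u" for om
  using that letter_words_count(1)[OF that] E(4) by (auto simp: letter_words_def)
 show ?thesis
 proof (rule sum.reindex_bij_witness[where i = M and j = "%om. restrict (count om) E"])
  fix om assume w: "om \<in> letter_words t u"
  show "M (restrict (count om) E) = om"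
   using sub[OF w] by (intro multiset_eqI) (auto simp: cM not_in_iff[symmetric])
  show mem: "restrict (count om) E \<in> ?H"
   using letter_words_count(2)[OF w] w \<open>t <= q\<close> sum_mset_count[OF E(1) sub[OF w]]
   by (auto simp: letter_words_def intro: order_trans)
  have len: "length (letters e) = Suc (length (letters e) - Suc 0)" if "e \<in> E" for e
   using that E(2) X_tilde_nonempty[of e] by (cases "letters e") auto
  have t: "t = (\<Sum>e\<in>E. count om e * length (letters e))"
   using w sum_mset_count[OF E(1) sub[OF w]] by (simp add: letter_words_def)
  have "t + size om = (\<Sum>e\<in>E. count om e * (length (letters e) + 1))"
   using sum_mset_count[OF E(1) sub[OF w], of "%_. 1"] by (subst t) (simp add: sum.distrib algebra_simps)
  also have "... = (\<Sum>e\<in>E. (length (letters e) - Suc 0) * count om e + 2 * count om e)"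
   by (intro sum.cong refl, subst len) (simp_all add: algebra_simps)
  finally have "(- 1) ^ (t + size om) = (\<Prod>e\<in>E. (- 1 :: 'r) ^ ((length (letters e) - Suc 0) * count om e))"
   by (simp add: power_sum power_add power_mult)
  moreover have "(\<Prod>e\<in>set_mset om. g e (count om e)) = (\<Prod>e\<in>E. g e (count om e))"
   using E(1) sub[OF w] g by (intro prod.mono_neutral_left) (auto simp: not_in_iff)
  ultimately show "?G (restrict (count om) E) = (- 1) ^ (t + size om) * (\<Prod>e\<in>set_mset om. g e (count om e))"
   by (simp add: prod.distrib)
 next
  fix h assume h: "h \<in> ?H"
  show "restrict (count (M h)) E = h" using h by (auto simp: cM fun_eq_iff PiE_def extensional_def)
  show "M h \<in> letter_words t u"
   using h sM[of h] E sum_mset_count[OF E(1) sM[of h], of "%e. length (letters e)"] by (auto simp: letter_words_def cM)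
 qed
qed

definition letter_elem :: "nat => (word \<Rightarrow>\<^sub>0 'a::field)" where
 "letter_elem u = (\<Sum>k<u. of_word (Word [k]))"

lemma free_alg_letter_elem: "letter_elem u \<in> free_alg"
 unfolding letter_elem_def by (induction u) (simp_all add: free_alg_0 free_alg_add free_alg_of_word zero_word_def)

lemma alg_mat_letter_elem:
 fixes c :: "'a::field => 'r::comm_ring_1"
 assumes c: "comm_ring_hom c" and Xs: "!!k. Xs k \<in> carrier_mat N N"
 shows "alg_mat N c Xs (letter_elem u) = letter_sum N Xs u"
proof (induction u)
 interpret comm_ring_hom c by fact
 case 0
 show ?case by (auto simp: letter_elem_def letter_sum_def alg_mat_0[of Xs N] Xs)
next
 interpret comm_ring_hom c by fact
 case (Suc u)
 have "c 1 \<cdot>\<^sub>m Xs u = Xs u" using Xs[of u] by (auto intro!: eq_matI)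
 hence "alg_mat N c Xs (of_word (Word [u])) = Xs u"
  unfolding of_word_def by (subst alg_mat_single) (simp_all add: Xs)
 moreover have "letter_elem (Suc u) = (letter_elem u + of_word (Word [u]) :: word \<Rightarrow>\<^sub>0 'a)" by (simp add: letter_elem_def)
 ultimately have "alg_mat N c Xs (letter_elem (Suc u)) = letter_sum N Xs u + Xs u"
  using Suc by (simp add: alg_mat_add[OF Xs])
 also have "... = letter_sum N Xs (Suc u)"
  using Xs[of u] by (intro eq_matI) (auto simp: letter_sum_def)
 finally show ?case .
qed

lemma sigma_tilde'_var: "sigma_tilde' e k = (if k = 0 then 1 else var_pol (Abs_tilde_sym (k, e)))"
 by (simp add: sigma_tilde'_def sigma_tilde_def)

lemma pcompose_monom: "monom a k \<circ>\<^sub>p q = smult a (q ^ k)"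
 by (induction k) (simp_all add: monom_0 monom_Suc pcompose_pCons)

text \<open>Some p representing \<sigma>_t(x_1 + ... + x_u) is already known to exist; it is
  identified by its values. On a direct sum of cyclic matrices det (1 + xY), for Y the sum of the
  letters, factors over the words, and expanding the product gives the signed sum over
  multisets.\<close>

lemma represents_F_tilde:
 assumes inf: "infinite (UNIV :: 'a::field set)" and t: "t > 0" and u: "u > 0"
 shows "represents (F_tilde t u :: 'a sigma_tilde_alg) t (letter_elem u)"
proof -
 obtain p :: "'a sigma_tilde_alg" where p: "represents p t (letter_elem u)"
  using ex_represents[OF inf free_alg_letter_elem] by blast
 define c where "c k = (if k < u then 1 else 0 :: 'a)" for k
 have "represents (theta c p) t (letter_elem u)"
  unfolding represents_def
 proof
  fix N
  let ?Y = "%k. const_pol (c k) \<cdot>\<^sub>m generic_mat N k :: 'a gen_ring mat"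
  have Y: "?Y k \<in> carrier_mat N N" for k by simp
  interpret m: comm_ring_hom "mat_ev const_pol ?Y :: 'a gen_ring => _"
   by (rule comm_ring_hom_mat_ev[OF const_pol_hom Y])
  have "Phi_tilde N (theta c p) = mat_ev const_pol ?Y (sigma_gen N t (letter_elem u))"
   using p by (simp add: Phi_tilde_theta represents_def)
  also have "... = sigma_mat t (letter_sum N ?Y u)"
   by (simp only: mat_ev_alg_mat[OF const_pol_hom Y] alg_mat_letter_elem[OF const_pol_hom Y]
     flip: m.sigma_mat_hom[OF alg_mat_carrier])
  also have "letter_sum N ?Y u = letter_sum N (generic_mat N) u"
   unfolding letter_sum_def by (intro cong_mat refl sum.cong) (auto simp: c_def generic_mat_def)
  finally show "Phi_tilde N (theta c p) = sigma_gen N t (letter_elem u)"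
   by (simp add: alg_mat_letter_elem[OF const_pol_hom])
 qed
 \<comment> \<open>Removing the letters from u on does not change p, so the specialization below may
   assign trivial matrices to all words that contain such a letter.\<close>
 hence theta: "theta c p = p" using represents_unique[OF inf _ p] by blast
 have "p = F_tilde t u"
 proof (rule ccontr)
  assume "p ~= F_tilde t u"
  hence ne: "p - F_tilde t u ~= 0" by simp
  interpret toac: comm_ring_hom "to_ac :: 'a => 'a alg_closure" by (rule to_ac_hom)
  obtain f where f: "ev to_ac f (p - F_tilde t u) ~= (0 :: 'a alg_closure)"
   using ex_ev_nonzero[OF to_ac_hom _ infinite_alg_closure[OF inf] ne] by auto
  interpret ev: comm_ring_hom "ev to_ac f :: 'a sigma_tilde_alg => 'a alg_closure" by (rule toac.ev_hom)
  define g where "g e k = (if k = 0 then 1 else f (Abs_tilde_sym (k, e)))" for e k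
  define V where "V = (\<Union>m\<in>keys p. keys m)"
  have V: "finite V" by (simp add: V_def)
  \<comment> \<open>\<open>E\<close> collects the words of p and those of \<open>F_tilde\<close>,
    restricted to the first u letters because only then the determinant of the letter sum is
    known.\<close>
  define E where "E = ((%v. snd (Rep_tilde_sym v)) ` V \<union> {e. set (letters e) \<subseteq> {..<u} & length (letters e) <= t})
   \<inter> {e \<in> X_tilde. set (letters e) \<subseteq> {..<u}}"
  define q where "q = Max (insert t ((%v. fst (Rep_tilde_sym v)) ` V))"
  have q: "t <= q" "!!v. v \<in> V ==> fst (Rep_tilde_sym v) <= q"
   unfolding q_def using V by (auto intro!: Max_ge)
  have E: "finite E" "E \<subseteq> X_tilde" "!!e. e \<in> E ==> set (letters e) \<subseteq> {..<u}"
   "!!e. [|e \<in> X_tilde; set (letters e) \<subseteq> {..<u}; length (letters e) <= t|] ==> e \<in> E"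
   using V finite_words[of u t] by (auto simp: E_def)
  define P where "P e = (\<Sum>k\<le>q. monom (g e k) k)" for e
  have coP: "coeff (P e) k = (if k <= q then g e k else 0)" for e k
   by (simp add: P_def coeff_sum)
  have P: "coeff (P e) 0 = 1 & degree (P e) <= q" for e
   by (auto simp: coP g_def intro!: degree_le)
  define N where "N = q * (\<Sum>e\<in>E. length (letters e))"
  have sp: "\<exists>Xs. (\<forall>k. Xs k \<in> carrier_mat N N) &
   (\<forall>f\<in>X_tilde. gdet (word_mat N Xs f) = (if f \<in> E then P f else 1)) &
   (\<forall>u. (\<forall>e\<in>E. set (letters e) \<subseteq> {..<u}) --> gdet (letter_sum N Xs u)
    = (\<Prod>e\<in>E. P e \<circ>\<^sub>p monom ((- 1) ^ (length (letters e) - Suc 0)) (length (letters e))))"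
   unfolding N_def by (rule ex_specialization[OF E(1,2) P])
  then obtain Xs where sp: "\<forall>k. Xs k \<in> carrier_mat N N"
   "\<forall>f\<in>X_tilde. gdet (word_mat N Xs f) = (if f \<in> E then P f else 1)"
   "\<forall>u. (\<forall>e\<in>E. set (letters e) \<subseteq> {..<u}) --> gdet (letter_sum N Xs u)
    = (\<Prod>e\<in>E. P e \<circ>\<^sub>p monom ((- 1) ^ (length (letters e) - Suc 0)) (length (letters e)))"
   by (elim exE conjE)
  have Xs: "!!k. Xs k \<in> carrier_mat N N" using sp(1) by blast
  have det: "!!f. f \<in> X_tilde ==> gdet (word_mat N Xs f) = (if f \<in> E then P f else 1)" using sp(2) by blast
  have det_sum: "gdet (letter_sum N Xs u)
    = (\<Prod>e\<in>E. P e \<circ>\<^sub>p monom ((- 1) ^ (length (letters e) - Suc 0)) (length (letters e)))"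
   by (rule sp(3)[rule_format]) (rule E(3))
  interpret m: comm_ring_hom "mat_ev to_ac Xs :: 'a gen_ring => _"
   by (rule comm_ring_hom_mat_ev[OF to_ac_hom Xs])
  have "ev to_ac f p = ev to_ac f (theta c p)" by (simp add: theta)
  also have "... = ev to_ac (%v. ev to_ac f (theta c (var_pol v))) p"
   unfolding theta_def ev_ev[OF toac.ev_hom const_pol_hom] by (simp add: toac.ev_const toac.ev_var)
  also have "... = ev to_ac (sym_mat N Xs) p"
  proof (rule ev_cong)
   fix mn v assume "mn \<in> keys p" "v \<in> keys mn"
   hence v: "v \<in> V" by (auto simp: V_def)
   obtain k e where r: "Rep_tilde_sym v = (k, e)" by fastforce
   have ke: "k \<ge> 1" "e \<in> X_tilde" using Rep_tilde_symD[OF r] by blast+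
   have kq: "k <= q" using q(2)[OF v] unfolding r by simp
   have ab: "Abs_tilde_sym (k, e) = v" using r using Rep_tilde_sym_inverse[of v] by simp
   have L: "ev to_ac f (theta c (var_pol v)) = to_ac (prod_list (map c (letters e)) ^ k) * f v"
    by (simp add: theta_var r ev.hom_mult toac.ev_const toac.ev_var)
   have R: "sym_mat N Xs v = coeff (if e \<in> E then P e else 1) k"
    by (simp add: sym_mat_def r coeff_gdet[OF word_mat_carrier[OF Xs], symmetric] det[OF ke(2)])
   show "ev to_ac f (theta c (var_pol v)) = sym_mat N Xs v"
   proof (cases "set (letters e) \<subseteq> {..<u}")
    case True
    hence "map c (letters e) = map (%_. 1) (letters e)"
     by (intro map_cong refl) (auto simp: c_def)
    hence "prod_list (map c (letters e)) = 1" by (simp only: map_replicate_const prod_list_replicate power_one)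
    moreover have "e \<in> E" using True ke v r by (force simp: E_def)
    ultimately show ?thesis unfolding L R using ke kq by (simp add: coP g_def ab)
   next
    case False
    hence "\<exists>k\<in>set (letters e). c k = 0" by (auto simp: c_def)
    hence "prod_list (map c (letters e)) = 0" by (auto simp: prod_list_zero_iff)
    moreover have "e \<notin> E" using False E(3) by blast
    ultimately show ?thesis unfolding L R using ke by (simp add: coeff_1 zero_power)
   qed
  qed
  also have "... = mat_ev to_ac Xs (sigma_gen N t (letter_elem u))"
   using p by (simp add: represents_def flip: mat_ev_Phi[OF to_ac_hom Xs])
  also have "... = sigma_mat t (letter_sum N Xs u)"
   by (simp add: m.sigma_mat_hom[OF alg_mat_carrier, symmetric] mat_ev_alg_mat[OF to_ac_hom Xs]
     alg_mat_letter_elem[OF to_ac_hom Xs])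
  also have "... = coeff (gdet (letter_sum N Xs u)) t"
   by (rule coeff_gdet[of _ N, symmetric]) (simp add: letter_sum_def)
  also have "... = coeff (\<Prod>e\<in>E. \<Sum>k\<le>q. monom ((- 1) ^ ((length (letters e) - Suc 0) * k) * g e k) (k * length (letters e))) t"
  proof -
   have "P e \<circ>\<^sub>p monom s l = (\<Sum>k\<le>q. monom (s ^ k * g e k) (k * l))" for e s l
    unfolding P_def by (simp add: pcompose_sum pcompose_monom monom_power smult_monom mult.commute)
   thus ?thesis unfolding det_sum by (simp add: power_mult)
  qed
  also have "... = (\<Sum>om\<in>letter_words t u. (- 1) ^ (t + size om) * (\<Prod>e\<in>set_mset om. g e (count om e)))"
   unfolding coeff_prod_sum_monom[OF E(1)]
   by (rule letter_words_sum[OF E _ q(1), symmetric]) (simp_all add: g_def)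
  also have "... = ev to_ac f (F_tilde t u)"
  proof -
   have "ev to_ac f (sigma_tilde' e k) = g e k" for e k by (simp add: sigma_tilde'_var g_def toac.ev_var)
   thus ?thesis by (simp add: F_tilde_eq[OF t u] ev.hom_sum ev.hom_prod ev.hom_mult ev.hom_power ev.hom_uminus)
  qed
  finally show False using f by (simp add: ev.hom_minus)
 qed
 with p show ?thesis by simp
qed

text \<open>Specializing the generic identity makes it available for the values of arbitrary
  elements of the free algebra, as the sum relation of Donkin's theorem requires.\<close>

lemma sigma_letter_sum:
 fixes A :: "nat => 'a::field gen_ring mat"
 assumes inf: "infinite (UNIV :: 'a set)" and t: "t > 0" and u: "u > 0" and A: "!!k. A k \<in> carrier_mat N N"
 shows "sigma_mat t (letter_sum N A u) = (\<Sum>ts | length ts = u & sum_list ts = t.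
   if Omega ts = {} then 1
   else (- 1) ^ sum_list ts *
    (\<Sum>om\<in>Omega ts. (- 1) ^ size om * (\<Prod>e\<in>set_mset om. sigma_mat (count om e) (word_mat N A e))))"
proof -
 interpret m: comm_ring_hom "mat_ev const_pol A :: 'a gen_ring => _"
  by (rule comm_ring_hom_mat_ev[OF const_pol_hom A])
 have "sigma_mat t (letter_sum N A u) = mat_ev const_pol A (sigma_gen N t (letter_elem u))"
  by (simp add: m.sigma_mat_hom[OF alg_mat_carrier, symmetric] mat_ev_alg_mat[OF const_pol_hom A]
    alg_mat_letter_elem[OF const_pol_hom A])
 also have "... = mat_ev const_pol A (Phi_tilde N (F_tilde t u))"
  using represents_F_tilde[OF inf t u] by (simp add: represents_def)
 finally have eq: "sigma_mat t (letter_sum N A u) = mat_ev const_pol A (Phi_tilde N (F_tilde t u))" .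
 interpret mP: comm_ring_hom "%p. mat_ev const_pol A (Phi_tilde N p)"
  by (rule comm_ring_hom_compose[OF m.comm_ring_hom_axioms Phi.comm_ring_hom_axioms])
 have s: "mat_ev const_pol A (Phi_tilde N (sigma_tilde' e k)) = sigma_mat k (word_mat N A e)" if "e \<in> X_tilde" for e k
  using that by (simp add: Phi_tilde_sigma_tilde' mat_ev_sigma[OF const_pol_hom A])
 show ?thesis
  unfolding eq F_tilde_def mP.hom_sum
 proof (intro sum.cong refl)
  fix ts
  have "(\<Prod>e\<in>set_mset om. mat_ev const_pol A (Phi_tilde N (sigma_tilde' e (count om e))))
   = (\<Prod>e\<in>set_mset om. sigma_mat (count om e) (word_mat N A e))" if "om \<in> Omega ts" for om
   using that s by (intro prod.cong) (auto simp: Omega_def)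
  thus "mat_ev const_pol A (Phi_tilde N (if Omega ts = {} then 1 else (- 1) ^ sum_list ts *
    (\<Sum>om\<in>Omega ts. (- 1) ^ size om * (\<Prod>e\<in>set_mset om. sigma_tilde' e (count om e)))))
   = (if Omega ts = {} then 1 else (- 1) ^ sum_list ts *
    (\<Sum>om\<in>Omega ts. (- 1) ^ size om * (\<Prod>e\<in>set_mset om. sigma_mat (count om e) (word_mat N A e))))"
   by (simp add: mP.hom_sum mP.hom_prod mP.hom_mult mP.hom_power mP.hom_uminus)
 qed
qed

subsection \<open>Ideals\<close>

lemma module_times: "Modules.module ((*) :: 'r::comm_ring_1 => 'r => 'r)"
 by standard (simp_all add: algebra_simps)

lemma ideal_gen_base: "x \<in> S ==> x \<in> ideal_gen S"
 unfolding ideal_gen_def by (rule module.span_base[OF module_times])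

lemma ideal_gen_0: "0 \<in> ideal_gen S"
 unfolding ideal_gen_def by (rule module.span_zero[OF module_times])

lemma ideal_gen_add: "x \<in> ideal_gen S ==> y \<in> ideal_gen S ==> x + y \<in> ideal_gen S"
 unfolding ideal_gen_def by (rule module.span_add[OF module_times])

lemma ideal_gen_mult: "x \<in> ideal_gen S ==> r * x \<in> ideal_gen S"
 unfolding ideal_gen_def by (rule module.span_scale[OF module_times])

lemma ideal_gen_mult_right: "x \<in> ideal_gen S ==> x * r \<in> ideal_gen S"
 using ideal_gen_mult[of x S r] by (simp add: mult.commute)


lemma ideal_gen_diff: "x \<in> ideal_gen S ==> y \<in> ideal_gen S ==> x - y \<in> ideal_gen S"
 unfolding ideal_gen_def by (rule module.span_diff[OF module_times])

lemma ideal_gen_sum: "(!!i. i \<in> I ==> f i \<in> ideal_gen S) ==> sum f I \<in> ideal_gen S"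
 unfolding ideal_gen_def by (rule module.span_sum[OF module_times])

lemma ideal_gen_kernel:
 assumes "comm_ring_hom h" "!!x. x \<in> S ==> h x = 0" "f \<in> ideal_gen S"
 shows "h f = 0"
proof -
 interpret comm_ring_hom h by fact
 have "f \<in> module.span (*) S" using assms(3) by (simp add: ideal_gen_def)
 thus ?thesis
  by (rule Modules.module.span_induct_alt[OF module_times]) (simp_all add: assms(2) hom_distribs)
qed

lemma donkin_relations_cyclic:
 "[|t > 0; a ~= 0; b ~= 0|] ==> sigma t (of_word (a + b)) - sigma t (of_word (b + a)) \<in> donkin_relations"
 unfolding donkin_relations_def by blast

lemma donkin_relations_power:
 "[|t > 0; l > 1; a ~= 0|] ==> sigma t (of_word a ^ l) - P_rel t l (of_word a) \<in> donkin_relations"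
 unfolding donkin_relations_def by blast

lemma donkin_relations_sum:
 "[|t > 0; length as > 1; set as \<subseteq> free_alg|] ==> sigma t (sum_list as) - F_rel t as \<in> donkin_relations"
 unfolding donkin_relations_def by blast

subsection \<open>The map \<open>\<pi>\<close>\<close>

lemma of_word_add: "of_word (v + w) = of_word v * of_word w"
 by (simp add: of_word_def mult_single)

lemma of_word_power: "of_word (sum_list (replicate l w)) = of_word w ^ l"
 by (induction l) (simp_all add: of_word_add, simp add: of_word_def)

lemma word_mat_alg_mat:
 fixes as :: "(word \<Rightarrow>\<^sub>0 'a::field) list"
 assumes A: "!!k. A k \<in> carrier_mat N N" and "!!k. k < length as ==> A k = gen_alg N (as ! k)"
  and "set (letters e) \<subseteq> {..<length as}"
 shows "word_mat N A e = gen_alg N (subst_word as e)"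
proof -
 have "set ks \<subseteq> {..<length as} ==> word_mat N A (Word ks) = gen_alg N (prod_list (map ((!) as) ks))" for ks
 proof (induction ks)
  case Nil
  show ?case by (simp add: const_pol.alg_mat_1)
 next
  case (Cons k ks)
  thus ?case by (simp add: word_mat_Cons const_pol.alg_mat_mult assms(2))
 qed
 from this[OF assms(3)] show ?thesis by (simp add: subst_word_def)
qed

lemma subst_word_free_alg:
 assumes "set as \<subseteq> free_alg" "letters e ~= []" "set (letters e) \<subseteq> {..<length as}"
 shows "subst_word as e \<in> free_alg"
proof -
 obtain k ks where "letters e = k # ks" using assms(2) by (cases "letters e") auto
 thus ?thesis using assms by (auto simp: subst_word_def intro!: free_alg_mult)
qed

lemma alg_mat_sum:
 fixes f :: "nat => (word \<Rightarrow>\<^sub>0 'a::field)"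
 shows "gen_alg N (\<Sum>k<u. f k) = letter_sum N (%k. gen_alg N (f k)) u"
proof (induction u)
 case 0
 show ?case by (auto simp: letter_sum_def const_pol.alg_mat_0[of "generic_mat N" N])
next
 case (Suc u)
 have "letter_sum N (%k. gen_alg N (f k)) u + gen_alg N (f u)
  = letter_sum N (%k. gen_alg N (f k)) (Suc u)"
  by (intro eq_matI) (auto simp: letter_sum_def)
 thus ?case by (simp add: const_pol.alg_mat_add Suc)
qed

text \<open>A free generator goes to an element that represents it; over an infinite field there is
  exactly one, by \<open>ex_represents\<close> and \<open>represents_unique\<close>.\<close>

definition donkin_map :: "'a::field sigma_alg => 'a sigma_tilde_alg" where
 "donkin_map = ev const_pol (%s. case Rep_sigma_sym s of (t, a) => SOME p. represents p t a)"

definition donkin_section :: "'a::field sigma_tilde_alg => 'a sigma_alg" where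
 "donkin_section = ev const_pol (%s. case Rep_tilde_sym s of (t, e) => sigma t (of_word e))"

lemma comm_ring_hom_donkin: "comm_ring_hom donkin_map"
 unfolding donkin_map_def by (rule const_pol.ev_hom)

lemma comm_ring_hom_section: "comm_ring_hom donkin_section"
 unfolding donkin_section_def by (rule const_pol.ev_hom)

lemma represents_donkin:
 fixes a :: "word \<Rightarrow>\<^sub>0 'a::field"
 assumes inf: "infinite (UNIV :: 'a set)" and a: "a \<in> free_alg"
 shows "represents (donkin_map (sigma t a)) t a"
proof -
 interpret d: comm_ring_hom "donkin_map :: 'a sigma_alg => _" by (rule comm_ring_hom_donkin)
 consider "t = 0" | "t > 0" "a = 0" | "t > 0" "a ~= 0" by blast
 thus ?thesis
 proof cases
  case 1
  thus ?thesis by (simp add: represents_def sigma_gen_0)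
 next
  case 2
  thus ?thesis by (simp add: represents_def sigma_def const_pol.alg_mat_0[of "generic_mat _"] sigma_mat_zero)
 next
  case 3
  let ?c = "highest_coeff a"
  define b where "b = single 0 (inverse ?c) * a"
  have "Max (keys a) \<in> keys a" using 3 by (intro Max_in) auto
  hence c: "?c ~= 0" by (simp add: highest_coeff_def in_keys_iff)
  hence k: "keys b = keys a" by (simp add: b_def keys_scale)
  have b: "b \<in> free_alg" "b ~= 0" "highest_coeff b = 1"
  proof -
   show "b \<in> free_alg" using a by (simp add: b_def free_alg_scale)
   show "b ~= 0" using k 3 by (metis keys_eq_empty)
   have "highest_coeff b = inverse ?c * ?c" by (simp add: highest_coeff_def k) (simp add: b_def lookup_scale highest_coeff_def)
   thus "highest_coeff b = 1" using c by simp
  qed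
  have r: "Rep_sigma_sym (Abs_sigma_sym (t, b)) = (t, b)"
   by (rule Abs_sigma_sym_inverse) (use b 3 in auto)
  have "a = single 0 ?c * b"
   using c by (simp add: b_def mult_single flip: mult.assoc)
  hence sa: "sigma_gen N t a = const_pol (?c ^ t) * sigma_gen N t b" for N
   by (metis sigma_gen_scale)
  have "represents (SOME p. represents p t b) t b"
   by (rule someI_ex) (rule ex_represents[OF inf b(1)])
  moreover have "donkin_map (sigma t a) = const_pol (?c ^ t) * (SOME p. represents p t b)"
   using 3 by (simp add: sigma_def d.hom_mult flip: b_def) (simp add: donkin_map_def const_pol.ev_const const_pol.ev_var r)
  ultimately show ?thesis by (simp add: represents_def sa Phi.hom_mult Phi_tilde_const)
 qed
qed

context
 assumes inf: "infinite (UNIV :: 'a::field set)"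
begin

interpretation d: comm_ring_hom "donkin_map :: 'a sigma_alg => _" by (rule comm_ring_hom_donkin)
interpretation sec: comm_ring_hom "donkin_section :: 'a sigma_tilde_alg => _" by (rule comm_ring_hom_section)

lemma Phi_donkin_F_rel:
 fixes as :: "(word \<Rightarrow>\<^sub>0 'a) list"
 assumes t: "t > 0" and as: "length as > 1" "set as \<subseteq> free_alg"
 shows "represents (donkin_map (F_rel t as)) t (sum_list as)"
 unfolding represents_def
proof
 fix N
 interpret Pd: comm_ring_hom "%p. Phi_tilde N (donkin_map p :: 'a sigma_tilde_alg)"
  by (rule comm_ring_hom_compose[OF Phi.comm_ring_hom_axioms d.comm_ring_hom_axioms])
 define A where "A k = (if k < length as then gen_alg N (as ! k) else 0\<^sub>m N N)" for k
 have A: "A k \<in> carrier_mat N N" for k by (simp add: A_def)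
 have "gen_alg N (sum_list as) = letter_sum N A (length as)"
  by (simp add: sum_list_sum_nth atLeast0LessThan alg_mat_sum) (auto simp: letter_sum_def A_def)
 hence "sigma_gen N t (sum_list as) = sigma_mat t (letter_sum N A (length as))" by simp
 also have "... = (\<Sum>ts | length ts = length as & sum_list ts = t.
   if Omega ts = {} then 1
   else (- 1) ^ sum_list ts *
    (\<Sum>om\<in>Omega ts. (- 1) ^ size om * (\<Prod>e\<in>set_mset om. sigma_mat (count om e) (word_mat N A e))))"
  by (rule sigma_letter_sum[OF inf t _ A]) (use as in auto)
 also have "... = (\<Sum>ts | length ts = length as & sum_list ts = t. Phi_tilde N (donkin_map (sigma_multi ts as)))"
 proof (intro sum.cong refl)
  fix ts assume "ts \<in> {ts. length ts = length as & sum_list ts = t}"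
  hence len: "length ts = length as" by simp
  have "sigma_mat k (word_mat N A e) = Phi_tilde N (donkin_map (sigma k (subst_word as e)))"
   if "om \<in> Omega ts" "e \<in># om" for om e k
  proof -
   have l: "set (letters e) \<subseteq> {..<length as}" using Omega_letters[OF that] len by simp
   have "letters e ~= []" using that X_tilde_nonempty[of e] by (auto simp: Omega_def)
   from subst_word_free_alg[OF as(2) this l] have "represents (donkin_map (sigma k (subst_word as e))) k (subst_word as e)"
    by (rule represents_donkin[OF inf])
   moreover have "word_mat N A e = gen_alg N (subst_word as e)"
    by (rule word_mat_alg_mat[OF A _ l]) (simp add: A_def)
   ultimately show ?thesis by (simp add: represents_def)
  qed
  hence "(\<Prod>e\<in>set_mset om. sigma_mat (count om e) (word_mat N A e))
   = (\<Prod>e\<in>set_mset om. Phi_tilde N (donkin_map (sigma (count om e) (subst_word as e))))" if "om \<in> Omega ts" for om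
   using that by (intro prod.cong) auto
  thus "(if Omega ts = {} then 1 else (- 1) ^ sum_list ts *
    (\<Sum>om\<in>Omega ts. (- 1) ^ size om * (\<Prod>e\<in>set_mset om. sigma_mat (count om e) (word_mat N A e))))
   = Phi_tilde N (donkin_map (sigma_multi ts as))"
   by (simp add: sigma_multi_def Pd.hom_sum Pd.hom_prod Pd.hom_mult Pd.hom_power Pd.hom_uminus)
 qed
 also have "... = Phi_tilde N (donkin_map (F_rel t as))" by (simp add: F_rel_def Pd.hom_sum)
 finally show "Phi_tilde N (donkin_map (F_rel t as)) = sigma_gen N t (sum_list as)" ..
qed

lemma Phi_donkin_P_rel:
 assumes "a ~= 0" "l > 0"
 shows "represents (donkin_map (P_rel t l (of_word a)) :: 'a sigma_tilde_alg) t (of_word a ^ l)"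
 unfolding represents_def
proof
 fix N
 have Pd: "comm_ring_hom (%p. Phi_tilde N (donkin_map p :: 'a sigma_tilde_alg))"
  by (rule comm_ring_hom_compose[OF Phi.comm_ring_hom_axioms d.comm_ring_hom_axioms])
 have dc: "donkin_map (const_pol x) = const_pol x" for x :: 'a by (simp add: donkin_map_def const_pol.ev_const)
 have "represents (donkin_map (sigma i (of_word a)) :: 'a sigma_tilde_alg) i (of_word a)" for i
  by (rule represents_donkin[OF inf]) (simp add: free_alg_of_word assms(1))
 hence "Phi_tilde N (donkin_map (P_rel t l (of_word a)) :: 'a sigma_tilde_alg)
   = ev const_pol (%i. sigma_mat i (gen_word N a)) (power_pol t l :: (nat, 'a) pol)"
  by (simp add: P_rel_def subst_pol_ev ev_ev[OF Pd const_pol_hom] dc Phi_tilde_const represents_def sigma_gen_of_word)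
 also have "... = sigma_mat t (gen_word N a ^\<^sub>m l)"
  using subst_power_pol[OF word_mat_gen_carrier assms(2), of N a t] by (simp add: subst_pol_ev)
 also have "... = sigma_gen N t (of_word a ^ l)"
  by (simp add: sigma_gen_of_word word_mat_power[of "generic_mat N"] flip: of_word_power)
 finally show "Phi_tilde N (donkin_map (P_rel t l (of_word a)) :: 'a sigma_tilde_alg) = sigma_gen N t (of_word a ^ l)" .
qed

lemma free_alg_power: "a ~= 0 ==> l > 0 ==> (of_word a ^ l :: word \<Rightarrow>\<^sub>0 'a) \<in> free_alg"
 by (cases l) (auto intro!: free_alg_mult simp: free_alg_of_word)

text \<open>The two sides of each relation represent the same \<sigma>_t(a), and representing
  elements are unique.\<close>

lemma donkin_map_relations:
 assumes "r \<in> donkin_relations"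
 shows "donkin_map r = (0 :: 'a sigma_tilde_alg)"
proof -
 have diff: "donkin_map (f - g) = (0 :: 'a sigma_tilde_alg)"
  if "represents (donkin_map f :: 'a sigma_tilde_alg) t a" "represents (donkin_map g :: 'a sigma_tilde_alg) t a" for f g t a
  using represents_unique[OF inf that] by (simp add: d.hom_minus)
 consider t as where "r = sigma t (sum_list as) - F_rel t as" "t > 0" "length as > 1" "set as \<subseteq> free_alg"
  | t l a where "r = sigma t (of_word a ^ l) - P_rel t l (of_word a)" "t > 0" "l > 1" "a ~= 0"
  | t a b where "r = sigma t (of_word (a + b)) - sigma t (of_word (b + a))" "t > 0" "a ~= 0" "b ~= 0"
  using assms unfolding donkin_relations_def by blast
 thus ?thesis
 proof cases
  case 1
  have "sum_list as \<in> free_alg" using 1(4) by (induction as) (auto simp: free_alg_0 free_alg_add)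
  with 1 show ?thesis using diff[OF represents_donkin[OF inf] Phi_donkin_F_rel] by blast
 next
  case 2
  thus ?thesis using diff[OF represents_donkin[OF inf free_alg_power] Phi_donkin_P_rel, of a l] by simp
 next
  case 3
  have "represents (donkin_map (sigma t (of_word (a + b))) :: 'a sigma_tilde_alg) t (of_word (b + a))"
   using represents_donkin[OF inf, of "of_word (a + b)" t] 3
   by (simp add: represents_def sigma_gen_of_word sigma_word_add_comm[of t _ a b] free_alg_of_word word_add_eq_0_iff)
  from diff[OF this represents_donkin[OF inf]] show ?thesis
   using 3 by (simp add: free_alg_of_word word_add_eq_0_iff)
 qed
qed

lemma donkin_sigma_tilde:
 assumes "t \<ge> 1" "e \<in> X_tilde"
 shows "donkin_map (sigma t (of_word e)) = (sigma_tilde t e :: 'a sigma_tilde_alg)"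
proof (rule represents_unique[OF inf])
 show "represents (donkin_map (sigma t (of_word e)) :: 'a sigma_tilde_alg) t (of_word e)"
  by (rule represents_donkin[OF inf]) (simp add: free_alg_of_word X_tilde_nonzero assms)
 show "represents (sigma_tilde t e :: 'a sigma_tilde_alg) t (of_word e)"
  by (simp add: represents_def Phi_tilde_sigma_tilde[OF assms] sigma_gen_of_word)
qed

lemma hom_section:
 fixes h :: "'a sigma_alg => 'a sigma_tilde_alg"
 assumes "alg_hom h" "!!t e. [|t \<ge> 1; e \<in> X_tilde|] ==> h (sigma t (of_word e)) = sigma_tilde t e"
 shows "h (donkin_section p) = p"
proof (rule comm_ring_hom_pol_eqI)
 show "comm_ring_hom (%p. h (donkin_section p))"
  by (rule comm_ring_hom_compose[OF alg_homD(1)[OF assms(1)] comm_ring_hom_section])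
 show "comm_ring_hom (%p :: 'a sigma_tilde_alg. p)" by standard auto
 show "h (donkin_section (const_pol a)) = const_pol a" for a
  by (simp add: donkin_section_def const_pol.ev_const alg_homD(2)[OF assms(1)])
 show "h (donkin_section (var_pol s)) = var_pol s" for s
 proof -
  obtain t e where r: "Rep_tilde_sym s = (t, e)" by fastforce
  have "h (donkin_section (var_pol s)) = sigma_tilde t e"
   using Rep_tilde_symD[OF r] by (simp add: donkin_section_def const_pol.ev_var r assms(2))
  also have "... = var_pol s" using Rep_tilde_sym_inverse[of s] by (simp add: sigma_tilde_def r)
  finally show ?thesis .
 qed
qed

lemma alg_hom_donkin: "alg_hom (donkin_map :: 'a sigma_alg => _)"
 by (simp add: alg_hom_def d.hom_add d.hom_mult) (simp add: donkin_map_def const_pol.ev_const)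

abbreviation (input) donkin_ideal :: "'a sigma_alg set" where "donkin_ideal \<equiv> ideal_gen donkin_relations"

text \<open>Congruence to an element of the section modulo the relations. Once this holds for all
  elements, the kernel of \<open>donkin_map\<close> is no larger than the ideal, because
  \<open>donkin_map\<close> is a left inverse of the section.\<close>

definition in_section :: "'a sigma_alg => bool" where
 "in_section f \<longleftrightarrow> (\<exists>p. f - donkin_section p \<in> donkin_ideal)"

lemma in_section_section: "in_section (donkin_section p)"
 unfolding in_section_def by (rule exI[of _ p]) (simp add: ideal_gen_0)

lemma in_section_const: "in_section (const_pol a)"
 using in_section_section[of "const_pol a"] by (simp add: donkin_section_def const_pol.ev_const)

lemma in_section_add: "in_section f ==> in_section g ==> in_section (f + g)"
 unfolding in_section_def
proof (elim exE)
 fix p q assume "f - donkin_section p \<in> donkin_ideal" "g - donkin_section q \<in> donkin_ideal"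
 hence "(f - donkin_section p) + (g - donkin_section q) \<in> donkin_ideal" by (rule ideal_gen_add)
 thus "\<exists>p. f + g - donkin_section p \<in> donkin_ideal" by (intro exI[of _ "p + q"]) (simp add: sec.hom_add algebra_simps)
qed

lemma in_section_mult: "in_section f ==> in_section g ==> in_section (f * g)"
 unfolding in_section_def
proof (elim exE)
 fix p q assume "f - donkin_section p \<in> donkin_ideal" "g - donkin_section q \<in> donkin_ideal"
 hence "(f - donkin_section p) * g + donkin_section p * (g - donkin_section q) \<in> donkin_ideal"
  by (intro ideal_gen_add ideal_gen_mult ideal_gen_mult_right)
 thus "\<exists>p. f * g - donkin_section p \<in> donkin_ideal" by (intro exI[of _ "p * q"]) (simp add: sec.hom_mult algebra_simps)
qed

lemma in_section_cong: "f - g \<in> donkin_ideal ==> in_section g ==> in_section f"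
 unfolding in_section_def
proof (elim exE)
 fix p assume "f - g \<in> donkin_ideal" "g - donkin_section p \<in> donkin_ideal"
 hence "(f - g) + (g - donkin_section p) \<in> donkin_ideal" by (rule ideal_gen_add)
 thus "\<exists>p. f - donkin_section p \<in> donkin_ideal" by auto
qed

lemma in_section_1: "in_section 1" using in_section_const[of 1] by simp
lemma in_section_0: "in_section 0" using in_section_const[of 0] by simp

lemma in_section_sum: "(!!i. i \<in> J ==> in_section (f i)) ==> in_section (sum f J)"
 by (induction J rule: infinite_finite_induct) (auto intro: in_section_add in_section_0)

lemma in_section_prod: "(!!i. i \<in> J ==> in_section (f i)) ==> in_section (prod f J)"
 by (induction J rule: infinite_finite_induct) (auto intro: in_section_mult in_section_1)

lemma in_section_sign: "in_section ((- 1) ^ k)"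
 using in_section_const[of "(- 1) ^ k"] by (simp add: const_pol.hom_power const_pol.hom_uminus)

lemma in_section_ev:
 assumes "!!v. in_section (g v)"
 shows "in_section (ev const_pol g p)"
 by (induction p rule: pol_induct)
  (auto simp: const_pol.ev_const const_pol.ev_var const_pol.ev_add const_pol.ev_mult assms
   intro: in_section_const in_section_add in_section_mult)

lemma in_section_X_tilde:
 assumes "e \<in> X_tilde"
 shows "in_section (sigma t (of_word e))"
proof (cases "t = 0")
 case False
 hence "donkin_section (var_pol (Abs_tilde_sym (t, e))) = sigma t (of_word e)"
  using assms by (simp add: donkin_section_def const_pol.ev_var Abs_tilde_sym_inverse)
 thus ?thesis using in_section_section by metis
qed (simp add: in_section_1)

lemma in_section_of_word:
 assumes "w ~= 0"
 shows "in_section (sigma t (of_word w))"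
proof (cases "t = 0")
 case False
 obtain e l where e: "e \<in> X_tilde" "l > 0" "cyclic_equiv w (sum_list (replicate l e))"
  using ex_X_tilde_root[OF assms] by blast
 have "sigma t (of_word w) - sigma t (of_word (sum_list (replicate l e))) \<in> donkin_ideal"
 proof -
  obtain a b where ab: "w = a + b" "sum_list (replicate l e) = b + a" using e(3) by (auto simp: cyclic_equiv_def)
  show ?thesis
  proof (cases "a = 0 \<or> b = 0")
   case True
   thus ?thesis by (auto simp: ab ideal_gen_0)
  next
   case nz: False
   thus ?thesis unfolding ab using False by (intro ideal_gen_base donkin_relations_cyclic) auto
  qed
 qed
 moreover have "in_section (sigma t (of_word (sum_list (replicate l e))))"
 proof (cases "l = 1")
  case True
  thus ?thesis by (simp add: in_section_X_tilde e(1))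
 next
  case l: False
  have "sigma t (of_word e ^ l) - P_rel t l (of_word e) \<in> donkin_ideal"
   using l e(2) False X_tilde_nonzero[OF e(1)] by (intro ideal_gen_base donkin_relations_power) auto
  moreover have "in_section (P_rel t l (of_word e))"
   unfolding P_rel_def subst_pol_ev by (rule in_section_ev) (rule in_section_X_tilde[OF e(1)])
  ultimately show ?thesis unfolding of_word_power by (rule in_section_cong)
 qed
 ultimately show ?thesis by (rule in_section_cong)
qed (simp add: in_section_1)

text \<open>Writing \<open>a\<close> as a sum of scalar multiples of words, the sum relation reduces
  \<sigma>_t(a) to products of \<sigma>_k of such multiples, because substituting them into a word
  gives again one of them.\<close>

lemma in_section_sigma:
 fixes a :: "word \<Rightarrow>\<^sub>0 'a"
 assumes a: "a \<in> free_alg" and t: "t > 0"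
 shows "in_section (sigma t a)"
proof -
 define T where "T = {single w c | (w :: word) (c :: 'a). w ~= 0}"
 have "\<exists>as. set as \<subseteq> T & a = sum_list as"
  using a
 proof (induction a rule: free_alg_induct)
  case zero
  show ?case by (rule exI[of _ "[]"]) simp
 next
  case (single w c)
  thus ?case by (intro exI[of _ "[single w c]"]) (auto simp: T_def)
 next
  case (add a b)
  then obtain as bs where "set as \<subseteq> T" "a = sum_list as" "set bs \<subseteq> T" "b = sum_list bs" by blast
  thus ?case by (intro exI[of _ "as @ bs"]) simp
 qed
 then obtain as' where as': "set as' \<subseteq> T" "a = sum_list as'" by (elim exE conjE)
 \<comment> \<open>The sum relation asks for at least two summands; the prepended zeros make it
   applicable to zero and to a single word as well.\<close>
 define as where "as = 0 # 0 # as'"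
 have "single (Word [0]) 0 \<in> T" unfolding T_def
  by (rule CollectI, rule exI[of _ "Word [0]"], rule exI[of _ 0]) (simp add: zero_word_def)
 hence "0 \<in> T" by simp
 hence T: "set as \<subseteq> T" and sum: "a = sum_list as" and len: "length as > 1" using as' by (auto simp: as_def)
 have fr: "set as \<subseteq> free_alg" using T by (auto simp: T_def free_alg_single)
 have "sigma t a - F_rel t as \<in> donkin_ideal"
  unfolding sum using t len fr by (intro ideal_gen_base donkin_relations_sum) auto
 moreover have "in_section (F_rel t as)"
  unfolding F_rel_def
 proof (rule in_section_sum)
  fix ts assume "ts \<in> {ts. length ts = length as & sum_list ts = t}"
  hence lts: "length ts = length as" by simp
  have "in_section (sigma k (subst_word as e))" if "om \<in> Omega ts" "e \<in># om" for om e k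
  proof -
   have l: "set (letters e) \<subseteq> {..<length as}" using Omega_letters[OF that] lts by simp
   have ne: "letters e ~= []" using that X_tilde_nonempty[of e] by (auto simp: Omega_def)
   have "set ks \<subseteq> {..<length as} ==> \<exists>w c. (ks ~= [] --> w ~= 0) & prod_list (map ((!) as) ks) = single w c" for ks
   proof (induction ks)
    case Nil
    show ?case by (intro exI[of _ 0] exI[of _ 1]) simp
   next
    case (Cons k ks)
    then obtain w c where "prod_list (map ((!) as) ks) = single w c" by auto
    moreover have "as ! k \<in> T" using Cons.prems T by auto
    then obtain v d where "as ! k = single v d" "v ~= 0" by (auto simp: T_def)
    ultimately show ?case by (intro exI[of _ "v + w"] exI[of _ "d * c"]) (simp add: mult_single word_add_eq_0_iff)
   qed
   from this[OF l] ne obtain w c where w: "w ~= 0" "subst_word as e = single w c"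
    by (auto simp: subst_word_def)
   show ?thesis unfolding w(2) sigma_single[OF w(1)]
    by (intro in_section_mult in_section_const in_section_of_word w(1))
  qed
  thus "in_section (sigma_multi ts as)"
   unfolding sigma_multi_def
   by (auto intro!: in_section_1 in_section_mult in_section_sign in_section_sum in_section_prod)
 qed
 ultimately show ?thesis by (rule in_section_cong)
qed

lemma in_section_all: "in_section f"
proof (induction f rule: pol_induct)
 case (var v)
 obtain t a where r: "Rep_sigma_sym v = (t, a)" by fastforce
 hence ta: "t \<ge> 1" "a \<in> free_alg" "a ~= 0" "highest_coeff a = 1"
  using Rep_sigma_sym[of v] by auto
 have "sigma t a = var_pol v"
  using ta Rep_sigma_sym_inverse[of v] by (simp add: sigma_def r)
 thus ?case using in_section_sigma[OF ta(2), of t] ta(1) by simp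
qed (auto intro: in_section_const in_section_add in_section_mult)

lemma is_donkin_map: "is_donkin_map (donkin_map :: 'a sigma_alg => _)"
 unfolding is_donkin_map_def
proof (intro conjI allI impI ballI)
 show "alg_hom (donkin_map :: 'a sigma_alg => _)" by (rule alg_hom_donkin)
 have ds: "donkin_map (donkin_section p) = p" for p :: "'a sigma_tilde_alg"
  by (rule hom_section[OF alg_hom_donkin donkin_sigma_tilde])
 thus "surj (donkin_map :: 'a sigma_alg => _)" by (metis surjI)
 show "1 <= t ==> e \<in> X_tilde ==> donkin_map (sigma t (of_word e)) = (sigma_tilde t e :: 'a sigma_tilde_alg)" for t e
  by (rule donkin_sigma_tilde)
 show "{f. donkin_map f = (0 :: 'a sigma_tilde_alg)} = donkin_ideal"
 proof (intro equalityI subsetI)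
  fix f :: "'a sigma_alg" assume "f \<in> {f. donkin_map f = 0}"
  hence f: "donkin_map f = 0" by simp
  obtain p where p: "f - donkin_section p \<in> donkin_ideal" using in_section_all[of f] by (auto simp: in_section_def)
  from ideal_gen_kernel[OF comm_ring_hom_donkin donkin_map_relations p]
  have "p = 0" using f ds by (simp add: d.hom_minus)
  thus "f \<in> donkin_ideal" using p by (simp add: sec.hom_zero)
 next
  fix f assume "f \<in> donkin_ideal"
  thus "f \<in> {f. donkin_map f = 0}" using ideal_gen_kernel[OF comm_ring_hom_donkin donkin_map_relations] by simp
 qed
qed

lemma pi_tilde_eq: "pi_tilde = (donkin_map :: 'a sigma_alg => _)"
 unfolding pi_tilde_def
proof (rule the_equality)
 show "is_donkin_map (donkin_map :: 'a sigma_alg => _)" by (rule is_donkin_map)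
 fix h :: "'a sigma_alg => 'a sigma_tilde_alg" assume h: "is_donkin_map h"
 have ah: "alg_hom h" using h unfolding is_donkin_map_def by (elim conjE)
 interpret h: comm_ring_hom h by (rule alg_homD(1)[OF ah])
 have st: "\<forall>t\<ge>1. \<forall>e\<in>X_tilde. h (sigma t (of_word e)) = sigma_tilde t e"
  using h unfolding is_donkin_map_def by (elim conjE)
 have ker: "{f. h f = 0} = donkin_ideal" using h unfolding is_donkin_map_def by (elim conjE)
 have hs: "h (donkin_section p) = p" for p
  by (rule hom_section[OF ah]) (use st in blast)
 have ds: "donkin_map (donkin_section p) = p" for p :: "'a sigma_tilde_alg"
  by (rule hom_section[OF alg_hom_donkin donkin_sigma_tilde])
 show "h = donkin_map"
 proof
  fix f
  obtain p where p: "f - donkin_section p \<in> donkin_ideal" using in_section_all[of f] by (auto simp: in_section_def)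
  have "h (f - donkin_section p) = 0" using p ker by blast
  moreover have "donkin_map (f - donkin_section p) = 0" by (rule ideal_gen_kernel[OF comm_ring_hom_donkin donkin_map_relations p])
  ultimately show "h f = donkin_map f" by (simp add: h.hom_minus d.hom_minus hs ds)
 qed
qed

lemma represents_pi_tilde:
 fixes a :: "word \<Rightarrow>\<^sub>0 'a"
 assumes "a \<in> free_alg"
 shows "represents (pi_tilde (sigma t a)) t a"
 unfolding pi_tilde_eq by (rule represents_donkin[OF inf assms])

end

subsection \<open>Powers of the ideal of polynomials without constant term\<close>

definition wt :: "('v => nat) => ('v \<Rightarrow>\<^sub>0 nat) => nat" where
 "wt w m = (\<Sum>v\<in>keys m. w v * lookup m v)"

lemma wt_superset:
 assumes "finite V" "keys m \<subseteq> V"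
 shows "wt w m = (\<Sum>v\<in>V. w v * lookup m v)"
 unfolding wt_def using assms by (intro sum.mono_neutral_left) (auto simp: in_keys_iff)

lemma wt_add: "wt w (m + m') = wt w m + wt w m'"
proof -
 let ?V = "keys m \<union> keys m'"
 have "keys (m + m') \<subseteq> ?V" by (rule Poly_Mapping.keys_add)
 thus ?thesis
  by (simp add: wt_superset[of ?V] lookup_add distrib_left sum.distrib)
qed

lemma wt_single: "wt w (single v k) = w v * k"
 by (cases "k = 0") (auto simp: wt_def)

lemma wt_0 [simp]: "wt w 0 = 0"
 by (simp add: wt_def)

definition high_degree :: "nat => ('v, 'a::comm_ring_1) pol set" where
 "high_degree d = {p. \<forall>m\<in>keys p. d <= wt (%_. 1) m}"

lemma high_degree_0 [simp]: "0 \<in> high_degree d"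
 by (simp add: high_degree_def)

lemma high_degree_zero [simp]: "p \<in> high_degree 0"
 by (simp add: high_degree_def)

lemma high_degree_add: "p \<in> high_degree d ==> q \<in> high_degree d ==> p + q \<in> high_degree d"
 using Poly_Mapping.keys_add[of p q] by (auto simp: high_degree_def)


lemma high_degree_mult: "p \<in> high_degree d ==> q \<in> high_degree e ==> p * q \<in> high_degree (d + e)"
 using Poly_Mapping.keys_mult[of p q] by (force simp: high_degree_def wt_add intro: add_mono)


lemma high_degree_mult1: "p \<in> high_degree d ==> p * q \<in> high_degree d"
 using high_degree_mult[of p d q 0] by simp

lemma high_degree_mult2: "q \<in> high_degree d ==> p * q \<in> high_degree d"
 using high_degree_mult[of p 0 q d] by simp

lemma high_degree_sum: "(!!i. i \<in> I ==> f i \<in> high_degree d) ==> sum f I \<in> high_degree d"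
 by (induction I rule: infinite_finite_induct) (auto intro: high_degree_add)

lemma high_degree_var [simp]: "var_pol v \<in> high_degree (Suc 0)"
 by (auto simp: high_degree_def var_pol_def wt_single)

lemma prod_cong_high_degree:
 fixes f g :: "'i => ('v, 'a::comm_ring_1) pol"
 assumes "!!i. i \<in> I ==> f i - g i \<in> high_degree d"
 shows "prod f I - prod g I \<in> high_degree d"
 using assms
proof (induction I rule: infinite_finite_induct)
 case (insert i I)
 have "f i * prod f I - g i * prod g I = (f i - g i) * prod f I + g i * (prod f I - prod g I)"
  by (simp add: algebra_simps)
 moreover have "(f i - g i) * prod f I + g i * (prod f I - prod g I) \<in> high_degree d"
  by (rule high_degree_add[OF high_degree_mult1 high_degree_mult2]) (use insert in auto)
 ultimately show ?case using insert.hyps by simp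
qed auto

lemma det_cong_high_degree:
 fixes A B :: "('v, 'a::comm_ring_1) pol mat"
 assumes A: "A \<in> carrier_mat n n" "B \<in> carrier_mat n n"
  and "!!i j. [|i < n; j < n|] ==> A $$ (i, j) - B $$ (i, j) \<in> high_degree d"
 shows "det A - det B \<in> high_degree d"
 unfolding det_def'[OF A(1)] det_def'[OF A(2)] sum_subtractf[symmetric] right_diff_distrib[symmetric]
proof (rule high_degree_sum, rule high_degree_mult2, rule prod_cong_high_degree)
 fix p i assume "p \<in> {p. p permutes {0..<n}}" "i \<in> {0..<n}"
 hence "i < n" "p i < n" using permutes_in_image[of p "{0..<n}" i] by auto
 thus "A $$ (i, p i) - B $$ (i, p i) \<in> high_degree d"
  by (rule assms(3))
qed

definition high_degree_mat :: "nat => ('v, 'a::comm_ring_1) pol mat => bool" where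
 "high_degree_mat d A \<longleftrightarrow> (\<forall>i<dim_row A. \<forall>j<dim_col A. A $$ (i, j) \<in> high_degree d)"

lemma high_degree_mat_mult:
 assumes "A \<in> carrier_mat n k" "B \<in> carrier_mat k m" "high_degree_mat d A" "high_degree_mat e B"
 shows "high_degree_mat (d + e) (A * B)"
 unfolding high_degree_mat_def
proof (intro allI impI)
 fix i j assume ij: "i < dim_row (A * B)" "j < dim_col (A * B)"
 hence "(A * B) $$ (i, j) = (\<Sum>l\<in>{0..<k}. A $$ (i, l) * B $$ (l, j))"
  using assms(1,2) by (simp add: times_mat_def scalar_prod_def)
 also have "... \<in> high_degree (d + e)"
  using assms ij by (intro high_degree_sum high_degree_mult) (auto simp: high_degree_mat_def)
 finally show "(A * B) $$ (i, j) \<in> high_degree (d + e)" .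
qed

lemma high_degree_mat_mult1:
 assumes "A \<in> carrier_mat n k" "B \<in> carrier_mat k m" "high_degree_mat d A"
 shows "high_degree_mat d (A * B)"
 using high_degree_mat_mult[OF assms, of 0] by (simp add: high_degree_mat_def del: index_mult_mat)

lemma high_degree_mat_alg_mat:
 fixes a :: "word \<Rightarrow>\<^sub>0 'a::field"
 assumes "a \<in> free_alg"
 shows "high_degree_mat 1 (gen_alg N a)"
proof -
 have gen: "high_degree_mat 1 (generic_mat N k :: 'a gen_ring mat)" for k
  by (auto simp: high_degree_mat_def generic_mat_def high_degree_var)
 have w: "high_degree_mat 1 (gen_word N w :: 'a gen_ring mat)" if nz: "w ~= 0" for w
 proof -
  obtain k ks where "w = Word (k # ks)" using nz by (cases w rule: word.exhaust; cases "letters w") (auto simp: zero_word_def)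
  thus ?thesis
   using high_degree_mat_mult1[OF generic_mat_carrier word_mat_gen_carrier gen]
   by (simp add: word_mat_Cons)
 qed
 have "w ~= 0" if "w \<in> keys a" for w using assms that by (auto simp: free_alg_def in_keys_iff)
 hence "(gen_word N w :: 'a gen_ring mat) $$ (i, j) \<in> high_degree 1" if "w \<in> keys a" "i < N" "j < N" for w i j
  using w[of w] that carrier_matD[OF word_mat_gen_carrier[of N w, where 'a = 'a]] by (auto simp: high_degree_mat_def)
 thus ?thesis
  by (auto simp: high_degree_mat_def alg_mat_def intro!: high_degree_sum high_degree_mult2)
qed

lemma high_degree_mat_power:
 assumes "a \<in> free_alg"
 shows "high_degree_mat k (gen_alg N (a ^ k))"
proof (induction k)
 case 0
 show ?case by (simp add: high_degree_mat_def)
next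
 case (Suc k)
 show ?case
  using high_degree_mat_mult[OF alg_mat_carrier alg_mat_carrier high_degree_mat_alg_mat[OF assms] Suc]
  by (simp add: const_pol.alg_mat_mult[OF generic_mat_carrier])
qed

subsection \<open>The ideal generated by the relations\<close>

definition rel_ideal :: "nat => 'a::field sigma_tilde_alg set" where
 "rel_ideal n = ideal_gen
   ({pi_tilde (sigma t a) | t a. n < t & t <= 2 * n & a \<in> free_alg} \<union>
   {sigma_tilde t b | t b. t > 2 * n & b \<in> X_tilde})"

lemma rel_ideal_sigma_tilde: "t > 2 * n ==> b \<in> X_tilde ==> sigma_tilde t b \<in> rel_ideal n"
 unfolding rel_ideal_def by (rule ideal_gen_base) blast

context
 assumes inf: "infinite (UNIV :: 'a::field set)"
begin

lemma pi_tilde_eqI: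
 fixes a :: "word \<Rightarrow>\<^sub>0 'a"
 assumes "a \<in> free_alg" "represents p t a"
 shows "pi_tilde (sigma t a) = p"
 by (rule represents_unique[OF inf represents_pi_tilde[OF inf assms(1)] assms(2)])

lemma comm_ring_hom_pi_tilde: "comm_ring_hom (pi_tilde :: 'a sigma_alg => _)"
 unfolding pi_tilde_eq[OF inf] by (rule comm_ring_hom_donkin)


lemma pi_tilde_sigma_add:
 "\<exists>l ts :: nat => nat => 'a. \<forall>a\<in>free_alg. \<forall>b\<in>free_alg.
  pi_tilde (sigma t (a + b)) = (\<Sum>i\<le>t. pi_tilde (sigma i a) * pi_tilde (sigma (t - i) b))
   - (\<Sum>s | s < t & t <= 2 * s. \<Sum>j\<le>s. const_pol (l s j) * pi_tilde (sigma s (a + b + single 0 (ts s j) * (a * b))))"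
proof -
 obtain l ts :: "nat => nat => 'a" where
  l: "\<forall>N a b. sigma_gen N t (a + b) = (\<Sum>i\<le>t. sigma_gen N i a * sigma_gen N (t - i) b)
   - (\<Sum>s | s < t & t <= 2 * s. \<Sum>j\<le>s. const_pol (l s j) * sigma_gen N s (a + b + single 0 (ts s j) * (a * b)))"
  using sigma_gen_add_functional[OF inf, of t] by (elim exE) (rule that)
 show ?thesis
 proof (rule exI[of _ l], rule exI[of _ ts], intro ballI)
  fix a b :: "word \<Rightarrow>\<^sub>0 'a" assume ab: "a \<in> free_alg" "b \<in> free_alg"
  have "a + b + single 0 (ts s j) * (a * b) \<in> free_alg" for s j
   using ab by (intro free_alg_add free_alg_scale free_alg_mult)
  hence r: "Phi_tilde N (pi_tilde (sigma s (a + b + single 0 (ts s j) * (a * b))))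
    = sigma_gen N s (a + b + single 0 (ts s j) * (a * b))" for N s j
   using represents_pi_tilde[OF inf] by (simp add: represents_def)
  have rab: "Phi_tilde N (pi_tilde (sigma i a)) = sigma_gen N i a" "Phi_tilde N (pi_tilde (sigma i b)) = sigma_gen N i b" for N i
   using represents_pi_tilde[OF inf] ab by (simp_all add: represents_def)
  show "pi_tilde (sigma t (a + b)) = (\<Sum>i\<le>t. pi_tilde (sigma i a) * pi_tilde (sigma (t - i) b))
   - (\<Sum>s | s < t & t <= 2 * s. \<Sum>j\<le>s. const_pol (l s j) * pi_tilde (sigma s (a + b + single 0 (ts s j) * (a * b))))"
  proof (rule pi_tilde_eqI)
   show "a + b \<in> free_alg" using ab by (rule free_alg_add)
   show "represents ((\<Sum>i\<le>t. pi_tilde (sigma i a) * pi_tilde (sigma (t - i) b))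
   - (\<Sum>s | s < t & t <= 2 * s. \<Sum>j\<le>s. const_pol (l s j) * pi_tilde (sigma s (a + b + single 0 (ts s j) * (a * b))))) t (a + b)"
    unfolding represents_def l[rule_format] Phi.hom_minus Phi.hom_sum Phi.hom_mult Phi_tilde_const r rab by simp
  qed
 qed
qed

text \<open>A word is a power of a primitive one up to rotation, and every monomial of \<open>P\<^sub>t\<^sub>,\<^sub>l\<close> has a
 variable with number at least \<open>t\<close>. In the formula for a sum, the terms with \<open>s <= n\<close> drop out
 because \<open>2s < t\<close>.\<close>

lemma pi_tilde_sigma_in_ideal:
 assumes a: "a \<in> free_alg" and t: "t > n"
 shows "pi_tilde (sigma t a) \<in> (rel_ideal n :: 'a sigma_tilde_alg set)"
 using assms
proof (induction t arbitrary: a rule: less_induct)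
 case (less t)
 interpret pi: comm_ring_hom "pi_tilde :: 'a sigma_alg => _" by (rule comm_ring_hom_pi_tilde)
 show ?case
 proof (cases "t <= 2 * n")
  case True
  thus ?thesis using less.prems unfolding rel_ideal_def by (intro ideal_gen_base) blast
 next
  case False
  hence t: "t > 2 * n" by simp
  from less.prems(1) show ?thesis
  proof (induction a rule: free_alg_induct)
   case zero
   thus ?case using t by (simp add: sigma_def rel_ideal_def ideal_gen_0)
  next
   case (single w c)
   obtain e l where e: "e \<in> X_tilde" "l > 0" "cyclic_equiv w (sum_list (replicate l e))"
    using ex_X_tilde_root[OF single] by blast
   have "pi_tilde (sigma t (of_word w)) = (ev const_pol (sigma_tilde' e) (power_pol t l) :: 'a sigma_tilde_alg)"
    by (rule pi_tilde_eqI) (use represents_word[OF single e] single in "simp_all add: free_alg_of_word")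
   also have "... \<in> rel_ideal n"
    unfolding ev_def rel_ideal_def
   proof (intro ideal_gen_sum ideal_gen_mult)
    fix m assume "m \<in> keys (power_pol t l :: (nat, 'a) pol)"
    then obtain s where s: "s \<ge> t" "s \<in> keys m"
     using power_pol_high_vars[of l t m] e(2) t by auto
    hence "(sigma_tilde' e s :: 'a sigma_tilde_alg) ^ lookup m s
      = sigma_tilde s e * sigma_tilde' e s ^ (lookup m s - 1)"
     using t by (simp add: sigma_tilde'_def in_keys_iff flip: power_Suc)
    hence "mon_ev (sigma_tilde' e) m = (sigma_tilde s e :: 'a sigma_tilde_alg) * (sigma_tilde' e s ^ (lookup m s - 1)
      * (\<Prod>v\<in>keys m - {s}. sigma_tilde' e v ^ lookup m v))"
     unfolding mon_ev_def using s by (subst prod.remove[of _ s]) (auto simp: mult.assoc)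
    moreover note rel_ideal_sigma_tilde[of n s e, where 'a = 'a, unfolded rel_ideal_def, OF _ e(1)]
    ultimately show "mon_ev (sigma_tilde' e) m \<in> ideal_gen
     ({pi_tilde (sigma t a) | t (a :: word \<Rightarrow>\<^sub>0 'a). n < t & t <= 2 * n & a \<in> free_alg} \<union> {sigma_tilde t b | t b. t > 2 * n & b \<in> X_tilde})"
     using s t by (simp add: ideal_gen_mult_right)
   qed
   finally show ?case
    unfolding sigma_single[OF single] pi.hom_mult rel_ideal_def by (rule ideal_gen_mult)
  next
   case (add a b)
   obtain l ts :: "nat => nat => 'a" where
    l: "\<forall>a\<in>free_alg. \<forall>b\<in>free_alg.
    pi_tilde (sigma t (a + b)) = (\<Sum>i\<le>t. pi_tilde (sigma i a) * pi_tilde (sigma (t - i) b))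
    - (\<Sum>s | s < t & t <= 2 * s. \<Sum>j\<le>s. const_pol (l s j) * pi_tilde (sigma s (a + b + single 0 (ts s j) * (a * b))))"
    using pi_tilde_sigma_add[of t] by (elim exE) (rule that)
   have fr: "a + b + single 0 (ts s j) * (a * b) \<in> free_alg" for s j
    using add.hyps by (intro free_alg_add free_alg_scale free_alg_mult)
   have small: "pi_tilde (sigma i a) * pi_tilde (sigma (t - i) b) \<in> rel_ideal n" if "i <= t" for i
   proof (cases "i > n")
    case True
    hence "pi_tilde (sigma i a) \<in> rel_ideal n"
     using less.IH[of i a] add that by (cases "i = t") auto
    thus ?thesis unfolding rel_ideal_def by (rule ideal_gen_mult_right)
   next
    case False
    hence "t - i > n" using t by simp
    hence "pi_tilde (sigma (t - i) b) \<in> rel_ideal n"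
     using less.IH[of "t - i" b] add t by (cases "i = 0") auto
    thus ?thesis unfolding rel_ideal_def by (rule ideal_gen_mult)
   qed
   have "pi_tilde (sigma s (a + b + single 0 (ts s j) * (a * b))) \<in> rel_ideal n"
    if "s < t" "t <= 2 * s" for s j
    using less.IH[OF that(1) fr] that t by simp
   hence "(\<Sum>s | s < t & t <= 2 * s. \<Sum>j\<le>s. const_pol (l s j) * pi_tilde (sigma s (a + b + single 0 (ts s j) * (a * b))))
     \<in> rel_ideal n"
    unfolding rel_ideal_def by (intro ideal_gen_sum ideal_gen_mult) auto
   moreover have "(\<Sum>i\<le>t. pi_tilde (sigma i a) * pi_tilde (sigma (t - i) b)) \<in> rel_ideal n"
    using small unfolding rel_ideal_def by (intro ideal_gen_sum) auto
   ultimately show ?case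
    unfolding l[rule_format, OF add.hyps] rel_ideal_def by (intro ideal_gen_diff)
  qed
 qed
qed

end

subsection \<open>Determinants of block matrices with entries in the free algebra\<close>

text \<open>\<open>q\<close> inverts T only up to terms of degree at least d. Subtracting the last
  block column times qR from the first leaves R - TqR in the lower left corner, and discarding it
  changes the determinant in degree at least d only.\<close>

lemma schur_cong:
 fixes P :: "'a::field gen_ring mat"
 assumes [simp]: "P \<in> carrier_mat m m" "Q \<in> carrier_mat m N" "R \<in> carrier_mat N m" "T \<in> carrier_mat N N" "q \<in> carrier_mat N N"
  and hd: "high_degree_mat d (R - T * q * R)"
 shows "det (four_block_mat P Q R T) - det (P - Q * q * R) * det T \<in> high_degree d"
proof -
 let ?E = "four_block_mat (1\<^sub>m m) (0\<^sub>m m N) (- (q * R)) (1\<^sub>m N)"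
 let ?F = "four_block_mat (P - Q * q * R) Q (R - T * q * R) T"
 have qR[simp]: "q * R \<in> carrier_mat N m" "Q * q * R \<in> carrier_mat m m" "T * q * R \<in> carrier_mat N m"
  by (auto intro!: mult_carrier_mat[where n = N])
 have [simp]: "P - Q * q * R \<in> carrier_mat m m" by (rule minus_carrier_mat) simp
 have [simp]: "four_block_mat (P - Q * q * R) Q V T \<in> carrier_mat (m + N) (m + N)" for V
  by (rule four_block_carrier_mat) simp_all
 have "det (four_block_mat P Q R T) = det (four_block_mat P Q R T) * det ?E"
  by (subst det_four_block_mat_upper_right_zero[of _ m _ N]) (auto simp: uminus_carrier_iff_mat)
 also have "... = det (four_block_mat P Q R T * ?E)"
  by (rule det_mult[symmetric, of _ "m + N"]) auto
 also have "four_block_mat P Q R T * ?E = ?F"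
 proof (subst mult_four_block_mat[of _ m m _ N _ N _ _ m _ N])
  have 1: "Q * - (q * R) = - (Q * q * R)"
   using assoc_mult_mat[of Q m N q N R m] uminus_mult_right_mat[of Q "q * R"] carrier_matD[OF qR(1)] carrier_matD[OF assms(2)] by simp
  have 2: "T * - (q * R) = - (T * q * R)"
   using assoc_mult_mat[of T N N q N R m] uminus_mult_right_mat[of T "q * R"] carrier_matD[OF qR(1)] carrier_matD[OF assms(4)] by simp
  show "four_block_mat (P * 1\<^sub>m m + Q * - (q * R)) (P * 0\<^sub>m m N + Q * 1\<^sub>m N) (R * 1\<^sub>m m + T * - (q * R)) (R * 0\<^sub>m m N + T * 1\<^sub>m N) = ?F"
   unfolding 1 2
    right_mult_one_mat[OF assms(1)] right_mult_zero_mat[OF assms(1)] right_mult_one_mat[OF assms(2)]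
    right_mult_one_mat[OF assms(3)] right_mult_zero_mat[OF assms(3)] right_mult_one_mat[OF assms(4)]
    add_uminus_minus_mat[OF assms(1) qR(2)] add_uminus_minus_mat[OF assms(3) qR(3)]
    left_add_zero_mat[OF assms(2)] left_add_zero_mat[OF assms(4)] ..
 qed auto
 finally have "det (four_block_mat P Q R T) = det ?F" .
 moreover have "det ?F - det (four_block_mat (P - Q * q * R) Q (0\<^sub>m N m) T) \<in> high_degree d"
 proof (rule det_cong_high_degree[of _ "m + N"])
  fix i j assume ij: "i < m + N" "j < m + N"
  show "?F $$ (i, j) - four_block_mat (P - Q * q * R) Q (0\<^sub>m N m) T $$ (i, j) \<in> high_degree d"
   using hd ij carrier_matD[OF qR(3)] carrier_matD[OF qR(2)] carrier_matD[OF assms(3)] carrier_matD[OF assms(1)] carrier_matD[OF assms(4)]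
   by (auto simp: high_degree_mat_def)
 qed auto
 moreover have "det (four_block_mat (P - Q * q * R) Q (0\<^sub>m N m) T) = det (P - Q * q * R) * det T"
  by (rule det_four_block_mat_lower_left_zero[of _ m _ N]) auto
 ultimately show ?thesis by simp
qed

text \<open>The identity plus an s by s matrix over the free algebra evaluated at generic matrices;
  the index u = iN + a stands for row a of block i.\<close>

definition node_mat :: "nat => nat => (nat => nat => (word \<Rightarrow>\<^sub>0 'a::field)) => 'a gen_ring mat" where
 "node_mat N s b = mat (s * N) (s * N) (%(u, v). (if u = v then 1 else 0) +
   gen_alg N (b (u div N) (v div N)) $$ (u mod N, v mod N))"

lemma node_mat_carrier [simp]: "node_mat N s b \<in> carrier_mat (s * N) (s * N)"
 by (simp add: node_mat_def)

lemma alg_mat_minus: "gen_alg N (a - b)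
 = gen_alg N a - gen_alg N b"
 using const_pol.alg_mat_add[of "generic_mat N" N a "- b"]
 by (simp add: const_pol.alg_mat_uminus minus_add_uminus_mat[OF alg_mat_carrier alg_mat_carrier])

lemma one_minus_mult_geometric: "(1 - x) * (\<Sum>i<d. x ^ i) = 1 - x ^ d" for x :: "'r::ring_1"
proof (induction d)
 case (Suc d)
 have "(1 - x) * (\<Sum>i<Suc d. x ^ i) = (1 - x) * (\<Sum>i<d. x ^ i) + (1 - x) * x ^ d" by (simp add: distrib_left)
 also have "(1 - x) * x ^ d = x ^ d - x * x ^ d" by (simp only: left_diff_distrib mult_1_left)
 also note Suc
 finally show ?case by simp
qed simp

text \<open>Elimination of the last block. The inverse of 1 + b_ss is a power series, and its
  truncation \<open>qq\<close> has an error of degree d. The Schur complement is again a node matrix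
  over the free algebra, so the step can be repeated.\<close>

lemma node_mat_Suc:
 fixes b :: "nat => nat => (word \<Rightarrow>\<^sub>0 'a::field)" and s d :: nat
 assumes fr: "!!i j. b i j \<in> free_alg"
 defines "qq \<equiv> \<Sum>i<d. (- b s s) ^ i"
 shows "det (node_mat N (Suc s) b) - det (node_mat N s (%i j. b i j - b i s * qq * b s j))
  * det (1\<^sub>m N + gen_alg N (b s s)) \<in> high_degree d"
proof -
 let ?A = "gen_alg N"
 define Q where "Q = mat (s * N) N (%(u, v). ?A (b (u div N) s) $$ (u mod N, v))"
 define R where "R = mat N (s * N) (%(u, v). ?A (b s (v div N)) $$ (u, v mod N))"
 define T where "T = 1\<^sub>m N + ?A (b s s)"
 have [simp]: "Q \<in> carrier_mat (s * N) N" "R \<in> carrier_mat N (s * N)" "T \<in> carrier_mat N N"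
  by (simp_all add: Q_def R_def T_def)
 have div: "(u + s * N) div N = s" "(u + s * N) mod N = u" if "u < N" for u using that by auto
 have div': "u div N = s" "u mod N = u - s * N" if "u < s * N + N" "\<not> u < s * N" for u
 proof -
  have "u = (u - s * N) + s * N" "u - s * N < N" using that by auto
  thus "u div N = s" "u mod N = u - s * N" using div[of "u - s * N"] by metis+
 qed
 have fb: "node_mat N (Suc s) b = four_block_mat (node_mat N s b) Q R T"
  using div' by (intro eq_matI) (auto simp: node_mat_def Q_def R_def T_def)
 have geo: "(1 + b s s) * qq = 1 - (- b s s) ^ d"
  using one_minus_mult_geometric[of "- b s s" d]
  by (simp add: qq_def)
 have Tq: "T * ?A qq = 1\<^sub>m N - ?A ((- b s s) ^ d)"
 proof -
  have "T = ?A (1 + b s s)" by (simp add: T_def const_pol.alg_mat_add const_pol.alg_mat_1)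
  hence "T * ?A qq = ?A ((1 + b s s) * qq)" by (simp add: const_pol.alg_mat_mult)
  thus ?thesis by (simp add: geo alg_mat_minus const_pol.alg_mat_1)
 qed
 have "R - T * ?A qq * R = ?A ((- b s s) ^ d) * R"
  unfolding Tq by (subst minus_mult_distrib_mat[of _ N N _ _ "s * N"]) (auto intro!: eq_matI simp: left_mult_one_mat[of R N "s * N"])
 moreover have "high_degree_mat d (?A ((- b s s) ^ d) * R)"
 proof (rule high_degree_mat_mult1[of _ N N _ "s * N"])
  have "- b s s \<in> free_alg" using fr[of s s] by (simp add: free_alg_def)
  thus "high_degree_mat d (?A ((- b s s) ^ d))" by (rule high_degree_mat_power)
 qed auto
 ultimately have "det (four_block_mat (node_mat N s b) Q R T) - det (node_mat N s b - Q * ?A qq * R) * det T \<in> high_degree d"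
  by (intro schur_cong[of _ "s * N" _ N]) auto
 moreover have "node_mat N s b - Q * ?A qq * R = node_mat N s (%i j. b i j - b i s * qq * b s j)"
 proof (rule eq_matI)
  fix u v assume "u < dim_row (node_mat N s (%i j. b i j - b i s * qq * b s j))" "v < dim_col (node_mat N s (%i j. b i j - b i s * qq * b s j))"
  hence uv: "u < s * N" "v < s * N" by (simp_all add: node_mat_def)
  hence N: "N > 0" by (cases N) auto
  have m: "u mod N < N" "v mod N < N" using N by auto
  have QA: "(Q * ?A qq) $$ (u, x) = (?A (b (u div N) s) * ?A qq) $$ (u mod N, x)" if "x < N" for x
   using uv m that by (simp add: times_mat_def scalar_prod_def Q_def)
  have "(Q * ?A qq * R) $$ (u, v) = (\<Sum>x\<in>{0..<N}. (Q * ?A qq) $$ (u, x) * R $$ (x, v))"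
   using uv by (simp add: times_mat_def scalar_prod_def Q_def R_def)
  also have "... = (\<Sum>x\<in>{0..<N}. (?A (b (u div N) s) * ?A qq) $$ (u mod N, x) * ?A (b s (v div N)) $$ (x, v mod N))"
   using uv by (intro sum.cong) (auto simp: QA R_def)
  also have "... = (?A (b (u div N) s) * ?A qq * ?A (b s (v div N))) $$ (u mod N, v mod N)"
   using m by (simp add: times_mat_def scalar_prod_def)
  finally have "(Q * ?A qq * R) $$ (u, v) = ?A (b (u div N) s * qq * b s (v div N)) $$ (u mod N, v mod N)"
   by (simp add: const_pol.alg_mat_mult)
  thus "(node_mat N s b - Q * ?A qq * R) $$ (u, v) = node_mat N s (%i j. b i j - b i s * qq * b s j) $$ (u, v)"
   using uv m by (simp add: node_mat_def Q_def R_def alg_mat_minus)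
 qed (simp_all add: node_mat_def Q_def R_def)
 ultimately show ?thesis by (simp add: fb T_def)
qed

lemma free_alg_sum: "(!!i. i \<in> J ==> f i \<in> free_alg) ==> sum f J \<in> free_alg"
 by (induction J rule: infinite_finite_induct) (auto intro: free_alg_add free_alg_0)

definition ideal_mod :: "nat => nat => nat => 'a::field gen_ring set" where
 "ideal_mod n N d = {r. \<exists>g\<in>rel_ideal n. r - Phi_tilde N g \<in> high_degree d}"

lemma ideal_mod_0: "0 \<in> ideal_mod n N d"
proof -
 show ?thesis unfolding ideal_mod_def
  by (rule CollectI, rule bexI[of _ 0]) (simp_all add: rel_ideal_def ideal_gen_0)
qed

lemma ideal_mod_add: "x \<in> ideal_mod n N d ==> y \<in> ideal_mod n N d ==> x + y \<in> ideal_mod n N d"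
proof -
 assume "x \<in> ideal_mod n N d" "y \<in> ideal_mod n N d"
 then obtain g g' where g: "g \<in> rel_ideal n" "g' \<in> rel_ideal n"
  and "x - Phi_tilde N g \<in> high_degree d" "y - Phi_tilde N g' \<in> high_degree d" by (auto simp: ideal_mod_def)
 from high_degree_add[OF this(3,4)] have "x + y - Phi_tilde N (g + g') \<in> high_degree d"
  by (simp add: Phi.hom_add algebra_simps)
 moreover have "g + g' \<in> rel_ideal n" using g unfolding rel_ideal_def by (rule ideal_gen_add)
 ultimately show ?thesis by (auto simp: ideal_mod_def)
qed

lemma ideal_mod_scale: "x \<in> ideal_mod n N d ==> const_pol c * x \<in> ideal_mod n N d"
proof -
 assume "x \<in> ideal_mod n N d"
 then obtain g where g: "g \<in> rel_ideal n" "x - Phi_tilde N g \<in> high_degree d" by (auto simp: ideal_mod_def)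
 from high_degree_mult2[OF this(2)] have "const_pol c * x - Phi_tilde N (const_pol c * g) \<in> high_degree d"
  by (simp add: Phi.hom_mult Phi_tilde_const right_diff_distrib)
 moreover have "const_pol c * g \<in> rel_ideal n" using g(1) unfolding rel_ideal_def by (rule ideal_gen_mult)
 ultimately show ?thesis by (auto simp: ideal_mod_def)
qed

section \<open>Expansion of the determinant of a node matrix into labelled permutations\<close>

definition row_scale :: "'a::field => (nat => nat => (word \<Rightarrow>\<^sub>0 'a)) => nat => nat => (word \<Rightarrow>\<^sub>0 'a)" where
 "row_scale z b i j = (if i = 0 then single 0 z * b i j else b i j)"

text \<open>Labelled permutations of the rows of a node matrix: the label \<open>K\<close> marks fixed points which
 contribute the summand \<open>1\<close> of a diagonal entry, the labels below \<open>K\<close> are letters.\<close>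

definition lab_perms :: "nat => nat => ((nat => nat) \<times> (nat => nat)) set" where
 "lab_perms J K = {(p, ka). p permutes {..<J} & ka \<in> PiE {..<J} (%_. {..K}) & (\<forall>u<J. ka u = K --> p u = u)}"

definition lab_term :: "nat => nat => nat => (nat => nat) \<times> (nat => nat) => 'a::field gen_ring" where
 "lab_term N J K = (%(p, ka). of_int (sign p) * (\<Prod>u | u < J & ka u < K. var_pol (u mod N, p u mod N, ka u)))"

text \<open>The type of a factor, that is source block, target block and letter, packed into one
  number below S * S * K so that it can index a family of scalars.\<close>

definition lab_code :: "nat => nat => nat => (nat => nat) \<times> (nat => nat) => nat => nat" where
 "lab_code N S K = (%(p, ka) u. (u div N * S + p u div N) * K + ka u)"

definition lab_type :: "nat => nat => nat => (nat => nat) \<times> (nat => nat) => nat => nat" where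
 "lab_type N S K x c = card {u. u < S * N & snd x u < K & lab_code N S K x u = c}"

text \<open>The exponent of z in the term after \<open>row_scale z\<close>, which multiplies block
  row 0 by z.\<close>

definition lab_zero :: "nat => nat => nat => (nat => nat) \<times> (nat => nat) => nat" where
 "lab_zero N S K x = card {u. u < S * N & snd x u < K & u div N = 0}"

lemma finite_lab_perms: "finite (lab_perms J K)"
proof (rule finite_subset)
 show "lab_perms J K \<subseteq> {p. p permutes {..<J}} \<times> PiE {..<J} (%_. {..K})" by (auto simp: lab_perms_def)
qed (intro finite_cartesian_product finite_permutations finite_PiE finite_lessThan finite_atMost)

lemma prod_fibres:
 fixes t :: "nat => 'r::comm_monoid_mult"
 assumes "finite U" "g ` U \<subseteq> {..<r}"
 shows "(\<Prod>u\<in>U. t (g u)) = (\<Prod>c<r. t c ^ card {u \<in> U. g u = c})"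
proof -
 have "(\<Prod>u\<in>U. t (g u)) = (\<Prod>c<r. \<Prod>u\<in>{u \<in> U. g u = c}. t (g u))"
  by (rule prod.group[symmetric]) (use assms in auto)
 also have "... = (\<Prod>c<r. t c ^ card {u \<in> U. g u = c})"
  by (intro prod.cong refl) simp
 finally show ?thesis .
qed

lemma lab_code_less:
 assumes "x \<in> lab_perms (S * N) K" "u < S * N" "snd x u < K"
 shows "lab_code N S K x u < S * S * K"
proof -
 obtain p ka where px: "x = (p, ka)" by fastforce
 have "p u < S * N" using assms permutes_in_image[of p "{..<S * N}" u] by (auto simp: lab_perms_def px)
 hence *: "u div N < S" "p u div N < S" using assms(2) by (auto simp: less_mult_imp_div_less)
 hence "Suc (u div N) * S <= S * S" by (intro mult_le_mono1) auto
 hence "u div N * S + p u div N < S * S" using * by simp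
 hence "Suc (u div N * S + p u div N) * K <= S * S * K" by (intro mult_le_mono1) auto
 thus ?thesis using assms(3) by (simp add: px lab_code_def)
qed

context
 assumes inf: "infinite (UNIV :: 'a::field set)"
begin

lemma det_one_plus_alg_mat:
 fixes a :: "word \<Rightarrow>\<^sub>0 'a"
 assumes "a \<in> free_alg"
 shows "det (1\<^sub>m N + gen_alg N a) = Phi_tilde N (\<Sum>t\<le>N. pi_tilde (sigma t a))"
proof -
 show ?thesis
  using represents_pi_tilde[OF inf assms] by (simp add: det_one_plus[OF alg_mat_carrier] Phi.hom_sum represents_def)
qed

text \<open>Blocks are eliminated from the last one down to block 1. The factors split off are det
  (1 + b_ll) with l > 0, which do not involve z, and each Schur complement is linear in row 0; hence
  \<open>e\<close> and \<open>a\<close> do not depend on z.\<close>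

lemma det_node_mat_reduce:
 fixes b :: "nat => nat => (word \<Rightarrow>\<^sub>0 'a)"
 assumes "!!i j. b i j \<in> free_alg"
 shows "\<exists>e. \<exists>a\<in>free_alg. \<forall>z. det (node_mat N (Suc s) (row_scale z b))
  - Phi_tilde N e * det (1\<^sub>m N + gen_alg N (single 0 z * a)) \<in> high_degree d"
 using assms
proof (induction s arbitrary: b)
 case 0
 have "node_mat N (Suc 0) (row_scale z b) = 1\<^sub>m N + gen_alg N (single 0 z * b 0 0)" for z
  by (auto simp: node_mat_def row_scale_def intro!: eq_matI)
 thus ?case by (intro exI[of _ 1] bexI[of _ "b 0 0"]) (simp_all add: 0)
next
 case (Suc s)
 define l where "l = Suc s"
 define q where "q = (\<Sum>i<d. (- b l l) ^ i)"
 define b' where "b' i j = b i j - b i l * q * b l j" for i j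
 have b': "b' i j \<in> free_alg" for i j
 proof -
  have "b i l * q * b l j \<in> free_alg" by (intro free_alg_mult Suc.prems)
  thus ?thesis using Suc.prems[of i j] by (simp add: b'_def free_alg_def lookup_minus)
 qed
 obtain e a where a: "a \<in> free_alg" and e: "!!z. det (node_mat N (Suc s) (row_scale z b'))
  - Phi_tilde N e * det (1\<^sub>m N + gen_alg N (single 0 z * a)) \<in> high_degree d"
  using Suc.IH[of b', OF b'] by blast
 define p where "p = (\<Sum>t\<le>N. pi_tilde (sigma t (b l l)))"
 have "det (node_mat N (Suc (Suc s)) (row_scale z b)) - Phi_tilde N (p * e)
   * det (1\<^sub>m N + gen_alg N (single 0 z * a)) \<in> high_degree d" for z :: 'a
 proof -
  let ?T = "det (1\<^sub>m N + gen_alg N (b l l))"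
  let ?D = "det (1\<^sub>m N + gen_alg N (single 0 z * a))"
  have rs: "row_scale z b l j = b l j" for j by (simp add: row_scale_def l_def)
  have fr: "row_scale z b i j \<in> free_alg" for i j
   using Suc.prems by (simp add: row_scale_def free_alg_scale)
  have "(%i j. row_scale z b i j - row_scale z b i l * (\<Sum>i<d. (- row_scale z b l l) ^ i) * row_scale z b l j) = row_scale z b'"
   unfolding rs q_def[symmetric]
   by (intro ext) (simp add: row_scale_def b'_def right_diff_distrib mult.assoc)
  hence "det (node_mat N (Suc l) (row_scale z b)) - det (node_mat N l (row_scale z b')) * ?T \<in> high_degree d"
   using node_mat_Suc[of "row_scale z b" N l d, OF fr] by (simp add: rs)
  moreover have "(det (node_mat N l (row_scale z b')) - Phi_tilde N e * ?D) * ?T \<in> high_degree d"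
   by (rule high_degree_mult1) (use e[of z] in "simp add: l_def")
  ultimately have "(det (node_mat N (Suc l) (row_scale z b)) - det (node_mat N l (row_scale z b')) * ?T)
   + (det (node_mat N l (row_scale z b')) - Phi_tilde N e * ?D) * ?T \<in> high_degree d" by (rule high_degree_add)
  moreover have "?T = Phi_tilde N p" unfolding p_def by (rule det_one_plus_alg_mat) (rule Suc.prems)
  ultimately show ?thesis by (simp add: l_def Phi.hom_mult algebra_simps)
 qed
 thus ?case using a by blast
qed

text \<open>The Leibniz expansion with every entry multiplied out: a label chooses one letter of the
  entry or, as K, the summand 1 of a diagonal entry.\<close>

lemma det_node_mat_expand:
 fixes c :: "nat => nat => nat => 'a" and K S :: nat
 defines "b \<equiv> %i j. \<Sum>k<K. single (Word [k]) (c i j k)"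
 shows "det (node_mat N S b) = (\<Sum>x\<in>lab_perms (S * N) K.
  const_pol (\<Prod>u | u < S * N & snd x u < K. c (u div N) (fst x u div N) (snd x u)) * lab_term N (S * N) K x)"
proof -
 let ?J = "S * N"
 define ent where "ent u v k = (if k = K then (if u = v then 1 else 0)
  else const_pol (c (u div N) (v div N) k) * var_pol (u mod N, v mod N, k) :: 'a gen_ring)" for u v k
 have entry: "node_mat N S b $$ (u, v) = (\<Sum>k\<le>K. ent u v k)" if "u < ?J" "v < ?J" for u v
 proof -
  have N: "u mod N < N" "v mod N < N" using that by (cases N; simp)+
  have s: "gen_alg N (single (Word [k]) x) $$ (u mod N, v mod N)
    = const_pol x * var_pol (u mod N, v mod N, k)" for k x
   using N by (simp add: const_pol.alg_mat_single[OF generic_mat_carrier] word_mat_letter[OF generic_mat_carrier])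
    (simp add: generic_mat_def)
  have "gen_alg N (b i j) $$ (u mod N, v mod N)
    = (\<Sum>k<K. const_pol (c i j k) * var_pol (u mod N, v mod N, k))" for i j
   unfolding b_def alg_mat_sum using N by (simp add: letter_sum_def s)
  hence "node_mat N S b $$ (u, v) = (if u = v then 1 else 0) + (\<Sum>k<K. const_pol (c (u div N) (v div N) k) * var_pol (u mod N, v mod N, k))"
   using that by (simp add: node_mat_def)
  also have "... = (\<Sum>k\<le>K. ent u v k)"
   by (simp add: ent_def lessThan_Suc_atMost[symmetric] add.commute)
  finally show ?thesis .
 qed
 have "det (node_mat N S b) = (\<Sum>p | p permutes {..<?J}. of_int (sign p) * (\<Prod>u<?J. node_mat N S b $$ (u, p u)))"
  by (simp add: det_def'[OF node_mat_carrier] atLeast0LessThan sign_def)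
 also have "... = (\<Sum>p | p permutes {..<?J}. \<Sum>ka\<in>PiE {..<?J} (%_. {..K}). of_int (sign p) * (\<Prod>u<?J. ent u (p u) (ka u)))"
 proof (intro sum.cong refl)
  fix p assume p: "p \<in> {p. p permutes {..<?J}}"
  have "(\<Prod>u<?J. node_mat N S b $$ (u, p u)) = (\<Prod>u<?J. \<Sum>k\<le>K. ent u (p u) k)"
   using p permutes_in_image[of p "{..<?J}"] by (intro prod.cong refl entry) auto
  also have "... = (\<Sum>ka\<in>PiE {..<?J} (%_. {..K}). \<Prod>u<?J. ent u (p u) (ka u))"
   by (rule prod_sum_PiE) auto
  finally show "of_int (sign p) * (\<Prod>u<?J. node_mat N S b $$ (u, p u))
   = (\<Sum>ka\<in>PiE {..<?J} (%_. {..K}). of_int (sign p) * (\<Prod>u<?J. ent u (p u) (ka u)))"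
   by (simp add: sum_distrib_left)
 qed
 also have "... = (\<Sum>(p, ka)\<in>{p. p permutes {..<?J}} \<times> PiE {..<?J} (%_. {..K}). of_int (sign p) * (\<Prod>u<?J. ent u (p u) (ka u)))"
  by (rule sum.cartesian_product)
 also have "... = (\<Sum>(p, ka)\<in>lab_perms ?J K. of_int (sign p) * (\<Prod>u<?J. ent u (p u) (ka u)))"
 proof (rule sum.mono_neutral_right)
  show "finite ({p. p permutes {..<?J}} \<times> PiE {..<?J} (%_. {..K}))"
   by (intro finite_cartesian_product finite_permutations finite_PiE finite_lessThan finite_atMost)
  show "\<forall>x\<in>{p. p permutes {..<?J}} \<times> PiE {..<?J} (%_. {..K}) - lab_perms ?J K. (case x of (p, ka) => of_int (sign p) * (\<Prod>u<?J. ent u (p u) (ka u))) = 0"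
  proof
   fix x assume "x \<in> {p. p permutes {..<?J}} \<times> PiE {..<?J} (%_. {..K}) - lab_perms ?J K"
   then obtain p ka u where x: "x = (p, ka)" and u: "u < ?J" "ka u = K" "p u ~= u" by (auto simp: lab_perms_def)
   hence "(\<Prod>u<?J. ent u (p u) (ka u)) = 0" by (intro prod_zero bexI[of _ u]) (auto simp: ent_def)
   thus "(case x of (p, ka) => of_int (sign p) * (\<Prod>u<?J. ent u (p u) (ka u))) = 0" by (simp add: x)
  qed
 qed (auto simp: lab_perms_def)
 also have "... = (\<Sum>x\<in>lab_perms ?J K. const_pol (\<Prod>u | u < ?J & snd x u < K. c (u div N) (fst x u div N) (snd x u)) * lab_term N ?J K x)"
 proof (intro sum.cong refl)
  fix x assume x: "x \<in> lab_perms ?J K"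
  obtain p ka where px: "x = (p, ka)" by fastforce
  have le: "ka u <= K" if "u < ?J" for u using x that by (auto simp: lab_perms_def px)
  have fx: "p u = u" if "u < ?J" "ka u = K" for u using x that by (auto simp: lab_perms_def px)
  have "(\<Prod>u<?J. ent u (p u) (ka u)) = (\<Prod>u | u < ?J & ka u < K. ent u (p u) (ka u))"
  proof (rule prod.mono_neutral_right)
   show "\<forall>u\<in>{..<?J} - {u. u < ?J & ka u < K}. ent u (p u) (ka u) = 1"
   proof
    fix u assume "u \<in> {..<?J} - {u. u < ?J & ka u < K}"
    hence "u < ?J" "ka u = K" using le[of u] by auto
    thus "ent u (p u) (ka u) = 1" using fx[of u] by (simp add: ent_def)
   qed
  qed auto
  also have "... = (\<Prod>u | u < ?J & ka u < K. const_pol (c (u div N) (p u div N) (ka u)) * var_pol (u mod N, p u mod N, ka u))"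
   by (intro prod.cong) (auto simp: ent_def)
  finally show "(case x of (p, ka) => of_int (sign p) * (\<Prod>u<?J. ent u (p u) (ka u)))
   = const_pol (\<Prod>u | u < ?J & snd x u < K. c (u div N) (fst x u div N) (snd x u)) * lab_term N ?J K x"
   by (simp add: px lab_term_def prod.distrib const_pol.hom_prod algebra_simps)
 qed
 finally show ?thesis .
qed

text \<open>By \<open>det_node_mat_reduce\<close> the coefficient of z^\<rho> in the determinant is
  congruent to the value of e \<sigma>_\<rho>(a), which comes from the ideal for \<rho> > n. Giving
  every type its own scalar coefficient then separates the types.\<close>

lemma lab_sum_mem:
 assumes "\<rho> > n"
 shows "(\<Sum>x | x \<in> lab_perms (Suc s * N) K & lab_zero N (Suc s) K x = \<rho> & (\<forall>i<Suc s * Suc s * K. lab_type N (Suc s) K x i = \<nu> i).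
  lab_term N (Suc s * N) K x) \<in> (ideal_mod n N d :: 'a gen_ring set)"
proof -
 let ?S = "Suc s"
 let ?L = "lab_perms (?S * N) K"
 let ?r = "?S * ?S * K"
 have fin: "finite {u. u < ?S * N & P u}" for P by simp
 have "(\<Sum>x | x \<in> ?L & lab_zero N ?S K x = \<rho>. const_pol (\<Prod>i<?r. t i ^ lab_type N ?S K x i) * lab_term N (?S * N) K x) \<in> (ideal_mod n N d :: 'a gen_ring set)" for t
 proof -
  define b where "b i j = (\<Sum>k<K. single (Word [k]) (t ((i * ?S + j) * K + k)))" for i j
  have "b i j \<in> free_alg" for i j
   unfolding b_def by (rule free_alg_sum) (simp add: free_alg_single zero_word_def)
  then obtain e a where a: "a \<in> free_alg" and e: "!!z. det (node_mat N ?S (row_scale z b))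
   - Phi_tilde N e * det (1\<^sub>m N + gen_alg N (single 0 z * a)) \<in> high_degree d"
   using det_node_mat_reduce[of b N s d] by blast
  let ?f = "%x. const_pol (\<Prod>i<?r. t i ^ lab_type N ?S K x i) * lab_term N (?S * N) K x"
  have det1: "det (node_mat N ?S (row_scale z b)) = (\<Sum>x\<in>?L. const_pol (z ^ lab_zero N ?S K x) * ?f x)" for z
  proof -
   define c where "c i j k = (if i = 0 then z else 1) * t ((i * ?S + j) * K + k)" for i j k
   have "row_scale z b = (%i j. \<Sum>k<K. single (Word [k]) (c i j k))"
    by (intro ext) (auto simp: row_scale_def b_def c_def sum_distrib_left mult_single)
   hence "det (node_mat N ?S (row_scale z b)) = (\<Sum>x\<in>?L.
     const_pol (\<Prod>u | u < ?S * N & snd x u < K. c (u div N) (fst x u div N) (snd x u)) * lab_term N (?S * N) K x)"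
    by (simp only: det_node_mat_expand)
   also have "... = (\<Sum>x\<in>?L. const_pol (z ^ lab_zero N ?S K x) * ?f x)"
   proof (intro sum.cong refl)
    fix x assume x: "x \<in> ?L"
    let ?U = "{u. u < ?S * N & snd x u < K}"
    have "(\<Prod>u\<in>?U. c (u div N) (fst x u div N) (snd x u)) = (\<Prod>u\<in>?U. if u div N = 0 then z else 1) * (\<Prod>u\<in>?U. t (lab_code N ?S K x u))"
     by (simp add: c_def prod.distrib lab_code_def split_beta)
    also have "(\<Prod>u\<in>?U. if u div N = 0 then z else 1) = z ^ lab_zero N ?S K x"
     using fin by (simp add: prod.If_cases lab_zero_def Int_def conj_assoc)
    also have "(\<Prod>u\<in>?U. t (lab_code N ?S K x u)) = (\<Prod>i<?r. t i ^ lab_type N ?S K x i)"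
     using lab_code_less[OF x] by (subst prod_fibres[of _ _ ?r]) (auto simp: lab_type_def conj_assoc)
    finally show "const_pol (\<Prod>u | u < ?S * N & snd x u < K. c (u div N) (fst x u div N) (snd x u)) * lab_term N (?S * N) K x
     = const_pol (z ^ lab_zero N ?S K x) * ?f x"
     by (simp add: const_pol.hom_mult mult.assoc)
   qed
   finally show ?thesis .
  qed
  have det2: "Phi_tilde N e * det (1\<^sub>m N + gen_alg N (single 0 z * a))
   = (\<Sum>m\<le>N. const_pol (z ^ m) * Phi_tilde N (e * pi_tilde (sigma m a)))" for z
   using represents_pi_tilde[OF inf a]
   by (simp add: det_one_plus[OF alg_mat_carrier] sigma_gen_scale represents_def Phi.hom_mult sum_distrib_left algebra_simps)
  have "(\<Sum>x | x \<in> ?L <+> {..N} & (\<forall>i\<in>{0::nat}. case_sum (lab_zero N ?S K) (%m. m) x = \<rho>). case_sum ?f (%m. - Phi_tilde N (e * pi_tilde (sigma m a))) x)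
   \<in> high_degree d"
  proof (rule multigrade_mem[OF const_pol_hom inf, where A = "{0::nat}" and gs = "%_. \<rho>"
     and g = "%x _. case_sum (lab_zero N ?S K) (%m. m) x"])
   show "(\<Sum>m\<in>?L <+> {..N}. const_pol (\<Prod>i\<in>{0::nat}. z i ^ case_sum (lab_zero N ?S K) (%m. m) m)
    * case_sum ?f (%m. - Phi_tilde N (e * pi_tilde (sigma m a))) m) \<in> high_degree d" for z
    using e[of "z 0"] unfolding det1 det2 by (simp add: sum.Plus finite_lab_perms sum_negf)
  qed (auto intro: finite_lab_perms high_degree_add high_degree_mult2)
  also have "{x \<in> ?L <+> {..N}. \<forall>i\<in>{0::nat}. case_sum (lab_zero N ?S K) (%m. m) x = \<rho>}
   = {x \<in> ?L. lab_zero N ?S K x = \<rho>} <+> {m. m <= N & m = \<rho>}" by auto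
  finally have hd: "(\<Sum>x | x \<in> ?L & lab_zero N ?S K x = \<rho>. ?f x) - (\<Sum>m | m <= N & m = \<rho>. Phi_tilde N (e * pi_tilde (sigma m a))) \<in> high_degree d"
   by (simp add: sum.Plus finite_lab_perms sum_negf)
  have "(\<Sum>m | m <= N & m = \<rho>. Phi_tilde N (e * pi_tilde (sigma m a))) = Phi_tilde N (\<Sum>m | m <= N & m = \<rho>. e * pi_tilde (sigma m a))"
   by (simp add: Phi.hom_sum)
  moreover have "(\<Sum>m | m <= N & m = \<rho>. e * pi_tilde (sigma m a)) \<in> rel_ideal n"
   unfolding rel_ideal_def
   by (intro ideal_gen_sum ideal_gen_mult) (use pi_tilde_sigma_in_ideal[OF inf a, of n] assms in "auto simp: rel_ideal_def")
  ultimately show ?thesis using hd by (auto simp: ideal_mod_def)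
 qed
 hence "(\<Sum>x | x \<in> {x \<in> ?L. lab_zero N ?S K x = \<rho>} & (\<forall>i\<in>{..<?r}. lab_type N ?S K x i = \<nu> i). lab_term N (?S * N) K x) \<in> (ideal_mod n N d :: 'a gen_ring set)"
  by (intro multigrade_mem[OF const_pol_hom inf])
   (auto intro: finite_lab_perms ideal_mod_0 ideal_mod_add ideal_mod_scale finite_subset[OF _ finite_lab_perms[of "?S * N" K]])
 thus ?thesis by (simp add: conj_assoc Ball_def)
qed

end

subsection \<open>The lattice property of leading exponents\<close>

lemma poly_eqI_infinite:
 fixes p q :: "'a::field poly"
 assumes "infinite (UNIV :: 'a set)" "!!x. poly p x = poly q x"
 shows "p = q"
proof (rule ccontr)
 assume "p ~= q"
 hence "finite {x. poly (p - q) x = 0}" by (intro poly_roots_finite) simp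
 moreover have "{x. poly (p - q) x = 0} = UNIV" using assms(2) by auto
 ultimately show False using assms(1) by simp
qed

lemma coeff_linear_power_top:
 assumes "b <= k"
 shows "coeff ([:1, 1 :: 'a::field:] ^ b) k = (if b = k then 1 else 0)"
proof (cases "b = k")
 case True
 have "degree ([:1, 1 :: 'a:] ^ b) = b" by (simp add: degree_power_eq)
 thus ?thesis using True lead_coeff_power[of "[:1, 1 :: 'a:]" b] by simp
next
 case False
 thus ?thesis using assms by (simp add: coeff_eq_0 degree_power_eq)
qed

text \<open>Two adjacent rows of a form in isolation: column i has a variable \<xi>_i in the upper
  and \<eta>_i in the lower row with total exponent \<open>D i\<close>, of which
  \<open>be m i\<close> belongs to \<eta>_i. The assumption \<open>inv\<close> is invariance under
  adding the upper row to the lower one, and \<open>Max\<close> says that M leads when columns are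
  compared from the last one down.\<close>

locale lattice_form =
 fixes B :: "'k set" and be :: "'k => nat => nat" and ka :: "'k => 'a::field" and M :: 'k
  and D :: "nat => nat" and Q r :: nat
 assumes inf: "infinite (UNIV :: 'a set)" and fin: "finite B" and M: "M \<in> B" "ka M ~= 0"
  and bD: "!!m i. [|m \<in> B; i < r|] ==> be m i <= D i"
  and Q: "!!m. m \<in> B ==> (\<Sum>i<r. be m i) = Q"
  and inj: "!!m m'. [|m \<in> B; m' \<in> B; !!i. i < r ==> be m i = be m' i|] ==> m = m'"
  and Max: "!!m c. [|m \<in> B; c < r; !!i. [|c < i; i < r|] ==> be m i = be M i|] ==> be m c <= be M c"
  and inv: "!!\<xi> \<eta> :: nat => 'a. (\<Sum>m\<in>B. ka m * (\<Prod>i<r. \<xi> i ^ (D i - be m i) * (\<xi> i + \<eta> i) ^ be m i))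
   = (\<Sum>m\<in>B. ka m * (\<Prod>i<r. \<xi> i ^ (D i - be m i) * \<eta> i ^ be m i))"
begin

definition top :: "nat => 'k set" where
 "top s = {m \<in> B. \<forall>i. s <= i & i < r --> be m i = be M i}"

lemma finite_top [simp]: "finite (top s)"
 using fin by (simp add: top_def)

lemma M_top: "M \<in> top s"
 using M by (simp add: top_def)

text \<open>Put \<xi>_s = 1, \<eta>_s = y and compare the coefficients of y^(be M s). By
  \<open>Max\<close> no larger power of y occurs, so on both sides only the terms with be m s = be M
  s contribute, with factor 1.\<close>

lemma inv_top:
 assumes "s <= r"
 shows "\<forall>\<xi> \<eta> :: nat => 'a. (\<Sum>m\<in>top s. ka m * (\<Prod>i<s. \<xi> i ^ (D i - be m i) * (\<xi> i + \<eta> i) ^ be m i))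
   = (\<Sum>m\<in>top s. ka m * (\<Prod>i<s. \<xi> i ^ (D i - be m i) * \<eta> i ^ be m i))"
 using assms
proof (induction rule: inc_induct)
 case base
 have "top r = B" by (auto simp: top_def)
 thus ?case using inv by simp
next
 case (step s)
 show ?case
 proof (intro allI)
  fix \<xi> \<eta> :: "nat => 'a"
  define A where "A m = ka m * (\<Prod>i<s. \<xi> i ^ (D i - be m i) * (\<xi> i + \<eta> i) ^ be m i)" for m
  define A' where "A' m = ka m * (\<Prod>i<s. \<xi> i ^ (D i - be m i) * \<eta> i ^ be m i)" for m
  define p where "p = (\<Sum>m\<in>top (Suc s). smult (A m) ([:1, 1:] ^ be m s))"
  define p' where "p' = (\<Sum>m\<in>top (Suc s). monom (A' m) (be m s))"
  have "poly p y = poly p' y" for y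
  proof -
   let ?\<xi> = "\<xi>(s := 1)" and ?\<eta> = "\<eta>(s := y)"
   have "poly p y = (\<Sum>m\<in>top (Suc s). ka m * (\<Prod>i<Suc s. ?\<xi> i ^ (D i - be m i) * (?\<xi> i + ?\<eta> i) ^ be m i))"
    by (simp add: p_def poly_sum A_def mult.assoc)
   also have "... = (\<Sum>m\<in>top (Suc s). ka m * (\<Prod>i<Suc s. ?\<xi> i ^ (D i - be m i) * ?\<eta> i ^ be m i))"
    using step.IH by blast
   also have "... = poly p' y"
    by (simp add: p'_def poly_sum poly_monom A'_def mult.assoc)
   finally show ?thesis .
  qed
  hence eq: "p = p'" by (rule poly_eqI_infinite[OF inf])
  have le: "be m s <= be M s" if "m \<in> top (Suc s)" for m
   using that step.hyps by (intro Max) (auto simp: top_def)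
  have t: "{m \<in> top (Suc s). be m s = be M s} = top s"
  proof -
   have "(\<forall>i. s <= i & i < r --> be m i = be M i) \<longleftrightarrow> (\<forall>i. Suc s <= i & i < r --> be m i = be M i) & be m s = be M s" for m
    using step.hyps by (metis Suc_leD le_eq_less_or_eq less_eq_Suc_le order_refl)
   thus ?thesis by (auto simp: top_def)
  qed
  have "coeff p (be M s) = (\<Sum>m\<in>top (Suc s). if be m s = be M s then A m else 0)"
   unfolding p_def coeff_sum by (intro sum.cong) (auto simp: coeff_linear_power_top le)
  also have "... = (\<Sum>m\<in>top s. A m)" unfolding t[symmetric] by (simp add: sum.inter_filter)
  finally have 1: "coeff p (be M s) = (\<Sum>m\<in>top s. A m)" .
  have "coeff p' (be M s) = (\<Sum>m\<in>top (Suc s). if be m s = be M s then A' m else 0)"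
   unfolding p'_def coeff_sum by (intro sum.cong) auto
  also have "... = (\<Sum>m\<in>top s. A' m)" unfolding t[symmetric] by (simp add: sum.inter_filter)
  finally show "(\<Sum>m\<in>top s. ka m * (\<Prod>i<s. \<xi> i ^ (D i - be m i) * (\<xi> i + \<eta> i) ^ be m i))
   = (\<Sum>m\<in>top s. ka m * (\<Prod>i<s. \<xi> i ^ (D i - be m i) * \<eta> i ^ be m i))"
   using 1 eq by (simp add: A_def A'_def)
 qed
qed

lemma top_sum:
 assumes "m \<in> top s" "s <= r"
 shows "(\<Sum>i<s. be m i) = (\<Sum>i<s. be M i)"
proof -
 have split: "(\<Sum>i<r. be m' i) = (\<Sum>i<s. be m' i) + (\<Sum>i\<in>{s..<r}. be m' i)" for m'
  using assms(2) by (simp add: lessThan_atLeast0 sum.atLeastLessThan_concat)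
 have "(\<Sum>i\<in>{s..<r}. be m i) = (\<Sum>i\<in>{s..<r}. be M i)"
  using assms by (intro sum.cong) (auto simp: top_def)
 moreover have "(\<Sum>i<r. be m i) = (\<Sum>i<r. be M i)" using assms(1) M Q by (simp add: top_def)
 ultimately show ?thesis using split[of m] split[of M] by simp
qed

text \<open>With \<open>\<xi>\<^sub>c = 1\<close>, \<open>\<eta>\<^sub>c = -1\<close> the left side of the invariance keeps only the exponents with
 \<open>be\<^sub>c = 0\<close>. Along \<open>\<xi> = z - \<epsilon>y\<close>, \<open>\<eta> = \<epsilon>y\<close> its degree in \<open>\<epsilon>\<close> is then too small for the power of
 \<open>\<epsilon>\<close> which divides the right side, unless the asserted inequality holds.\<close>

theorem lattice:
 assumes c: "c < r"
 shows "(\<Sum>i\<le>c. be M i) <= (\<Sum>i<c. D i - be M i)"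
proof (rule ccontr)
 assume viol: "\<not> ?thesis"
 define q where "q = (\<Sum>i<c. be M i)"
 let ?T = "top (Suc c)"
 have TB: "m \<in> B" if "m \<in> ?T" for m using that by (simp add: top_def)
 have sums: "(\<Sum>i<c. be m i) + be m c = q + be M c" if "m \<in> ?T" for m
  using top_sum[OF that] c by (simp add: q_def)
 have le: "be m c <= be M c" if "m \<in> ?T" for m
  using that c by (intro Max) (auto simp: top_def)
 have Dsum: "(\<Sum>i<c. D i - be m i) + (\<Sum>i<c. be m i) = (\<Sum>i<c. D i)" if "m \<in> B" for m
  unfolding sum.distrib[symmetric] using bD[OF that] c by (intro sum.cong) auto
 have zero: "(\<Sum>m\<in>?T. ka m * (- 1) ^ be m c * (\<Prod>i<c. (z i - y i) ^ (D i - be m i) * y i ^ be m i)) = 0" for z y :: "nat => 'a"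
 proof -
  define L where "L = (\<Sum>m\<in>?T. smult (ka m * 0 ^ be m c) (\<Prod>i<c. [:z i, - y i:] ^ (D i - be m i) * [:z i:] ^ be m i))"
  define R where "R = (\<Sum>m\<in>?T. smult (ka m * (- 1) ^ be m c) (\<Prod>i<c. [:z i, - y i:] ^ (D i - be m i) * [:0, y i:] ^ be m i))"
  have polyR: "poly R e = (\<Sum>m\<in>?T. ka m * (- 1) ^ be m c * (\<Prod>i<c. (z i - e * y i) ^ (D i - be m i) * (e * y i) ^ be m i))" for e
   by (simp add: R_def poly_sum poly_prod)
  have "poly L e = poly R e" for e
  proof -
   let ?\<xi> = "%i. if i = c then 1 else z i - e * y i" and ?\<eta> = "%i. if i = c then - 1 else e * y i"
   have "poly L e = (\<Sum>m\<in>?T. ka m * (\<Prod>i<Suc c. ?\<xi> i ^ (D i - be m i) * (?\<xi> i + ?\<eta> i) ^ be m i))"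
    by (simp add: L_def poly_sum poly_prod algebra_simps)
   also have "... = (\<Sum>m\<in>?T. ka m * (\<Prod>i<Suc c. ?\<xi> i ^ (D i - be m i) * ?\<eta> i ^ be m i))"
    by (rule inv_top[rule_format, of "Suc c" ?\<xi> ?\<eta>]) (use c in simp)
   also have "... = poly R e" by (simp add: polyR algebra_simps)
   finally show ?thesis .
  qed
  hence LR: "L = R" by (rule poly_eqI_infinite[OF inf])
  have "coeff L k = 0" if "k \<ge> q" for k
   unfolding L_def coeff_sum
  proof (intro sum.neutral ballI)
   fix m assume m: "m \<in> ?T"
   show "coeff (smult (ka m * 0 ^ be m c) (\<Prod>i<c. [:z i, - y i:] ^ (D i - be m i) * [:z i:] ^ be m i)) k = 0"
   proof (cases "be m c = 0")
    case True
    have "degree (\<Prod>i<c. [:z i, - y i:] ^ (D i - be m i) * [:z i:] ^ be m i) <= (\<Sum>i<c. D i - be m i)"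
    proof (rule order_trans[OF degree_prod_sum_le], simp, rule sum_mono)
     fix i
     have "degree ([:z i, - y i:] ^ (D i - be m i)) <= 1 * (D i - be m i)"
      by (rule order_trans[OF degree_power_le]) (intro mult_le_mono1 degree_linear_le)
     moreover have "degree ([:z i:] ^ be m i) <= 0"
      by (rule order_trans[OF degree_power_le]) simp
     ultimately show "(degree \<circ> (%i. [:z i, - y i:] ^ (D i - be m i) * [:z i:] ^ be m i)) i <= D i - be m i"
      using degree_mult_le[of "[:z i, - y i:] ^ (D i - be m i)" "[:z i:] ^ be m i"] by simp
    qed
    also have "... < q"
     using Dsum[OF TB[OF m]] Dsum[OF M(1)] sums[OF m] True viol by (simp add: q_def lessThan_Suc_atMost[symmetric])
    finally show ?thesis using that by (simp add: coeff_eq_0)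
   qed simp
  qed
  moreover have "coeff R k = 0" if "k < q" for k
   unfolding R_def coeff_sum
  proof (intro sum.neutral ballI)
   fix m assume m: "m \<in> ?T"
   have "(\<Prod>i<c. [:z i, - y i:] ^ (D i - be m i) * [:0, y i:] ^ be m i)
    = monom 1 (\<Sum>i<c. be m i) * (\<Prod>i<c. [:z i, - y i:] ^ (D i - be m i) * [:y i:] ^ be m i)"
   proof -
    have "[:0, y i:] ^ b = monom 1 b * [:y i:] ^ b" for i b
    proof -
     have "[:0, y i:] ^ b = (monom 1 1 * [:y i:]) ^ b" by (simp add: monom_Suc monom_0)
     also have "... = monom 1 1 ^ b * [:y i:] ^ b" by (rule power_mult_distrib)
     also have "monom (1 :: 'a) 1 ^ b = monom 1 b" by (simp add: monom_power)
     finally show ?thesis .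
    qed
    moreover have "monom 1 (\<Sum>i<c. be m i) = (\<Prod>i<c. monom (1 :: 'a) (be m i))"
    proof -
     have "monom (1 :: 'a) (a + b) = monom 1 a * monom 1 b" for a b
      by (simp add: mult_monom)
     thus ?thesis by (induction c) (simp_all add: mult.commute)
    qed
    ultimately show ?thesis by (simp add: prod.distrib algebra_simps)
   qed
   moreover have "k < (\<Sum>i<c. be m i)" using sums[OF m] le[OF m] that by simp
   ultimately show "coeff (smult (ka m * (- 1) ^ be m c) (\<Prod>i<c. [:z i, - y i:] ^ (D i - be m i) * [:0, y i:] ^ be m i)) k = 0"
    by (simp add: coeff_monom_mult)
  qed
  ultimately have "R = 0" using LR by (intro poly_eqI) (metis coeff_0 not_le)
  thus ?thesis using polyR[of 1] by simp
 qed
 \<comment> \<open>With y = t and z = 1 + t the factors z_i - y_i become 1, so the exponents below c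
   separate the terms. Together with the total in \<open>sums\<close> they determine the term, and
   only M is left.\<close>
 have "(\<Sum>m | m \<in> ?T & (\<forall>i\<in>{..<c}. be m i = be M i). ka m * (- 1) ^ be m c) \<in> {0}"
 proof (rule multigrade_mem[OF comm_ring_hom_id inf])
  show "(\<Sum>m\<in>?T. (\<Prod>i<c. t i ^ be m i) * (ka m * (- 1) ^ be m c)) \<in> {0}" for t
   using zero[of "%i. 1 + t i" t] by (simp add: mult.commute)
 qed auto
 also have "{m \<in> ?T. \<forall>i\<in>{..<c}. be m i = be M i} = {M}"
 proof -
  have "m = M" if m: "m \<in> ?T" "\<forall>i\<in>{..<c}. be m i = be M i" for m
  proof (rule inj[OF TB[OF m(1)] M(1)])
   fix i assume i: "i < r"
   have "be m c = be M c" using sums[OF m(1)] m(2) by (simp add: q_def)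
   thus "be m i = be M i"
    using m i by (cases i c rule: linorder_cases) (auto simp: top_def)
  qed
  thus ?thesis using M_top by auto
 qed
 finally show False using M(2) by simp
qed

end

section \<open>Forms with P(gX) = P(Xg) and the lattice property of adjacent rows\<close>

lemma bij_betw_div_mod: "bij_betw (%c. (c mod N, c div N)) {..<u * N} ({..<N} \<times> {..<u :: nat})"
proof (rule bij_betwI[where g = "%(j, k). k * N + j"])
 show "(%c. (c mod N, c div N)) \<in> {..<u * N} \<rightarrow> {..<N} \<times> {..<u}"
 proof
  fix c assume "c \<in> {..<u * N}"
  thus "(c mod N, c div N) \<in> {..<N} \<times> {..<u}" by (cases "N = 0") (auto simp: less_mult_imp_div_less)
 qed
 show "(%(j, k). k * N + j) \<in> {..<N} \<times> {..<u} \<rightarrow> {..<u * N}"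
 proof
  fix x :: "nat \<times> nat" assume "x \<in> {..<N} \<times> {..<u}"
  then obtain j k where x: "x = (j, k)" "j < N" "k < u" by auto
  hence "Suc k * N <= u * N" by (intro mult_le_mono1) auto
  thus "(case x of (j, k) => k * N + j) \<in> {..<u * N}" using x by simp
 qed
qed auto

abbreviation vars :: "nat => nat => (nat \<times> nat \<times> nat) set" where
 "vars N u \<equiv> {..<N} \<times> {..<N} \<times> {..<u}"

text \<open>For invertible g the condition P(gX) = P(Xg) is invariance under conjugation. In this
  form it holds for singular g as well and needs no inverses, so both sides are polynomial in
  g.\<close>

locale gl_form =
 fixes N u :: nat and K :: "'k set" and co :: "'k => 'a::field" and e :: "'k => nat \<times> nat \<times> nat => nat"
 assumes inf: "infinite (UNIV :: 'a set)" and fin: "finite K"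
  and inj: "!!m m'. [|m \<in> K; m' \<in> K; !!v. v \<in> vars N u ==> e m v = e m' v|] ==> m = m'"
  and co: "!!m. m \<in> K ==> co m ~= 0"
  and invar: "!!(g :: nat => nat => 'a) Z.
   (\<Sum>m\<in>K. co m * (\<Prod>(i, j, k)\<in>vars N u. (\<Sum>l<N. g i l * Z (l, j, k)) ^ e m (i, j, k)))
   = (\<Sum>m\<in>K. co m * (\<Prod>(i, j, k)\<in>vars N u. (\<Sum>l<N. Z (i, l, k) * g l j) ^ e m (i, j, k)))"
begin

abbreviation "V \<equiv> vars N u"

definition row_wt :: "nat => 'k => nat" where
 "row_wt i m = (\<Sum>(j, k)\<in>{..<N} \<times> {..<u}. e m (i, j, k))"

definition col_wt :: "nat => 'k => nat" where
 "col_wt j m = (\<Sum>(i, k)\<in>{..<N} \<times> {..<u}. e m (i, j, k))"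

lemma prod_row:
 fixes t :: "nat => 'r::comm_ring_1"
 shows "(\<Prod>(i, j, k)\<in>V. t i ^ e m (i, j, k)) = (\<Prod>i<N. t i ^ row_wt i m)"
proof -
 have "(\<Prod>(i, j, k)\<in>V. t i ^ e m (i, j, k)) = (\<Prod>i<N. \<Prod>x\<in>{..<N} \<times> {..<u}. t i ^ e m (i, x))"
  by (subst prod.cartesian_product) (auto intro!: prod.cong)
 also have "... = (\<Prod>i<N. t i ^ row_wt i m)"
  by (simp add: row_wt_def power_sum case_prod_unfold)
 finally show ?thesis .
qed

lemma prod_col:
 fixes t :: "nat => 'r::comm_ring_1"
 shows "(\<Prod>(i, j, k)\<in>V. t j ^ e m (i, j, k)) = (\<Prod>j<N. t j ^ col_wt j m)"
proof -
 have "(\<Prod>(i, j, k)\<in>V. t j ^ e m (i, j, k)) = (\<Prod>(j, i, k)\<in>V. t j ^ e m (i, j, k))"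
  by (rule prod.reindex_bij_witness[where i = "%(j, i, k). (i, j, k)" and j = "%(i, j, k). (j, i, k)"]) auto
 also have "... = (\<Prod>j<N. \<Prod>(i, k)\<in>{..<N} \<times> {..<u}. t j ^ e m (i, j, k))"
  by (subst prod.cartesian_product) (auto intro!: prod.cong)
 also have "... = (\<Prod>j<N. t j ^ col_wt j m)"
  by (simp add: col_wt_def power_sum case_prod_unfold)
 finally show ?thesis .
qed

lemma prod_scaled:
 assumes "!!i j k. [|i < N; j < N|] ==> F i j k = T i j * W (i, j, k)"
 shows "(\<Prod>(i, j, k)\<in>V. F i j k ^ e m (i, j, k)) = (\<Prod>(i, j, k)\<in>V. T i j ^ e m (i, j, k)) * (\<Prod>v\<in>V. W v ^ e m v :: 'a)"
proof -
 have "(\<Prod>(i, j, k)\<in>V. F i j k ^ e m (i, j, k)) = (\<Prod>(i, j, k)\<in>V. T i j ^ e m (i, j, k) * W (i, j, k) ^ e m (i, j, k))"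
  using assms by (intro prod.cong) (auto simp: power_mult_distrib)
 thus ?thesis by (simp add: prod.distrib case_prod_unfold)
qed

text \<open>For g = diag(t) the left side of the invariance weights a monomial by its row weights
  and the right side by its column weights; the entries of Z act as further parameters that separate
  the monomials.\<close>

lemma row_eq_col:
 assumes m: "m \<in> K" and i: "i < N"
 shows "row_wt i m = col_wt i m"
proof -
 let ?A = "{..<N} <+> V"
 let ?g = "%m. case_sum (%i. row_wt i m) (e m)" and ?g' = "%m. case_sum (%i. col_wt i m) (e m)"
 have "(\<Sum>m'\<in>K. (\<Prod>i\<in>?A. t i ^ ?g m' i) * co m') = (\<Sum>m'\<in>K. (\<Prod>i\<in>?A. t i ^ ?g' m' i) * co m')" for t :: "nat + nat \<times> nat \<times> nat => 'a"
 proof -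
  let ?d = "%i l. if l = i then t (Inl i) else 0" and ?Z = "%v. t (Inr v)"
  have "(\<Prod>(i, j, k)\<in>V. (\<Sum>l<N. ?d i l * ?Z (l, j, k)) ^ e m' (i, j, k)) = (\<Prod>i\<in>?A. t i ^ ?g m' i)"
   "(\<Prod>(i, j, k)\<in>V. (\<Sum>l<N. ?Z (i, l, k) * ?d l j) ^ e m' (i, j, k)) = (\<Prod>i\<in>?A. t i ^ ?g' m' i)" for m'
   by (subst prod_scaled[where T = "%i j. t (Inl i)" and W = ?Z], simp add: if_distrib[of "%x. x * _"] cong: if_cong,
     simp add: prod_row prod.Plus,
     subst prod_scaled[where T = "%i j. t (Inl j)" and W = ?Z], simp add: if_distrib[of "%x. _ * x"] cong: if_cong,
     simp add: prod_col prod.Plus)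
  thus ?thesis using invar[of ?d ?Z] by (simp add: mult.commute)
 qed
 hence eq: "(\<Sum>m' | m' \<in> K & (\<forall>x\<in>?A. ?g m' x = ?g m x). co m') = (\<Sum>m' | m' \<in> K & (\<forall>x\<in>?A. ?g' m' x = ?g m x). co m')"
  by (intro multigrade_eq[OF comm_ring_hom_id inf fin fin]) auto
 have one: "m' = m" if "m' \<in> K" "\<forall>x\<in>?A. case_sum f (e m') x = ?g m x" for m' f
 proof (rule inj[OF that(1) m])
  fix v assume "v \<in> V"
  hence "case_sum f (e m') (Inr v) = ?g m (Inr v)" using that(2) by blast
  thus "e m' v = e m v" by simp
 qed
 hence "{m' \<in> K. \<forall>x\<in>?A. ?g m' x = ?g m x} = {m}" using m by blast
 hence "(\<Sum>m' | m' \<in> K & (\<forall>x\<in>?A. ?g' m' x = ?g m x). co m') ~= 0" using eq co[OF m] by simp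
 then obtain m' where m': "m' \<in> K" "\<forall>x\<in>?A. ?g' m' x = ?g m x" by (elim sum.not_neutral_contains_not_neutral) blast
 moreover have "Inl i \<in> ?A" using i by blast
 ultimately have "?g' m' (Inl i) = ?g m (Inl i)" by blast
 thus ?thesis using one[OF m'] by simp
qed

definition row_op :: "nat => (nat \<times> nat \<times> nat => 'a) => nat \<times> nat \<times> nat => 'a" where
 "row_op a Z = (%(i, j, k). Z (i, j, k) + (if i = Suc a then Z (a, j, k) else 0))"

text \<open>Conjugation by \<open>diag t\<close> turns the elementary matrix adding row \<open>a\<close> to row \<open>a + 1\<close> into one with
 the entry \<open>t\<^sub>a\<^sub>+\<^sub>1 / t\<^sub>a\<close>; the weight \<open>ch\<close> in \<open>t\<close> is compared after multiplication by a power of \<open>t\<^sub>a\<close>.\<close>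

lemma row_op_invariant:
 assumes a: "Suc a < N"
  and top: "!!m j. [|m \<in> K; j \<ge> 1|] ==>
   \<not> (\<forall>i<N. row_wt i m + (if i = Suc a then j else 0) = ch i + (if i = a then j else 0))"
 shows "(\<Sum>m | m \<in> K & (\<forall>i<N. row_wt i m = ch i). co m * (\<Prod>v\<in>V. row_op a Z v ^ e m v))
  = (\<Sum>m | m \<in> K & (\<forall>i<N. row_wt i m = ch i). co m * (\<Prod>v\<in>V. Z v ^ e m v))"
proof -
 define q where "q m = (\<Prod>(i, j, k)\<in>V. [:Z (i, j, k), if j = a then Z (i, Suc a, k) else 0:] ^ e m (i, j, k))" for m
 define D where "D = (\<Sum>m\<in>K. degree (q m))"
 have D: "degree (q m) <= D" if "m \<in> K" for m
  using member_le_sum[OF that, of "%m. degree (q m)"] fin by (simp add: D_def)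
 \<comment> \<open>The shift is D + 1 rather than D: then t_a keeps a positive exponent in every
   term, and both sides vanish for t_a = 0, where the conjugation is undefined.\<close>
 let ?g = "%m i. row_wt i m + (if i = a then Suc D else 0)"
 let ?g' = "%x i. row_wt i (fst x) + (if i = a then Suc D - snd x else 0) + (if i = Suc a then snd x else 0)"
 have "(\<Sum>m\<in>K. (\<Prod>i\<in>{..<N}. t i ^ ?g m i) * (co m * (\<Prod>v\<in>V. row_op a Z v ^ e m v)))
  = (\<Sum>x\<in>K \<times> {..D}. (\<Prod>i\<in>{..<N}. t i ^ ?g' x i) * (co (fst x) * coeff (q (fst x)) (snd x)))" for t :: "nat => 'a"
 proof -
  have pw: "(\<Prod>i<N. t i ^ (f i + (if i = b then j else 0))) = (\<Prod>i<N. t i ^ f i) * t b ^ j" if "b < N" for f b j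
   using that by (simp add: power_add prod.distrib if_distrib[of "%j. _ ^ j"] cong: if_cong)
  show ?thesis
  proof (cases "t a = 0")
   case True
   have "a < N" using a by simp
   have z1: "(\<Prod>i\<in>{..<N}. t i ^ ?g m i) = 0" for m using True by (subst pw[OF \<open>a < N\<close>]) simp
   have z2: "(\<Prod>i\<in>{..<N}. t i ^ ?g' x i) = 0" if "x \<in> K \<times> {..D}" for x
    using True that by (subst pw[OF a], subst pw[OF \<open>a < N\<close>]) (auto simp: Suc_diff_le)
   show ?thesis
    by (rule trans[OF sum.neutral sum.neutral[symmetric]]; intro ballI; simp only: z1 z2 mult_zero_left)
  next
   case False
   define s where "s = t (Suc a) / t a"
   have aN: "a < N" using a by simp
   let ?Y = "%(i, j, k). t i * Z (i, j, k)"
   let ?G = "%i l. (if l = i then 1 else 0) + (if l = a then if i = Suc a then s else 0 else 0)"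
   have sd: "(\<Sum>l<N. ((if l = i then 1 else 0) + (if l = b then c else 0)) * f l) = f i + c * f b" if "i < N" "b < N" for i b c and f :: "nat => 'a"
    using that by (simp add: distrib_right sum.distrib if_distrib[of "%x. x * _"] cong: if_cong)
   have "(\<Sum>l<N. ?G i l * ?Y (l, j, k)) = t i * row_op a Z (i, j, k)" if "i < N" for i j k
    using False by (subst sd[OF that aN]) (simp add: row_op_def s_def algebra_simps)
   hence 1: "(\<Prod>(i, j, k)\<in>V. (\<Sum>l<N. ?G i l * ?Y (l, j, k)) ^ e m (i, j, k)) = (\<Prod>i<N. t i ^ row_wt i m) * (\<Prod>v\<in>V. row_op a Z v ^ e m v)" for m
    by (subst prod_scaled[where T = "%i j. t i" and W = "row_op a Z"]) (simp_all add: prod_row)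
   have "(\<Sum>l<N. ?Y (i, l, k) * ?G l j) = t i * poly [:Z (i, j, k), if j = a then Z (i, Suc a, k) else 0:] s" if "j < N" for i j k
   proof -
    have "(\<Sum>l<N. ?Y (i, l, k) * ?G l j) = (\<Sum>l<N. ((if l = j then 1 else 0) + (if l = Suc a then if j = a then s else 0 else 0)) * ?Y (i, l, k))"
     by (intro sum.cong) auto
    thus ?thesis by (simp only: sd[OF that a]) (simp add: algebra_simps)
   qed
   hence 2: "(\<Prod>(i, j, k)\<in>V. (\<Sum>l<N. ?Y (i, l, k) * ?G l j) ^ e m (i, j, k)) = (\<Prod>i<N. t i ^ row_wt i m) * poly (q m) s" for m
    by (subst prod_scaled[where T = "%i j. t i" and W = "%(i, j, k). poly [:Z (i, j, k), if j = a then Z (i, Suc a, k) else 0:] s"])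
     (simp, simp only: prod_row, simp add: q_def poly_prod case_prod_unfold del: poly_pCons)
   have qs: "poly (q m) s * t a ^ Suc D = (\<Sum>j\<le>D. coeff (q m) j * (t a ^ (Suc D - j) * t (Suc a) ^ j))" if "m \<in> K" for m
   proof -
    have "poly (q m) s = (\<Sum>j\<le>D. coeff (q m) j * s ^ j)"
     unfolding poly_altdef by (rule sum.mono_neutral_left) (use D[OF that] in "auto simp: coeff_eq_0")
    moreover have "s ^ j * t a ^ Suc D = t a ^ (Suc D - j) * t (Suc a) ^ j" if "j <= D" for j
     using False that power_add[of "t a" "Suc D - j" j] by (simp add: s_def power_divide)
    ultimately show ?thesis by (simp add: sum_distrib_right mult.assoc)
   qed
   have "(\<Sum>m\<in>K. co m * ((\<Prod>i<N. t i ^ row_wt i m) * (\<Prod>v\<in>V. row_op a Z v ^ e m v)))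
    = (\<Sum>m\<in>K. co m * ((\<Prod>i<N. t i ^ row_wt i m) * poly (q m) s))"
    using invar[of ?G ?Y] unfolding 1 2 .
   hence "(\<Sum>m\<in>K. co m * ((\<Prod>i<N. t i ^ row_wt i m) * (\<Prod>v\<in>V. row_op a Z v ^ e m v))) * t a ^ Suc D
    = (\<Sum>m\<in>K. co m * ((\<Prod>i<N. t i ^ row_wt i m) * (poly (q m) s * t a ^ Suc D)))"
    by (simp add: sum_distrib_right mult.assoc)
   thus ?thesis
    by (simp add: pw[OF aN] pw[OF a] qs sum.cartesian_product case_prod_unfold sum_distrib_left sum_distrib_right mult_ac
      cong: sum.cong del: power_Suc)
  qed
 qed
 hence "(\<Sum>m | m \<in> K & (\<forall>i\<in>{..<N}. ?g m i = ch i + (if i = a then Suc D else 0)). co m * (\<Prod>v\<in>V. row_op a Z v ^ e m v))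
  = (\<Sum>x | x \<in> K \<times> {..D} & (\<forall>i\<in>{..<N}. ?g' x i = ch i + (if i = a then Suc D else 0)). co (fst x) * coeff (q (fst x)) (snd x))"
  by (intro multigrade_eq[OF comm_ring_hom_id inf]) (use fin in simp_all)
 also have "{x \<in> K \<times> {..D}. \<forall>i\<in>{..<N}. ?g' x i = ch i + (if i = a then Suc D else 0)} = (%m. (m, 0)) ` {m \<in> K. \<forall>i<N. row_wt i m = ch i}" (is "?X = ?X'")
 proof (intro equalityI subsetI)
  fix x assume "x \<in> ?X"
  define m j where "m = fst x" and "j = snd x"
  have x: "x = (m, j)" "m \<in> K" "j <= D" and "\<forall>i\<in>{..<N}. ?g' x i = ch i + (if i = a then Suc D else 0)"
   using \<open>x \<in> ?X\<close> by (auto simp: m_def j_def)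
  hence eq: "row_wt i m + (if i = a then Suc D - j else 0) + (if i = Suc a then j else 0) = ch i + (if i = a then Suc D else 0)" if "i < N" for i
   using that by (metis fst_conv snd_conv lessThan_iff)
  have r: "row_wt i m + (if i = Suc a then j else 0) = ch i + (if i = a then j else 0)" if "i < N" for i
   using eq[OF that] x(3) by (auto split: if_splits)
  hence j: "j = 0" using top[OF x(2), of j] by (cases j) auto
  hence "row_wt i m = ch i" if "i < N" for i using r[OF that] by (simp split: if_splits)
  thus "x \<in> ?X'" using x j by blast
 qed auto
 finally show ?thesis
  by (simp add: sum.reindex inj_on_def Ball_def q_def poly_0_coeff_0[symmetric] poly_prod case_prod_unfold)
qed

definition x_var :: "nat => nat => nat \<times> nat \<times> nat" where
 "x_var a c = (a, c mod N, c div N)"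

lemma prod_V_rows:
 fixes F :: "nat \<times> nat \<times> nat => 'r::comm_monoid_mult"
 assumes "Suc a < N"
 shows "(\<Prod>v\<in>V. F v) = (\<Prod>v\<in>{v \<in> V. fst v ~= a & fst v ~= Suc a}. F v) * (\<Prod>c<u * N. F (x_var a c) * F (x_var (Suc a) c))"
proof -
 let ?R = "%b. {b} \<times> ({..<N} \<times> {..<u})"
 have r: "(\<Prod>v\<in>?R b. F v) = (\<Prod>c<u * N. F (x_var b c))" for b
 proof -
  have "(\<Prod>v\<in>?R b. F v) = (\<Prod>x\<in>{..<N} \<times> {..<u}. F (b, x))"
   by (rule prod.reindex_bij_witness[where i = "%x. (b, x)" and j = snd]) auto
  also have "... = (\<Prod>c<u * N. F (b, c mod N, c div N))"
   by (rule prod.reindex_bij_betw[OF bij_betw_div_mod, symmetric])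
  finally show ?thesis by (simp add: x_var_def)
 qed
 have "V = {v \<in> V. fst v ~= a & fst v ~= Suc a} \<union> (?R a \<union> ?R (Suc a))" using assms by auto
 hence "(\<Prod>v\<in>V. F v) = (\<Prod>v\<in>{v \<in> V. fst v ~= a & fst v ~= Suc a} \<union> (?R a \<union> ?R (Suc a)). F v)" by simp
 also have "... = (\<Prod>v\<in>{v \<in> V. fst v ~= a & fst v ~= Suc a}. F v) * (\<Prod>v\<in>?R a \<union> ?R (Suc a). F v)"
  by (rule prod.union_disjoint) auto
 also have "(\<Prod>v\<in>?R a \<union> ?R (Suc a). F v) = (\<Prod>v\<in>?R a. F v) * (\<Prod>v\<in>?R (Suc a). F v)"
  by (rule prod.union_disjoint) auto
 finally show ?thesis by (simp add: r prod.distrib)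
qed

lemma row_x_var: "row_wt i m = (\<Sum>c<u * N. e m (x_var i c))"
proof -
 have "(\<Sum>x\<in>{..<N} \<times> {..<u}. e m (i, x)) = (\<Sum>c<u * N. e m (i, c mod N, c div N))"
  by (rule sum.reindex_bij_betw[OF bij_betw_div_mod, symmetric])
 thus ?thesis by (simp add: row_wt_def x_var_def case_prod_unfold)
qed

text \<open>\<open>lattice_form\<close> is applied to the monomials of row weights \<open>ch\<close>
  that agree with M outside the rows a and a + 1 and have the same column totals in these two rows.
  These data can be fixed because \<open>row_op\<close> preserves the degree in each other variable
  and in each pair of variables of one column of the two rows.\<close>

lemma row_lattice:
 assumes a: "Suc a < N" and M: "M \<in> K" "!!i. i < N ==> row_wt i M = ch i"
  and top: "!!m j. [|m \<in> K; j \<ge> 1|] ==>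
   \<not> (\<forall>i<N. row_wt i m + (if i = Suc a then j else 0) = ch i + (if i = a then j else 0))"
  and Max: "!!m c. [|m \<in> K; !!i. i < N ==> row_wt i m = ch i; c < u * N;
   !!v. [|v \<in> V; fst v ~= a; fst v ~= Suc a|] ==> e m v = e M v;
   !!i. [|c < i; i < u * N|] ==> e m (x_var a i) = e M (x_var a i) & e m (x_var (Suc a) i) = e M (x_var (Suc a) i)|]
   ==> e m (x_var (Suc a) c) <= e M (x_var (Suc a) c)"
  and c: "c < u * N"
 shows "(\<Sum>i\<le>c. e M (x_var (Suc a) i)) <= (\<Sum>i<c. e M (x_var a i))"
proof -
 define H where "H = {m \<in> K. \<forall>i<N. row_wt i m = ch i}"
 let ?V' = "{v \<in> V. fst v ~= a & fst v ~= Suc a}"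
 let ?A = "?V' <+> {..<u * N}"
 let ?g = "%m. case_sum (e m) (%c. e m (x_var a c) + e m (x_var (Suc a) c))"
 define B where "B = {m \<in> H. \<forall>x\<in>?A. ?g m x = ?g M x}"
 define D where "D i = e M (x_var a i) + e M (x_var (Suc a) i)" for i
 have fH: "finite H" using fin by (simp add: H_def)
 have MH: "M \<in> H" using M by (simp add: H_def)
 have BV: "e m v = e M v" if "m \<in> B" "v \<in> ?V'" for m v
 proof -
  have "Inl v \<in> ?A" using that(2) by blast
  hence "?g m (Inl v) = ?g M (Inl v)" using that(1) unfolding B_def by blast
  thus ?thesis by simp
 qed
 have BD: "e m (x_var a i) + e m (x_var (Suc a) i) = D i" if "m \<in> B" "i < u * N" for m i
 proof -
  have "Inr i \<in> ?A" using that(2) by blast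
  hence "?g m (Inr i) = ?g M (Inr i)" using that(1) unfolding B_def by blast
  thus ?thesis by (simp add: D_def)
 qed
 have inV: "x_var b i \<in> V" if "b < N" "i < u * N" for b i
  using bij_betwE[OF bij_betw_div_mod[of N u]] that by (force simp: x_var_def)
 interpret lattice_form B "%m i. e m (x_var (Suc a) i)" co M D "ch (Suc a)" "u * N"
 proof
  show "infinite (UNIV :: 'a set)" by (rule inf)
  show "finite B" using fH by (simp add: B_def)
  show "M \<in> B" using MH by (simp add: B_def)
  show "co M ~= 0" by (rule co[OF M(1)])
  show "e m (x_var (Suc a) i) <= D i" if "m \<in> B" "i < u * N" for m i
   using BD[OF that] by simp
  show "(\<Sum>i<u * N. e m (x_var (Suc a) i)) = ch (Suc a)" if "m \<in> B" for m
   using that a by (simp add: B_def H_def flip: row_x_var)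
  show "m = m'" if m: "m \<in> B" "m' \<in> B" and eq: "!!i. i < u * N ==> e m (x_var (Suc a) i) = e m' (x_var (Suc a) i)" for m m'
  proof (rule inj)
   show "m \<in> K" "m' \<in> K" using m by (auto simp: B_def H_def)
   fix v assume v: "v \<in> V"
   obtain b j k where bjk: "v = (b, j, k)" by (metis prod_cases3)
   hence "(j, k) \<in> (%c. (c mod N, c div N)) ` {..<u * N}" using v bij_betw_imp_surj_on[OF bij_betw_div_mod[of N u]] by auto
   then obtain i where i: "i < u * N" "v = x_var b i" by (auto simp: x_var_def bjk)
   show "e m v = e m' v"
   proof (cases "b = a \<or> b = Suc a")
    case True
    thus ?thesis using eq[OF i(1)] BD[OF m(1) i(1)] BD[OF m(2) i(1)] i(2) by auto
   next
    case False
    thus ?thesis using BV[OF m(1), of v] BV[OF m(2), of v] v bjk by simp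
   qed
  qed
  show "e m (x_var (Suc a) c) <= e M (x_var (Suc a) c)"
   if m: "m \<in> B" and c: "c < u * N" and eq: "!!i. [|c < i; i < u * N|] ==> e m (x_var (Suc a) i) = e M (x_var (Suc a) i)" for m c
  proof (rule Max[OF _ _ c])
   show "m \<in> K" "!!i. i < N ==> row_wt i m = ch i" using m by (auto simp: B_def H_def)
   show "e m v = e M v" if "v \<in> V" "fst v ~= a" "fst v ~= Suc a" for v using BV[OF m, of v] that by simp
   show "e m (x_var a i) = e M (x_var a i) & e m (x_var (Suc a) i) = e M (x_var (Suc a) i)" if "c < i" "i < u * N" for i
    using eq[OF that] BD[OF m that(2)] by (simp add: D_def)
  qed
  fix \<xi> \<eta> :: "nat => 'a"
  have eq: "(\<Sum>m | m \<in> H & (\<forall>x\<in>?A. ?g m x = ?g M x). co m * (\<Prod>c<u * N. \<xi> c ^ e m (x_var a c) * (\<xi> c + \<eta> c) ^ e m (x_var (Suc a) c)))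
   = (\<Sum>m | m \<in> H & (\<forall>x\<in>?A. ?g m x = ?g M x). co m * (\<Prod>c<u * N. \<xi> c ^ e m (x_var a c) * \<eta> c ^ e m (x_var (Suc a) c)))"
  proof (rule multigrade_eq[OF comm_ring_hom_id inf fH fH])
   fix t :: "nat \<times> nat \<times> nat + nat => 'a"
   \<comment> \<open>The scalars t mark each variable outside the two rows and, jointly for both
     rows, each column; comparing multidegrees in t selects the set \<open>B\<close>.\<close>
   define Z where "Z = (%(i, j, k). if i = a then t (Inr (k * N + j)) * \<xi> (k * N + j)
    else if i = Suc a then t (Inr (k * N + j)) * \<eta> (k * N + j) else t (Inl (i, j, k)))"
   have xa: "Z (x_var a c) = t (Inr c) * \<xi> c" and ya: "Z (x_var (Suc a) c) = t (Inr c) * \<eta> c" for c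
    by (simp_all add: Z_def x_var_def)
   have xa': "row_op a Z (x_var a c) = t (Inr c) * \<xi> c" and ya': "row_op a Z (x_var (Suc a) c) = t (Inr c) * (\<xi> c + \<eta> c)" for c
    using xa[of c] ya[of c] by (simp_all add: row_op_def x_var_def algebra_simps)
   have o: "Z v = t (Inl v)" "row_op a Z v = t (Inl v)" if "v \<in> ?V'" for v
    using that by (auto simp: Z_def row_op_def)
   have "(\<Prod>v\<in>V. Z v ^ e m v) = (\<Prod>i\<in>?A. t i ^ ?g m i) * (\<Prod>c<u * N. \<xi> c ^ e m (x_var a c) * \<eta> c ^ e m (x_var (Suc a) c))" for m
   proof -
    have "(\<Prod>v\<in>?V'. Z v ^ e m v) = (\<Prod>v\<in>?V'. t (Inl v) ^ e m v)" by (intro prod.cong refl) (simp only: o)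
    thus ?thesis
     by (simp add: prod_V_rows[OF a] xa ya prod.Plus power_mult_distrib power_add prod.distrib mult_ac)
   qed
   moreover have "(\<Prod>v\<in>V. row_op a Z v ^ e m v) = (\<Prod>i\<in>?A. t i ^ ?g m i) * (\<Prod>c<u * N. \<xi> c ^ e m (x_var a c) * (\<xi> c + \<eta> c) ^ e m (x_var (Suc a) c))" for m
   proof -
    have "(\<Prod>v\<in>?V'. row_op a Z v ^ e m v) = (\<Prod>v\<in>?V'. t (Inl v) ^ e m v)" by (intro prod.cong refl) (simp only: o)
    thus ?thesis
     by (simp add: prod_V_rows[OF a] xa' ya' prod.Plus power_mult_distrib power_add prod.distrib mult_ac)
   qed
   ultimately show "(\<Sum>m\<in>H. (\<Prod>i\<in>?A. t i ^ ?g m i) * (co m * (\<Prod>c<u * N. \<xi> c ^ e m (x_var a c) * (\<xi> c + \<eta> c) ^ e m (x_var (Suc a) c))))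
    = (\<Sum>m\<in>H. (\<Prod>i\<in>?A. t i ^ ?g m i) * (co m * (\<Prod>c<u * N. \<xi> c ^ e m (x_var a c) * \<eta> c ^ e m (x_var (Suc a) c))))"
    using row_op_invariant[OF a top, of Z] by (simp add: H_def mult.left_commute)
  qed simp
  have ex: "e m (x_var a i) = D i - e m (x_var (Suc a) i)" if "m \<in> B" "i < u * N" for m i
   using BD[OF that] by simp
  show "(\<Sum>m\<in>B. co m * (\<Prod>i<u * N. \<xi> i ^ (D i - e m (x_var (Suc a) i)) * (\<xi> i + \<eta> i) ^ e m (x_var (Suc a) i)))
   = (\<Sum>m\<in>B. co m * (\<Prod>i<u * N. \<xi> i ^ (D i - e m (x_var (Suc a) i)) * \<eta> i ^ e m (x_var (Suc a) i)))"
  proof -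
   have "(\<Sum>m\<in>B. co m * (\<Prod>i<u * N. \<xi> i ^ (D i - e m (x_var (Suc a) i)) * F m i))
    = (\<Sum>m\<in>B. co m * (\<Prod>i<u * N. \<xi> i ^ e m (x_var a i) * F m i))" for F
    by (intro sum.cong refl arg_cong2[of _ _ _ _ "(*)"] prod.cong) (simp add: ex)
   thus ?thesis using eq unfolding B_def[symmetric] by (simp only:)
  qed
 qed
 show ?thesis using lattice[OF c] by (simp add: D_def)
qed

end

subsection \<open>Pictures\<close>

text \<open>A cell (a, i) is row a of block i of a node matrix, and an edge from (a, i) to (b, j)
  with label k stands for the factor x_ab(k) taken from block (i, j). An edge system is thus a
  labelled permutation of its cells.\<close>

type_synonym cell = "nat \<times> nat"
type_synonym edge = "cell \<times> cell \<times> nat"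

abbreviation src :: "edge => cell" where "src x \<equiv> fst x"
abbreviation tgt :: "edge => cell" where "tgt x \<equiv> fst (snd x)"
abbreviation lab :: "edge => nat" where "lab x \<equiv> snd (snd x)"

abbreviation srow :: "edge => nat" where "srow x \<equiv> fst (src x)"
abbreviation scol :: "edge => nat" where "scol x \<equiv> snd (src x)"
abbreviation trow :: "edge => nat" where "trow x \<equiv> fst (tgt x)"
abbreviation tcol :: "edge => nat" where "tcol x \<equiv> snd (tgt x)"

definition edge_rev :: "edge => edge" where
 "edge_rev x = (tgt x, src x, lab x)"

lemma edge_rev_simps [simp]: "src (edge_rev x) = tgt x" "tgt (edge_rev x) = src x" "lab (edge_rev x) = lab x"
 "edge_rev (edge_rev x) = x"
 by (simp_all add: edge_rev_def)

lemma inj_edge_rev: "inj_on edge_rev E"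
 by (rule inj_on_inverseI[of _ edge_rev]) simp

lemma card_edge_rev: "card {x \<in> edge_rev ` E. P x} = card {x \<in> E. P (edge_rev x)}"
proof -
 have "{x \<in> edge_rev ` E. P x} = edge_rev ` {x \<in> E. P (edge_rev x)}" by auto
 thus ?thesis by (simp add: card_image[OF inj_edge_rev])
qed

definition edge_system :: "cell set => edge set => bool" where
 "edge_system U E \<longleftrightarrow> finite E & inj_on src E & src ` E = U & inj_on tgt E & tgt ` E = U"

lemma edge_system_rev: "edge_system U E ==> edge_system U (edge_rev ` E)"
 unfolding edge_system_def by (auto simp: image_image o_def intro!: inj_on_imageI)

abbreviation etype :: "edge => nat \<times> nat \<times> nat" where "etype x \<equiv> (scol x, tcol x, lab x)"
abbreviation evar :: "edge => nat \<times> nat \<times> nat" where "evar x \<equiv> (srow x, trow x, lab x)"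

definition edge_type :: "edge set => nat \<times> nat \<times> nat => nat" where
 "edge_type E v = card {x \<in> E. etype x = v}"

definition edge_exps :: "edge set => nat \<times> nat \<times> nat => nat" where
 "edge_exps E v = card {x \<in> E. evar x = v}"

lemma card_fibres:
 assumes "finite F" "finite T" "!!x. [|x \<in> F; Q x|] ==> f x \<in> T"
 shows "card {x \<in> F. Q x} = (\<Sum>v\<in>T. card {x \<in> F. f x = v & Q x})"
proof -
 have "{x \<in> F. Q x} = (\<Union>v\<in>T. {x \<in> F. f x = v & Q x})" using assms(3) by auto
 moreover have "card (\<Union>v\<in>T. {x \<in> F. f x = v & Q x}) = (\<Sum>v\<in>T. card {x \<in> F. f x = v & Q x})"
  by (rule card_UN_disjoint) (use assms in auto)
 ultimately show ?thesis by (simp only:)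
qed

lemma same_fibres:
 assumes "finite E" "finite F" "!!v. card {x \<in> E. f x = v} = card {x \<in> F. f x = v}"
 shows "image_mset f (mset_set E) = image_mset f (mset_set F)"
proof (rule multiset_eqI)
 have *: "count (image_mset f (mset_set G)) v = card {x \<in> G. f x = v}" if "finite G" for G v
  using that by (simp add: count_image_mset vimage_def Int_def conj_commute)
 show "count (image_mset f (mset_set E)) v = count (image_mset f (mset_set F)) v" for v
  unfolding *[OF assms(1)] *[OF assms(2)] by (rule assms(3))
qed

lemma card_fibres_eq:
 assumes "finite E" "finite F" "!!v. card {x \<in> E. f x = v} = card {x \<in> F. f x = v}"
 shows "card {x \<in> E. Q (f x)} = card {x \<in> F. Q (f x)}"
proof -
 have "card {x \<in> G. Q (f x)} = size (filter_mset Q (image_mset f (mset_set G)))" if "finite G" for G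
  using that by (simp add: filter_mset_image_mset filter_mset_mset_set)
 thus ?thesis using same_fibres[OF assms] assms by simp
qed

lemma edge_type_card_eq:
 assumes "finite E" "finite F" "edge_type E = edge_type F"
 shows "card {x \<in> E. P (scol x) (tcol x) (lab x)} = card {x \<in> F. P (scol x) (tcol x) (lab x)}"
 using card_fibres_eq[OF assms(1,2) fun_cong[OF assms(3), unfolded edge_type_def], of "%(i, j, k). P i j k"] by simp

text \<open>A picture is an edge system on the diagram of a partition such that the codes \<open>(k, b)\<close> of the
 edges leaving the cells form a semistandard tableau (strictly increasing down the columns, weakly
 along the rows), likewise the codes \<open>(k, a)\<close> of the edges entering the cells, and which preserves
 contents up to a shift depending on \<open>(a, b, k)\<close> only.\<close>

definition code_less :: "nat \<times> nat => nat \<times> nat => bool" where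
 "code_less c d \<longleftrightarrow> fst c < fst d \<or> fst c = fst d & snd c < snd d"

abbreviation out_code :: "edge => nat \<times> nat" where "out_code x \<equiv> (lab x, trow x)"

definition col_strict :: "edge set => bool" where
 "col_strict E \<longleftrightarrow> (\<forall>x\<in>E. \<forall>y\<in>E. scol x = scol y & srow x < srow y --> code_less (out_code x) (out_code y))"

definition diagram :: "nat => (nat => nat) => cell set" where
 "diagram N ch = {(a, i). a < N & i < ch a}"

text \<open>The tableau condition at the sources alone. The condition at the targets is the same one
  for the reversed edges, so each counting argument is made once and transported by
  \<open>edge_rev\<close>.\<close>

locale half_picture =
 fixes N :: nat and ch :: "nat => nat" and E0 :: "edge set"
 assumes decr: "!!a. Suc a < N ==> ch (Suc a) <= ch a"
  and sys0: "edge_system (diagram N ch) E0"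
  and strict: "col_strict E0"
begin

lemma chi_antimono: "a <= b ==> b < N ==> ch b <= ch a"
 by (induction b rule: dec_induct) (auto intro: order_trans[OF decr])

lemma diagram_up: "(b, i) \<in> diagram N ch ==> a <= b ==> (a, i) \<in> diagram N ch"
 using chi_antimono[of a b] by (auto simp: diagram_def)

lemma ex_edge: "c \<in> diagram N ch ==> \<exists>x\<in>E0. src x = c"
 using sys0 unfolding edge_system_def by (metis imageE)

lemma fin0: "finite E0" using sys0 by (simp add: edge_system_def)

lemma strictD:
 "[|x \<in> E0; y \<in> E0; scol x = scol y; srow x < srow y|] ==> code_less (out_code x) (out_code y)"
 using strict unfolding col_strict_def by blast

lemma src_diagram: "x \<in> E0 ==> src x \<in> diagram N ch"
 using sys0 by (auto simp: edge_system_def)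

lemma same_row_eq:
 "[|x \<in> E0; y \<in> E0; scol x = scol y; srow x = srow y|] ==> x = y"
 using sys0 unfolding edge_system_def inj_on_def by (metis prod_eq_iff)

lemma lab_mono:
 "[|x \<in> E0; y \<in> E0; scol x = scol y; srow x <= srow y|] ==> lab x <= lab y"
 using strictD[of x y] same_row_eq[of x y] by (cases "srow x = srow y") (auto simp: code_less_def)

text \<open>The label is monotone down a column, hence constant between x and y, and with constant
  label the target row grows at every cell.\<close>

lemma chain:
 assumes "x \<in> E0" "y \<in> E0" "scol x = scol y" "srow x <= srow y" "lab x = lab y"
 shows "trow x + (srow y - srow x) <= trow y"
 using assms
proof (induction "srow y - srow x" arbitrary: y)
 case 0
 thus ?case using same_row_eq[of x y] by auto
next
 case (Suc d)
 let ?a = "srow y - 1" and ?i = "scol y"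
 have "(srow y, ?i) \<in> diagram N ch" using src_diagram[OF Suc.prems(2)] by simp
 hence "(?a, ?i) \<in> diagram N ch" by (rule diagram_up) simp
 then obtain z where z: "z \<in> E0" "src z = (?a, ?i)" using ex_edge by blast
 have zy: "code_less (out_code z) (out_code y)" using z Suc by (intro strictD) auto
 have xz: "lab x <= lab z" using z Suc by (intro lab_mono) auto
 have lz: "lab z = lab y" using zy xz Suc.prems(5) by (auto simp: code_less_def)
 have "trow x + (srow z - srow x) <= trow z"
  using Suc.hyps z lz Suc.prems by (intro Suc.hyps(1)) auto
 moreover have "trow z < trow y" using zy lz by (auto simp: code_less_def)
 ultimately show ?case using z Suc.hyps(2) by auto
qed

text \<open>Labels increase weakly down column i of the picture. So either all its edges with label
  at least k start in rows from a0 on, and the type bounds the count, or all cells of the column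
  from a0 on carry labels at least k, and the number of cells bounds it.\<close>

lemma bottom:
 assumes E: "edge_system (diagram N ch) E" and type: "edge_type E = edge_type E0"
 shows "card {x \<in> E. scol x = i & k <= lab x & a0 <= srow x}
  <= card {x \<in> E0. scol x = i & k <= lab x & a0 <= srow x}" (is "card ?A <= card ?B")
proof (cases "\<exists>y\<in>E0. scol y = i & a0 <= srow y & lab y < k")
 case True
 then obtain y where y: "y \<in> E0" "scol y = i" "a0 <= srow y" "lab y < k" by blast
 have fE: "finite E" using E by (simp add: edge_system_def)
 have "card ?A <= card {x \<in> E. scol x = i & k <= lab x}"
  using fE by (intro card_mono) auto
 also have "... = card {x \<in> E0. scol x = i & k <= lab x}"
  using edge_type_card_eq[OF fE fin0 type, of "%i' j l. i' = i & k <= l"] .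
 also have "{x \<in> E0. scol x = i & k <= lab x} = ?B"
 proof -
  have "a0 <= srow x" if "x \<in> E0" "scol x = i" "k <= lab x" for x
   using lab_mono[OF that(1) y(1)] that y by (cases "srow x <= srow y") auto
  thus ?thesis by blast
 qed
 finally show ?thesis .
next
 case False
 have fE: "finite E" using E by (simp add: edge_system_def)
 have "inj_on src E" using E by (simp add: edge_system_def)
 hence "inj_on src ?A" by (rule inj_on_subset) blast
 hence "card ?A = card (src ` ?A)" by (rule card_image[symmetric])
 also have "... <= card (src ` ?B)"
 proof (rule card_mono)
  show "finite (src ` ?B)" using fin0 by simp
  show "src ` ?A \<subseteq> src ` ?B"
  proof
   fix c assume "c \<in> src ` ?A"
   then obtain x where x: "x \<in> E" "c = src x" "scol x = i" "a0 <= srow x" by blast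
   hence "c \<in> diagram N ch" using E by (auto simp: edge_system_def)
   then obtain y where y: "y \<in> E0" "src y = c" using ex_edge by blast
   hence "y \<in> ?B" using False x by (auto simp: not_less)
   thus "c \<in> src ` ?B" using y(2) by blast
  qed
 qed
 also have "... <= card ?B" using fin0 by (intro card_image_le) simp
 finally show ?thesis .
qed

lemma bottom_eq:
 assumes E: "edge_system (diagram N ch) E" and type: "edge_type E = edge_type E0"
  and tot: "card {x \<in> E. k <= lab x & a0 <= srow x} = card {x \<in> E0. k <= lab x & a0 <= srow x}"
 shows "card {x \<in> E. scol x = i & k <= lab x & a0 <= srow x}
  = card {x \<in> E0. scol x = i & k <= lab x & a0 <= srow x}"
proof -
 have fE: "finite E" using E by (simp add: edge_system_def)
 define T where "T = insert i (snd ` src ` E \<union> snd ` src ` E0)"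
 have T: "finite T" "i \<in> T" using fE fin0 by (simp_all add: T_def)
 let ?c = "%F i. card {x \<in> F. scol x = i & k <= lab x & a0 <= srow x}"
 have s: "card {x \<in> F. k <= lab x & a0 <= srow x} = (\<Sum>i\<in>T. ?c F i)" if "F = E \<or> F = E0" for F
  by (rule card_fibres) (use that fE fin0 T in "auto simp: T_def")
 have "?c E i' <= ?c E0 i'" for i' by (rule bottom[OF E type])
 moreover have "(\<Sum>i\<in>T. ?c E i) = (\<Sum>i\<in>T. ?c E0 i)" using s[of E] s[of E0] tot by simp
 ultimately show ?thesis using sum_mono_inv[of "?c E" T "?c E0" i] T by blast
qed

lemma exact_label_le:
 assumes E: "edge_system (diagram N ch) E" and type: "edge_type E = edge_type E0"
  and tot: "card {x \<in> E. Suc k <= lab x & a0 <= srow x} = card {x \<in> E0. Suc k <= lab x & a0 <= srow x}"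
 shows "card {x \<in> E. scol x = i & lab x = k & a0 <= srow x}
  <= card {x \<in> E0. scol x = i & lab x = k & a0 <= srow x}"
proof -
 let ?c = "%F k. card {x \<in> F. scol x = i & k <= lab x & a0 <= srow x}"
 have fE: "finite E" using E by (simp add: edge_system_def)
 have "?c F k = card {x \<in> F. scol x = i & lab x = k & a0 <= srow x} + ?c F (Suc k)" if "finite F" for F
  by (subst card_Un_disjoint[symmetric]) (use that in "auto intro!: arg_cong[of _ _ card]")
 from this[OF fE] this[OF fin0] bottom[OF E type, of i k a0] bottom_eq[OF E type tot, of i]
 show ?thesis by simp
qed

lemma exact_label_sum_le:
 assumes E: "edge_system (diagram N ch) E" and type: "edge_type E = edge_type E0"
  and tot: "card {x \<in> E. Suc k <= lab x & a0 <= srow x} = card {x \<in> E0. Suc k <= lab x & a0 <= srow x}"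
 shows "card {x \<in> E. lab x = k & a0 <= srow x & scol x \<in> I}
  <= card {x \<in> E0. lab x = k & a0 <= srow x & scol x \<in> I}"
proof -
 have fE: "finite E" using E by (simp add: edge_system_def)
 define T where "T = (snd ` src ` E \<union> snd ` src ` E0) \<inter> I"
 have T: "finite T" using fE fin0 by (simp add: T_def)
 have s: "card {x \<in> F. lab x = k & a0 <= srow x & scol x \<in> I} = (\<Sum>i\<in>T. card {x \<in> F. scol x = i & lab x = k & a0 <= srow x})"
  if "F = E \<or> F = E0" for F
 proof (subst card_fibres[where f = scol and T = T])
  show "(\<Sum>i\<in>T. card {x \<in> F. scol x = i & lab x = k & a0 <= srow x & scol x \<in> I})
    = (\<Sum>i\<in>T. card {x \<in> F. scol x = i & lab x = k & a0 <= srow x})"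
   by (intro sum.cong refl arg_cong[of _ _ card]) (auto simp: T_def)
 qed (use that fE fin0 T in "auto simp: T_def")
 show ?thesis using s[of E] s[of E0] by (simp add: sum_mono exact_label_le[OF E type tot])
qed

end

locale picture = half_picture +
 assumes rev: "col_strict (edge_rev ` E0)"
  and shift: "!!x y. [|x \<in> E0; y \<in> E0; srow x = srow y; trow x = trow y; lab x = lab y|]
   ==> tcol x + scol y = tcol y + scol x"
begin

sublocale rev: half_picture N ch "edge_rev ` E0"
 by standard (use decr sys0 rev in "auto intro: edge_system_rev")

lemma picture_rev: "picture N ch (edge_rev ` E0)"
proof
 show "col_strict (edge_rev ` edge_rev ` E0)" using strict by (simp add: image_image)
 show "tcol x + scol y = tcol y + scol x"
  if "x \<in> edge_rev ` E0" "y \<in> edge_rev ` E0" "srow x = srow y" "trow x = trow y" "lab x = lab y" for x y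
  using that shift by fastforce
qed

lemma rev_strictD:
 "[|x \<in> E0; y \<in> E0; tcol x = tcol y; trow x < trow y|] ==> code_less (lab x, srow x) (lab y, srow y)"
 using rev.strictD[of "edge_rev x" "edge_rev y"] by simp

lemma rev_chain:
 assumes "x \<in> E0" "y \<in> E0" "tcol x = tcol y" "trow x <= trow y" "lab x = lab y"
 shows "srow x + (trow y - trow x) <= srow y"
 using rev.chain[of "edge_rev x" "edge_rev y"] assms by simp

definition counted :: "edge set => nat => nat => nat => edge set" where
 "counted E a0 b0 k = {x \<in> E. lab x = k & a0 <= srow x & b0 <= trow x}"

text \<open>With \<open>good_tgt\<close> this splits \<open>counted\<close> into three parts whose
  sizes are controlled: the first two by the bounds of \<open>half_picture\<close> at sources and
  targets, the third by the type alone. The parts cover \<open>counted\<close> for every edge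
  system; for the picture they are disjoint and lie inside it. The weak inequality here against the
  strict one in \<open>good_tgt\<close> is what makes the first two disjoint.\<close>

definition good_src :: "nat => nat => nat => nat set" where
 "good_src a0 b0 k = {i. \<forall>x\<in>E0. scol x = i & a0 <= srow x & lab x <= k --> lab x = k & b0 <= trow x}"

definition good_tgt :: "nat => nat => nat => nat set" where
 "good_tgt a0 b0 k = {j. \<forall>x\<in>E0. tcol x = j & b0 <= trow x & lab x <= k --> lab x = k & a0 < srow x}"

definition part_src :: "edge set => nat => nat => nat => edge set" where
 "part_src E a0 b0 k = {x \<in> E. lab x = k & a0 <= srow x & scol x \<in> good_src a0 b0 k}"

definition part_tgt :: "edge set => nat => nat => nat => edge set" where
 "part_tgt E a0 b0 k = {x \<in> E. lab x = k & b0 <= trow x & tcol x \<in> good_tgt a0 b0 k}"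

definition part_rest :: "edge set => nat => nat => nat => edge set" where
 "part_rest E a0 b0 k = {x \<in> E. scol x \<notin> good_src a0 b0 k & tcol x \<notin> good_tgt a0 b0 k & lab x = k}"

lemma counted_subset: "counted E a0 b0 k \<subseteq> part_src E a0 b0 k \<union> part_tgt E a0 b0 k \<union> part_rest E a0 b0 k"
 by (auto simp: counted_def part_src_def part_tgt_def part_rest_def)

lemma parts0_subset: "part_src E0 a0 b0 k \<union> part_tgt E0 a0 b0 k \<union> part_rest E0 a0 b0 k \<subseteq> counted E0 a0 b0 k"
proof -
 have "part_src E0 a0 b0 k \<subseteq> counted E0 a0 b0 k"
  by (auto simp: part_src_def good_src_def counted_def)
 moreover have "part_tgt E0 a0 b0 k \<subseteq> counted E0 a0 b0 k"
  by (force simp: part_tgt_def good_tgt_def counted_def)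
 moreover have "x \<in> counted E0 a0 b0 k" if x: "x \<in> part_rest E0 a0 b0 k" for x
 proof -
  have E: "x \<in> E0" "lab x = k" using x by (auto simp: part_rest_def)
  from x obtain y where y: "y \<in> E0" "scol y = scol x" "a0 <= srow y" "lab y <= k" "lab y < k \<or> trow y < b0"
   by (force simp: part_rest_def good_src_def)
  from x obtain z where z: "z \<in> E0" "tcol z = tcol x" "b0 <= trow z" "lab z <= k" "lab z < k \<or> srow z <= a0"
   by (force simp: part_rest_def good_tgt_def)
  have y': "lab y = k & trow x < trow y & trow y < b0 & trow x + (srow y - srow x) <= trow y"
   if "srow x < a0"
   using strictD[OF E(1) y(1)] y that E(2) chain[OF E(1) y(1)] by (auto simp: code_less_def)
  have z': "lab z = k & srow x < srow z & srow z <= a0 & srow x + (trow z - trow x) <= srow z"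
   if "trow x < b0"
   using rev_strictD[OF E(1) z(1)] z that E(2) rev_chain[OF E(1) z(1)] by (auto simp: code_less_def)
  have "\<not> srow x < a0"
  proof
   assume a: "srow x < a0"
   \<comment> \<open>The two chains contradict each other: the one to y gives a0 - srow x < b0 -
     trow x, the one to z gives b0 - trow x <= a0 - srow x.\<close>
   note y'' = y'[OF a]
   show False using z' y'' y(3) z(3) a by linarith
  qed
  moreover have "\<not> trow x < b0" using z' calculation by auto
  ultimately show ?thesis using E by (simp add: counted_def)
 qed
 ultimately show ?thesis by blast
qed

text \<open>In the source column the target rows rise from at least b0 at row a0; in the target
  column the source rows rise from more than a0 at row b0. For a common edge x this gives srow x -
  a0 <= trow x - b0 < srow x - a0.\<close>

lemma parts0_disjoint: "part_src E0 a0 b0 k \<inter> part_tgt E0 a0 b0 k = {}"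
proof -
 have False if x: "x \<in> part_src E0 a0 b0 k" "x \<in> part_tgt E0 a0 b0 k" for x
 proof -
  have E: "x \<in> E0" "lab x = k" "a0 <= srow x" "b0 <= trow x" using x by (auto simp: part_src_def part_tgt_def)
  have "(srow x, scol x) \<in> diagram N ch" using src_diagram[OF E(1)] by simp
  hence "(a0, scol x) \<in> diagram N ch" by (rule diagram_up) (rule E(3))
  then obtain y where y: "y \<in> E0" "src y = (a0, scol x)" using ex_edge by blast
  have "lab y <= k" using lab_mono[OF y(1) E(1)] y E by simp
  hence y': "lab y = k" "b0 <= trow y" using x(1) y by (auto simp: part_src_def good_src_def)
  have 1: "b0 + (srow x - a0) <= trow x" using chain[OF y(1) E(1)] y y' E by simp
  have "(trow x, tcol x) \<in> diagram N ch" using rev.src_diagram[of "edge_rev x"] E(1) by simp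
  hence "(b0, tcol x) \<in> diagram N ch" by (rule diagram_up) (rule E(4))
  then obtain z where "z \<in> edge_rev ` E0" "src z = (b0, tcol x)" using rev.ex_edge by blast
  then obtain z where z: "z \<in> E0" "tgt z = (b0, tcol x)" by auto
  have "lab z <= k" using rev.lab_mono[of "edge_rev z" "edge_rev x"] z E by simp
  hence z': "lab z = k" "a0 < srow z" using x(2) z by (auto simp: part_tgt_def good_tgt_def)
  have 2: "Suc a0 + (trow x - b0) <= srow x" using rev_chain[OF z(1) E(1)] z z' E by simp
  show False using 1 2 E by linarith
 qed
 thus ?thesis by blast
qed

context
 fixes E :: "edge set"
 assumes E: "edge_system (diagram N ch) E" and type: "edge_type E = edge_type E0"
begin

lemma finE: "finite E"
 using E by (simp add: edge_system_def)

lemma type_rev: "edge_type (edge_rev ` E) = edge_type (edge_rev ` E0)"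
proof
 fix v :: "nat \<times> nat \<times> nat"
 obtain i j k where v: "v = (i, j, k)" by (metis prod_cases3)
 have "edge_type (edge_rev ` F) v = edge_type F (j, i, k)" for F
  unfolding edge_type_def card_edge_rev v by (intro arg_cong[of _ _ card]) auto
 thus "edge_type (edge_rev ` E) v = edge_type (edge_rev ` E0) v" using type by simp
qed

lemma card_parts_le:
 assumes tot: "card {x \<in> E. Suc k <= lab x & a0 <= srow x} = card {x \<in> E0. Suc k <= lab x & a0 <= srow x}"
  "card {x \<in> E. Suc k <= lab x & b0 <= trow x} = card {x \<in> E0. Suc k <= lab x & b0 <= trow x}"
 shows "card (part_src E a0 b0 k \<union> part_tgt E a0 b0 k \<union> part_rest E a0 b0 k) <= card (counted E0 a0 b0 k)"
proof -
 have 1: "card (part_src E a0 b0 k) <= card (part_src E0 a0 b0 k)"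
  unfolding part_src_def by (rule exact_label_sum_le[OF E type tot(1)])
 have 2: "card (part_tgt E a0 b0 k) <= card (part_tgt E0 a0 b0 k)"
  using rev.exact_label_sum_le[OF edge_system_rev[OF E] type_rev, of k b0 "good_tgt a0 b0 k"] tot(2)
  unfolding part_tgt_def card_edge_rev by simp
 have 3: "card (part_rest E a0 b0 k) = card (part_rest E0 a0 b0 k)"
  unfolding part_rest_def
  using edge_type_card_eq[OF finE fin0 type, of "%i j l. i \<notin> good_src a0 b0 k & j \<notin> good_tgt a0 b0 k & l = k"] by simp
 have fin: "finite (part_src E0 a0 b0 k)" "finite (part_tgt E0 a0 b0 k)" "finite (part_rest E0 a0 b0 k)"
  using fin0 by (simp_all add: part_src_def part_tgt_def part_rest_def)
 have d: "(part_src E0 a0 b0 k \<union> part_tgt E0 a0 b0 k) \<inter> part_rest E0 a0 b0 k = {}"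
  by (auto simp: part_src_def part_tgt_def part_rest_def)
 have "card (part_src E a0 b0 k \<union> part_tgt E a0 b0 k \<union> part_rest E a0 b0 k)
  <= card (part_src E a0 b0 k) + card (part_tgt E a0 b0 k) + card (part_rest E a0 b0 k)"
  by (meson add_mono card_Un_le order_refl order_trans)
 also have "... <= card (part_src E0 a0 b0 k) + card (part_tgt E0 a0 b0 k) + card (part_rest E0 a0 b0 k)"
  using 1 2 3 by simp
 also have "... = card (part_src E0 a0 b0 k \<union> part_tgt E0 a0 b0 k \<union> part_rest E0 a0 b0 k)"
  using card_Un_disjoint[OF fin(1,2) parts0_disjoint] card_Un_disjoint[OF _ fin(3) d] fin by simp
 also have "... <= card (counted E0 a0 b0 k)"
  by (rule card_mono[OF _ parts0_subset]) (simp add: counted_def fin0)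
 finally show ?thesis .
qed

lemma counted_le:
 assumes tot: "card {x \<in> E. Suc k <= lab x & a0 <= srow x} = card {x \<in> E0. Suc k <= lab x & a0 <= srow x}"
  "card {x \<in> E. Suc k <= lab x & b0 <= trow x} = card {x \<in> E0. Suc k <= lab x & b0 <= trow x}"
 shows "card (counted E a0 b0 k) <= card (counted E0 a0 b0 k)"
 by (rule order_trans[OF card_mono[OF _ counted_subset] card_parts_le[OF tot]])
  (simp add: part_src_def part_tgt_def part_rest_def finE)

lemma counted_eq:
 assumes tot: "card {x \<in> E. Suc k <= lab x & a0 <= srow x} = card {x \<in> E0. Suc k <= lab x & a0 <= srow x}"
  "card {x \<in> E. Suc k <= lab x & b0 <= trow x} = card {x \<in> E0. Suc k <= lab x & b0 <= trow x}"
  and eq: "card (counted E a0 b0 k) = card (counted E0 a0 b0 k)" and x: "x \<in> part_src E a0 b0 k"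
 shows "b0 <= trow x"
proof -
 have "counted E a0 b0 k = part_src E a0 b0 k \<union> part_tgt E a0 b0 k \<union> part_rest E a0 b0 k"
  by (rule card_seteq[OF _ counted_subset]) (use card_parts_le[OF tot] eq finE in "simp_all add: part_src_def part_tgt_def part_rest_def")
 thus ?thesis using x by (auto simp: counted_def)
qed

text \<open>Equal exponents turn the counting inequalities into equalities. The labels follow from
  the difference of the counts for two consecutive rows. The target rows are then at least those of
  the picture, and both have the same total because targets run once over all cells.\<close>

lemma same_exps_out:
 assumes exps: "edge_exps E = edge_exps E0" and x: "x \<in> E" and y: "y \<in> E0" and xy: "src x = src y"
 shows "lab x = lab y" "trow x = trow y"
proof -
 have P: "card {x \<in> E. P (srow x) (trow x) (lab x)} = card {x \<in> E0. P (srow x) (trow x) (lab x)}" for P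
  using card_fibres_eq[OF finE fin0 fun_cong[OF exps, unfolded edge_exps_def], of "%(i, j, k). P i j k"] by simp
 have tot: "card {x \<in> E. k <= lab x & a0 <= srow x} = card {x \<in> E0. k <= lab x & a0 <= srow x}" for k a0
  using P[of "%a b l. k <= l & a0 <= a"] .
 have tot': "card {x \<in> E. k <= lab x & a0 <= trow x} = card {x \<in> E0. k <= lab x & a0 <= trow x}" for k a0
  using P[of "%a b l. k <= l & a0 <= b"] .
 have cnt: "card (counted E a0 b0 k) = card (counted E0 a0 b0 k)" for a0 b0 k
  unfolding counted_def using P[of "%a b l. l = k & a0 <= a & b0 <= b"] .
 have one: "lab x = lab y" if x: "x \<in> E" and y: "y \<in> E0" and xy: "src x = src y" for x y
 proof -
  have "k <= lab x \<longleftrightarrow> k <= lab y" for k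
  proof -
   let ?i = "scol x" and ?a = "srow x"
   have split: "card {z \<in> F. scol z = ?i & k <= lab z & ?a <= srow z}
    = card {z \<in> F. scol z = ?i & k <= lab z & Suc ?a <= srow z} + (if k <= lab w then 1 else 0)"
    if F: "finite F" "inj_on src F" and w: "w \<in> F" "src w = src x" for F w
   proof -
    have zw: "z = w" if "z \<in> F" "scol z = ?i" "srow z = ?a" for z
     by (rule inj_onD[OF F(2) _ that(1) w(1)]) (simp add: w(2) prod_eq_iff that)
    have "z \<in> F & scol z = ?i & k <= lab z & srow z = ?a \<longleftrightarrow> z = w & k <= lab w" for z
     using zw[of z] w by (cases "z = w") auto
    hence "(if k <= lab w then 1 else 0) = card {z \<in> F. scol z = ?i & k <= lab z & srow z = ?a}" by simp
    thus ?thesis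
     using F(1) by (simp only: add.commute[of _ "if _ then _ else _"]) (subst card_Un_disjoint[symmetric]; auto intro!: arg_cong[of _ _ card])
   qed
   have i: "inj_on src E" "inj_on src E0" using E sys0 by (auto simp: edge_system_def)
   have "(if k <= lab x then 1 else 0 :: nat) = (if k <= lab y then 1 else 0)"
    using split[OF finE i(1) x refl] split[OF fin0 i(2) y xy[symmetric]]
     bottom_eq[OF E type tot, of ?i k ?a] bottom_eq[OF E type tot, of ?i k "Suc ?a"] by simp
   thus ?thesis by (simp split: if_splits)
  qed
  thus ?thesis by (metis order_refl order_antisym)
 qed
 thus "lab x = lab y" using x y xy by blast
 have ge: "trow y <= trow x" if x: "x \<in> E" and y: "y \<in> E0" and xy: "src x = src y" for x y
 proof (rule counted_eq[OF tot tot' cnt])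
  have "scol y \<in> good_src (srow y) (trow y) (lab y)"
   unfolding good_src_def
  proof (intro CollectI ballI impI)
   fix z assume z: "z \<in> E0" "scol z = scol y & srow y <= srow z & lab z <= lab y"
   show "lab z = lab y & trow y <= trow z"
   proof (cases "srow y = srow z")
    case True
    thus ?thesis using same_row_eq[OF y z(1)] z by auto
   next
    case False
    thus ?thesis using strictD[OF y z(1)] z by (auto simp: code_less_def)
   qed
  qed
  thus "x \<in> part_src E (srow y) (trow y) (lab y)"
   using x y xy one[OF x y xy] by (simp add: part_src_def)
 qed
 have bij: "bij_betw src E (diagram N ch)" "bij_betw src E0 (diagram N ch)"
  "bij_betw tgt E (diagram N ch)" "bij_betw tgt E0 (diagram N ch)"
  using E sys0 by (auto simp: edge_system_def bij_betw_def)
 define g where "g = inv_into E0 src"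
 have g: "g c \<in> E0" "src (g c) = c" if "c \<in> diagram N ch" for c
  using bij(2) that unfolding g_def bij_betw_def by (auto intro: inv_into_into f_inv_into_f)
 have src_in: "src z \<in> diagram N ch" if "z \<in> E" for z using bij(1) that by (auto simp: bij_betw_def)
 have gx: "g (src x) = y"
  using g[OF src_in[OF x]] y xy bij(2) by (auto simp: bij_betw_def inj_on_def)
 have "(\<Sum>z\<in>E. fst (tgt (g (src z)))) = (\<Sum>c\<in>diagram N ch. fst (tgt (g c)))"
  by (rule sum.reindex_bij_betw[OF bij(1)])
 also have "... = (\<Sum>z\<in>E0. fst (tgt (g (src z))))"
  by (rule sum.reindex_bij_betw[OF bij(2), symmetric])
 also have "... = (\<Sum>z\<in>E0. trow z)"
  using bij(2) by (intro sum.cong) (auto simp: g_def bij_betw_def)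
 also have "... = (\<Sum>c\<in>diagram N ch. fst c)" by (rule sum.reindex_bij_betw[OF bij(4)])
 also have "... = (\<Sum>z\<in>E. trow z)" by (rule sum.reindex_bij_betw[OF bij(3), symmetric])
 finally have s: "(\<Sum>z\<in>E. fst (tgt (g (src z)))) = (\<Sum>z\<in>E. trow z)" .
 have "fst (tgt (g (src x))) = trow x"
  by (rule sum_mono_inv[OF s _ x finE]) (use g src_in in "auto intro!: ge")
 thus "trow x = trow y" by (simp add: gx)
qed

end

end

section \<open>Comparison of an edge system with a picture of the same type\<close>

lemma sum_edge_type:
 fixes h :: "nat \<times> nat \<times> nat => int"
 assumes "finite E" "finite F" "edge_type E = edge_type F"
 shows "(\<Sum>x\<in>E. h (etype x)) = (\<Sum>x\<in>F. h (etype x))"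
proof -
 have "image_mset h (image_mset etype (mset_set E)) = image_mset h (image_mset etype (mset_set F))"
  by (intro arg_cong[of _ _ "image_mset h"] same_fibres assms(1,2)
    fun_cong[OF assms(3), unfolded edge_type_def])
 thus ?thesis by (simp add: sum_unfold_sum_mset image_mset.compositionality o_def)
qed

lemma edge_exps_rev: "edge_exps (edge_rev ` F) (a, b, k) = edge_exps F (b, a, k)"
 unfolding edge_exps_def card_edge_rev by (intro arg_cong[of _ _ card]) auto

definition rows_below :: "nat => (nat => nat) => (nat => nat) => bool" where
 "rows_below N r ch \<longleftrightarrow> (\<exists>a<N. (\<forall>a'<a. r a' = ch a') & r a < ch a)"

definition exps_below :: "nat => nat => (nat \<times> nat \<times> nat => nat) => (nat \<times> nat \<times> nat => nat) => bool" where
 "exps_below N u f e \<longleftrightarrow> (\<exists>a b k. a < N & b < N & k < u & f (a, b, k) < e (a, b, k) &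
  (\<forall>a' b' k'. a' < N & b' < N & k' < u & (k * N + a) * N + b < (k' * N + a') * N + b' --> f (a', b', k') = e (a', b', k')))"

lemma rows_below_cong:
 "(!!a. a < N ==> r a = r' a) ==> rows_below N r ch \<longleftrightarrow> rows_below N r' ch"
 unfolding rows_below_def by (simp cong: conj_cong)

context half_picture
begin

text \<open>The type fixes the number of cells in each column, and in the diagram every column is
  pushed up as far as possible. In the first row where the two sets of cells differ, the other set
  can therefore only miss cells.\<close>

lemma rows_less:
 assumes E: "edge_system U E" and type: "edge_type E = edge_type E0"
  and U: "!!a i. (a, i) \<in> U ==> a < N" and ne: "U ~= diagram N ch"
 shows "rows_below N (%a. card {x \<in> E. srow x = a}) ch"
proof -
 have finE: "finite E" and finU: "finite U" using E by (auto simp: edge_system_def)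
 have rowU: "card {x \<in> E. srow x = a} = card {i. (a, i) \<in> U}" for a
 proof -
  have "bij_betw (%x. scol x) {x \<in> E. srow x = a} {i. (a, i) \<in> U}"
   using E unfolding edge_system_def bij_betw_def inj_on_def
   by (auto simp: image_iff) (metis fst_conv snd_conv prod.collapse)+
  thus ?thesis by (rule bij_betw_same_card)
 qed
 have colU: "card {a. (a, i) \<in> U} = card {a. (a, i) \<in> diagram N ch}" for i
 proof -
  have "bij_betw (%x. srow x) {x \<in> F. scol x = i} {a. (a, i) \<in> W}" if "edge_system W F" for W F
   using that unfolding edge_system_def bij_betw_def inj_on_def
   by (auto simp: image_iff) (metis fst_conv snd_conv prod.collapse)+
  from bij_betw_same_card[OF this[OF E]] bij_betw_same_card[OF this[OF sys0]]
  show ?thesis using edge_type_card_eq[OF finE fin0 type, of "%i' j l. i' = i"] by simp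
 qed
 have "\<exists>a. \<exists>i. ((a, i) \<in> U) ~= ((a, i) \<in> diagram N ch)" using ne by auto
 define a where "a = (LEAST a. \<exists>i. ((a, i) \<in> U) ~= ((a, i) \<in> diagram N ch))"
 have a: "\<exists>i. ((a, i) \<in> U) ~= ((a, i) \<in> diagram N ch)"
  unfolding a_def by (rule LeastI_ex) fact
 have below: "((a', i) \<in> U) = ((a', i) \<in> diagram N ch)" if "a' < a" for a' i
  using not_less_Least[of a' "%a. \<exists>i. ((a, i) \<in> U) ~= ((a, i) \<in> diagram N ch)"] that unfolding a_def by blast
 have sub: "i < ch a" if iU: "(a, i) \<in> U" for i
 proof (rule ccontr)
  assume i: "\<not> i < ch a"
  have "(b, i) \<notin> diagram N ch" if "a <= b" for b
   using i diagram_up[of b i a] that by (auto simp: diagram_def)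
  hence "{b. (b, i) \<in> diagram N ch} \<subseteq> {b. (b, i) \<in> U} - {a}"
   using below by (auto simp: not_le[symmetric])
  moreover have f: "finite {b. (b, i) \<in> U}" by (rule finite_subset[OF _ finite_imageI[OF finU, of fst]]) force
  ultimately have "card {b. (b, i) \<in> diagram N ch} <= card ({b. (b, i) \<in> U} - {a})" by (intro card_mono) auto
  also have "... < card {b. (b, i) \<in> U}" using f iU by (intro card_Diff1_less) auto
  finally show False using colU[of i] by simp
 qed
 have aN: "a < N" using a U by (auto simp: diagram_def)
 have "{i. (a, i) \<in> U} \<subset> {..<ch a}" using sub a aN by (auto simp: diagram_def)
 hence "card {i. (a, i) \<in> U} < card {..<ch a}" by (rule psubset_card_mono[OF finite_lessThan])
 moreover have "card {i. (a', i) \<in> U} = ch a'" if "a' < a" for a'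
 proof -
  have "{i. (a', i) \<in> U} = {..<ch a'}" using below[OF that] that aN by (auto simp: diagram_def)
  thus ?thesis by simp
 qed
 ultimately show ?thesis using aN by (auto simp: rows_below_def rowU)
qed

end

context picture
begin

context
 fixes E :: "edge set"
 assumes E: "edge_system (diagram N ch) E" and type: "edge_type E = edge_type E0"
begin

lemma same_exps_in:
 assumes exps: "edge_exps E = edge_exps E0" and x: "x \<in> E" and y: "y \<in> E0" and xy: "tgt x = tgt y"
 shows "lab x = lab y" "srow x = srow y"
proof -
 interpret r: picture N ch "edge_rev ` E0" by (rule picture_rev)
 have e: "edge_exps (edge_rev ` E) = edge_exps (edge_rev ` E0)"
  using exps by (auto simp: fun_eq_iff edge_exps_rev)
 note r.same_exps_out[OF edge_system_rev[OF E] type_rev[OF E type] e, of "edge_rev x" "edge_rev y"]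
 thus "lab x = lab y" "srow x = srow y" using x y xy by simp_all
qed

text \<open>The sum of the squares of \<open>j - i - de(a, b, k)\<close> over the edges depends only on the type and on
 the codes at the cells, and it vanishes for the picture.\<close>

lemma same_exps_eq:
 assumes exps: "edge_exps E = edge_exps E0"
 shows "E = E0"
proof -
 have finE: "finite E" using E by (simp add: edge_system_def)
 define de where "de v = (let y = SOME y. y \<in> E0 & evar y = v in int (tcol y) - int (scol y))" for v
 have de: "de (evar y) = int (tcol y) - int (scol y)" if y: "y \<in> E0" for y
 proof -
  define z where "z = (SOME z. z \<in> E0 & evar z = evar y)"
  have "z \<in> E0 & evar z = evar y" unfolding z_def by (rule someI[of _ y]) (use y in simp)
  hence "tcol z + scol y = tcol y + scol z" using y by (intro shift) auto
  moreover have "de (evar y) = int (tcol z) - int (scol z)" unfolding de_def z_def Let_def by (rule refl)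
  ultimately show ?thesis by simp
 qed
 have bij: "bij_betw src E (diagram N ch)" "bij_betw src E0 (diagram N ch)"
  "bij_betw tgt E (diagram N ch)" "bij_betw tgt E0 (diagram N ch)"
  using E sys0 by (auto simp: edge_system_def bij_betw_def)
 define gs where "gs = inv_into E0 src"
 define gt where "gt = inv_into E0 tgt"
 have gs: "gs c \<in> E0" "src (gs c) = c" and gt: "gt c \<in> E0" "tgt (gt c) = c" if "c \<in> diagram N ch" for c
  using bij(2,4) that unfolding gs_def gt_def bij_betw_def by (auto intro: inv_into_into f_inv_into_f)
 have gs0: "gs (src y) = y" if "y \<in> E0" for y
  unfolding gs_def by (rule inv_into_f_f[OF bij_betw_imp_inj_on[OF bij(2)] that])
 have gt0: "gt (tgt y) = y" if "y \<in> E0" for y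
  unfolding gt_def by (rule inv_into_f_f[OF bij_betw_imp_inj_on[OF bij(4)] that])
 have dia: "src x \<in> diagram N ch" "tgt x \<in> diagram N ch" if "x \<in> E" for x
  using bij(1,3) that by (auto simp: bij_betw_def)
 have es: "evar (gs (src x)) = evar x" and et: "evar (gt (tgt x)) = evar x" if "x \<in> E" for x
  using gs[OF dia(1)[OF that]] gt[OF dia(2)[OF that]] same_exps_out[OF E type exps that, of "gs (src x)"]
   same_exps_in[OF exps that, of "gt (tgt x)"] by simp_all
 define f where "f x = (int (tcol x) - int (scol x) - de (evar x))\<^sup>2" for x :: edge
 have f: "f x = (int (tcol x) - int (scol x))\<^sup>2 - 2 * (de (evar x) * int (tcol x))
  + (2 * (de (evar x) * int (scol x)) + (de (evar x))\<^sup>2)" for x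
  by (simp add: f_def power2_eq_square algebra_simps)
 have s1: "(\<Sum>x\<in>E. (int (tcol x) - int (scol x))\<^sup>2) = (\<Sum>x\<in>E0. (int (tcol x) - int (scol x))\<^sup>2)"
  using sum_edge_type[OF finE fin0 type, of "%(i, j, k). (int j - int i)\<^sup>2"] by simp
 have s2: "(\<Sum>x\<in>E. de (evar x) * int (tcol x)) = (\<Sum>x\<in>E0. de (evar x) * int (tcol x))"
 proof -
  have "(\<Sum>x\<in>E. de (evar x) * int (tcol x)) = (\<Sum>x\<in>E. de (evar (gt (tgt x))) * int (tcol x))"
   by (intro sum.cong refl) (simp only: et)
  also have "... = (\<Sum>c\<in>diagram N ch. de (evar (gt c)) * int (snd c))" by (rule sum.reindex_bij_betw[OF bij(3)])
  also have "... = (\<Sum>x\<in>E0. de (evar (gt (tgt x))) * int (tcol x))" by (rule sum.reindex_bij_betw[OF bij(4), symmetric])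
  also have "... = (\<Sum>x\<in>E0. de (evar x) * int (tcol x))" by (intro sum.cong refl) (simp only: gt0)
  finally show ?thesis .
 qed
 have s3: "(\<Sum>x\<in>E. 2 * (de (evar x) * int (scol x)) + (de (evar x))\<^sup>2) = (\<Sum>x\<in>E0. 2 * (de (evar x) * int (scol x)) + (de (evar x))\<^sup>2)"
 proof -
  have "(\<Sum>x\<in>E. 2 * (de (evar x) * int (scol x)) + (de (evar x))\<^sup>2) = (\<Sum>x\<in>E. 2 * (de (evar (gs (src x))) * int (scol x)) + (de (evar (gs (src x))))\<^sup>2)"
   by (intro sum.cong refl) (simp only: es)
  also have "... = (\<Sum>c\<in>diagram N ch. 2 * (de (evar (gs c)) * int (snd c)) + (de (evar (gs c)))\<^sup>2)" by (rule sum.reindex_bij_betw[OF bij(1)])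
  also have "... = (\<Sum>x\<in>E0. 2 * (de (evar (gs (src x))) * int (scol x)) + (de (evar (gs (src x))))\<^sup>2)" by (rule sum.reindex_bij_betw[OF bij(2), symmetric])
  also have "... = (\<Sum>x\<in>E0. 2 * (de (evar x) * int (scol x)) + (de (evar x))\<^sup>2)" by (intro sum.cong refl) (simp only: gs0)
  finally show ?thesis .
 qed
 have "sum f E = sum f E0"
  unfolding f sum.distrib sum_subtractf sum_distrib_left[symmetric] using s1 s2 s3
  by (simp add: sum.distrib sum_distrib_left[symmetric])
 also have "... = 0" by (intro sum.neutral) (simp add: f_def de)
 finally have f0: "f x = 0" if "x \<in> E" for x
  using sum_nonneg_eq_0_iff[of E f] finE that by (simp add: f_def)
 have j: "int (tcol x) = int (scol x) + de (evar x)" if "x \<in> E" for x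
  using f0[OF that] by (simp add: f_def)
 have sub: "x \<in> E0" if x: "x \<in> E" for x
 proof -
  let ?y = "gs (src x)"
  have y: "?y \<in> E0" "src ?y = src x" using gs dia(1)[OF x] by auto
  have "int (snd (tgt ?y)) = int (tcol x)" using j[OF x] de[OF y(1)] y(2) es[OF x] by simp
  moreover have "fst (tgt ?y) = trow x" "lab ?y = lab x" using es[OF x] by simp_all
  ultimately have "?y = x" using y(2) by (simp add: prod_eq_iff)
  thus ?thesis using y by simp
 qed
 moreover have "card E = card E0"
  using bij_betw_same_card[OF bij(1)] bij_betw_same_card[OF bij(2)] by simp
 ultimately show ?thesis using fin0 by (intro card_subset_eq) auto
qed

text \<open>Let v0 = (a0, b0, k0) be the largest variable at which the exponents differ. The counts
  for larger labels agree, so \<open>counted_le\<close> applies; all other variables of the counted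
  region are larger than v0 and agree, so the inequality is one for v0 alone.\<close>

lemma exps_less:
 assumes R: "!!x. x \<in> E0 ==> lab x < u" "!!x. x \<in> E ==> lab x < u" and ne: "E ~= E0"
 shows "exps_below N u (edge_exps E) (edge_exps E0)"
proof -
 let ?R = "vars N u"
 let ?idx = "%(a, b, k). (k * N + a) * N + b"
 have finE: "finite E" using E by (simp add: edge_system_def)
 have inR: "evar x \<in> ?R" if "x \<in> E \<or> x \<in> E0" for x
 proof -
  have "src x \<in> diagram N ch" "tgt x \<in> diagram N ch" using that E sys0 by (auto simp: edge_system_def)
  moreover have "lab x < u" using that R by blast
  ultimately show ?thesis by (simp add: diagram_def case_prod_unfold)
 qed
 define D where "D = {v \<in> ?R. edge_exps E v ~= edge_exps E0 v}"
 have D: "finite D" by (simp add: D_def)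
 have out: "edge_exps F v = 0" if "v \<notin> ?R" "F = E \<or> F = E0" for F v
 proof -
  have "{x \<in> F. evar x = v} = {}" using inR that by blast
  thus ?thesis by (simp only: edge_exps_def card.empty)
 qed
 have "D ~= {}"
 proof
  assume "D = {}"
  hence "edge_exps E v = edge_exps E0 v" for v using out[of v E] out[of v E0] by (cases "v \<in> ?R") (auto simp: D_def)
  thus False using same_exps_eq ne by blast
 qed
 hence "Max (?idx ` D) \<in> ?idx ` D" using D by (intro Max_in) auto
 then obtain v0 where v0: "Max (?idx ` D) = ?idx v0" "v0 \<in> D" by (rule imageE)
 obtain a0 b0 k0 where v0': "v0 = (a0, b0, k0)" by (metis prod_cases3)
 have lt: "a0 < N" "b0 < N" "k0 < u" using v0 by (auto simp: D_def v0')
 have above: "edge_exps E v = edge_exps E0 v" if "v \<in> ?R" "?idx v0 < ?idx v" for v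
 proof (rule ccontr)
  assume "edge_exps E v ~= edge_exps E0 v"
  hence "v \<in> D" using that by (simp add: D_def)
  hence "?idx v <= Max (?idx ` D)" using D by (intro Max_ge) auto
  thus False using that(2) v0(1) by simp
 qed
 have big: "?idx v0 < (k * N + a) * N + b" if "k0 < k" for a b k
 proof -
  have "Suc (k0 * N + a0) <= k0 * N + N" using lt by simp
  also have "... = Suc k0 * N" by simp
  also have "... <= k * N + a" using that by (intro trans_le_add1 mult_le_mono1) auto
  finally have "Suc (k0 * N + a0) * N <= (k * N + a) * N" by (rule mult_le_mono1)
  thus ?thesis using lt by (simp add: v0')
 qed
 have big2: "?idx v0 < (k0 * N + a) * N + b" if "a0 < a" for a b
 proof -
  have "Suc (k0 * N + a0) * N <= (k0 * N + a) * N" using that by (intro mult_le_mono1) auto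
  thus ?thesis using lt by (simp add: v0')
 qed
 have eqP: "card {x \<in> E. P (evar x)} = card {x \<in> E0. P (evar x)}" if "!!v. v \<in> ?R ==> P v ==> ?idx v0 < ?idx v" for P
 proof -
  have f: "{x \<in> {x \<in> F. P (evar x)}. evar x = v} = (if P v then {x \<in> F. evar x = v} else {})" for F v
   by (cases v) auto
  have "edge_exps E v = edge_exps E0 v" if "P v" for v
   using above[of v] out[of v E] out[of v E0] \<open>v \<in> ?R ==> P v ==> ?idx v0 < ?idx v\<close> that by (cases "v \<in> ?R") simp_all
  hence "card {x \<in> {x \<in> E. P (evar x)}. evar x = v} = card {x \<in> {x \<in> E0. P (evar x)}. evar x = v}" for v
   unfolding f edge_exps_def by (cases "P v") (simp_all only: if_True if_False)
  from card_fibres_eq[OF _ _ this, of "%_. True"] finE fin0 show ?thesis by simp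
 qed
 have tot1: "card {x \<in> E. Suc k0 <= lab x & a0 <= srow x} = card {x \<in> E0. Suc k0 <= lab x & a0 <= srow x}"
 proof -
  have "card {x \<in> E. (%(a, b, k). Suc k0 <= k & a0 <= a) (evar x)} = card {x \<in> E0. (%(a, b, k). Suc k0 <= k & a0 <= a) (evar x)}"
  proof (rule eqP)
   fix v :: "nat \<times> nat \<times> nat" assume "case v of (a, b, k) => Suc k0 <= k & a0 <= a"
   thus "?idx v0 < ?idx v" using big by (cases v) simp
  qed
  thus ?thesis by simp
 qed
 have tot2: "card {x \<in> E. Suc k0 <= lab x & b0 <= trow x} = card {x \<in> E0. Suc k0 <= lab x & b0 <= trow x}"
 proof -
  have "card {x \<in> E. (%(a, b, k). Suc k0 <= k & b0 <= b) (evar x)} = card {x \<in> E0. (%(a, b, k). Suc k0 <= k & b0 <= b) (evar x)}"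
  proof (rule eqP)
   fix v :: "nat \<times> nat \<times> nat" assume "case v of (a, b, k) => Suc k0 <= k & b0 <= b"
   thus "?idx v0 < ?idx v" using big by (cases v) simp
  qed
  thus ?thesis by simp
 qed
 have le: "card (counted E a0 b0 k0) <= card (counted E0 a0 b0 k0)" by (rule counted_le[OF E type tot1 tot2])
 let ?P = "%(a, b, k). k = k0 & a0 <= a & b0 <= b & (a, b) ~= (a0, b0)"
 have rest: "card {x \<in> E. ?P (evar x)} = card {x \<in> E0. ?P (evar x)}"
 proof (rule eqP)
  fix v assume v: "v \<in> ?R" "?P v"
  obtain a b k where abk: "v = (a, b, k)" by (metis prod_cases3)
  show "?idx v0 < ?idx v"
  proof (cases "a0 < a")
   case True
   thus ?thesis using big2[of a b] v abk by simp
  next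
   case False
   thus ?thesis using v abk v0' by auto
  qed
 qed
 have split: "card (counted F a0 b0 k0) = edge_exps F v0 + card {x \<in> F. ?P (evar x)}" if "F = E \<or> F = E0" for F
 proof -
  have "counted F a0 b0 k0 = {x \<in> F. evar x = v0} \<union> {x \<in> F. ?P (evar x)}"
   by (auto simp: counted_def v0')
  moreover have "card ({x \<in> F. evar x = v0} \<union> {x \<in> F. ?P (evar x)}) = card {x \<in> F. evar x = v0} + card {x \<in> F. ?P (evar x)}"
   by (rule card_Un_disjoint) (use that finE fin0 v0' in auto)
  ultimately show ?thesis by (simp add: edge_exps_def)
 qed
 have "edge_exps E v0 <= edge_exps E0 v0" using le split[of E] split[of E0] rest by simp
 hence "edge_exps E v0 < edge_exps E0 v0" using v0(2) by (auto simp: D_def)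
 thus ?thesis unfolding exps_below_def using lt above v0' by (intro exI[of _ a0] exI[of _ b0] exI[of _ k0]) auto
qed

end

end

section \<open>The picture belonging to exponents with the lattice property\<close>

lemma prefix_mono: "c <= d ==> (\<Sum>i<c. f i) <= (\<Sum>i<d. f i)" for f :: "nat => nat"
 by (rule sum_mono2) auto

lemma prefix_less:
 fixes f :: "nat => nat"
 assumes "(\<Sum>i<c. f i) <= x" "x < (\<Sum>i<d. f i)"
 shows "c < d"
 using prefix_mono[of d c f] assms by (cases "c < d") auto

lemma prefix_decomp:
 fixes f :: "nat => nat"
 assumes "x < (\<Sum>i<n. f i)"
 shows "\<exists>c<n. \<exists>r<f c. x = (\<Sum>i<c. f i) + r"
 using assms
proof (induction n)
 case (Suc n)
 show ?case
 proof (cases "x < (\<Sum>i<n. f i)")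
  case True
  thus ?thesis using Suc.IH less_SucI by blast
 next
  case False
  thus ?thesis using Suc.prems by (intro exI[of _ n] conjI exI[of _ "x - (\<Sum>i<n. f i)"]) auto
 qed
qed simp

lemma prefix_unique:
 fixes f :: "nat => nat"
 assumes "(\<Sum>i<c. f i) + r = (\<Sum>i<d. f i) + s" "r < f c" "s < f d"
 shows "c = d & r = s"
proof -
 have "(\<Sum>i<c. f i) + r < (\<Sum>i<Suc c. f i)" "(\<Sum>i<d. f i) + s < (\<Sum>i<Suc d. f i)" using assms by simp_all
 hence "c < Suc d" "d < Suc c" using prefix_less[of f c _ "Suc d"] prefix_less[of f d _ "Suc c"] assms(1)
  by (metis le_add1)+
 hence "c = d" by simp
 thus ?thesis using assms by simp
qed

definition row_seq :: "nat => (nat \<times> nat \<times> nat => nat) => nat => nat => nat" where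
 "row_seq N e a c = e (a, c mod N, c div N)"

definition exps_transp :: "(nat \<times> nat \<times> nat => nat) => nat \<times> nat \<times> nat => nat" where
 "exps_transp e = (%(a, b, k). e (b, a, k))"

text \<open>The r-th copy of x_ab(k). Source row a is filled from left to right by increasing (k, b)
  and target row b by increasing (k, a), so both columns are prefix sums of exponents. The copies of
  one variable run in parallel, which gives the shift condition of a picture.\<close>

definition pic_edge :: "nat => (nat \<times> nat \<times> nat => nat) => nat => nat => nat => nat => edge" where
 "pic_edge N e a b k r = ((a, (\<Sum>c<k * N + b. row_seq N e a c) + r), (b, (\<Sum>c<k * N + a. row_seq N (exps_transp e) b c) + r), k)"

definition pic :: "nat => nat => (nat \<times> nat \<times> nat => nat) => edge set" where
 "pic N u e = {pic_edge N e a b k r | a b k r. a < N & b < N & k < u & r < e (a, b, k)}"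

lemma edge_rev_pic: "edge_rev ` pic N u e = pic N u (exps_transp e)"
proof -
 have tt: "exps_transp (exps_transp e) = e" for e by (auto simp: exps_transp_def)
 have r: "edge_rev (pic_edge N e a b k r) = pic_edge N (exps_transp e) b a k r" for e a b k r
  by (simp add: pic_edge_def edge_rev_def tt)
 have sub: "edge_rev ` pic N u e \<subseteq> pic N u (exps_transp e)" for e
 proof
  fix y assume "y \<in> edge_rev ` pic N u e"
  then obtain a b k s where y: "y = edge_rev (pic_edge N e a b k s)" "a < N" "b < N" "k < u" "s < e (a, b, k)"
   unfolding pic_def by blast
  have "s < exps_transp e (b, a, k)" using y by (simp add: exps_transp_def)
  thus "y \<in> pic N u (exps_transp e)" unfolding y(1) r pic_def using y by blast
 qed
 have "pic N u (exps_transp e) = edge_rev ` edge_rev ` pic N u (exps_transp e)" by (simp add: image_image)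
 also have "... \<subseteq> edge_rev ` pic N u e" using sub[of "exps_transp e"] unfolding tt by (rule image_mono)
 finally show ?thesis using sub[of e] by blast
qed

lemma index_less:
 assumes "b < N" "k < (u :: nat)"
 shows "k * N + b < u * N"
proof -
 have "Suc k * N <= u * N" using assms by (intro mult_le_mono1) simp
 thus ?thesis using assms by simp
qed

locale lattice_exps =
 fixes N u :: nat and e :: "nat \<times> nat \<times> nat => nat" and ch :: "nat => nat"
 assumes rows: "!!a c. [|Suc a < N; c < u * N|] ==> (\<Sum>i\<le>c. row_seq N e (Suc a) i) <= (\<Sum>i<c. row_seq N e a i)"
  and cols: "!!a c. [|Suc a < N; c < u * N|] ==>
   (\<Sum>i\<le>c. row_seq N (exps_transp e) (Suc a) i) <= (\<Sum>i<c. row_seq N (exps_transp e) a i)"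
  and chi_row: "!!a. a < N ==> (\<Sum>i<u * N. row_seq N e a i) = ch a"
  and chi_col: "!!a. a < N ==> (\<Sum>i<u * N. row_seq N (exps_transp e) a i) = ch a"
begin

lemma transpose: "lattice_exps N u (exps_transp e) ch"
proof -
 have "exps_transp (exps_transp e) = e" by (auto simp: exps_transp_def)
 thus ?thesis using rows cols chi_row chi_col by unfold_locales simp_all
qed

lemma row_seq_index: "b < N ==> row_seq N e a (k * N + b) = e (a, b, k)"
 by (simp add: row_seq_def)

lemma finite_pic: "finite (pic N u e)"
proof -
 have "pic N u e = (%((a, b, k), r). pic_edge N e a b k r) ` (SIGMA v : vars N u. {..<e v})"
 proof (intro equalityI subsetI)
  fix x assume "x \<in> pic N u e"
  then obtain a b k r where "x = pic_edge N e a b k r" "a < N" "b < N" "k < u" "r < e (a, b, k)"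
   unfolding pic_def by blast
  thus "x \<in> (%((a, b, k), r). pic_edge N e a b k r) ` (SIGMA v : vars N u. {..<e v})"
   by (intro image_eqI[of _ _ "((a, b, k), r)"]) auto
 qed (auto simp: pic_def)
 thus ?thesis by simp
qed

lemma src_pic: "src ` pic N u e = diagram N ch"
proof (intro equalityI subsetI)
 fix c assume "c \<in> src ` pic N u e"
 then obtain a b k r where x: "c = (a, (\<Sum>c<k * N + b. row_seq N e a c) + r)" "a < N" "b < N" "k < u" "r < e (a, b, k)"
  by (auto simp: pic_def pic_edge_def)
 have "(\<Sum>c<k * N + b. row_seq N e a c) + r < (\<Sum>c<Suc (k * N + b). row_seq N e a c)"
  using x by (simp add: row_seq_index)
 also have "... <= (\<Sum>c<u * N. row_seq N e a c)" using x index_less by (intro prefix_mono) (simp add: Suc_le_eq)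
 finally show "c \<in> diagram N ch" using x by (simp add: diagram_def chi_row)
next
 fix c assume "c \<in> diagram N ch"
 then obtain a i where c: "c = (a, i)" "a < N" "i < (\<Sum>i<u * N. row_seq N e a i)" by (auto simp: diagram_def chi_row)
 then obtain d r where d: "d < u * N" "r < row_seq N e a d" "i = (\<Sum>i<d. row_seq N e a i) + r"
  using prefix_decomp by blast
 hence N: "d mod N < N" "d div N < u" by (cases "N = 0"; simp add: less_mult_imp_div_less)+
 have "d = (d div N) * N + d mod N" by simp
 hence "src (pic_edge N e a (d mod N) (d div N) r) = c" using c d by (simp add: pic_edge_def)
 moreover have "pic_edge N e a (d mod N) (d div N) r \<in> pic N u e"
  unfolding pic_def mem_Collect_eq
  by (rule exI[of _ a], rule exI[of _ "d mod N"], rule exI[of _ "d div N"], rule exI[of _ r])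
   (use c N d(2) in "simp add: row_seq_def")
 ultimately show "c \<in> src ` pic N u e" by force
qed

lemma pic_same_src:
 assumes "x \<in> pic N u e" "y \<in> pic N u e" "src x = src y"
 shows "x = y"
proof -
 obtain a b k r where x: "x = pic_edge N e a b k r" "a < N" "b < N" "k < u" "r < e (a, b, k)"
  using assms(1) unfolding pic_def by blast
 obtain a' b' k' r' where y: "y = pic_edge N e a' b' k' r'" "a' < N" "b' < N" "k' < u" "r' < e (a', b', k')"
  using assms(2) unfolding pic_def by blast
 have "a = a'" using assms(3) x y by (simp add: pic_edge_def)
 moreover have "k * N + b = k' * N + b' & r = r'"
  using assms(3) x y by (intro prefix_unique[of "row_seq N e a"]) (auto simp: pic_edge_def row_seq_index)
 moreover have "b = b'" "k = k'"
 proof -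
  have "(k * N + b) mod N = b" "(k' * N + b') mod N = b'" "(k * N + b) div N = k" "(k' * N + b') div N = k'" using x y by simp_all
  thus "b = b'" "k = k'" using calculation by metis+
 qed
 ultimately show ?thesis using x y by simp
qed

text \<open>The lattice inequality moves an entry up: if row a + 1 passes column i within its first
  c + 1 codes, then row a does so within its first c. Iterated from the lower to the upper cell,
  this gives a strictly smaller code.\<close>

lemma col_strict_pic: "col_strict (pic N u e)"
 unfolding col_strict_def
proof (intro ballI impI)
 fix x y assume xy: "x \<in> pic N u e" "y \<in> pic N u e" "scol x = scol y & srow x < srow y"
 obtain a b k r where x: "x = pic_edge N e a b k r" "a < N" "b < N" "k < u" "r < e (a, b, k)"
  using xy(1) unfolding pic_def by blast
 obtain a' b' k' r' where y: "y = pic_edge N e a' b' k' r'" "a' < N" "b' < N" "k' < u" "r' < e (a', b', k')"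
  using xy(2) unfolding pic_def by blast
 define i where "i = scol x"
 have i: "i = (\<Sum>c<k * N + b. row_seq N e a c) + r" "i = (\<Sum>c<k' * N + b'. row_seq N e a' c) + r'"
  using xy(3) x y by (simp_all add: i_def pic_edge_def)
 have "\<exists>c<k' * N + b'. i < (\<Sum>j<Suc c. row_seq N e a'' j)" if "a'' < a'" for a''
  using that
 proof (induction "a' - a''" arbitrary: a'')
  case (Suc d)
  have step: "\<exists>c'<c. i < (\<Sum>j<Suc c'. row_seq N e a'' j)" if c: "c < u * N" "i < (\<Sum>j<Suc c. row_seq N e (Suc a'') j)" for c
  proof -
   have "(\<Sum>j<Suc c. row_seq N e (Suc a'') j) <= (\<Sum>j<c. row_seq N e a'' j)"
    using rows[of a'' c] c Suc.prems y(2) by (simp add: lessThan_Suc_atMost)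
   hence "i < (\<Sum>j<c. row_seq N e a'' j)" using c by simp
   then obtain c' s where "c' < c" "s < row_seq N e a'' c'" "i = (\<Sum>j<c'. row_seq N e a'' j) + s" using prefix_decomp by blast
   thus ?thesis by (intro exI[of _ c']) simp
  qed
  have lt: "k' * N + b' < u * N" using y index_less by blast
  show ?case
  proof (cases "Suc a'' = a'")
   case True
   have "i < (\<Sum>j<Suc (k' * N + b'). row_seq N e (Suc a'') j)" using i(2) y True by (simp add: row_seq_index)
   thus ?thesis using step[OF lt] by blast
  next
   case False
   then obtain c where c: "c < k' * N + b'" "i < (\<Sum>j<Suc c. row_seq N e (Suc a'') j)"
    using Suc.hyps(1)[of "Suc a''"] Suc.hyps(2) Suc.prems by force
   thus ?thesis using step[of c] lt by (meson less_trans)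
  qed
 qed simp
 from this[of a] obtain c where c: "c < k' * N + b'" "i < (\<Sum>j<Suc c. row_seq N e a j)"
  using xy(3) x y by (auto simp: pic_edge_def)
 have "k * N + b < Suc c" by (rule prefix_less[OF _ c(2)]) (simp add: i(1))
 hence "k * N + b < k' * N + b'" using c(1) by simp
 hence "code_less (k, b) (k', b')"
 proof -
  have "k <= k'"
  proof (rule ccontr)
   assume "\<not> k <= k'"
   hence "Suc k' * N <= k * N" by (intro mult_le_mono1) auto
   thus False using \<open>k * N + b < k' * N + b'\<close> y by simp
  qed
  thus ?thesis using \<open>k * N + b < k' * N + b'\<close> by (auto simp: code_less_def le_less)
 qed
 thus "code_less (out_code x) (out_code y)" using x y by (simp add: pic_edge_def)
qed

lemma chi_decr:
 assumes "Suc a < N"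
 shows "ch (Suc a) <= ch a"
proof (cases "u * N = 0")
 case True
 thus ?thesis using chi_row[of a] chi_row[of "Suc a"] assms by simp
next
 case False
 then obtain c where c: "u * N = Suc c" by (cases "u * N") auto
 have "ch (Suc a) = (\<Sum>i\<le>c. row_seq N e (Suc a) i)" using chi_row[of "Suc a"] assms c by (simp add: lessThan_Suc_atMost)
 also have "... <= (\<Sum>i<c. row_seq N e a i)" using rows[of a c] assms c by simp
 also have "... <= ch a" using chi_row[of a] assms c by simp
 finally show ?thesis .
qed

lemma picture_pic: "picture N ch (pic N u e)"
proof -
 interpret t: lattice_exps N u "exps_transp e" ch by (rule local.transpose)
 have inj: "inj_on src (pic N u e)" using pic_same_src by (rule inj_onI)
 have tgt_src: "tgt ` E = src ` edge_rev ` E" for E by (simp add: image_image)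
 have tgt: "tgt ` pic N u e = diagram N ch"
  unfolding tgt_src edge_rev_pic by (rule t.src_pic)
 have injt: "inj_on tgt (pic N u e)"
 proof (rule inj_onI)
  fix x y assume xy: "x \<in> pic N u e" "y \<in> pic N u e" "tgt x = tgt y"
  hence "edge_rev x = edge_rev y"
   using t.pic_same_src[of "edge_rev x" "edge_rev y"] by (simp flip: edge_rev_pic)
  thus "x = y" by (metis edge_rev_simps(4))
 qed
 show ?thesis
 proof
  show "edge_system (diagram N ch) (pic N u e)"
   unfolding edge_system_def using finite_pic inj src_pic tgt injt by blast
  show "col_strict (edge_rev ` pic N u e)" unfolding edge_rev_pic by (rule t.col_strict_pic)
  show "tcol x + scol y = tcol y + scol x"
   if "x \<in> pic N u e" "y \<in> pic N u e" "srow x = srow y" "trow x = trow y" "lab x = lab y" for x y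
   using that by (auto simp: pic_def pic_edge_def)
 qed (auto intro: chi_decr col_strict_pic)
qed

lemma edge_exps_pic:
 assumes "a < N" "b < N" "k < u"
 shows "edge_exps (pic N u e) (a, b, k) = e (a, b, k)"
proof -
 have "{x \<in> pic N u e. evar x = (a, b, k)} = pic_edge N e a b k ` {..<e (a, b, k)}"
  using assms by (auto simp: pic_def pic_edge_def)
 moreover have "inj (pic_edge N e a b k)" by (auto simp: inj_on_def pic_edge_def)
 ultimately show ?thesis by (simp add: edge_exps_def card_image inj_on_subset[of _ UNIV])
qed

lemma lab_pic: "x \<in> pic N u e ==> lab x < u"
 by (auto simp: pic_def pic_edge_def)

end

subsection \<open>Labelled permutations as edge systems\<close>

definition lab_edge :: "nat => (nat => nat) \<times> (nat => nat) => nat => edge" where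
 "lab_edge N x w = ((w mod N, w div N), (fst x w mod N, fst x w div N), snd x w)"

definition lab_edges :: "nat => nat => nat => (nat => nat) \<times> (nat => nat) => edge set" where
 "lab_edges N J K x = lab_edge N x ` {w. w < J & snd x w < K}"

lemma div_mod_eq: "v div N = w div N ==> v mod N = w mod N ==> v = (w :: nat)"
 by (metis div_mult_mod_eq)

lemma inj_lab_edge: "inj (lab_edge N x)"
 by (rule injI) (auto simp: lab_edge_def intro: div_mod_eq)

lemma card_lab_edges: "card {y \<in> lab_edges N J K x. P y} = card {w. w < J & snd x w < K & P (lab_edge N x w)}"
proof -
 have "{y \<in> lab_edges N J K x. P y} = lab_edge N x ` {w. w < J & snd x w < K & P (lab_edge N x w)}"
  by (auto simp: lab_edges_def)
 thus ?thesis by (simp add: card_image inj_on_subset[OF inj_lab_edge])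
qed

text \<open>Points with label K are fixed, so no other point is moved onto one of them.\<close>

lemma lab_perms_closed:
 assumes "x \<in> lab_perms J K"
 shows "fst x ` {w. w < J & snd x w < K} = {w. w < J & snd x w < K}"
proof (rule endo_inj_surj)
 obtain p ka where x: "x = (p, ka)" by fastforce
 have p: "p permutes {..<J}" and ka: "!!w. w < J ==> ka w <= K" and fx: "!!w. [|w < J; ka w = K|] ==> p w = w"
  using assms by (auto simp: lab_perms_def x)
 show "inj_on (fst x) {w. w < J & snd x w < K}" using permutes_inj_on[OF p] by (simp add: x)
 show "fst x ` {w. w < J & snd x w < K} \<subseteq> {w. w < J & snd x w < K}"
 proof
  fix v assume "v \<in> fst x ` {w. w < J & snd x w < K}"
  then obtain w where w: "w < J" "ka w < K" "v = p w" by (auto simp: x)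
  have v: "v < J" using permutes_in_image[OF p, of w] w by simp
  have "ka v ~= K"
  proof
   assume "ka v = K"
   hence "p v = v" using fx v by blast
   hence "v = w" using w(3) permutes_inj[OF p] by (metis injD)
   thus False using w \<open>ka v = K\<close> by simp
  qed
  thus "v \<in> {w. w < J & snd x w < K}" using v ka[OF v] by (simp add: x)
 qed
qed simp

lemma edge_system_lab_edges:
 assumes "x \<in> lab_perms J K"
 shows "edge_system ((%w. (w mod N, w div N)) ` {w. w < J & snd x w < K}) (lab_edges N J K x)"
proof -
 let ?W = "{w. w < J & snd x w < K}"
 have p: "fst x permutes {..<J}" using assms by (auto simp: lab_perms_def)
 have "tgt ` lab_edges N J K x = (%w. (w mod N, w div N)) ` fst x ` ?W"
  by (simp add: lab_edges_def image_image lab_edge_def)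
 moreover have "inj_on src (lab_edges N J K x)"
  by (auto simp: inj_on_def lab_edges_def lab_edge_def dest: div_mod_eq)
 moreover have "inj_on tgt (lab_edges N J K x)"
 proof (rule inj_onI)
  fix y z assume "y \<in> lab_edges N J K x" "z \<in> lab_edges N J K x" and t: "tgt y = tgt z"
  then obtain v w where vw: "y = lab_edge N x v" "z = lab_edge N x w" by (auto simp: lab_edges_def)
  hence "fst x v = fst x w" using t by (auto simp: lab_edge_def intro: div_mod_eq)
  hence "v = w" using permutes_inj[OF p] by (metis injD)
  thus "y = z" using vw by simp
 qed
 ultimately show ?thesis
  using lab_perms_closed[OF assms] by (simp add: edge_system_def) (simp add: lab_edges_def image_image lab_edge_def)
qed

lemma lab_edges_inj:
 assumes x: "x \<in> lab_perms J K" and y: "y \<in> lab_perms J K" and eq: "lab_edges N J K x = lab_edges N J K y"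
 shows "x = y"
proof -
 obtain p ka where px: "x = (p, ka)" by fastforce
 obtain p' ka' where py: "y = (p', ka')" by fastforce
 have X: "p permutes {..<J}" "!!w. w < J ==> ka w <= K" "!!w. [|w < J; ka w = K|] ==> p w = w" "ka \<in> extensional {..<J}"
  using x by (auto simp: lab_perms_def px PiE_def)
 have Y: "p' permutes {..<J}" "!!w. w < J ==> ka' w <= K" "!!w. [|w < J; ka' w = K|] ==> p' w = w" "ka' \<in> extensional {..<J}"
  using y by (auto simp: lab_perms_def py PiE_def)
 have one: "ka2 w = ka1 w & p2 w = p1 w" if "w < J" "ka1 w < K" "lab_edges N J K (p1, ka1) = lab_edges N J K (p2, ka2)" for w p1 p2 ka1 ka2
 proof -
  have "lab_edge N (p1, ka1) w \<in> lab_edges N J K (p2, ka2)" using that by (auto simp: lab_edges_def)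
  then obtain v where v: "lab_edge N (p1, ka1) w = lab_edge N (p2, ka2) v" by (auto simp: lab_edges_def)
  have "v div N = w div N" "v mod N = w mod N" using v by (simp_all add: lab_edge_def)
  hence "v = w" by (rule div_mod_eq)
  have "p1 w div N = p2 v div N" "p1 w mod N = p2 v mod N" using v by (simp_all add: lab_edge_def)
  hence "p1 w = p2 v" by (rule div_mod_eq)
  with \<open>v = w\<close> show ?thesis using v by (simp add: lab_edge_def)
 qed
 have "ka w = ka' w & p w = p' w" for w
 proof (cases "w < J")
  case True
  consider "ka w < K" | "ka' w < K" | "ka w = K" "ka' w = K" using X(2)[OF True] Y(2)[OF True] by linarith
  thus ?thesis
  proof cases
   case 1
   thus ?thesis using one[OF True 1 eq[unfolded px py]] by simp
  next
   case 2
   thus ?thesis using one[OF True 2 eq[unfolded px py, symmetric]] by simp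
  next
   case 3
   thus ?thesis using X(3)[OF True] Y(3)[OF True] by simp
  qed
 next
  case False
  thus ?thesis using X(1,4) Y(1,4) by (simp add: permutes_def extensional_def)
 qed
 thus ?thesis by (auto simp: px py)
qed

text \<open>On the indices outside U the permutation is completed by fixed points with label
  K.\<close>

lemma lab_edges_surj:
 assumes E: "edge_system U E" and U: "!!a i. (a, i) \<in> U ==> a < N & i < S" and lab: "!!y. y \<in> E ==> lab y < K"
 shows "\<exists>x\<in>lab_perms (S * N) K. lab_edges N (S * N) K x = E"
proof -
 let ?J = "S * N"
 let ?c = "%w. (w mod N, w div N)"
 let ?i = "%(a, i). i * N + a"
 have ci: "?c (?i c) = c" "?i c < ?J" if "c \<in> U" for c
 proof -
  obtain a i where c: "c = (a, i)" by fastforce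
  hence "a < N" "i < S" using U \<open>c \<in> U\<close> by auto
  note c = c this
  hence "Suc i * N <= S * N" by (intro mult_le_mono1) auto
  thus "?c (?i c) = c" "?i c < ?J" using c by auto
 qed
 define g where "g = inv_into E src"
 have g: "g c \<in> E" "src (g c) = c" if "c \<in> U" for c
  using E that unfolding g_def edge_system_def by (auto intro: inv_into_into f_inv_into_f)
 have tU: "tgt (g c) \<in> U" if "c \<in> U" for c using E g(1)[OF that] by (auto simp: edge_system_def)
 define p where "p w = (if w < ?J & ?c w \<in> U then ?i (tgt (g (?c w))) else w)" for w
 define ka where "ka w = (if w < ?J then if ?c w \<in> U then lab (g (?c w)) else K else undefined)" for w
 have "bij_betw p {..<?J} {..<?J}"
 proof -
  have "p ` {..<?J} \<subseteq> {..<?J}" using ci(2)[OF tU] by (auto simp: p_def)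
  moreover have "inj_on p {..<?J}"
  proof (rule inj_onI)
   fix v w assume vw: "v \<in> {..<?J}" "w \<in> {..<?J}" and eq: "p v = p w"
   have cp: "?c (p v) = (if ?c v \<in> U then tgt (g (?c v)) else ?c v)" if "v < ?J" for v
    using that ci(1)[OF tU] by (simp add: p_def)
   have iff: "?c (p v) \<in> U \<longleftrightarrow> ?c v \<in> U" if "v < ?J" for v
    using that tU[of "?c v"] by (simp only: cp) (simp split: if_splits)
   show "v = w"
   proof (cases "?c v \<in> U")
    case True
    hence w: "?c w \<in> U" using iff[of v] iff[of w] vw eq by simp
    have "tgt (g (?c v)) = tgt (g (?c w))" using cp[of v] cp[of w] vw eq True w by simp
    hence "g (?c v) = g (?c w)" using E g(1)[OF True] g(1)[OF w] by (auto simp: edge_system_def inj_on_def)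
    hence "?c v = ?c w" using g(2)[OF True] g(2)[OF w] by metis
    thus ?thesis by (auto intro: div_mod_eq)
   next
    case False
    hence "?c w \<notin> U" using iff[of v] iff[of w] vw eq by simp
    thus ?thesis using False eq by (simp add: p_def)
   qed
  qed
  ultimately show ?thesis unfolding bij_betw_def using endo_inj_surj[of "{..<?J}" p] by simp
 qed
 hence perm: "p permutes {..<?J}" by (rule bij_imp_permutes) (simp add: p_def)
 have labg: "lab (g (?c w)) < K" if "?c w \<in> U" for w by (rule lab[OF g(1)[OF that]])
 have ka_le: "ka w <= K" if "w < ?J" for w using labg[of w] that by (auto simp: ka_def less_imp_le)
 have K: "ka w = K \<longleftrightarrow> ?c w \<notin> U" if "w < ?J" for w
  using labg[of w] that by (auto simp: ka_def)
 have "ka \<in> PiE {..<?J} (%_. {..K})"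
  by (rule PiE_I) (use ka_le in "auto simp: ka_def")
 hence mem: "(p, ka) \<in> lab_perms ?J K"
  using perm K by (simp add: lab_perms_def) (simp add: p_def)
 have W: "{w. w < ?J & ka w < K} = {w. w < ?J & ?c w \<in> U}"
  using ka_le K by (auto simp: le_less)
 have le: "lab_edge N (p, ka) w = g (?c w)" if "w < ?J" "?c w \<in> U" for w
  using that g(2)[OF that(2)] ci(1)[OF tU[OF that(2)]] by (simp add: lab_edge_def p_def ka_def prod_eq_iff)
 have "lab_edges N ?J K (p, ka) = g ` ?c ` {w. w < ?J & ?c w \<in> U}"
  unfolding lab_edges_def snd_conv W image_image using le by (intro image_cong) auto
 also have "?c ` {w. w < ?J & ?c w \<in> U} = U"
 proof (intro equalityI subsetI)
  fix c assume "c \<in> U"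
  hence "?c (?i c) = c" "?i c < ?J" "?c (?i c) \<in> U" using ci by (metis, metis, metis)
  thus "c \<in> ?c ` {w. w < ?J & ?c w \<in> U}" by (metis (mono_tags, lifting) imageI mem_Collect_eq)
 qed auto
 also have "g ` U = E"
 proof -
  have "g ` src ` E = E" unfolding g_def
   by (rule inv_into_image_cancel) (use E in "simp_all add: edge_system_def")
  thus ?thesis using E by (simp add: edge_system_def)
 qed
 finally show ?thesis using mem by blast
qed

definition lab_exps :: "nat => nat => nat => (nat => nat) \<times> (nat => nat) => nat \<times> nat \<times> nat => nat" where
 "lab_exps N J K x v = card {w. w < J & snd x w < K & (w mod N, fst x w mod N, snd x w) = v}"

definition lab_row :: "nat => nat => nat => (nat => nat) \<times> (nat => nat) => nat => nat" where
 "lab_row N J K x a = card {w. w < J & snd x w < K & w mod N = a}"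

lemma edge_exps_lab_edges: "edge_exps (lab_edges N J K x) v = lab_exps N J K x v"
 unfolding edge_exps_def card_lab_edges by (simp add: lab_exps_def lab_edge_def)

lemma edge_row_lab_edges: "card {y \<in> lab_edges N J K x. srow y = a} = lab_row N J K x a"
 unfolding card_lab_edges by (simp add: lab_row_def lab_edge_def)

lemma code_inj:
 assumes "(i * S + j) * K + k = (i' * S + j') * K + k'" "j < S" "j' < S" "k < K" "k' < (K :: nat)"
 shows "i = i' & j = j' & k = k'"
proof -
 have "((i * S + j) * K + k) div K = i * S + j" "((i' * S + j') * K + k') div K = i' * S + j'"
  "((i * S + j) * K + k) mod K = k" "((i' * S + j') * K + k') mod K = k'" using assms(2-5) by simp_all
 hence 1: "i * S + j = i' * S + j'" "k = k'" using assms(1) by metis+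
 have "(i * S + j) div S = i" "(i' * S + j') div S = i'" "(i * S + j) mod S = j" "(i' * S + j') mod S = j'"
  using assms(2-5) by simp_all
 thus ?thesis using 1 by metis
qed

lemma lab_type_eq:
 assumes x: "x \<in> lab_perms (S * N) K" and ijk: "i < S" "j < S" "k < K"
 shows "lab_type N S K x ((i * S + j) * K + k) = edge_type (lab_edges N (S * N) K x) (i, j, k)"
proof -
 have "{u. u < S * N & snd x u < K & lab_code N S K x u = (i * S + j) * K + k}
  = {u. u < S * N & snd x u < K & etype (lab_edge N x u) = (i, j, k)}"
 proof -
  have "lab_code N S K x u = (i * S + j) * K + k \<longleftrightarrow> etype (lab_edge N x u) = (i, j, k)" if u: "u < S * N" "snd x u < K" for u
  proof -
   have "fst x permutes {..<S * N}" using x by (auto simp: lab_perms_def)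
   hence "fst x u < S * N" using permutes_in_image[of "fst x" "{..<S * N}" u] u by simp
   hence "fst x u div N < S" by (rule less_mult_imp_div_less)
   thus ?thesis
    using code_inj[of "u div N" S "fst x u div N" K "snd x u" i j k] ijk u(2)
    by (auto simp: lab_code_def lab_edge_def case_prod_unfold)
  qed
  thus ?thesis by blast
 qed
 thus ?thesis unfolding lab_type_def edge_type_def card_lab_edges by simp
qed

lemma edge_type_out:
 assumes x: "x \<in> lab_perms (S * N) K" and out: "\<not> (i < S & j < S & k < K)"
 shows "edge_type (lab_edges N (S * N) K x) (i, j, k) = 0"
proof -
 have "\<not> (u < S * N & snd x u < K & etype (lab_edge N x u) = (i, j, k))" for u
 proof
  assume u: "u < S * N & snd x u < K & etype (lab_edge N x u) = (i, j, k)"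
  have "fst x permutes {..<S * N}" using x by (auto simp: lab_perms_def)
  hence "fst x u < S * N" using permutes_in_image[of "fst x" "{..<S * N}" u] u by simp
  thus False using u out by (auto simp: lab_edge_def less_mult_imp_div_less)
 qed
 hence "{u. u < S * N & snd x u < K & etype (lab_edge N x u) = (i, j, k)} = {}" by blast
 thus ?thesis unfolding edge_type_def card_lab_edges by (simp only: card.empty)
qed

context lattice_exps
begin

text \<open>The maximum at the picture is strict, so its term cannot cancel. Column 0 of the diagram
  has one cell in every nonempty row; hence \<open>lab_zero\<close> of the picture, which becomes
  \<rho> in \<open>lab_sum_mem\<close>, counts the rows.\<close>

theorem picture_leading:
 assumes S: "!!a. a < N ==> ch a <= S"
 shows "\<exists>x0\<in>lab_perms (S * N) u. (\<forall>a b k. a < N & b < N & k < u --> lab_exps N (S * N) u x0 (a, b, k) = e (a, b, k)) &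
  lab_zero N S u x0 = card {a. a < N & 0 < ch a} &
  (\<forall>x\<in>lab_perms (S * N) u. (\<forall>c<S * S * u. lab_type N S u x c = lab_type N S u x0 c) --> x = x0 \<or>
   rows_below N (lab_row N (S * N) u x) ch \<or>
   (\<forall>a<N. lab_row N (S * N) u x a = ch a) & exps_below N u (lab_exps N (S * N) u x) e)"
proof -
 interpret P: picture N ch "pic N u e" by (rule picture_pic)
 have "a < N & i < S" if "(a, i) \<in> diagram N ch" for a i
  using S[of a] that by (auto simp: diagram_def)
 then obtain x0 where x0: "x0 \<in> lab_perms (S * N) u" "lab_edges N (S * N) u x0 = pic N u e"
  using lab_edges_surj[of "diagram N ch" "pic N u e" N S u, OF P.sys0] lab_pic by blast
 have exps0: "lab_exps N (S * N) u x0 (a, b, k) = e (a, b, k)" if "a < N" "b < N" "k < u" for a b k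
  using edge_exps_pic[OF that] by (simp add: x0(2) flip: edge_exps_lab_edges)
 have "lab_zero N S u x0 = card {y \<in> pic N u e. scol y = 0}"
  unfolding x0(2)[symmetric] card_lab_edges by (simp add: lab_zero_def lab_edge_def)
 also have "... = card (fst ` src ` {y \<in> pic N u e. scol y = 0})"
  unfolding image_image
 proof (rule card_image[symmetric], rule inj_onI)
  fix y z assume "y \<in> {y \<in> pic N u e. scol y = 0}" "z \<in> {y \<in> pic N u e. scol y = 0}" "srow y = srow z"
  hence "y \<in> pic N u e" "z \<in> pic N u e" "src y = src z" by (simp_all add: prod_eq_iff)
  thus "y = z" using P.sys0 by (simp add: edge_system_def inj_on_def)
 qed
 also have "fst ` src ` {y \<in> pic N u e. scol y = 0} = {a. a < N & 0 < ch a}"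
 proof (intro equalityI subsetI)
  fix a assume "a \<in> fst ` src ` {y \<in> pic N u e. scol y = 0}"
  then obtain y where "y \<in> pic N u e" "scol y = 0" "a = srow y" by blast
  thus "a \<in> {a. a < N & 0 < ch a}" using P.src_diagram[of y] by (auto simp: diagram_def split: prod.splits)
 next
  fix a assume "a \<in> {a. a < N & 0 < ch a}"
  hence "(a, 0) \<in> diagram N ch" by (simp add: diagram_def)
  then obtain y where y: "y \<in> pic N u e" "src y = (a, 0)" using P.ex_edge by blast
  hence "y \<in> {y \<in> pic N u e. scol y = 0}" "a = srow y" by simp_all
  thus "a \<in> fst ` src ` {y \<in> pic N u e. scol y = 0}" by blast
 qed
 finally have zero: "lab_zero N S u x0 = card {a. a < N & 0 < ch a}" .
 have main: "x = x0 \<or> rows_below N (lab_row N (S * N) u x) ch \<or>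
   (\<forall>a<N. lab_row N (S * N) u x a = ch a) & exps_below N u (lab_exps N (S * N) u x) e"
  if x: "x \<in> lab_perms (S * N) u" and ty: "\<forall>c<S * S * u. lab_type N S u x c = lab_type N S u x0 c" for x
 proof -
  let ?E = "lab_edges N (S * N) u x"
  let ?U = "(%w. (w mod N, w div N)) ` {w. w < S * N & snd x w < u}"
  have E: "edge_system ?U ?E" by (rule edge_system_lab_edges[OF x])
  have type: "edge_type ?E = edge_type (pic N u e)"
  proof
   fix v :: "nat \<times> nat \<times> nat"
   obtain i j k where v: "v = (i, j, k)" by (metis prod_cases3)
   show "edge_type ?E v = edge_type (pic N u e) v"
   proof (cases "i < S & j < S & k < u")
    case True
    have "Suc i * S <= S * S" using True by (intro mult_le_mono1) simp
    hence "i * S + j < S * S" using True by simp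
    hence "Suc (i * S + j) * u <= S * S * u" by (intro mult_le_mono1) simp
    hence "(i * S + j) * u + k < S * S * u" using True by simp
    hence "lab_type N S u x ((i * S + j) * u + k) = lab_type N S u x0 ((i * S + j) * u + k)"
     using ty by blast
    thus ?thesis using True lab_type_eq[OF x, of i j k] lab_type_eq[OF x0(1), of i j k] by (simp add: v x0(2))
   next
    case F: False
    show ?thesis using edge_type_out[OF x F] edge_type_out[OF x0(1) F] by (simp add: v x0(2))
   qed
  qed
  have U: "a < N" if aU: "(a, i) \<in> ?U" for a i
  proof -
   obtain w where "w < S * N" "a = w mod N" using aU by blast
   thus ?thesis by (cases "N = 0") simp_all
  qed
  show ?thesis
  proof (cases "?U = diagram N ch")
   case False
   have "rows_below N (lab_row N (S * N) u x) ch"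
    using P.rows_less[OF E type U False] unfolding edge_row_lab_edges .
   thus ?thesis by (intro disjI2 disjI1)
  next
   case True
   hence E': "edge_system (diagram N ch) ?E" using E by simp
   have row: "lab_row N (S * N) u x a = ch a" if "a < N" for a
   proof -
    have "lab_row N (S * N) u x a = card ({a} \<times> {..<ch a})"
    proof -
     have "bij_betw (%w. (w mod N, w div N)) {w. w < S * N & snd x w < u & w mod N = a} ({a} \<times> {..<ch a})"
      unfolding bij_betw_def
     proof
      show "inj_on (%w. (w mod N, w div N)) {w. w < S * N & snd x w < u & w mod N = a}"
       by (auto simp: inj_on_def intro: div_mod_eq)
      have "(%w. (w mod N, w div N)) ` {w. w < S * N & snd x w < u & w mod N = a} = {c \<in> ?U. fst c = a}" by auto
      also have "... = {a} \<times> {..<ch a}" unfolding True using that by (auto simp: diagram_def)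
      finally show "(%w. (w mod N, w div N)) ` {w. w < S * N & snd x w < u & w mod N = a} = {a} \<times> {..<ch a}" .
     qed
     thus ?thesis unfolding lab_row_def by (rule bij_betw_same_card)
    qed
    thus ?thesis by simp
   qed
   show ?thesis
   proof (cases "?E = pic N u e")
    case True
    hence "x = x0" using lab_edges_inj[OF x x0(1), of N] x0(2) by simp
    thus ?thesis by (rule disjI1)
   next
    case ne: False
    have labx: "lab y < u" if "y \<in> ?E" for y using that by (auto simp: lab_edges_def lab_edge_def)
    have "exps_below N u (edge_exps ?E) (edge_exps (pic N u e))"
     by (rule P.exps_less[OF E' type]) (fact lab_pic labx ne)+
    hence "exps_below N u (lab_exps N (S * N) u x) e"
     unfolding exps_below_def by (simp add: edge_exps_pic edge_exps_lab_edges cong: conj_cong)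
    thus ?thesis using row by simp
   qed
  qed
 qed
 show ?thesis using x0(1) exps0 zero main by blast
qed

end

subsection \<open>Leading monomials\<close>

definition exps_row :: "nat => nat => (nat \<times> nat \<times> nat => nat) => nat => nat" where
 "exps_row N u e a = (\<Sum>(j, k)\<in>{..<N} \<times> {..<u}. e (a, j, k))"

definition exps_digit :: "nat => nat => (nat \<times> nat \<times> nat => nat) => nat => nat" where
 "exps_digit N u e x = (if x < u * N * N then e (x div N mod N, x mod N, x div N div N)
   else exps_row N u e (u * N * N + N - 1 - x))"

text \<open>Exponents are compared by the row weights first, the first row being the most significant
 one, then by the exponent of the largest variable with respect to the order by \<open>(k, i, j)\<close>.\<close>

definition exps_code :: "nat => nat => nat => (nat \<times> nat \<times> nat => nat) => nat" where
 "exps_code N u B e = (\<Sum>x<u * N * N + N. exps_digit N u e x * B ^ x)"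

lemma index_less': "i < N ==> j < N ==> k < u ==> (k * N + i) * N + j < u * N * (N :: nat)"
 by (intro index_less)

lemma index_le:
 assumes "x * N + r < y * N + (j :: nat)" "j < N"
 shows "x <= y"
proof (rule ccontr)
 assume "\<not> ?thesis"
 hence "Suc y * N <= x * N" by (intro mult_le_mono1) simp
 thus False using assms by simp
qed

lemma index_decomp:
 assumes "x < u * N * (N :: nat)"
 shows "x div N mod N < N" "x mod N < N" "x div N div N < u" "x = (x div N div N * N + x div N mod N) * N + x mod N"
proof -
 have "N > 0" using assms by (cases N) auto
 thus "x div N mod N < N" "x mod N < N" by simp_all
 show "x div N div N < u" using assms by (simp add: less_mult_imp_div_less)
qed simp

lemma exps_digit_var:
 assumes "i < N" "j < N" "k < u"
 shows "exps_digit N u e ((k * N + i) * N + j) = e (i, j, k)"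
proof -
 have "((k * N + i) * N + j) div N = k * N + i" using assms by simp
 thus ?thesis using assms index_less'[OF assms] by (simp add: exps_digit_def)
qed

lemma exps_code_less_var:
 assumes B: "!!x. x < u * N * N + N ==> exps_digit N u e x < B" and less: "exps_below N u e e'"
  and row: "!!a. a < N ==> exps_row N u e a = exps_row N u e' a"
 shows "exps_code N u B e < exps_code N u B e'"
proof -
 obtain i j k where ijk: "i < N" "j < N" "k < u" and less: "e (i, j, k) < e' (i, j, k)"
  and eq: "\<forall>i' j' k'. i' < N & j' < N & k' < u & (k * N + i) * N + j < (k' * N + i') * N + j' --> e (i', j', k') = e' (i', j', k')"
  using less unfolding exps_below_def by (elim exE conjE) (rule that)
 show ?thesis
  unfolding exps_code_def
 proof (rule sum_base_less[where i = "(k * N + i) * N + j"])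
  show "(k * N + i) * N + j < u * N * N + N" using index_less'[OF ijk] by simp
  show "exps_digit N u e ((k * N + i) * N + j) < exps_digit N u e' ((k * N + i) * N + j)"
   using less by (simp add: exps_digit_var[OF ijk])
  show "exps_digit N u e x = exps_digit N u e' x" if x: "(k * N + i) * N + j < x" "x < u * N * N + N" for x
  proof (cases "x < u * N * N")
   case True
   thus ?thesis using eq index_decomp[OF True] x(1) by (simp add: exps_digit_def)
  next
   case False
   thus ?thesis using x(2) ijk by (simp add: exps_digit_def row)
  qed
 qed (fact B)
qed

lemma exps_code_less_row:
 assumes B: "!!x. x < u * N * N + N ==> exps_digit N u e x < B" and "rows_below N (exps_row N u e) (exps_row N u e')"
 shows "exps_code N u B e < exps_code N u B e'"
proof -
 obtain a where a: "a < N" "exps_row N u e a < exps_row N u e' a" "!!a'. a' < a ==> exps_row N u e a' = exps_row N u e' a'"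
  using assms(2) by (auto simp: rows_below_def)
 show ?thesis
  unfolding exps_code_def
 proof (rule sum_base_less[where i = "u * N * N + (N - 1 - a)"])
  show "exps_digit N u e x = exps_digit N u e' x" if x: "u * N * N + (N - 1 - a) < x" "x < u * N * N + N" for x
  proof -
   have "u * N * N <= x" using x by linarith
   then obtain y where "x = u * N * N + y" using le_Suc_ex by blast
   thus ?thesis using x a by (simp add: exps_digit_def)
  qed
 qed (use a B in "simp_all add: exps_digit_def")
qed

lemma exps_code_inj:
 assumes "!!x. x < u * N * N + N ==> exps_digit N u e x < B" "!!x. x < u * N * N + N ==> exps_digit N u e' x < B"
  and "exps_code N u B e = exps_code N u B e'" and "i < N" "j < N" "k < u"
 shows "e (i, j, k) = e' (i, j, k)"
 using sum_base_inj[OF assms(1,2) assms(3)[unfolded exps_code_def], of "(k * N + i) * N + j"] index_less'[OF assms(4-6)]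
 by (simp add: exps_digit_var[OF assms(4-6)])

context gl_form
begin

lemma transpose: "gl_form N u K co (%m. exps_transp (e m))"
proof
 show "m = m'" if "m \<in> K" "m' \<in> K" "!!v. v \<in> V ==> exps_transp (e m) v = exps_transp (e m') v" for m m'
 proof (rule inj[OF that(1,2)])
  fix v assume "v \<in> V"
  then obtain i j k where v: "v = (i, j, k)" "(j, i, k) \<in> V" by auto
  show "e m v = e m' v" using that(3)[OF v(2)] by (simp add: v(1) exps_transp_def)
 qed
 fix g :: "nat => nat => 'a" and Z
 have swap: "(\<Prod>(i, j, k)\<in>V. F i j k) = (\<Prod>(i, j, k)\<in>V. F j i k)" for F :: "nat => nat => nat => 'a"
  by (rule prod.reindex_bij_witness[of _ "%(i, j, k). (j, i, k)" "%(i, j, k). (j, i, k)"]) auto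
 have "(\<Sum>m\<in>K. co m * (\<Prod>(i, j, k)\<in>V. (\<Sum>l<N. g i l * Z (l, j, k)) ^ e m (j, i, k)))
   = (\<Sum>m\<in>K. co m * (\<Prod>(i, j, k)\<in>V. (\<Sum>l<N. Z (l, i, k) * g j l) ^ e m (i, j, k)))"
  by (subst swap) (simp add: mult.commute)
 also have "... = (\<Sum>m\<in>K. co m * (\<Prod>(i, j, k)\<in>V. (\<Sum>l<N. g l i * Z (j, l, k)) ^ e m (i, j, k)))"
  using invar[of "%l j. g j l" "%(i, l, k). Z (l, i, k)"] by simp
 also have "... = (\<Sum>m\<in>K. co m * (\<Prod>(i, j, k)\<in>V. (\<Sum>l<N. Z (i, l, k) * g l j) ^ e m (j, i, k)))"
  by (subst swap) (simp add: mult.commute)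
 finally show "(\<Sum>m\<in>K. co m * (\<Prod>(i, j, k)\<in>V. (\<Sum>l<N. g i l * Z (l, j, k)) ^ exps_transp (e m) (i, j, k)))
   = (\<Sum>m\<in>K. co m * (\<Prod>(i, j, k)\<in>V. (\<Sum>l<N. Z (i, l, k) * g l j) ^ exps_transp (e m) (i, j, k)))"
  by (simp add: exps_transp_def)
qed (use inf fin co in auto)

lemma row_wt_exps_row: "row_wt i m = exps_row N u (e m) i"
 by (simp add: row_wt_def exps_row_def)

text \<open>The order \<open>idx\<close> is a parameter because the transposed form is ordered by
  (k, j, i). All that matters is \<open>after\<close>: inside the rows a and a + 1, a variable
  beyond a given one of row a + 1 lies in a later column.\<close>

lemma row_inequality:
 assumes a: "Suc a < N" "c < u * N" and M: "M \<in> K" "!!i. i < N ==> row_wt i M = ch i"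
  and top: "!!m. [|m \<in> K; !!i. i < a ==> row_wt i m = ch i|] ==> row_wt a m <= ch a"
  and max: "!!m i j k. [|m \<in> K; !!i. i < N ==> row_wt i m = ch i; i < N; j < N; k < u;
   !!i' j' k'. [|i' < N; j' < N; k' < u; idx i j k < (idx i' j' k' :: nat)|] ==> e m (i', j', k') = e M (i', j', k')|]
   ==> e m (i, j, k) <= e M (i, j, k)"
  and after: "!!j k i' j' k'. [|idx (Suc a) j k < idx i' j' k'; i' < N; i' = a \<or> i' = Suc a; j < N; j' < N|] ==> k * N + j < k' * N + j'"
 shows "(\<Sum>i\<le>c. row_seq N (e M) (Suc a) i) <= (\<Sum>i<c. row_seq N (e M) a i)"
 unfolding row_seq_def
proof (rule row_lattice[unfolded x_var_def, OF a(1) M])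
 show "\<not> (\<forall>i<N. row_wt i m + (if i = Suc a then j else 0) = ch i + (if i = a then j else 0))"
  if "m \<in> K" "j \<ge> 1" for m j
 proof
  assume *: "\<forall>i<N. row_wt i m + (if i = Suc a then j else 0) = ch i + (if i = a then j else 0)"
  have "row_wt i m = ch i" if "i < a" for i using *[rule_format, of i] that a by simp
  hence "row_wt a m <= ch a" by (rule top[OF that(1)])
  thus False using *[rule_format, of a] that a by simp
 qed
 fix m c assume m: "m \<in> K" "!!i. i < N ==> row_wt i m = ch i" and c: "c < u * N"
  and out: "!!v. [|v \<in> V; fst v ~= a; fst v ~= Suc a|] ==> e m v = e M v"
  and above: "!!i. [|c < i; i < u * N|] ==> e m (a, i mod N, i div N) = e M (a, i mod N, i div N) &
   e m (Suc a, i mod N, i div N) = e M (Suc a, i mod N, i div N)"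
 have cd: "c mod N < N" "c div N < u" using a c by (simp_all add: less_mult_imp_div_less)
 show "e m (Suc a, c mod N, c div N) <= e M (Suc a, c mod N, c div N)"
 proof (rule max[OF m a(1) cd])
  fix i' j' k' assume r: "i' < N" "j' < N" "k' < u" and l: "idx (Suc a) (c mod N) (c div N) < idx i' j' k'"
  show "e m (i', j', k') = e M (i', j', k')"
  proof (cases "i' = a \<or> i' = Suc a")
   case True
   have "c < k' * N + j'" using after[OF l r(1) True cd(1) r(2)] by simp
   moreover have "k' * N + j' < u * N" by (rule index_less[OF r(2,3)])
   ultimately show ?thesis using above[of "k' * N + j'"] r True by auto
  next
   case False
   thus ?thesis using out[of "(i', j', k')"] r by simp
  qed
 qed
qed (use a in auto)

lemma leading_lattice:
 assumes B: "!!m x. [|m \<in> K; x < u * N * N + N|] ==> exps_digit N u (e m) x < B"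
  and M: "M \<in> K" and max: "!!m. m \<in> K ==> exps_code N u B (e m) <= exps_code N u B (e M)"
 shows "lattice_exps N u (e M) (exps_row N u (e M))"
proof -
 interpret t: gl_form N u K co "%m. exps_transp (e m)" by (rule local.transpose)
 have trow: "t.row_wt i m = row_wt i m" if "m \<in> K" "i < N" for i m
  using row_eq_col[OF that] unfolding t.row_wt_def col_wt_def by (simp add: exps_transp_def)
 let ?ch = "%i. row_wt i M"
 have top: "row_wt a m <= ?ch a" if "m \<in> K" "!!i. i < a ==> row_wt i m = ?ch i" "a < N" for m a
 proof (rule ccontr)
  assume "\<not> ?thesis"
  hence "rows_below N (exps_row N u (e M)) (exps_row N u (e m))"
   using that unfolding rows_below_def row_wt_exps_row[symmetric] by (intro exI[of _ a]) simp
  thus False using exps_code_less_row[OF B[OF M]] max[OF that(1)] by (meson leD)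
 qed
 have xle: "e m (i, j, k) <= e M (i, j, k)"
  if m: "m \<in> K" "!!i. i < N ==> row_wt i m = ?ch i" and ijk: "i < N" "j < N" "k < u"
   and eq: "!!i' j' k'. [|i' < N; j' < N; k' < u; (k * N + i) * N + j < (k' * N + i') * N + j'|] ==> e m (i', j', k') = e M (i', j', k')"
  for m i j k
 proof (rule ccontr)
  assume "\<not> ?thesis"
  hence "exps_below N u (e M) (e m)"
   unfolding exps_below_def using ijk eq by (intro exI[of _ i] exI[of _ j] exI[of _ k]) simp
  hence "exps_code N u B (e M) < exps_code N u B (e m)"
   using m(2) by (intro exps_code_less_var[OF B[OF M]]) (simp_all add: row_wt_exps_row)
  thus False using max[OF m(1)] by simp
 qed
 show ?thesis
 proof
  fix a c assume a: "Suc a < N" "c < u * N"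
  show "(\<Sum>i\<le>c. row_seq N (e M) (Suc a) i) <= (\<Sum>i<c. row_seq N (e M) a i)"
  proof (rule row_inequality[OF a M, where ch = ?ch and idx = "%i j k. (k * N + i) * N + j"])
   show "row_wt a m <= ?ch a" if "m \<in> K" "!!i. i < a ==> row_wt i m = ?ch i" for m
    by (rule top) (fact that, fact that, use a in simp)
   show "e m (i, j, k) <= e M (i, j, k)"
    if "m \<in> K" "!!i. i < N ==> row_wt i m = ?ch i" "i < N" "j < N" "k < u"
     and eq: "!!i' j' k'. [|i' < N; j' < N; k' < u; (k * N + i) * N + j < (k' * N + i') * N + j'|] ==> e m (i', j', k') = e M (i', j', k')" for m i j k
    by (rule xle) (fact that eq)+
   fix j k i' j' k' :: nat
   assume l: "(k * N + Suc a) * N + j < (k' * N + i') * N + j'" and i': "i' = a \<or> i' = Suc a" and j: "j < N" "j' < N"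
   have le: "k * N + Suc a <= k' * N + i'" by (rule index_le[OF l j(2)])
   moreover have "i' <= Suc a" using i' by auto
   ultimately have "k * N <= k' * N" by linarith
   hence "k <= k'" using j by simp
   show "k * N + j < k' * N + j'"
   proof (cases "k = k'")
    case True
    thus ?thesis using l le i' by auto
   next
    case False
    hence "Suc k * N <= k' * N" using \<open>k <= k'\<close> by (intro mult_le_mono1) simp
    thus ?thesis using j by simp
   qed
  qed (rule refl)
  show "(\<Sum>i\<le>c. row_seq N (exps_transp (e M)) (Suc a) i) <= (\<Sum>i<c. row_seq N (exps_transp (e M)) a i)"
  proof (rule t.row_inequality[OF a M, where idx = "%i j k. (k * N + j) * N + i" and ch = ?ch])
   show "t.row_wt i M = ?ch i" if "i < N" for i by (rule trow[OF M that])
   show "t.row_wt a m <= ?ch a" if "m \<in> K" "!!i. i < a ==> t.row_wt i m = ?ch i" for m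
    using top[OF that(1), of a] that a by (simp add: trow)
   show "exps_transp (e m) (i, j, k) <= exps_transp (e M) (i, j, k)"
    if "m \<in> K" "!!i. i < N ==> t.row_wt i m = ?ch i" "i < N" "j < N" "k < u"
     and eq: "!!i' j' k'. [|i' < N; j' < N; k' < u; (k * N + j) * N + i < (k' * N + j') * N + i'|]
      ==> exps_transp (e m) (i', j', k') = exps_transp (e M) (i', j', k')" for m i j k
    unfolding exps_transp_def prod.case
   proof (rule xle[OF that(1)])
    show "j < N" "i < N" "k < u" by (fact that)+
    show "row_wt i' m = ?ch i'" if "i' < N" for i' using \<open>!!i. i < N ==> t.row_wt i m = ?ch i\<close>[OF that] trow[OF \<open>m \<in> K\<close> that] by simp
    show "e m (i', j', k') = e M (i', j', k')" if "i' < N" "j' < N" "k' < u" "(k * N + j) * N + i < (k' * N + i') * N + j'" for i' j' k'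
     using eq[of j' i' k'] that by (simp add: exps_transp_def)
   qed
   fix j k i' j' k' :: nat
   assume l: "(k * N + j) * N + Suc a < (k' * N + j') * N + i'" and i': "i' < N" "i' = a \<or> i' = Suc a"
   have "k * N + j <= k' * N + j'" by (rule index_le[OF l i'(1)])
   moreover have "k * N + j ~= k' * N + j'" using l i'(2) by auto
   ultimately show "k * N + j < k' * N + j'" by simp
  qed
 next
  fix a assume a: "a < N"
  show "(\<Sum>i<u * N. row_seq N (e M) a i) = exps_row N u (e M) a"
   unfolding row_seq_def row_wt_exps_row[symmetric] row_x_var x_var_def ..
  have "(\<Sum>i<u * N. row_seq N (exps_transp (e M)) a i) = t.row_wt a M"
   unfolding row_seq_def t.row_x_var t.x_var_def ..
  thus "(\<Sum>i<u * N. row_seq N (exps_transp (e M)) a i) = exps_row N u (e M) a"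
   using trow[OF M a] by (simp add: row_wt_exps_row)
 qed
qed

end

subsection \<open>Rescaling the variables\<close>

lemma mon_ev_const: "mon_ev (%v. const_pol (\<tau> v)) m = const_pol (mon_ev \<tau> m)"
 by (simp add: mon_ev_def const_pol.hom_prod const_pol.hom_power)

lemma mon_ev_mult: "mon_ev (%v. f v * g v) m = mon_ev f m * mon_ev g m"
 by (simp add: mon_ev_def power_mult_distrib prod.distrib)

lemma mon_ev_power_wt: "mon_ev (%v. z ^ w v) m = z ^ wt w m"
 by (simp add: mon_ev_def wt_def power_mult[symmetric] power_sum)

lemma mon_ev_indicator: "mon_ev (%v. if v \<in> V then 1 else 0) m = (if keys m \<subseteq> V then 1 else 0 :: 'b::comm_ring_1)"
proof (cases "keys m \<subseteq> V")
 case True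
 thus ?thesis unfolding mon_ev_def by (auto intro!: prod.neutral)
next
 case False
 then obtain v where "v \<in> keys m" "v \<notin> V" by blast
 hence "(if v \<in> V then 1 else 0) ^ lookup m v = (0 :: 'b)" by (simp add: in_keys_iff zero_power)
 hence "mon_ev (%v. if v \<in> V then 1 else 0) m = (0 :: 'b)"
  unfolding mon_ev_def using \<open>v \<in> keys m\<close> by (intro prod_zero) (auto intro: bexI[of _ v])
 thus ?thesis using False by simp
qed

lemma lookup_rescale:
 "lookup (ev const_pol (%v. const_pol (\<tau> v) * var_pol v) p) m = mon_ev \<tau> m * lookup p m"
proof (induction p rule: pol_add_induct)
 case (single m' a)
 have "ev const_pol (%v. const_pol (\<tau> v) * var_pol v) (single m' a) = const_pol (a * mon_ev \<tau> m') * single m' 1"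
  by (simp add: const_pol.ev_single mon_ev_mult mon_ev_const mon_ev_var const_pol.hom_mult mult.assoc)
 thus ?case by (simp add: const_pol_mult_lookup lookup_single when_def)
qed (simp_all add: const_pol.ev_add lookup_add algebra_simps)

definition hpart :: "('v => nat) => nat => ('v, 'a::comm_ring_1) pol => ('v, 'a) pol" where
 "hpart w d p = (\<Sum>m | m \<in> keys p & wt w m = d. single m (lookup p m))"

lemma lookup_sum_single:
 assumes "finite M"
 shows "lookup (\<Sum>m\<in>M. single m (f m)) x = (if x \<in> M then f x else 0)"
 using assms by (simp add: Poly_Mapping.lookup_sum lookup_single when_def)


lemma lookup_hpart: "lookup (hpart w d p) m = (if wt w m = d then lookup p m else 0)"
 unfolding hpart_def by (subst lookup_sum_single) (auto simp: in_keys_iff)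

lemma keys_hpart: "keys (hpart w d p) = {m \<in> keys p. wt w m = d}"
proof (rule Set.set_eqI)
 fix m
 show "m \<in> keys (hpart w d p) \<longleftrightarrow> m \<in> {m \<in> keys p. wt w m = d}"
  unfolding mem_Collect_eq in_keys_iff lookup_hpart by simp
qed

lemma hpart_0 [simp]: "hpart w d 0 = 0"
 by (simp add: hpart_def)

lemma hpart_diff: "hpart w d (p - q) = hpart w d p - hpart w d q"
 by (rule poly_mapping_eqI) (simp add: lookup_hpart lookup_minus)

lemma hpart_id: "(!!m. m \<in> keys p ==> wt w m = d) ==> hpart w d p = p"
 by (rule poly_mapping_eqI) (auto simp: lookup_hpart in_keys_iff)

lemma hpart_high_degree: "p \<in> high_degree (Suc d) ==> hpart (%_. 1) d p = 0"
 by (rule poly_mapping_eqI) (force simp: lookup_hpart high_degree_def in_keys_iff)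

lemma sum_hpart:
 assumes "!!m. m \<in> keys p ==> wt w m <= D"
 shows "(\<Sum>d\<le>D. hpart w d p) = p"
proof (rule poly_mapping_eqI)
 fix m
 show "lookup (\<Sum>d\<le>D. hpart w d p) m = lookup p m"
  using assms[of m] by (auto simp: Poly_Mapping.lookup_sum lookup_hpart in_keys_iff)
qed

lemma sum_single_rescale:
 "(\<Sum>m\<in>keys p. const_pol (mon_ev \<tau> m) * single m (lookup p m))
  = ev const_pol (%v. const_pol (\<tau> v) * var_pol v) p"
proof (rule poly_mapping_eqI)
 fix x
 have "lookup (\<Sum>m\<in>keys p. const_pol (mon_ev \<tau> m) * single m (lookup p m)) x
  = mon_ev \<tau> x * lookup p x"
  by (simp add: Poly_Mapping.lookup_sum const_pol_mult_lookup lookup_single when_def if_distrib[of "(*) _"] sum.delta in_keys_iff cong: if_cong)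
 thus "lookup (\<Sum>m\<in>keys p. const_pol (mon_ev \<tau> m) * single m (lookup p m)) x
  = lookup (ev const_pol (%v. const_pol (\<tau> v) * var_pol v) p) x"
  by (simp add: lookup_rescale)
qed

subsection \<open>Variables and homogeneity of matrix invariants\<close>

definition pol_over :: "'v set => ('v, 'a::comm_ring_1) pol set" where
 "pol_over V = {p. \<forall>m\<in>keys p. keys m \<subseteq> V}"

text \<open>As a fixed point under setting the other variables to 0, the property can be checked
  through homomorphisms such as \<open>Phi_tilde N\<close>.\<close>

lemma pol_over_rescale: "p \<in> pol_over V \<longleftrightarrow> ev const_pol (%v. const_pol (if v \<in> V then 1 else 0) * var_pol v) p = p"
proof -
 have "ev const_pol (%v. const_pol (if v \<in> V then 1 else 0) * var_pol v) p = p \<longleftrightarrow>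
  (\<forall>m. (if keys m \<subseteq> V then 1 else 0) * lookup p m = lookup p m)"
  by (simp add: poly_mapping_eq_iff fun_eq_iff lookup_rescale mon_ev_indicator)
 also have "... \<longleftrightarrow> (\<forall>m. lookup p m ~= 0 --> keys m \<subseteq> V)"
 proof (intro iff_allI)
  fix m
  show "(if keys m \<subseteq> V then 1 else 0) * lookup p m = lookup p m \<longleftrightarrow>
   (lookup p m ~= 0 --> keys m \<subseteq> V)" by auto
 qed
 finally show ?thesis by (simp add: pol_over_def Ball_def in_keys_iff[of _ p])
qed

lemma ev_pol_over_cong:
 assumes "p \<in> pol_over V" "!!v. v \<in> V ==> f v = g v"
 shows "ev c f p = ev c g p"
 by (rule ev_cong) (use assms in "auto simp: pol_over_def")

lemma Phi_tilde_pol_over: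
 assumes s: "!!m v. [|m \<in> keys s; v \<in> keys m|] ==> set (letters (snd (Rep_tilde_sym v))) \<subseteq> A"
 shows "Phi_tilde N s \<in> pol_over ({..<N} \<times> {..<N} \<times> A)"
proof -
 let ?h = "ev const_pol (%v. const_pol (if v \<in> {..<N} \<times> {..<N} \<times> A then 1 else 0) * var_pol v) :: 'a gen_ring => _"
 interpret h: comm_ring_hom ?h by (rule const_pol.ev_hom)
 have "?h (Phi_tilde N s) = ev (%a. ?h (const_pol a)) (%v. ?h (sym_mat N (generic_mat N) v)) s"
  unfolding Phi_tilde_ev by (rule ev_ev) (fact h.comm_ring_hom_axioms const_pol_hom)+
 also have "... = ev const_pol (%v. ?h (sym_mat N (generic_mat N) v)) s" by (simp add: const_pol.ev_const)
 also have "... = ev const_pol (sym_mat N (generic_mat N)) s"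
 proof (rule ev_cong)
  fix m v assume "m \<in> keys s" "v \<in> keys m"
  hence l: "set (letters (snd (Rep_tilde_sym v))) \<subseteq> A" by (rule s)
  obtain t e where v: "Rep_tilde_sym v = (t, e)" by fastforce
  have "map_mat ?h (foldr (%k B. generic_mat N k * B) ks (1\<^sub>m N)) = foldr (%k B. generic_mat N k * B) ks (1\<^sub>m N)"
   if "set ks \<subseteq> A" for ks
   using that
  proof (induction ks)
   case (Cons k ks)
   have car: "foldr (%k B. generic_mat N k * B) ks (1\<^sub>m N) \<in> carrier_mat N N"
    using word_mat_carrier[of "generic_mat N" N "Word ks"] by (simp add: word_mat_def)
   have "map_mat ?h (generic_mat N k) = generic_mat N k"
    using Cons.prems by (intro eq_matI) (auto simp: generic_mat_def const_pol.ev_var)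
   thus ?case using Cons by (simp add: h.mat_hom_mult[OF generic_mat_carrier car])
  qed (simp add: h.mat_hom_one)
  hence w: "map_mat ?h (gen_word N e) = gen_word N e"
   using l by (simp add: word_mat_def v)
  show "?h (sym_mat N (generic_mat N) v) = sym_mat N (generic_mat N) v"
   unfolding sym_mat_def v by (simp add: h.sigma_mat_hom[OF word_mat_gen_carrier, symmetric] w)
 qed
 finally show ?thesis unfolding pol_over_rescale by (simp add: Phi_tilde_ev)
qed

lemma Phi_tilde_theta_rescale:
 "Phi_tilde N (theta c s) = ev const_pol (%v. const_pol (c (snd (snd v))) * var_pol v) (Phi_tilde N s)"
 unfolding Phi_tilde_theta mat_ev_def
 by (rule ev_pol_over_cong[OF Phi_tilde_pol_over[of s UNIV N]]) (auto simp: generic_mat_def)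

lemma theta_rescale: "theta c = ev const_pol (%s. const_pol (case Rep_tilde_sym s of (t, e) => prod_list (map c (letters e)) ^ t) * var_pol s)"
 unfolding theta_def by (intro arg_cong[of _ _ "ev const_pol"] ext) (simp split: prod.splits)

text \<open>The degree in the matrix entries of the value of the generator, which makes
  \<open>Phi_tilde\<close> a graded map.\<close>

definition sym_wt :: "tilde_sym => nat" where
 "sym_wt s = (case Rep_tilde_sym s of (t, e) => t * length (letters e))"

lemma theta_const_rescale: "theta (%_. z) = ev const_pol (%s. const_pol (z ^ sym_wt s) * var_pol s)"
 unfolding theta_rescale sym_wt_def
 by (intro arg_cong[of _ _ "ev const_pol"] ext) (simp add: map_replicate_const power_mult[symmetric] mult.commute split: prod.splits)

context
 assumes inf: "infinite (UNIV :: 'a::field set)"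
begin

text \<open>Both gradings are detected by multiplying all letters with one scalar, and
  \<open>Phi_tilde\<close> intertwines the two rescalings.\<close>

lemma Phi_tilde_hpart: "Phi_tilde N (hpart sym_wt d s) = hpart (%_. 1) d (Phi_tilde N s :: 'a gen_ring)"
proof -
 let ?P = "Phi_tilde N s"
 have "(\<Sum>m | m \<in> keys s & (\<forall>i\<in>{0::nat}. wt sym_wt m = d). Phi_tilde N (single m (lookup s m)))
  = (\<Sum>m | m \<in> keys ?P & (\<forall>i\<in>{0::nat}. wt (%_. 1) m = d). single m (lookup ?P m))"
 proof (rule multigrade_eq[OF const_pol_hom inf, where A = "{0::nat}" and gs = "%_. d" and g = "%m _. wt sym_wt m" and g' = "%m _. wt (%_. 1) m"])
  fix t :: "nat => 'a"
  have "(\<Sum>m\<in>keys s. const_pol (t 0 ^ wt sym_wt m) * Phi_tilde N (single m (lookup s m)))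
   = Phi_tilde N (theta (%_. t 0) s)"
   unfolding theta_const_rescale sum_single_rescale[symmetric]
   by (simp add: Phi.hom_sum Phi.hom_mult Phi_tilde_const mon_ev_power_wt)
  also have "... = (\<Sum>m\<in>keys ?P. const_pol (mon_ev (%_. t 0) m) * single m (lookup ?P m))"
   unfolding Phi_tilde_theta_rescale sum_single_rescale[symmetric] ..
  finally show "(\<Sum>m\<in>keys s. const_pol (\<Prod>i\<in>{0::nat}. t i ^ wt sym_wt m) * Phi_tilde N (single m (lookup s m)))
   = (\<Sum>m\<in>keys ?P. const_pol (\<Prod>i\<in>{0::nat}. t i ^ wt (%_. 1) m) * single m (lookup ?P m))"
   using mon_ev_power_wt[of "t 0" "%_ :: nat \<times> nat \<times> nat. 1"] by simp
 qed simp_all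
 thus ?thesis by (simp add: hpart_def Phi.hom_sum)
qed

lemma ideal_gen_hom:
 assumes "comm_ring_hom h" "!!x. x \<in> S ==> h x \<in> ideal_gen T" "f \<in> ideal_gen S"
 shows "h f \<in> ideal_gen T"
proof -
 interpret comm_ring_hom h by fact
 have "f \<in> module.span (*) S" using assms(3) by (simp add: ideal_gen_def)
 thus ?thesis
  by (rule Modules.module.span_induct_alt[OF module_times])
   (simp_all add: assms(2) hom_distribs ideal_gen_0 ideal_gen_add ideal_gen_mult)
qed

lemma alg_mat_rescale:
 fixes a :: "word \<Rightarrow>\<^sub>0 'a"
 assumes "a \<in> free_alg"
 shows "\<exists>b\<in>free_alg. \<forall>N. alg_mat N const_pol (%k. const_pol (c k) \<cdot>\<^sub>m generic_mat N k) a
  = (gen_alg N b :: 'a gen_ring mat)"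
 using assms
proof (induction a rule: free_alg_induct)
 case zero
 show ?case by (intro bexI[of _ 0]) (simp_all add: free_alg_0 const_pol.alg_mat_0)
next
 case (single w x)
 have pl: "prod_list (map (%k. const_pol (c k)) ks) = const_pol (prod_list (map c ks))" for ks
  by (induction ks) (simp_all add: const_pol.hom_mult)
 have ss: "y \<cdot>\<^sub>m (z \<cdot>\<^sub>m A) = (y * z) \<cdot>\<^sub>m A" for y z and A :: "'a gen_ring mat"
  by (rule eq_matI) (simp_all add: mult.assoc)
 show ?case
 proof (intro bexI[of _ "single w (x * prod_list (map c (letters w)))"] allI)
  fix N
  have car: "!!k. const_pol (c k) \<cdot>\<^sub>m generic_mat N k \<in> (carrier_mat N N :: 'a gen_ring mat set)" by simp
  show "alg_mat N const_pol (%k. const_pol (c k) \<cdot>\<^sub>m generic_mat N k) (single w x)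
   = (gen_alg N (single w (x * prod_list (map c (letters w)))) :: 'a gen_ring mat)"
   by (simp add: ss const_pol.alg_mat_single[OF car] const_pol.alg_mat_single[OF generic_mat_carrier]
     word_mat_smult[OF generic_mat_carrier] pl const_pol.hom_mult)
 qed (use single in "simp add: free_alg_single")
next
 case (add a b)
 then obtain a' b' where ab: "a' \<in> free_alg" "b' \<in> free_alg"
  "!!N. alg_mat N const_pol (%k. const_pol (c k) \<cdot>\<^sub>m generic_mat N k) a = (gen_alg N a' :: 'a gen_ring mat)"
  "!!N. alg_mat N const_pol (%k. const_pol (c k) \<cdot>\<^sub>m generic_mat N k) b = (gen_alg N b' :: 'a gen_ring mat)" by blast
 thus ?case
  by (intro bexI[of _ "a' + b'"]) (simp_all add: free_alg_add const_pol.alg_mat_add)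
qed

lemma theta_pi_tilde_sigma:
 fixes a :: "word \<Rightarrow>\<^sub>0 'a"
 assumes a: "a \<in> free_alg"
 shows "\<exists>b\<in>free_alg. theta c (pi_tilde (sigma t a)) = pi_tilde (sigma t b)"
proof -
 obtain b where b: "b \<in> free_alg" "!!N. alg_mat N const_pol (%k. const_pol (c k) \<cdot>\<^sub>m generic_mat N k) a
  = (gen_alg N b :: 'a gen_ring mat)" using alg_mat_rescale[OF a] by blast
 have "represents (theta c (pi_tilde (sigma t a))) t b"
  unfolding represents_def
 proof
  fix N
  have car: "!!k. const_pol (c k) \<cdot>\<^sub>m generic_mat N k \<in> (carrier_mat N N :: 'a gen_ring mat set)" by simp
  interpret m: comm_ring_hom "mat_ev const_pol (%k. const_pol (c k) \<cdot>\<^sub>m generic_mat N k) :: 'a gen_ring => _"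
   by (rule comm_ring_hom_mat_ev[OF const_pol_hom car])
  have "Phi_tilde N (pi_tilde (sigma t a)) = sigma_gen N t a"
   using represents_pi_tilde[OF inf a] by (simp add: represents_def)
  thus "Phi_tilde N (theta c (pi_tilde (sigma t a))) = sigma_gen N t b"
   unfolding Phi_tilde_theta
   by (simp add: m.sigma_mat_hom[OF alg_mat_carrier, symmetric] mat_ev_alg_mat[OF const_pol_hom car] b(2))
 qed
 hence "pi_tilde (sigma t b) = theta c (pi_tilde (sigma t a))" by (rule pi_tilde_eqI[OF inf b(1)])
 thus ?thesis using b(1) by metis
qed

text \<open>Rescaling the letters turns \<sigma>_t(a) into \<sigma>_t of another element of the free
  algebra and multiplies \<sigma>_t(b) by a scalar. Stability under these maps makes the ideal
  homogeneous.\<close>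

lemma rel_ideal_theta:
 assumes "g \<in> rel_ideal n"
 shows "theta c g \<in> (rel_ideal n :: 'a sigma_tilde_alg set)"
 unfolding rel_ideal_def
proof (rule ideal_gen_hom[OF comm_ring_hom_theta _ assms[unfolded rel_ideal_def]])
 fix x :: "'a sigma_tilde_alg"
 let ?S = "{pi_tilde (sigma t a) | t a. n < t & t <= 2 * n & a \<in> free_alg} \<union>
   {sigma_tilde t b | t b. t > 2 * n & b \<in> X_tilde} :: 'a sigma_tilde_alg set"
 assume "x \<in> ?S"
 then consider t a where "x = pi_tilde (sigma t a)" "n < t" "t <= 2 * n" "a \<in> free_alg"
  | t b where "x = sigma_tilde t b" "t > 2 * n" "b \<in> X_tilde" by blast
 thus "theta c x \<in> ideal_gen ?S"
 proof cases
  case 1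
  then obtain b where "b \<in> free_alg" "theta c x = pi_tilde (sigma t b)" using theta_pi_tilde_sigma by blast
  thus ?thesis using 1 by (intro ideal_gen_base) blast
 next
  case 2
  hence "Rep_tilde_sym (Abs_tilde_sym (t, b)) = (t, b)" by (intro Abs_tilde_sym_inverse) simp
  hence "theta c x = const_pol (prod_list (map c (letters b)) ^ t) * sigma_tilde t b"
   by (simp add: 2 sigma_tilde_def theta_var)
  moreover have "sigma_tilde t b \<in> ideal_gen ?S" using 2 by (intro ideal_gen_base) blast
  ultimately show ?thesis by (simp add: ideal_gen_mult)
 qed
qed

lemma rel_ideal_hpart:
 assumes g: "g \<in> rel_ideal n"
 shows "hpart sym_wt d g \<in> (rel_ideal n :: 'a sigma_tilde_alg set)"
proof -
 have "(\<Sum>m | m \<in> keys g & (\<forall>i\<in>{0::nat}. wt sym_wt m = d). single m (lookup g m)) \<in> rel_ideal n"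
 proof (rule multigrade_mem[OF const_pol_hom inf, where A = "{0::nat}" and gs = "%_. d" and g = "%m _. wt sym_wt m"])
  fix t :: "nat => 'a"
  have "(\<Sum>m\<in>keys g. const_pol (t 0 ^ wt sym_wt m) * single m (lookup g m)) = theta (%_. t 0) g"
   unfolding theta_const_rescale sum_single_rescale[symmetric] mon_ev_power_wt ..
  thus "(\<Sum>m\<in>keys g. const_pol (\<Prod>i\<in>{0::nat}. t i ^ wt sym_wt m) * single m (lookup g m)) \<in> rel_ideal n"
   using rel_ideal_theta[OF g, of "%_. t 0"] by simp
 qed (auto simp: rel_ideal_def intro: ideal_gen_0 ideal_gen_add ideal_gen_mult)
 thus ?thesis by (simp add: hpart_def)
qed

lemma rel_ideal_subset_K_tilde: "rel_ideal n \<subseteq> (K_tilde n :: 'a sigma_tilde_alg set)"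
proof
 fix f :: "'a sigma_tilde_alg" assume f: "f \<in> rel_ideal n"
 have "Phi_tilde n f = 0"
 proof (rule ideal_gen_kernel[OF comm_ring_hom_Phi_tilde _ f[unfolded rel_ideal_def]])
  fix x :: "'a sigma_tilde_alg"
  assume "x \<in> {pi_tilde (sigma t a) | t a. n < t & t <= 2 * n & a \<in> free_alg} \<union> {sigma_tilde t b | t b. t > 2 * n & b \<in> X_tilde}"
  then consider t a where "x = pi_tilde (sigma t a)" "n < t" "a \<in> free_alg"
   | t b where "x = sigma_tilde t b" "t > 2 * n" "b \<in> X_tilde" by blast
  thus "Phi_tilde n x = 0"
  proof cases
   case 1
   hence "Phi_tilde n x = sigma_gen n t a" using represents_pi_tilde[OF inf] by (simp add: represents_def)
   thus ?thesis using 1 by (simp add: sigma_mat_def)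
  next
   case 2
   hence "Phi_tilde n x = sigma_mat t (word_mat n (generic_mat n) b)" by (simp add: Phi_tilde_sigma_tilde)
   moreover have "dim_row (word_mat n (generic_mat n) b :: 'a gen_ring mat) = n"
    using word_mat_gen_carrier[of n b] by (rule carrier_matD(1))
   ultimately show ?thesis using 2 by (simp add: sigma_mat_def)
  qed
 qed
 thus "f \<in> K_tilde n" by (simp add: K_tilde_def)
qed

end

text \<open>Padding the generic M by M matrices with zeros to size N changes no \<sigma>_t of a
  nonempty word.\<close>

lemma Phi_tilde_restrict:
 fixes s :: "'a::field sigma_tilde_alg"
 assumes "M <= N"
 shows "Phi_tilde M s = ev const_pol (%v. const_pol (if v \<in> {..<M} \<times> {..<M} \<times> UNIV then 1 else 0) * var_pol v) (Phi_tilde N s)"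
proof -
 define m where "m = N - M"
 have N: "N = M + m" using assms by (simp add: m_def)
 define Xs :: "nat => 'a gen_ring mat" where
  "Xs k = four_block_mat (generic_mat M k) (0\<^sub>m M m) (0\<^sub>m m M) (0\<^sub>m m m)" for k
 have car: "Xs k \<in> carrier_mat N N" for k by (auto simp: Xs_def N)
 have "sigma_mat t (word_mat N Xs e) = sigma_mat t (word_mat M (generic_mat M) e)" if "e \<in> X_tilde" for t e
 proof -
  have *: "word_mat M (generic_mat M) e \<in> carrier_mat M M" "word_mat m (%k. 0\<^sub>m m m) e \<in> carrier_mat m m"
   by (rule word_mat_carrier, simp)+
  have "word_mat N Xs e = four_block_mat (word_mat M (generic_mat M) e) (0\<^sub>m M m) (0\<^sub>m m M) (word_mat m (%k. 0\<^sub>m m m) e)"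
   unfolding N Xs_def by (rule word_mat_block) auto
  hence "gdet (word_mat N Xs e) = gdet (word_mat M (generic_mat M) e)"
   using * by (simp add: gdet_block[where n = M and m = m] word_mat_zero X_tilde_nonzero that gdet_zero)
  thus ?thesis
   using * word_mat_carrier[of Xs N e, OF car] by (intro gdet_eqI)
 qed
 hence "sym_mat N Xs = sym_mat M (generic_mat M)"
  by (auto simp: sym_mat_def fun_eq_iff dest: Rep_tilde_symD split: prod.splits)
 hence "Phi_tilde M s = mat_ev const_pol Xs (Phi_tilde N s)"
  by (simp add: mat_ev_Phi[OF const_pol_hom car] Phi_tilde_ev[of M])
 also have "... = ev const_pol (%v. const_pol (if v \<in> {..<M} \<times> {..<M} \<times> UNIV then 1 else 0) * var_pol v) (Phi_tilde N s)"
  unfolding mat_ev_def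
 proof (rule ev_pol_over_cong[OF Phi_tilde_pol_over[of s UNIV N]])
  fix v :: "nat \<times> nat \<times> nat" assume v: "v \<in> {..<N} \<times> {..<N} \<times> UNIV"
  obtain i j k where ijk: "v = (i, j, k)" by (metis prod_cases3)
  have "i < M + m" "j < M + m" using v by (simp_all add: ijk N)
  hence "Xs k $$ (i, j) = (if i < M & j < M then var_pol (i, j, k) else 0)"
   by (auto simp: Xs_def carrier_matD[OF generic_mat_carrier]) (simp add: generic_mat_def)
  thus "(case v of (i, j, k) => Xs k $$ (i, j)) = const_pol (if v \<in> {..<M} \<times> {..<M} \<times> UNIV then 1 else 0) * var_pol v"
   by (simp add: ijk)
 qed simp
 finally show ?thesis .
qed

subsection \<open>Matrix invariants as invariant forms\<close>

lemma word_mat_conj: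
 fixes g :: "'r::comm_ring_1 mat"
 assumes g: "g \<in> carrier_mat N N" and Xs: "!!k. Xs k \<in> carrier_mat N N"
 shows "word_mat N (%k. g * Xs k) (Word ks) * g = g * word_mat N (%k. Xs k * g) (Word ks)"
proof (induction ks)
 case (Cons k ks)
 have gX: "!!k. g * Xs k \<in> carrier_mat N N" "!!k. Xs k * g \<in> carrier_mat N N"
  by (rule mult_carrier_mat[OF g Xs] mult_carrier_mat[OF Xs g])+
 have W: "word_mat N (%k. g * Xs k) w \<in> carrier_mat N N" "word_mat N (%k. Xs k * g) w \<in> carrier_mat N N" for w
  by (rule word_mat_carrier, rule gX)+
 have "word_mat N (%k. g * Xs k) (Word (k # ks)) * g = (g * Xs k) * (word_mat N (%k. g * Xs k) (Word ks) * g)"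
  by (simp add: word_mat_Cons assoc_mult_mat[OF gX(1) W(1) g])
 also have "... = (g * Xs k) * (g * word_mat N (%k. Xs k * g) (Word ks))" by (simp add: Cons.IH)
 also have "... = g * (Xs k * (g * word_mat N (%k. Xs k * g) (Word ks)))"
  by (rule assoc_mult_mat[OF g Xs mult_carrier_mat[OF g W(2)]])
 also have "... = g * word_mat N (%k. Xs k * g) (Word (k # ks))"
  by (simp add: word_mat_Cons assoc_mult_mat[OF Xs g W(2)])
 finally show ?case .
qed (use g in simp)

text \<open>For a nonempty word, w(gX) = gY and w(Xg) = Yg with the same matrix Y, and
  \<sigma>_t(gY) = \<sigma>_t(Yg).\<close>

lemma sigma_word_conj:
 fixes g :: "'r::idom mat"
 assumes g: "g \<in> carrier_mat N N" and Xs: "!!k. Xs k \<in> carrier_mat N N" and w: "w ~= 0"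
 shows "sigma_mat t (word_mat N (%k. g * Xs k) w) = sigma_mat t (word_mat N (%k. Xs k * g) w)"
proof -
 obtain k ks where wk: "w = Word (k # ks)" using w by (cases w; cases "letters w") (auto simp: zero_word_def)
 let ?W = "word_mat N (%k. g * Xs k) (Word ks)"
 have gX: "!!k. g * Xs k \<in> carrier_mat N N" "!!k. Xs k * g \<in> carrier_mat N N"
  by (rule mult_carrier_mat[OF g Xs] mult_carrier_mat[OF Xs g])+
 have W: "word_mat N (%k. g * Xs k) w \<in> carrier_mat N N" "word_mat N (%k. Xs k * g) w \<in> carrier_mat N N" for w
  by (rule word_mat_carrier, rule gX)+
 have "word_mat N (%k. g * Xs k) w = g * (Xs k * ?W)"
  by (simp add: wk word_mat_Cons assoc_mult_mat[OF g Xs W(1)])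
 moreover have "word_mat N (%k. Xs k * g) w = (Xs k * ?W) * g"
  by (simp add: wk word_mat_Cons assoc_mult_mat[OF Xs g W(2)] assoc_mult_mat[OF Xs W(1) g] word_mat_conj[OF g Xs])
 moreover have "Xs k * ?W \<in> carrier_mat N N" by (rule mult_carrier_mat[OF Xs W(1)])
 ultimately show ?thesis using sigma_mat_mult_comm[OF g] by simp
qed

lemma Phi_tilde_conj:
 fixes g :: "'a::field mat"
 assumes g: "g \<in> carrier_mat N N" and Xs: "!!k. Xs k \<in> carrier_mat N N"
 shows "mat_ev (%x. x) (%k. g * Xs k) (Phi_tilde N s) = mat_ev (%x. x) (%k. Xs k * g) (Phi_tilde N s)"
proof -
 have gX: "!!k. g * Xs k \<in> carrier_mat N N" "!!k. Xs k * g \<in> carrier_mat N N"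
  by (rule mult_carrier_mat[OF g Xs] mult_carrier_mat[OF Xs g])+
 have "sym_mat N (%k. g * Xs k) = sym_mat N (%k. Xs k * g)"
  by (auto simp: sym_mat_def fun_eq_iff sigma_word_conj[OF g Xs] X_tilde_nonzero dest: Rep_tilde_symD split: prod.splits)
 thus ?thesis by (simp add: mat_ev_Phi[OF comm_ring_hom_id gX(1)] mat_ev_Phi[OF comm_ring_hom_id gX(2)])
qed

lemma Phi_tilde_gl_form:
 fixes s :: "'a::field sigma_tilde_alg"
 assumes inf: "infinite (UNIV :: 'a set)" and P: "Phi_tilde N s \<in> pol_over (vars N u)"
 shows "gl_form N u (keys (Phi_tilde N s)) (lookup (Phi_tilde N s)) lookup"
proof
 let ?P = "Phi_tilde N s" and ?V = "vars N u"
 have keys: "keys m \<subseteq> ?V" if "m \<in> keys ?P" for m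
  using P that by (simp add: pol_over_def)
 show "m = m'" if m: "m \<in> keys ?P" "m' \<in> keys ?P"
  "!!v. v \<in> ?V ==> lookup m v = lookup m' v" for m m'
 proof (rule poly_mapping_eqI)
  fix v
  show "lookup m v = lookup m' v"
   using m(3)[of v] keys[OF m(1)] keys[OF m(2)] by (metis in_keys_iff subsetD)
 qed
 fix g :: "nat => nat => 'a" and Z :: "nat \<times> nat \<times> nat => 'a"
 define G where "G = mat N N (%(i, j). g i j)"
 define Xs where "Xs k = mat N N (%(i, j). Z (i, j, k))" for k
 have car: "G \<in> carrier_mat N N" "!!k. Xs k \<in> carrier_mat N N" by (simp_all add: G_def Xs_def)
 have ev: "mat_ev (%x. x) A ?P = (\<Sum>m\<in>keys ?P. lookup ?P m *
   (\<Prod>(i, j, k)\<in>?V. F i j k ^ lookup m (i, j, k)))"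
  if "!!i j k. [|i < N; j < N|] ==> A k $$ (i, j) = F i j k" for A and F :: "nat => nat => nat => 'a"
  unfolding mat_ev_def ev_def
 proof (intro sum.cong refl arg_cong2[of _ _ _ _ "(*)"])
  fix m assume "m \<in> keys ?P"
  hence "mon_ev (%(i, j, k). A k $$ (i, j)) m = (\<Prod>v\<in>?V. (%(i, j, k). A k $$ (i, j)) v ^ lookup m v)"
   using keys by (intro mon_ev_superset) auto
  also have "... = (\<Prod>(i, j, k)\<in>?V. F i j k ^ lookup m (i, j, k))"
   using that by (intro prod.cong) auto
  finally show "mon_ev (%(i, j, k). A k $$ (i, j)) m = (\<Prod>(i, j, k)\<in>?V. F i j k ^ lookup m (i, j, k))" .
 qed
 have "mat_ev (%x. x) (%k. G * Xs k) ?P = (\<Sum>m\<in>keys ?P. lookup ?P m *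
   (\<Prod>(i, j, k)\<in>?V. (\<Sum>l<N. g i l * Z (l, j, k)) ^ lookup m (i, j, k)))"
  by (rule ev) (simp add: G_def Xs_def scalar_prod_def lessThan_atLeast0)
 moreover have "mat_ev (%x. x) (%k. Xs k * G) ?P = (\<Sum>m\<in>keys ?P. lookup ?P m *
   (\<Prod>(i, j, k)\<in>?V. (\<Sum>l<N. Z (i, l, k) * g l j) ^ lookup m (i, j, k)))"
  by (rule ev) (simp add: G_def Xs_def scalar_prod_def lessThan_atLeast0)
 ultimately show "(\<Sum>m\<in>keys ?P. lookup ?P m *
   (\<Prod>(i, j, k)\<in>?V. (\<Sum>l<N. g i l * Z (l, j, k)) ^ lookup m (i, j, k)))
  = (\<Sum>m\<in>keys ?P. lookup ?P m *
   (\<Prod>(i, j, k)\<in>?V. (\<Sum>l<N. Z (i, l, k) * g l j) ^ lookup m (i, j, k)))"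
  using Phi_tilde_conj[OF car, where s = s] by simp
qed (use inf in "auto simp: in_keys_iff")

subsection \<open>The monomials of labelled permutations\<close>

definition lab_mon :: "nat => nat => nat => (nat => nat) \<times> (nat => nat) => (nat \<times> nat \<times> nat \<Rightarrow>\<^sub>0 nat)" where
 "lab_mon N J K x = (\<Sum>w | w < J & snd x w < K. single (w mod N, fst x w mod N, snd x w) 1)"

lemma prod_var_pol: "finite W ==> (\<Prod>w\<in>W. var_pol (f w)) = single (\<Sum>w\<in>W. single (f w) 1) 1"
 by (induction W rule: finite_induct) (simp_all add: var_pol_def mult_single)

lemma lookup_lab_term:
 "lookup (lab_term N J K x :: 'a::field gen_ring) m = (if lab_mon N J K x = m then of_int (sign (fst x)) else 0)"
proof -
 have "lab_term N J K x = const_pol (of_int (sign (fst x))) * (single (lab_mon N J K x) 1 :: 'a gen_ring)"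
  by (simp add: lab_term_def lab_mon_def case_prod_unfold prod_var_pol const_pol.hom_of_int)
 thus ?thesis by (simp only: const_pol_mult_lookup lookup_single when_def) simp
qed

lemma lookup_lab_mon: "lookup (lab_mon N J K x) v = lab_exps N J K x v"
proof -
 have "lookup (lab_mon N J K x) v
  = (\<Sum>w | w < J & snd x w < K. if (w mod N, fst x w mod N, snd x w) = v then 1 else 0)"
  by (simp add: lab_mon_def Poly_Mapping.lookup_sum lookup_single when_def del: One_nat_def)
 also have "... = card {w \<in> {w. w < J & snd x w < K}. (w mod N, fst x w mod N, snd x w) = v}"
  by (simp add: sum.If_cases Int_def)
 finally show ?thesis by (simp add: lab_exps_def conj_assoc)
qed

lemma keys_lab_mon: "N > 0 ==> keys (lab_mon N J K x) \<subseteq> {..<N} \<times> {..<N} \<times> {..<K}"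
 unfolding lab_mon_def by (rule order_trans[OF keys_sum]) auto

lemma exps_row_lab_mon:
 assumes "a < N"
 shows "exps_row N K (lookup (lab_mon N J K x)) a = lab_row N J K x a"
proof -
 have "exps_row N K (lookup (lab_mon N J K x)) a
  = (\<Sum>w | w < J & snd x w < K. \<Sum>(j, k)\<in>{..<N} \<times> {..<K}. if (w mod N, fst x w mod N, snd x w) = (a, j, k) then 1 else 0)"
  unfolding exps_row_def lab_mon_def Poly_Mapping.lookup_sum lookup_single when_def case_prod_unfold
  by (rule sum.swap)
 also have "... = (\<Sum>w | w < J & snd x w < K. if w mod N = a then 1 else 0)"
 proof (rule sum.cong[OF refl])
  fix w assume w: "w \<in> {w. w < J & snd x w < K}"
  have "(\<Sum>(j, k)\<in>{..<N} \<times> {..<K}. if (w mod N, fst x w mod N, snd x w) = (a, j, k) then 1 else 0)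
   = (\<Sum>y\<in>{..<N} \<times> {..<K}. if y = (fst x w mod N, snd x w) then (if w mod N = a then 1 else 0) else (0 :: nat))"
   by (rule sum.cong) (auto split: if_splits)
  also have "... = (if w mod N = a then 1 else 0)" using w assms by (subst sum.delta) simp_all
  finally show "(\<Sum>(j, k)\<in>{..<N} \<times> {..<K}. if (w mod N, fst x w mod N, snd x w) = (a, j, k) then 1 else 0)
   = (if w mod N = a then 1 else 0 :: nat)" .
 qed
 also have "... = lab_row N J K x a"
  by (simp add: lab_row_def sum.If_cases Int_def conj_assoc)
 finally show ?thesis .
qed

lemma wt_eq_sum:
 assumes "keys m \<subseteq> vars N u"
 shows "wt (%_. 1) m = (\<Sum>v\<in>vars N u. lookup m v)"
 by (subst wt_superset[OF _ assms]) simp_all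

lemma exps_row_le_wt:
 assumes keys: "keys m \<subseteq> vars N u" and a: "a < N"
 shows "exps_row N u (lookup m) a <= wt (%_. 1) m"
proof -
 have "exps_row N u (lookup m) a = (\<Sum>v\<in>Pair a ` ({..<N} \<times> {..<u}). lookup m v)"
  by (subst sum.reindex) (auto simp: inj_on_def exps_row_def case_prod_unfold)
 also have "... <= wt (%_. 1) m" unfolding wt_eq_sum[OF keys] by (rule sum_mono2) (use a in auto)
 finally show ?thesis .
qed

lemma exps_digit_less:
 assumes keys: "keys m \<subseteq> vars N u" and x: "x < u * N * N + N"
 shows "exps_digit N u (lookup m) x < Suc (wt (%_. 1) m)"
proof (cases "x < u * N * N")
 case True
 note d = index_decomp[OF True]
 have "lookup m (x div N mod N, x mod N, x div N div N) <= wt (%_. 1) m"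
  unfolding wt_eq_sum[OF keys] by (rule member_le_sum) (use d in auto)
 thus ?thesis using True by (simp add: exps_digit_def)
next
 case False
 hence "u * N * N + N - 1 - x < N" using x by linarith
 from exps_row_le_wt[OF keys this] show ?thesis using False by (simp add: exps_digit_def)
qed

subsection \<open>Relations of high rank\<close>

context
 assumes inf: "infinite (UNIV :: 'a::field set)"
begin

text \<open>Reduction by leading monomials, with \<open>c\<close> as a bound for their codes: each
  step subtracts a multiple of an element of the ideal with the same leading monomial. Degree and
  variables stay fixed, so the codes remain comparable.\<close>

theorem Phi_tilde_in_rel_ideal:
 fixes s :: "'a sigma_tilde_alg" and n N u d :: nat
 assumes "n <= N" "Phi_tilde n s = 0" "Phi_tilde N s \<in> pol_over (vars N u)"
  and "!!m. m \<in> keys (Phi_tilde N s) ==> wt (%_. 1) m = d"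
  and "!!m. m \<in> keys (Phi_tilde N s) ==> exps_code N u (Suc d) (lookup m) < c"
 shows "\<exists>g\<in>rel_ideal n. Phi_tilde N g = Phi_tilde N s"
 using assms(2-)
proof (induction c arbitrary: s)
 case 0
 hence "Phi_tilde N s = 0" by (metis ex_in_conv keys_eq_empty not_less_zero)
 moreover have "Phi_tilde N (0 :: 'a sigma_tilde_alg) = 0" using Phi_tilde_const[of N 0] by (simp add: const_pol.hom_zero)
 ultimately show ?case using ideal_gen_0 unfolding rel_ideal_def by (intro bexI[of _ 0]) simp_all
next
 case (Suc c)
 \<comment> \<open>A row of the diagram has at most d cells, so d + 1 blocks are enough; the extra
   block provides the block row 0 of \<open>lab_sum_mem\<close> even for d = 0.\<close>
 let ?V = "vars N u" and ?P = "Phi_tilde N s" and ?J = "Suc d * N"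
 let ?code = "%m. exps_code N u (Suc d) (lookup m)"
 show ?case
 proof (cases "\<forall>m\<in>keys ?P. ?code m < c")
  case True
  thus ?thesis using Suc by blast
 next
  case False
  then obtain M where M: "M \<in> keys ?P" "?code M = c"
   using Suc.prems(4) by (metis less_SucE)
  have keysV: "keys m \<subseteq> ?V" if "m \<in> keys ?P" for m
   using Suc.prems(2) that by (simp add: pol_over_def)
  interpret P: gl_form N u "keys ?P" "lookup ?P" lookup
   by (rule Phi_tilde_gl_form[OF inf Suc.prems(2)])
  define ch where "ch = exps_row N u (lookup M)"
  have digit: "exps_digit N u (lookup m) x < Suc d"
   if "keys m \<subseteq> ?V" "wt (%_. 1) m = d" "x < u * N * N + N" for m x
   using exps_digit_less[OF that(1,3)] that(2) by simp
  interpret L: lattice_exps N u "lookup M" ch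
   unfolding ch_def
  proof (rule P.leading_lattice[OF _ M(1)])
   show "exps_digit N u (lookup m) x < Suc d" if "m \<in> keys ?P" "x < u * N * N + N" for m x
    using digit keysV that Suc.prems(3) by blast
   show "?code m <= ?code M" if "m \<in> keys ?P" for m
    using Suc.prems(4)[OF that] M(2) by simp
  qed
  have wtM: "wt (%_. 1) M = d" by (rule Suc.prems(3)[OF M(1)])
  have ch_le: "ch a <= Suc d" if "a < N" for a
   using exps_row_le_wt[OF keysV[OF M(1)] that] wtM by (simp add: ch_def)
  obtain x0 where x0: "x0 \<in> lab_perms ?J u"
   "\<forall>a b k. a < N & b < N & k < u --> lab_exps N ?J u x0 (a, b, k) = lookup M (a, b, k)"
   "lab_zero N (Suc d) u x0 = card {a. a < N & 0 < ch a}"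
   and lead: "\<forall>x\<in>lab_perms ?J u. (\<forall>c<Suc d * Suc d * u. lab_type N (Suc d) u x c = lab_type N (Suc d) u x0 c) --> x = x0 \<or>
    rows_below N (lab_row N ?J u x) ch \<or> (\<forall>a<N. lab_row N ?J u x a = ch a) & exps_below N u (lab_exps N ?J u x) (lookup M)"
   by (rule bexE[OF L.picture_leading[of "Suc d"]], rule ch_le, assumption, elim conjE, rule that)
  \<comment> \<open>With at most n nonempty rows, M would involve only indices below n, because
    \<open>ch\<close> decreases and row and column weights agree. It would then survive the
    restriction to n by n matrices, where s vanishes.\<close>
  have rank: "lab_zero N (Suc d) u x0 > n"
  proof (rule ccontr)
   assume "\<not> ?thesis"
   hence card: "card {a. a < N & 0 < ch a} <= n" by (simp add: x0(3))
   have small: "a < n" if a: "a < N" "0 < ch a" for a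
   proof -
    have "0 < ch a'" if "a' <= a" for a'
     using that
    proof (induction rule: inc_induct)
     case (step b)
     thus ?case using L.chi_decr[of b] a(1) by simp
    qed (rule a(2))
    hence "{..a} \<subseteq> {a. a < N & 0 < ch a}" using a(1) by auto
    hence "card {..a} <= card {a. a < N & 0 < ch a}" by (intro card_mono) auto
    thus ?thesis using card by simp
   qed
   have "keys M \<subseteq> {..<n} \<times> {..<n} \<times> UNIV"
   proof
    fix v assume v: "v \<in> keys M"
    obtain i j k where ijk: "v = (i, j, k)" by (metis prod_cases3)
    have V: "i < N" "j < N" "k < u" using v keysV[OF M(1)] by (auto simp: ijk)
    have pos: "0 < lookup M (i, j, k)" using v by (simp add: ijk in_keys_iff)
    have "lookup M (i, j, k) <= P.row_wt i M"
     unfolding P.row_wt_def using V member_le_sum[of "(j, k)" "{..<N} \<times> {..<u}" "%(j, k). lookup M (i, j, k)"] by simp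
    moreover have "lookup M (i, j, k) <= P.col_wt j M"
     unfolding P.col_wt_def using V member_le_sum[of "(i, k)" "{..<N} \<times> {..<u}" "%(i, k). lookup M (i, j, k)"] by simp
    ultimately have "0 < ch i" "0 < ch j"
     using pos P.row_eq_col[OF M(1) V(2)] by (simp_all add: ch_def flip: P.row_wt_exps_row)
    thus "v \<in> {..<n} \<times> {..<n} \<times> UNIV" using small V by (simp add: ijk)
   qed
   hence "lookup (Phi_tilde n s) M = lookup ?P M"
    unfolding Phi_tilde_restrict[OF assms(1)] lookup_rescale mon_ev_indicator by simp
   thus False using M(1) Suc.prems(1) by (simp add: in_keys_iff)
  qed
  have "{a. a < N & 0 < ch a} ~= {}" using rank unfolding x0(3) by (metis card.empty not_less_zero)
  hence N: "N > 0" by auto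
  have mon0: "lab_mon N ?J u x0 = M"
  proof (rule poly_mapping_eqI)
   fix v
   show "lookup (lab_mon N ?J u x0) v = lookup M v"
   proof (cases "v \<in> ?V")
    case True
    thus ?thesis using x0(2) by (auto simp: lookup_lab_mon)
   next
    case False
    thus ?thesis using keysV[OF M(1)] keys_lab_mon[OF N, of ?J u x0] unfolding in_keys_iff subset_iff by (metis (no_types))
   qed
  qed
  let ?X = "{x. x \<in> lab_perms ?J u & lab_zero N (Suc d) u x = lab_zero N (Suc d) u x0 &
   (\<forall>i<Suc d * Suc d * u. lab_type N (Suc d) u x i = lab_type N (Suc d) u x0 i)}"
  define Q :: "'a gen_ring" where "Q = (\<Sum>x\<in>?X. lab_term N ?J u x)"
  have "Q \<in> ideal_mod n N (Suc d)" unfolding Q_def by (rule lab_sum_mem[OF inf rank])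
  then obtain g where g: "g \<in> rel_ideal n" "Q - Phi_tilde N g \<in> high_degree (Suc d)"
   by (auto simp: ideal_mod_def)
  \<comment> \<open>The congruence holds modulo degree d + 1, so it becomes an equality for the
    parts of degree d.\<close>
  define g1 where "g1 = hpart sym_wt d g"
  have g1: "g1 \<in> rel_ideal n" unfolding g1_def by (rule rel_ideal_hpart[OF inf g(1)])
  have PNg1: "Phi_tilde N g1 = hpart (%_. 1) d Q"
   using hpart_high_degree[OF g(2)] unfolding g1_def Phi_tilde_hpart[OF inf] hpart_diff by simp
  let ?H = "hpart (%_. 1) d Q"
  have lookupQ: "lookup Q m = (\<Sum>x\<in>?X. if lab_mon N ?J u x = m then of_int (sign (fst x)) else 0)" for m
   by (simp add: Q_def Poly_Mapping.lookup_sum lookup_lab_term)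
  have less: "?code (lab_mon N ?J u x) < c"
   if x: "x \<in> lab_perms ?J u" "\<forall>i<Suc d * Suc d * u. lab_type N (Suc d) u x i = lab_type N (Suc d) u x0 i" "x ~= x0"
    "wt (%_. 1) (lab_mon N ?J u x) = d" for x
  proof -
   note dig = digit[OF keys_lab_mon[OF N] x(4)]
   have rows: "lab_row N ?J u x a = exps_row N u (lookup (lab_mon N ?J u x)) a" if "a < N" for a
    using exps_row_lab_mon[OF that] by simp
   from lead[THEN bspec, OF x(1), THEN mp, OF x(2)] x(3)
   consider "rows_below N (lab_row N ?J u x) ch" | "\<forall>a<N. lab_row N ?J u x a = ch a" "exps_below N u (lab_exps N ?J u x) (lookup M)"
    by blast
   hence "?code (lab_mon N ?J u x) < ?code M"
   proof cases
    case 1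
    moreover have "rows_below N (lab_row N ?J u x) ch \<longleftrightarrow> rows_below N (exps_row N u (lookup (lab_mon N ?J u x))) ch"
     by (rule rows_below_cong) (rule rows)
    ultimately have "rows_below N (exps_row N u (lookup (lab_mon N ?J u x))) (exps_row N u (lookup M))" by (simp only: ch_def)
    thus ?thesis by (rule exps_code_less_row[rotated]) (rule dig)
   next
    case 2
    show ?thesis
    proof (rule exps_code_less_var)
     show "exps_digit N u (lookup (lab_mon N ?J u x)) y < Suc d" if "y < u * N * N + N" for y by (rule dig[OF that])
     show "exps_below N u (lookup (lab_mon N ?J u x)) (lookup M)"
      using 2(2) unfolding ext[OF lookup_lab_mon] .
     show "exps_row N u (lookup (lab_mon N ?J u x)) a = exps_row N u (lookup M) a" if "a < N" for a
      using 2(1) rows[OF that] that by (simp add: ch_def)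
    qed
   qed
   thus ?thesis by (simp add: M(2))
  qed
  \<comment> \<open>The leading coefficient of Q is a sign and hence its own inverse in every
    characteristic; this determines the multiplier z.\<close>
  define \<epsilon> :: 'a where "\<epsilon> = of_int (sign (fst x0))"
  have \<epsilon>: "\<epsilon> * \<epsilon> = 1" by (simp add: \<epsilon>_def flip: of_int_mult)
  have HM: "lookup ?H M = \<epsilon>"
  proof -
   have "lookup Q M = (\<Sum>x\<in>?X. if x = x0 then \<epsilon> else 0)"
    unfolding lookupQ
   proof (rule sum.cong[OF refl])
    fix x assume "x \<in> ?X"
    hence x: "x \<in> lab_perms ?J u" "\<forall>i<Suc d * Suc d * u. lab_type N (Suc d) u x i = lab_type N (Suc d) u x0 i" by blast+
    have "lab_mon N ?J u x ~= M" if "x ~= x0"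
     using less[OF x that] wtM M(2) by auto
    thus "(if lab_mon N ?J u x = M then of_int (sign (fst x)) else 0) = (if x = x0 then \<epsilon> else 0)"
     using mon0 by (auto simp: \<epsilon>_def)
   qed
   also have "... = \<epsilon>"
    using x0(1) finite_lab_perms[of ?J u] by (subst sum.delta) simp_all
   finally show ?thesis using wtM by (simp add: lookup_hpart)
  qed
  have keysH: "keys m \<subseteq> ?V" "wt (%_. 1) m = d" "m = M \<or> ?code m < c" if m: "m \<in> keys ?H" for m
  proof -
   have wt: "wt (%_. 1) m = d" and "lookup Q m ~= 0" using m by (auto simp: keys_hpart in_keys_iff)
   then obtain x where x: "x \<in> lab_perms ?J u" "\<forall>i<Suc d * Suc d * u. lab_type N (Suc d) u x i = lab_type N (Suc d) u x0 i"
    "lab_mon N ?J u x = m"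
    unfolding lookupQ by (elim sum.not_neutral_contains_not_neutral) (auto split: if_splits)
   show "keys m \<subseteq> ?V" using keys_lab_mon[OF N, of ?J u x] x(3) by simp
   show "wt (%_. 1) m = d" by (rule wt)
   show "m = M \<or> ?code m < c" using less[OF x(1,2)] x(3) wt mon0 by blast
  qed
  define z where "z = \<epsilon> * lookup ?P M"
  define s' where "s' = s - const_pol z * g1"
  have Ps': "Phi_tilde N s' = ?P - const_pol z * ?H"
   by (simp add: s'_def Phi.hom_minus Phi.hom_mult Phi_tilde_const PNg1)
  have lookup': "lookup (Phi_tilde N s') m = lookup ?P m - z * lookup ?H m" for m
   by (simp add: Ps' lookup_minus const_pol_mult_lookup)
  have keys': "m ~= M & (m \<in> keys ?P \<or> m \<in> keys ?H)" if "m \<in> keys (Phi_tilde N s')" for m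
  proof -
   have "z * \<epsilon> = (\<epsilon> * \<epsilon>) * lookup ?P M" unfolding z_def by (simp only: ac_simps)
   hence "lookup (Phi_tilde N s') M = 0" unfolding lookup' HM \<epsilon> by simp
   moreover have "lookup (Phi_tilde N s') m ~= 0" using that unfolding in_keys_iff .
   ultimately show ?thesis unfolding in_keys_iff lookup' by force
  qed
  have "\<exists>g'\<in>rel_ideal n. Phi_tilde N g' = Phi_tilde N s'"
  proof (rule Suc.IH)
   have "Phi_tilde n g1 = 0" using rel_ideal_subset_K_tilde[OF inf] g1 by (auto simp: K_tilde_def)
   thus "Phi_tilde n s' = 0" by (simp add: s'_def Phi.hom_minus Phi.hom_mult Suc.prems(1))
   show "Phi_tilde N s' \<in> pol_over ?V"
    unfolding pol_over_def using keys' keysV keysH(1) by blast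
   show "wt (%_. 1) m = d" if "m \<in> keys (Phi_tilde N s')" for m
    using keys'[OF that] Suc.prems(3) keysH(2) by blast
   show "?code m < c" if m: "m \<in> keys (Phi_tilde N s')" for m
   proof (cases "m \<in> keys ?P")
    case True
    have "?code m ~= c"
    proof
     assume eq: "?code m = c"
     have "m = M"
     proof (rule P.inj[OF True M(1)])
      fix v assume "v \<in> ?V"
      thus "lookup m v = lookup M v"
       using exps_code_inj[OF digit[OF keysV[OF True] Suc.prems(3)[OF True]] digit[OF keysV[OF M(1)] wtM]] eq M(2) by auto
     qed
     thus False using keys'[OF m] by blast
    qed
    thus ?thesis using Suc.prems(4)[OF True] by simp
   next
    case False
    thus ?thesis using keys'[OF m] keysH(3) by blast
   qed
  qed
  then obtain g' where g': "g' \<in> rel_ideal n" "Phi_tilde N g' = Phi_tilde N s'" by blast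
  show ?thesis
  proof (rule bexI)
   show "Phi_tilde N (g' + const_pol z * g1) = Phi_tilde N s"
    by (simp add: Phi.hom_add Phi.hom_mult Phi_tilde_const g'(2) Ps' PNg1)
   show "g' + const_pol z * g1 \<in> rel_ideal n"
    using g'(1) g1 unfolding rel_ideal_def by (intro ideal_gen_add ideal_gen_mult)
  qed
 qed
qed

end

section \<open>From homogeneous components at one large matrix size to the whole kernel\<close>

lemma member_le_wt:
 assumes "v \<in> keys m"
 shows "w v <= wt w m"
proof -
 have "w v * 1 <= w v * lookup m v" using assms by (intro mult_le_mono2) (simp add: in_keys_iff Suc_le_eq)
 also have "... <= wt w m" unfolding wt_def using assms by (intro member_le_sum) auto
 finally show ?thesis by simp
qed

lemma finite_syms: "finite {v. sym_wt v <= d & set (letters (snd (Rep_tilde_sym v))) \<subseteq> {..<u}}"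
proof (rule finite_imageD)
 let ?S = "{v. sym_wt v <= d & set (letters (snd (Rep_tilde_sym v))) \<subseteq> {..<u}}"
 have "Rep_tilde_sym ` ?S \<subseteq> {..d} \<times> {e. set (letters e) \<subseteq> {..<u} & length (letters e) <= d}"
 proof
  fix x assume "x \<in> Rep_tilde_sym ` ?S"
  then obtain v where v: "x = Rep_tilde_sym v" "sym_wt v <= d" "set (letters (snd (Rep_tilde_sym v))) \<subseteq> {..<u}" by blast
  obtain t e where te: "Rep_tilde_sym v = (t, e)" by fastforce
  hence "t \<ge> 1" "e ~= 0" using Rep_tilde_symD X_tilde_nonzero by blast+
  hence "length (letters e) \<ge> 1" by (cases e) (auto simp: zero_word_def Suc_le_eq)
  have "t * length (letters e) <= d" using v(2) by (simp add: sym_wt_def te)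
  moreover have "t * 1 <= t * length (letters e)" "1 * length (letters e) <= t * length (letters e)"
   using \<open>t \<ge> 1\<close> \<open>length (letters e) \<ge> 1\<close> by (intro mult_le_mono; simp)+
  ultimately have "t <= d" "length (letters e) <= d" by linarith+
  thus "x \<in> {..d} \<times> {e. set (letters e) \<subseteq> {..<u} & length (letters e) <= d}"
   using v(3) by (simp add: v(1) te)
 qed
 thus "finite (Rep_tilde_sym ` ?S)" by (rule finite_subset) (intro finite_cartesian_product finite_atMost finite_words)
 show "inj_on Rep_tilde_sym ?S" by (simp add: inj_on_def Rep_tilde_sym_inject)
qed

context
 assumes inf: "infinite (UNIV :: 'a::field set)"
begin

text \<open>The symbols of degree at most d in the finitely many letters of f form a finite set V,
  so polynomials in them are determined by their values at one size N0. The reduction is carried out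
  at a size N that is at least N0 and at least n.\<close>

lemma hpart_in_rel_ideal:
 fixes f :: "'a sigma_tilde_alg"
 assumes f: "f \<in> K_tilde n"
 shows "hpart sym_wt d f \<in> rel_ideal n"
proof -
 define s where "s = hpart sym_wt d f"
 have "finite (\<Union>m\<in>keys f. \<Union>v\<in>keys m. set (letters (snd (Rep_tilde_sym v))))" by simp
 then obtain u where u: "(\<Union>m\<in>keys f. \<Union>v\<in>keys m. set (letters (snd (Rep_tilde_sym v)))) \<subseteq> {..<u}"
  using finite_nat_bounded by blast
 define V where "V = {v. sym_wt v <= d & set (letters (snd (Rep_tilde_sym v))) \<subseteq> {..<u}}"
 have keys_s: "wt sym_wt m = d" "v \<in> keys m ==> set (letters (snd (Rep_tilde_sym v))) \<subseteq> {..<u}"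
  if "m \<in> keys s" for m v
  using that u by (auto simp: s_def keys_hpart)
 have finV: "finite V" unfolding V_def by (rule finite_syms)
 have "\<exists>N0. \<forall>r :: 'a sigma_tilde_alg. (\<Union>m\<in>keys r. keys m) \<subseteq> V --> Phi_tilde N0 r = 0 --> r = 0"
  by (rule Phi_tilde_inj_on_finite[OF inf finV]) (intro exI allI impI)
 then obtain N0 where N0: "\<forall>r :: 'a sigma_tilde_alg. (\<Union>m\<in>keys r. keys m) \<subseteq> V --> Phi_tilde N0 r = 0 --> r = 0" ..
 define N where "N = max n N0"
 have homog: "hpart (%_. 1) d (Phi_tilde N s) = Phi_tilde N s"
  unfolding Phi_tilde_hpart[OF inf, symmetric] by (subst hpart_id) (simp_all add: s_def keys_hpart)
 have over: "Phi_tilde N s \<in> pol_over (vars N u)"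
  by (rule Phi_tilde_pol_over) (rule keys_s(2))
 have "\<exists>g\<in>rel_ideal n. Phi_tilde N g = Phi_tilde N s"
 proof (rule Phi_tilde_in_rel_ideal[OF inf _ _ over])
  show "n <= N" by (simp add: N_def)
  show "Phi_tilde n s = 0" using f by (simp add: s_def Phi_tilde_hpart[OF inf] K_tilde_def)
  show "wt (%_. 1) m = d" if "m \<in> keys (Phi_tilde N s)" for m
   using that by (subst (asm) homog[symmetric]) (simp add: keys_hpart)
  let ?code = "%m. exps_code N u (Suc d) (lookup m)"
  show "?code m < Suc (Max (?code ` keys (Phi_tilde N s)))" if "m \<in> keys (Phi_tilde N s)" for m
   using that by (simp add: less_Suc_eq_le)
 qed
 then obtain g where g: "g \<in> rel_ideal n" "Phi_tilde N g = Phi_tilde N s" by blast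
 \<comment> \<open>The element g may involve other letters and degrees. Cutting it down to degree d
   and the first u letters keeps its value at size N and makes s - h a polynomial in V, to which
   injectivity applies.\<close>
 define c :: "nat => 'a" where "c k = (if k < u then 1 else 0)" for k
 define h where "h = theta c (hpart sym_wt d g)"
 have h: "h \<in> rel_ideal n"
  unfolding h_def by (intro rel_ideal_theta[OF inf] rel_ideal_hpart[OF inf] g(1))
 have "Phi_tilde N h = ev const_pol (%v. const_pol (c (snd (snd v))) * var_pol v) (Phi_tilde N s)"
  unfolding h_def Phi_tilde_theta_rescale Phi_tilde_hpart[OF inf] g(2) homog ..
 also have "... = ev const_pol (%v. const_pol (if v \<in> vars N u then 1 else 0) * var_pol v) (Phi_tilde N s)"
  by (rule ev_pol_over_cong[OF over]) (auto simp: c_def)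
 also have "... = Phi_tilde N s" using over by (simp add: pol_over_rescale)
 finally have eq: "Phi_tilde N (s - h) = 0" by (simp add: Phi.hom_minus)
 have keys_h: "wt sym_wt m = d & set (letters (snd (Rep_tilde_sym v))) \<subseteq> {..<u}"
  if m: "m \<in> keys h" and v: "v \<in> keys m" for m v
 proof -
  obtain t e where te: "Rep_tilde_sym v = (t, e)" by fastforce
  hence "t \<ge> 1" using Rep_tilde_symD by blast
  let ?\<tau> = "%s. case Rep_tilde_sym s of (t, e) => prod_list (map c (letters e)) ^ t"
  have nz: "mon_ev ?\<tau> m * lookup (hpart sym_wt d g) m ~= 0"
   using m unfolding h_def theta_rescale in_keys_iff lookup_rescale .
  hence "?\<tau> v ~= 0" using v unfolding mon_ev_def by (auto simp: in_keys_iff)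
  hence "prod_list (map c (letters e)) ~= 0" using \<open>t \<ge> 1\<close> by (auto simp: te zero_power)
  hence "set (letters e) \<subseteq> {..<u}" by (auto simp: prod_list_zero_iff c_def split: if_splits)
  moreover have "wt sym_wt m = d" using nz by (auto simp: lookup_hpart split: if_splits)
  ultimately show ?thesis by (simp add: te)
 qed
 have "s - h = 0"
 proof (rule N0[rule_format])
  show "(\<Union>m\<in>keys (s - h). keys m) \<subseteq> V"
  proof (intro UN_least subsetI)
   fix m v assume m: "m \<in> keys (s - h)" and v: "v \<in> keys m"
   hence "m \<in> keys s \<or> m \<in> keys h" by (auto simp: in_keys_iff lookup_minus)
   hence "wt sym_wt m = d" "set (letters (snd (Rep_tilde_sym v))) \<subseteq> {..<u}" using keys_s keys_h v by blast+
   thus "v \<in> V" using member_le_wt[OF v, of sym_wt] by (simp add: V_def)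
  qed
  have "N0 <= N" by (simp add: N_def)
  show "Phi_tilde N0 (s - h) = 0" unfolding Phi_tilde_restrict[OF \<open>N0 <= N\<close>] eq by (rule const_pol.ev_0)
 qed
 thus ?thesis using h by (simp add: s_def)
qed

lemma K_tilde_eq_rel_ideal: "K_tilde n = (rel_ideal n :: 'a sigma_tilde_alg set)"
proof
 show "rel_ideal n \<subseteq> (K_tilde n :: 'a sigma_tilde_alg set)" by (rule rel_ideal_subset_K_tilde[OF inf])
 show "K_tilde n \<subseteq> (rel_ideal n :: 'a sigma_tilde_alg set)"
 proof
  fix f :: "'a sigma_tilde_alg" assume f: "f \<in> K_tilde n"
  have "(\<Sum>d\<le>Max (wt sym_wt ` keys f). hpart sym_wt d f) = f"
   by (rule sum_hpart) simp
  moreover have "(\<Sum>d\<le>Max (wt sym_wt ` keys f). hpart sym_wt d f) \<in> rel_ideal n"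
   using hpart_in_rel_ideal[OF f] unfolding rel_ideal_def by (intro ideal_gen_sum)
  ultimately show "f \<in> rel_ideal n" by simp
 qed
qed

end

theorem theorem3p3:
  fixes n :: nat
  assumes "infinite (UNIV :: 'a::field set)"
    and "n > 1"
  shows "(K_tilde n :: 'a sigma_tilde_alg set) =
    ideal_gen
      ({pi_tilde (sigma t a) | t a. n < t \<and> t \<le> 2 * n \<and> a \<in> free_alg} \<union>
       {sigma_tilde t b | t b. t > 2 * n \<and> b \<in> X_tilde})"
  using K_tilde_eq_rel_ideal[OF assms(1), of n] by (simp only: rel_ideal_def)

end
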